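(* Let $n\ge3$, $p=\frac{n+2}{n-2}$, let $\Omega\subset\mathbb R^n$ be a bounded smooth open set with $0\in\Omega$, and for $\varrho>0$ let $\Omega_\varrho=\{x\in\Omega:|x|>\varrho\}$ and $Q_{\Omega_\varrho}=\mathbb 1_{\Omega_\varrho}-\mathbb 1_{\mathbb R^n\setminus\Omega_\varrho}$. There exists $\varrho_0>0$ such that, for each $\varrho\in(0,\varrho_0)$, the problem $$-\Delta u=Q_{\Omega_\varrho}|u|^{p-1}u,\qquad u\in D^{1,2}(\mathbb R^n),$$ has a positive weak solution of the form $u_\varrho=U_{\delta(\varrho),\xi(\varrho)}+\phi_\varrho$, with $\|\phi_\varrho\|\to0$, $\delta(\varrho)\varrho^{-1/2}\to d$ for some $d>0$, and $\xi(\varrho)\to0$ as $\varrho\to0$.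
   Context: $D^{1,2}(\mathbb R^n)=\{u\in L^{2^*}(\mathbb R^n):\nabla u\in L^2\}$, $2^*=\frac{2n}{n-2}$, norm $\|u\|=(\int|\nabla u|^2)^{1/2}$. Weak solution: $\int\nabla u\cdot\nabla v=\int Q_{\Omega_\varrho}|u|^{p-1}uv$ for all $v\in D^{1,2}(\mathbb R^n)$. Bubbles: $U_{\delta,\xi}(x)=\alpha_n\delta^{\frac{n-2}{2}}(\delta^2+|x-\xi|^2)^{-\frac{n-2}{2}}$, $\alpha_n=(n(n-2))^{\frac{n-2}{4}}$. *)

theory Defs
  imports "HOL-Analysis.Analysis"
begin

fun Ck :: "nat \<Rightarrow> ('a::euclidean_space \<Rightarrow> real) \<Rightarrow> bool" where
  "Ck 0 f = continuous_on UNIV f"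
| "Ck (Suc k) f = (continuous_on UNIV f \<and> (\<forall>x. f differentiable (at x)) \<and>
      (\<forall>i\<in>Basis. Ck k (\<lambda>x. frechet_derivative f (at x) i)))"

definition smooth :: "('a::euclidean_space \<Rightarrow> real) \<Rightarrow> bool" where
  "smooth f \<longleftrightarrow> (\<forall>k. Ck k f)"

definition test_fun :: "('a::euclidean_space \<Rightarrow> real) \<Rightarrow> bool" where
  "test_fun \<psi> \<longleftrightarrow> smooth \<psi> \<and> compact (closure {x. \<psi> x \<noteq> 0})"

definition smooth_bounded_domain :: "'a::euclidean_space set \<Rightarrow> bool" where
  "smooth_bounded_domain \<Omega> \<longleftrightarrow> open \<Omega> \<and> bounded \<Omega> \<and>
     (\<exists>g. smooth g \<and> \<Omega> = {x. g x < 0} \<and>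
          (\<forall>x. g x = 0 \<longrightarrow> frechet_derivative g (at x) \<noteq> (\<lambda>_. 0)))"

definition crit_exp :: "'a::euclidean_space itself \<Rightarrow> real" where
  "crit_exp _ = 2 * real DIM('a) / (real DIM('a) - 2)"

definition weak_grad :: "('a::euclidean_space \<Rightarrow> real) \<Rightarrow> ('a \<Rightarrow> 'a) \<Rightarrow> bool" where
  "weak_grad u G \<longleftrightarrow> G \<in> borel_measurable lebesgue \<and>
     (\<forall>\<psi>. test_fun \<psi> \<longrightarrow> (\<forall>i\<in>Basis.
        integrable lebesgue (\<lambda>x. u x * frechet_derivative \<psi> (at x) i) \<and>
        integrable lebesgue (\<lambda>x. (G x \<bullet> i) * \<psi> x) \<and>
        (\<integral>x. u x * frechet_derivative \<psi> (at x) i \<partial>lebesgue) =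
          - (\<integral>x. (G x \<bullet> i) * \<psi> x \<partial>lebesgue)))"

definition D12 :: "('a::euclidean_space \<Rightarrow> real) set" where
  "D12 = {u. u \<in> borel_measurable lebesgue \<and>
             integrable lebesgue (\<lambda>x. \<bar>u x\<bar> powr crit_exp TYPE('a)) \<and>
             (\<exists>G. weak_grad u G \<and> integrable lebesgue (\<lambda>x. (norm (G x))\<^sup>2))}"

definition wgrad :: "('a::euclidean_space \<Rightarrow> real) \<Rightarrow> 'a \<Rightarrow> 'a" where
  "wgrad u = (SOME G. weak_grad u G \<and> integrable lebesgue (\<lambda>x. (norm (G x))\<^sup>2))"

definition D12_norm :: "('a::euclidean_space \<Rightarrow> real) \<Rightarrow> real" where
  "D12_norm u = sqrt (\<integral>x. (norm (wgrad u x))\<^sup>2 \<partial>lebesgue)"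

definition Qsign :: "'a set \<Rightarrow> 'a \<Rightarrow> real" where
  "Qsign A x = (if x \<in> A then 1 else -1)"

definition Omega_rho :: "'a::euclidean_space set \<Rightarrow> real \<Rightarrow> 'a set" where
  "Omega_rho \<Omega> \<rho> = {x \<in> \<Omega>. norm x > \<rho>}"

definition weak_solution :: "('a::euclidean_space \<Rightarrow> real) \<Rightarrow> real \<Rightarrow> ('a \<Rightarrow> real) \<Rightarrow> bool" where
  "weak_solution Q p u \<longleftrightarrow> u \<in> D12 \<and>
     (\<forall>v\<in>D12. (\<integral>x. wgrad u x \<bullet> wgrad v x \<partial>lebesgue) =
               (\<integral>x. Q x * \<bar>u x\<bar> powr (p - 1) * u x * v x \<partial>lebesgue))"

definition alpha_n :: "'a::euclidean_space itself \<Rightarrow> real" where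
  "alpha_n _ = (real DIM('a) * (real DIM('a) - 2)) powr ((real DIM('a) - 2) / 4)"

definition bubble :: "real \<Rightarrow> 'a::euclidean_space \<Rightarrow> 'a \<Rightarrow> real" where
  "bubble \<delta> \<xi> x = alpha_n TYPE('a) * \<delta> powr ((real DIM('a) - 2) / 2) *
       (\<delta>\<^sup>2 + (norm (x - \<xi>))\<^sup>2) powr (- (real DIM('a) - 2) / 2)"

end

theory Submission
  imports Defs
begin

text \<open>
  Write \<open>u = U (1 + \<psi> ((x - \<xi>) / \<delta>))\<close> with \<open>U = U\<^sub>\<delta>\<^sub>,\<^sub>\<xi>\<close> and \<open>\<xi> = \<delta> \<eta>\<close>. Inverting the Laplacian by
  the Newtonian potential turns the equation into \<open>1 + \<psi> = K ((1 - 2 1\<^sub>A) (1 + \<psi>)\<^sup>p)\<close>, where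
  \<open>A = {y. \<delta> (y + \<eta>) \<notin> \<Omega>\<^sub>\<rho>}\<close> and \<open>K\<close> is the conformally invariant integral operator of the sphere
  in stereographic coordinates, normalised by \<open>K 1 = 1\<close>. Green's formula for powers of linear
  functions on the sphere yields the spectrum of \<open>K\<close>: \<open>p K\<close> is the identity on first harmonics and a strict
  contraction on the orthogonal complement of the harmonics of degree at most one. A fixed point
  argument in the space of bounded continuous functions therefore solves the equation modulo first harmonics whenever the
  mass of \<open>A\<close> is small. The remaining obstruction \<open>b A\<close> is to first order the barycentre of \<open>A\<close> on
  the sphere. As \<open>A\<close> is a neighbourhood of infinity of mass of order \<open>\<delta>\<^sup>n\<close> together with a ball about
  \<open>- \<eta>\<close> of mass of order \<open>(\<rho> / \<delta>)\<^sup>n\<close>, the two poles balance for \<open>\<delta>\<close> close to \<open>d \<rho>\<^sup>1\<^sup>/\<^sup>2\<close>, and Brouwer's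
  fixed point theorem provides \<open>\<delta>\<close> and \<open>\<eta>\<close>. No Sobolev inequality is needed: all functions involved are
  Newtonian potentials of densities with explicit decay, and the weak formulation follows by testing with
  cut-off gradients of regularised fundamental solutions.
\<close>

text \<open>The linearisation at a bubble degenerates exactly along the n + 1 infinitesimal
  translations and dilations, and the n + 1 parameters \<delta>, \<xi> are there to absorb this
  kernel. Dividing by the bubble makes the perturbation bounded: with |\<psi>| \<le> 1/2 the power
  (1 + \<psi>)^p is smooth however small p - 1 is, and the solution is positive at once. The price
  is that the linear operator contracts only in mean square. Since it also gains integrability, the
  sup norm plus a large multiple of the mean-square norm contracts as well. The obstruction must be
  known up to o(mass of A), but a sup bound on \<psi> does not see this mass; a mean-square bound
  whose square is linear in the mass closes the gap. The obstruction is only shown to be continuous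
  in the parameters, hence a topological argument instead of an implicit function theorem. The
  constant d comes from equating the leading masses a \<delta>^n and v (\<rho> / \<delta>)^n of the
  two pieces of A, where a is the integral of |x|^(-2n) outside \<Omega> and v the volume of the
  unit ball.\<close>

text \<open>The argument only fixes the type: inside the locale below \<open>N T\<close> abbreviates the real dimension.\<close>

abbreviation N :: "'a::euclidean_space itself \<Rightarrow> real" where "N S \<equiv> real DIM('a)"
abbreviation Np :: "'a::euclidean_space itself \<Rightarrow> real" where "Np S \<equiv> - (real DIM('a) + 2)/2"
abbreviation Nm :: "'a::euclidean_space itself \<Rightarrow> real" where "Nm S \<equiv> - (real DIM('a) - 2)/2"
abbreviation Nh :: "'a::euclidean_space itself \<Rightarrow> real" where "Nh S \<equiv> - (real DIM('a) - 1)/2"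

abbreviation BM :: "('a::topological_space \<Rightarrow> 'b::topological_space) set"
 where "BM \<equiv> borel_measurable borel"

abbreviation LI :: "('a::euclidean_space \<Rightarrow> 'b::{banach, second_countable_topology}) \<Rightarrow> bool"
 where "LI \<equiv> integrable lborel"

abbreviation nk1 :: "'a::euclidean_space \<Rightarrow> 'a \<Rightarrow> real" where "nk1 x y \<equiv> norm (x - y) powr (1 - real DIM('a))"
abbreviation nk2 :: "'a::euclidean_space \<Rightarrow> 'a \<Rightarrow> real" where "nk2 x y \<equiv> norm (x - y) powr (2 - real DIM('a))"

abbreviation bc :: "('a::topological_space \<Rightarrow>\<^sub>C 'b::metric_space) \<Rightarrow> 'a \<Rightarrow> 'b" where "bc \<equiv> apply_bcontfun"

abbreviation lims :: "(nat \<Rightarrow> 'a::topological_space) \<Rightarrow> 'a \<Rightarrow> bool" (infixr "\<leadsto>" 60)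
 where "f \<leadsto> l \<equiv> LIMSEQ f l"

abbreviation ind :: "'a set \<Rightarrow> 'a \<Rightarrow> 'b::zero_neq_one" where "ind \<equiv> indicator"

lemmas integrable_dom = Bochner_Integration.integrable_bound
lemmas integral_dct = integral_dominated_convergence

instance bcontfun :: (metric_space, banach) banach ..

section \<open>Decaying functions and integration by parts\<close>

text \<open>The square of the Japanese bracket. Up to the factor 2 its reciprocal is the conformal
  factor of stereographic projection, so powers of \<open>jb\<close> measure decay at infinity and
  conformal weights alike.\<close>

definition jb :: "'a::euclidean_space \<Rightarrow> real"
 where "jb x = 1 + (norm x)\<^sup>2"

lemma jb_ge1 [simp]: "1 \<le> jb x"
 by (simp add: jb_def)

lemma jb_pos [simp]: "0 < jb x"
 using jb_ge1[of x] by linarith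

lemma jb_nonzero [simp]: "jb x \<noteq> 0"
 using jb_pos[of x] by linarith

lemma jb_nonneg [simp]: "0 \<le> jb x"
 using jb_pos[of x] by linarith

lemma continuous_on_jb [continuous_intros]:
 "continuous_on S f \<Longrightarrow> continuous_on S (\<lambda>x. jb (f x))"
 unfolding jb_def by (intro continuous_intros)

lemma borel_measurable_jb [measurable]: "jb \<in> BM"
 by (intro borel_measurable_continuous_onI continuous_intros)

lemma norm_le_jb: "norm x \<le> jb x powr (1/2)"
 by (simp add: powr_half_sqrt real_le_rsqrt jb_def)

lemma jb_minus_le: "jb x \<le> 2 * ((norm (x - y))\<^sup>2 + jb y)"
proof -
 have "norm x \<le> norm (x - y) + norm y"
  by (metis diff_add_cancel norm_triangle_ineq)
 then have "(norm x)\<^sup>2 \<le> (norm (x - y) + norm y)\<^sup>2"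
  by (intro power_mono) auto
 also have "\<dots> \<le> 2 * ((norm (x - y))\<^sup>2 + (norm y)\<^sup>2)"
  using sum_squares_bound[of "norm (x - y)" "norm y"] by (simp add: power2_sum)
 finally show ?thesis by (simp add: jb_def)
qed

lemma sq_powr: "((x::real)\<^sup>2) powr a = \<bar>x\<bar> powr (2 * a)"
proof (cases "x = 0")
 case False
 then have "x\<^sup>2 = \<bar>x\<bar> powr 2"
  by simp
 then show ?thesis by (simp only: powr_powr)
qed simp

lemma powr_add_le:
 fixes a b q :: real
 assumes "0 \<le> a" "0 \<le> b" "0 \<le> q"
 shows "(a + b) powr q \<le> 2 powr q * (a powr q + b powr q)"
proof -
 have "(a + b) powr q \<le> (2 * max a b) powr q"
  using assms by (intro powr_mono2) auto
 also have "\<dots> = 2 powr q * (max a b) powr q"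
  using assms by (simp add: powr_mult)
 also have "\<dots> \<le> 2 powr q * (a powr q + b powr q)"
  by (intro mult_left_mono) (auto simp: max_def)
 finally show ?thesis .
qed

text \<open>A Peetre-type inequality: the weight at x is paid for either by the distance from x to y
  or by the weight at y. It turns decay of a density into decay of its potential.\<close>

lemma jb_powr_le:
 assumes "0 \<le> q"
 shows "jb x powr q \<le> 4 powr q * (norm (x - y) powr (2 * q) + jb y powr q)"
proof -
 have "jb x powr q \<le> (2 * ((norm (x - y))\<^sup>2 + jb y)) powr q"
  using jb_minus_le assms by (intro powr_mono2) auto
 also have "\<dots> = 2 powr q * ((norm (x - y))\<^sup>2 + jb y) powr q"
  by (rule powr_mult)
 also have "\<dots> \<le> 2 powr q * (2 powr q * (((norm (x - y))\<^sup>2) powr q + jb y powr q))"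
  using assms by (intro mult_left_mono powr_add_le) auto
 also have "((norm (x - y))\<^sup>2) powr q = norm (x - y) powr (2 * q)"
  by (simp add: sq_powr)
 also have "2 powr q * (2 powr q * (norm (x - y) powr (2 * q) + jb y powr q))
   = 4 powr q * (norm (x - y) powr (2 * q) + jb y powr q)"
  using powr_mult[of 2 2 q] by simp
 finally show ?thesis .
qed

section \<open>Affine changes of variables and integrability of powers\<close>

lemma lborel_integral_affine:
 fixes f :: "'a::euclidean_space \<Rightarrow> 'b::{banach, second_countable_topology}"
 assumes c: "c \<noteq> 0"
 shows "(LBINT x. f x) = \<bar>c\<bar> ^ DIM('a) *\<^sub>R (LBINT x. f (t + c *\<^sub>R x))"
  and "LI (\<lambda>x. f (t + c *\<^sub>R x)) \<longleftrightarrow> LI f"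
proof -
 have bij: "f \<in> BM" if "(\<lambda>x. f (t + c *\<^sub>R x)) \<in> BM"
 proof -
  have "(\<lambda>y. (\<lambda>x. f (t + c *\<^sub>R x)) ((1/c) *\<^sub>R (y - t))) \<in> BM"
   using that by measurable
  then show ?thesis using c by simp
 qed
 have I: "LI (\<lambda>x. f (t + c *\<^sub>R x)) \<longleftrightarrow> LI f"
 proof (cases "f \<in> BM")
  case True
  note [measurable] = True
  have c0: "\<bar>c\<bar> ^ DIM('a) \<noteq> 0" using c by simp
  have "LI f \<longleftrightarrow> integrable (density (distr lborel borel (\<lambda>x. t + c *\<^sub>R x)) (\<lambda>_. \<bar>c\<bar>^DIM('a))) f"
   by (subst lborel_affine[OF c, of t]) simp
  also have "\<dots> \<longleftrightarrow> integrable (distr lborel borel (\<lambda>x. t + c *\<^sub>R x)) (\<lambda>x. (\<bar>c\<bar>^DIM('a)) *\<^sub>R f x)"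
   by (subst integrable_density) auto
  also have "\<dots> \<longleftrightarrow> integrable (distr lborel borel (\<lambda>x. t + c *\<^sub>R x)) f"
   using c0 integrable_scaleR_right[of "inverse (\<bar>c\<bar> ^ DIM('a))" "distr lborel borel (\<lambda>x. t + c *\<^sub>R x)" "\<lambda>x. \<bar>c\<bar> ^ DIM('a) *\<^sub>R f x"]
   by (auto intro: integrable_scaleR_right)
  also have "\<dots> \<longleftrightarrow> LI (\<lambda>x. f (t + c *\<^sub>R x))"
   by (subst integrable_distr_eq) auto
  finally show ?thesis by simp
 next
  case False
  have "\<not> LI f"
  proof
   assume "LI f"
   then have "f \<in> borel_measurable lborel" by (rule borel_measurable_integrable)
   with False show False by simp
  qed
  moreover have "\<not> LI (\<lambda>x. f (t + c *\<^sub>R x))"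
  proof
   assume "LI (\<lambda>x. f (t + c *\<^sub>R x))"
   then have "(\<lambda>x. f (t + c *\<^sub>R x)) \<in> borel_measurable lborel" by (rule borel_measurable_integrable)
   then have "(\<lambda>x. f (t + c *\<^sub>R x)) \<in> BM" by simp
   from bij[OF this] False show False by contradiction
  qed
  ultimately show ?thesis by simp
 qed
 then show "LI (\<lambda>x. f (t + c *\<^sub>R x)) \<longleftrightarrow> LI f" .
 show "(LBINT x. f x) = \<bar>c\<bar> ^ DIM('a) *\<^sub>R (LBINT x. f (t + c *\<^sub>R x))"
 proof (cases "LI f")
  case True
  then have [measurable]: "f \<in> BM" by simp
  have "(LBINT x. f x) = (\<integral>x. f x \<partial>(density (distr lborel borel (\<lambda>x. t + c *\<^sub>R x)) (\<lambda>_. \<bar>c\<bar>^DIM('a))))"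
   by (subst lborel_affine[OF c, of t]) simp
  also have "\<dots> = (\<integral>x. \<bar>c\<bar>^DIM('a) *\<^sub>R f x \<partial>(distr lborel borel (\<lambda>x. t + c *\<^sub>R x)))"
   by (subst integral_density) auto
  also have "\<dots> = (LBINT x. \<bar>c\<bar>^DIM('a) *\<^sub>R f (t + c *\<^sub>R x))"
   by (subst integral_distr) auto
  finally show ?thesis by simp
 next
  \<comment> \<open>Integrability is the same for both integrands, so here both integrals have the
    default value 0.\<close>
  case False
  then show ?thesis using I by (simp add: not_integrable_integral_eq)
 qed
qed

lemma lborel_integral_shift:
 fixes f :: "'a::euclidean_space \<Rightarrow> 'b::{banach, second_countable_topology}"
 shows "(LBINT y. f (x - y)) = (LBINT y. f y)"
  and "LI (\<lambda>y. f (x - y)) \<longleftrightarrow> LI f"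
  and "(LBINT y. f (x + y)) = (LBINT y. f y)"
  and "LI (\<lambda>y. f (x + y)) \<longleftrightarrow> LI f"
 using lborel_integral_affine[of "-1" f x] lborel_integral_affine[of 1 f x] by simp_all

lemma integrable_powr_neg_1d:
 fixes \<beta> :: real
 assumes "1/2 < \<beta>"
 shows "LI (\<lambda>t::real. (1 + t\<^sup>2) powr (-\<beta>))"
proof -
 let ?g = "\<lambda>t::real. ind {1..} t * t powr (-2*\<beta>)"
 have "set_integrable lebesgue {1..} (\<lambda>t::real. t powr (-2*\<beta>))"
  by (rule nonnegative_absolutely_integrable_1)
    (use has_integral_powr_to_inf[of "-2*\<beta>" 1] assms in \<open>auto simp: has_integral_iff\<close>)
 then have "integrable lebesgue ?g" by (simp add: set_integrable_def)
 then have g: "LI ?g"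
  by (subst (asm) integrable_completion) auto
 then have g': "LI (\<lambda>t. ?g (- t))"
  using lborel_integral_shift(2)[of ?g 0] by simp
 have i: "LI (ind {-1..1::real} :: real \<Rightarrow> real)"
  by simp
 have "LI (\<lambda>t. ind {-1..1} t + ?g t + ?g (- t))"
  by (intro Bochner_Integration.integrable_add i g g')
 then show ?thesis
 proof (rule integrable_dom)
  show "AE t in lborel. norm ((1 + t\<^sup>2) powr (-\<beta>)) \<le> norm (ind {-1..1} t + ?g t + ?g (- t))"
  proof (intro AE_I2)
   fix t :: real
   have *: "(1 + t\<^sup>2) powr (-\<beta>) \<le> \<bar>t\<bar> powr (-2*\<beta>)" if "1 \<le> \<bar>t\<bar>"
   proof -
    have "\<bar>t\<bar> powr (-2*\<beta>) = (t\<^sup>2) powr (-\<beta>)" by (simp add: sq_powr)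
    moreover have "(1 + t\<^sup>2) powr (-\<beta>) \<le> (t\<^sup>2) powr (-\<beta>)"
     using that assms by (intro powr_mono2') auto
    ultimately show ?thesis by simp
   qed
   have **: "(1 + t\<^sup>2) powr (-\<beta>) \<le> 1"
    using powr_mono2'[of "-\<beta>" 1 "1+t\<^sup>2"] assms by simp
   consider "\<bar>t\<bar> \<le> 1" | "1 \<le> t" "\<not> \<bar>t\<bar> \<le> 1" | "t \<le> -1" "\<not> \<bar>t\<bar> \<le> 1" by linarith
   then show "norm ((1 + t\<^sup>2) powr (-\<beta>)) \<le> norm (ind {-1..1} t + ?g t + ?g (- t))"
   proof cases
    case 1
    then have i1: "ind {-1..1} t = (1::real)" by (auto simp: indicator_def)
    have "norm ((1 + t\<^sup>2) powr (-\<beta>)) \<le> 1" using ** by simp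
    also have "1 \<le> ind {-1..1} t + ?g t + ?g (- t)" unfolding i1 by (simp add: add.assoc)
    also have "\<dots> \<le> norm \<dots>" by simp
    finally show ?thesis .
   next
    case 2 then show ?thesis using * by (auto simp: indicator_def)
   next
    case 3 then show ?thesis using * by (auto simp: indicator_def)
   qed
  qed
 qed simp
qed

text \<open>Since \<open>jb x\<close> dominates every 1 + (x \<bullet> i)^2, the product of these
  factors is at most the n-th power of \<open>jb x\<close>, and Tonelli reduces the claim to the
  line with exponent b / n > 1/2. Polar coordinates are avoided in this way.\<close>

lemma integrable_jb_powr:
 assumes b: "real DIM('a) / 2 < b"
 shows "LI (\<lambda>x::'a::euclidean_space. jb x powr (- b))"
proof -
 let ?N = "real DIM('a)"
 define \<beta> where "\<beta> = b / ?N"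
 have \<beta>: "1/2 < \<beta>" using b by (simp add: \<beta>_def field_simps)
 have bpos: "b > 0" using b by (smt (verit) divide_nonneg_nonneg of_nat_0_le_iff)
 let ?f = "\<lambda>t::real. ennreal ((1 + t\<^sup>2) powr (-\<beta>))"
 have fin: "(\<integral>\<^sup>+t. ?f t \<partial>lborel) < \<infinity>"
  using integrable_powr_neg_1d[OF \<beta>] by (simp add: integrable_iff_bounded)
 have le: "ennreal (jb x powr (-b)) \<le> (\<Prod>i\<in>Basis. ?f (x \<bullet> i))" for x :: 'a
 proof -
  have "(\<Prod>i\<in>Basis. (1 + (x \<bullet> i)\<^sup>2)) \<le> (\<Prod>i\<in>(Basis::'a set). jb x)"
  proof (intro prod_mono conjI)
   fix i :: 'a assume "i \<in> Basis"
   then have "(x \<bullet> i)\<^sup>2 \<le> (norm x)\<^sup>2"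
    by (metis Basis_le_norm abs_ge_zero power2_abs power_mono)
   then show "1 + (x \<bullet> i)\<^sup>2 \<le> jb x" by (simp add: jb_def)
  qed simp
  then have P: "(\<Prod>i\<in>Basis. (1 + (x \<bullet> i)\<^sup>2)) \<le> jb x powr ?N"
   by (simp add: powr_realpow)
  have "(jb x powr ?N) powr (-\<beta>) \<le> (\<Prod>i\<in>Basis. (1 + (x \<bullet> i)\<^sup>2)) powr (-\<beta>)"
   using P \<beta> by (intro powr_mono2') (auto intro!: prod_pos simp: add_pos_nonneg)
  also have "\<dots> = (\<Prod>i\<in>Basis. (1 + (x \<bullet> i)\<^sup>2) powr (-\<beta>))"
   by (simp add: prod_powr_distrib)
  finally have "jb x powr (-b) \<le> (\<Prod>i\<in>Basis. (1 + (x \<bullet> i)\<^sup>2) powr (-\<beta>))"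
   by (simp add: powr_powr \<beta>_def)
  then have "ennreal (jb x powr (-b)) \<le> ennreal (\<Prod>i\<in>Basis. (1 + (x \<bullet> i)\<^sup>2) powr (-\<beta>))"
   by (rule ennreal_leI)
  then show ?thesis by (simp add: prod_ennreal)
 qed
 have "(\<integral>\<^sup>+x. ennreal (jb (x::'a) powr (-b)) \<partial>lborel) \<le> (\<integral>\<^sup>+x. (\<Prod>i\<in>Basis. ?f ((x::'a) \<bullet> i)) \<partial>lborel)"
  by (intro nn_integral_mono le)
 also have "\<dots> = (\<Prod>i\<in>(Basis::'a set). (\<integral>\<^sup>+t. ?f t \<partial>lborel))"
  by (rule nn_integral_lborel_prod) auto
 also have "\<dots> < \<infinity>" using fin by (simp add: power_less_top_ennreal)
 finally show ?thesis by (simp add: integrable_iff_bounded)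
qed

text \<open>The norm dominates every coordinate, so |x|^(1 - n) is at most the product of the |x
  \<bullet> i|^(1/n - 1), and the exponent 1/n - 1 > -1 is integrable at 0 on the line.\<close>

lemma integrable_norm_powr_cball:
 "LI (\<lambda>x::'a::euclidean_space. norm x powr (1 - real DIM('a)) * ind (cball 0 1) x)"
proof -
 let ?N = "real DIM('a)"
 define \<beta> where "\<beta> = 1/?N - 1"
 have N1: "1 \<le> ?N" by (simp add: Suc_leI)
 have \<beta>: "-1 < \<beta>" "\<beta> \<le> 0" using N1 by (auto simp: \<beta>_def)
 \<comment> \<open>The value \<open>top\<close> at 0 keeps the product bound true on the coordinate
   hyperplanes, where \<open>0 powr \<beta>\<close> would be 0; the integral does not notice a
   single point.\<close>
 let ?f = "\<lambda>t::real. (if t = 0 then top else ennreal (\<bar>t\<bar> powr \<beta>)) * ind {-1..1} t"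
 let ?g = "\<lambda>t::real. ind {0..1} t * t powr \<beta>"
 have "set_integrable lebesgue {0..1} (\<lambda>t::real. t powr \<beta>)"
  by (rule nonnegative_absolutely_integrable_1)
    (use has_integral_powr_from_0[of \<beta> 1] \<beta> in \<open>auto simp: has_integral_iff\<close>)
 then have "integrable lebesgue ?g" by (simp add: set_integrable_def)
 then have g: "LI ?g"
  by (subst (asm) integrable_completion) auto
 then have g': "LI (\<lambda>t. ?g (- t))"
  using lborel_integral_shift(2)[of ?g 0] by simp
 have gg: "LI (\<lambda>t. ?g t + ?g (- t))"
  by (intro Bochner_Integration.integrable_add g g')
 have "(\<integral>\<^sup>+t. ?f t \<partial>lborel) \<le> (\<integral>\<^sup>+t. ennreal (norm (?g t + ?g (- t))) \<partial>lborel)"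
 proof (intro nn_integral_mono_AE)
  have "AE t in lborel. t \<noteq> (0::real)" by (rule AE_lborel_singleton)
  then show "AE t in lborel. ?f t \<le> ennreal (norm (?g t + ?g (- t)))"
   by eventually_elim (auto simp: indicator_def)
 qed
 also have "\<dots> < \<infinity>" using gg by (simp add: integrable_iff_bounded)
 finally have fin: "(\<integral>\<^sup>+t. ?f t \<partial>lborel) < \<infinity>" .
 have le: "ennreal (norm (norm x powr (1 - ?N) * ind (cball 0 1) x)) \<le> (\<Prod>i\<in>Basis. ?f (x \<bullet> i))" for x :: 'a
 proof (cases "norm x \<le> 1")
  case True
  have b: "\<bar>x \<bullet> i\<bar> \<le> norm x" if "i \<in> Basis" for i using that by (rule Basis_le_norm)
  then have in1: "ind {-1..1} (x \<bullet> i) = (1::ennreal)" if "i \<in> Basis" for i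
   using that True by (force simp: indicator_def)
  show ?thesis
  proof (cases "\<exists>i\<in>Basis. x \<bullet> i = 0")
   case True
   then obtain i where i: "i \<in> Basis" "x \<bullet> i = 0" by auto
   have "(\<Prod>i\<in>Basis. ?f (x \<bullet> i)) = ?f (x \<bullet> i) * (\<Prod>j\<in>Basis-{i}. ?f (x \<bullet> j))"
    using i by (simp add: prod.remove)
   moreover have "(\<Prod>j\<in>Basis-{i}. ?f (x \<bullet> j)) \<noteq> 0"
    using in1 by (auto simp: prod_zero_iff)
   ultimately have "(\<Prod>i\<in>Basis. ?f (x \<bullet> i)) = top"
    using i by (simp add: ennreal_top_mult)
   then show ?thesis by simp
  next
   case False
   then have nz: "x \<bullet> i \<noteq> 0" if "i \<in> Basis" for i using that by auto
   have x0: "x \<noteq> 0"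
    using nz[OF SOME_Basis] by auto
   have "(\<Prod>i\<in>Basis. \<bar>x \<bullet> i\<bar>) \<le> (\<Prod>i\<in>(Basis::'a set). norm x)"
    by (intro prod_mono) (auto intro: b)
   then have P: "(\<Prod>i\<in>Basis. \<bar>x \<bullet> i\<bar>) \<le> norm x powr ?N"
    using x0 by (simp add: powr_realpow)
   have "(norm x powr ?N) powr \<beta> \<le> (\<Prod>i\<in>Basis. \<bar>x \<bullet> i\<bar>) powr \<beta>"
    using P \<beta> nz by (intro powr_mono2') (auto intro!: prod_pos)
   also have "\<dots> = (\<Prod>i\<in>Basis. \<bar>x \<bullet> i\<bar> powr \<beta>)"
    by (simp add: prod_powr_distrib)
   finally have "norm x powr (1 - ?N) \<le> (\<Prod>i\<in>Basis. \<bar>x \<bullet> i\<bar> powr \<beta>)"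
    by (simp add: powr_powr \<beta>_def algebra_simps)
   then have "ennreal (norm x powr (1 - ?N)) \<le> (\<Prod>i\<in>Basis. ennreal (\<bar>x \<bullet> i\<bar> powr \<beta>))"
    by (simp add: prod_ennreal ennreal_leI)
   also have "\<dots> = (\<Prod>i\<in>Basis. ?f (x \<bullet> i))"
    using in1 nz by (intro prod.cong) auto
   finally show ?thesis using \<open>norm x \<le> 1\<close> by (simp add: indicator_def)
  qed
 qed (simp add: indicator_def)
 have "(\<integral>\<^sup>+x. ennreal (norm (norm (x::'a) powr (1 - ?N) * ind (cball 0 1) x)) \<partial>lborel)
   \<le> (\<integral>\<^sup>+x. (\<Prod>i\<in>Basis. ?f ((x::'a) \<bullet> i)) \<partial>lborel)"
  by (intro nn_integral_mono le)
 also have "\<dots> = (\<Prod>i\<in>(Basis::'a set). (\<integral>\<^sup>+t. ?f t \<partial>lborel))"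
  by (rule nn_integral_lborel_prod) auto
 also have "\<dots> < \<infinity>" using fin by (simp add: power_less_top_ennreal)
 finally have fin': "(\<integral>\<^sup>+x. ennreal (norm (norm (x::'a) powr (1 - ?N) * ind (cball 0 1) x)) \<partial>lborel) < \<infinity>" .
 have [measurable]: "cball (0::'a) 1 \<in> sets borel" by simp
 have "(\<lambda>x::'a. norm x powr (1 - ?N) * ind (cball 0 1) x) \<in> borel_measurable lborel"
  by measurable
 then show ?thesis using fin' by (rule integrableI_bounded)
qed

text \<open>Near the singularity the weight is at most 1. Away from it the kernel is comparable with
  a power of \<open>jb z\<close>, and the smaller one of \<open>jb z\<close> and \<open>jb y\<close>
  absorbs the other factor. All three terms have integrals over y that do not depend on x.\<close>

lemma singular_bound:
 assumes z: "z = x - y"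
 shows "norm z powr (1 - real DIM('a)) * jb y powr (-1) \<le>
  norm z powr (1 - real DIM('a)) * ind (cball 0 1) z +
  2 powr ((real DIM('a) - 1)/2) * jb z powr (- (real DIM('a) + 1)/2) +
  2 powr ((real DIM('a) - 1)/2) * jb (y::'a::euclidean_space) powr (- (real DIM('a) + 1)/2)"
proof -
 let ?N = "real DIM('a)"
 let ?c = "2 powr ((?N - 1)/2)"
 have N1: "1 \<le> ?N" by (simp add: Suc_leI)
 show ?thesis
 proof (cases "norm z \<le> 1")
  case True
  have "jb y powr (-1) \<le> 1" by (simp add: powr_minus_divide)
  then have "norm z powr (1 - ?N) * jb y powr (-1) \<le> norm z powr (1 - ?N) * 1"
   by (intro mult_left_mono) auto
  then show ?thesis using True by (simp add: indicator_def add_increasing2)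
 next
  case False
  then have n1: "1 \<le> norm z" by simp
  then have "1 \<le> (norm z)\<^sup>2" by simp
  then have "jb z / 2 \<le> (norm z)\<^sup>2" by (simp add: jb_def)
  then have "((norm z)\<^sup>2) powr ((1 - ?N)/2) \<le> (jb z / 2) powr ((1 - ?N)/2)"
   using N1 by (intro powr_mono2') auto
  moreover have "((norm z)\<^sup>2) powr ((1 - ?N)/2) = norm z powr (1 - ?N)"
   by (simp add: sq_powr diff_divide_distrib)
  moreover have "(jb z / 2) powr ((1 - ?N)/2) = ?c * jb z powr ((1 - ?N)/2)"
  proof -
   have "- ((1-?N)/2) = (?N-1)/2" by (simp add: field_simps)
   then have "(2::real) powr (- ((1-?N)/2)) = 2 powr ((?N-1)/2)" by (rule arg_cong)
   then show ?thesis by (simp add: powr_divide powr_minus_divide[symmetric] divide_powr_uminus)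
  qed
  ultimately have A: "norm z powr (1 - ?N) \<le> ?c * jb z powr ((1 - ?N)/2)" by simp
  have ex: "jb w powr ((1 - ?N)/2) * jb w powr (-1) = jb w powr (- (?N + 1)/2)" for w :: 'a
  proof -
   have "(1 - ?N)/2 + -1 = - (?N + 1)/2" by (simp add: field_simps)
   then show ?thesis by (simp only: powr_add[symmetric])
  qed
  have "norm z powr (1 - ?N) * jb y powr (-1) \<le> ?c * jb z powr ((1 - ?N)/2) * jb y powr (-1)"
   using A by (intro mult_right_mono) auto
  also have "\<dots> \<le> ?c * (jb z powr (- (?N + 1)/2) + jb y powr (- (?N + 1)/2))"
  proof (cases "jb z \<le> jb y")
   case True
   then have "jb y powr (-1) \<le> jb z powr (-1)" by (intro powr_mono2') auto
   then have "jb z powr ((1 - ?N)/2) * jb y powr (-1) \<le> jb z powr ((1 - ?N)/2) * jb z powr (-1)"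
    by (intro mult_left_mono) auto
   then have "jb z powr ((1 - ?N)/2) * jb y powr (-1) \<le> jb z powr (- (?N + 1)/2) + jb y powr (- (?N + 1)/2)"
    unfolding ex by (rule order_trans) simp
   then show ?thesis unfolding mult.assoc by (rule mult_left_mono) simp
  next
   case False
   then have "jb z powr ((1 - ?N)/2) \<le> jb y powr ((1 - ?N)/2)" using N1 by (intro powr_mono2') auto
   then have "jb z powr ((1 - ?N)/2) * jb y powr (-1) \<le> jb y powr ((1 - ?N)/2) * jb y powr (-1)"
    by (intro mult_right_mono) auto
   then have "jb z powr ((1 - ?N)/2) * jb y powr (-1) \<le> jb z powr (- (?N + 1)/2) + jb y powr (- (?N + 1)/2)"
    unfolding ex by (rule order_trans) simp
   then show ?thesis unfolding mult.assoc by (rule mult_left_mono) simp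
  qed
  finally show ?thesis using False by (simp add: indicator_def algebra_simps)
 qed
qed

text \<open>Multiply by the power (n - 1)/2 of \<open>jb x\<close> and split it with
  \<open>jb_powr_le\<close>: the distance part cancels the kernel exactly, and the weight part
  leaves \<open>jb y powr (-1)\<close>, the situation of \<open>singular_bound\<close>. This single
  estimate later controls the gradients of potentials and the uniform integrability of the kernel
  \<open>ker\<close>.\<close>

proposition riesz_bound:
 obtains C where "0 < C"
  "\<And>x::'a::euclidean_space. LI (\<lambda>y. norm (x - y) powr (1 - real DIM('a)) * jb y powr (- (real DIM('a) + 1)/2))"
  "\<And>x::'a. (LBINT y. norm (x - y) powr (1 - real DIM('a)) * jb y powr (- (real DIM('a) + 1)/2))
    \<le> C * jb x powr (- (real DIM('a) - 1)/2)"
proof -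
 let ?N = "real DIM('a)"
 let ?c = "2 powr ((?N - 1)/2)"
 define q where "q = (?N - 1)/2"
 have N1: "1 \<le> ?N" by (simp add: Suc_leI)
 have q: "0 \<le> q" using N1 by (simp add: q_def)
 let ?S = "\<lambda>z::'a. norm z powr (1 - ?N) * ind (cball 0 1) z"
 let ?T = "\<lambda>z::'a. jb z powr (- (?N + 1)/2)"
 have iS: "LI ?S" by (rule integrable_norm_powr_cball)
 have iT: "LI ?T"
  using integrable_jb_powr[where 'a='a, of "(?N+1)/2"] unfolding minus_divide_left by simp
 define C where "C = 4 powr q * (integral\<^sup>L lborel ?T + (integral\<^sup>L lborel ?S + ?c * integral\<^sup>L lborel ?T + ?c * integral\<^sup>L lborel ?T)) + 1"
 have Tn: "0 \<le> integral\<^sup>L lborel ?T" and Sn: "0 \<le> integral\<^sup>L lborel ?S"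
  by (auto intro!: integral_nonneg_AE)
 have C0: "0 < C" unfolding C_def using Tn Sn by (intro add_nonneg_pos mult_nonneg_nonneg add_nonneg_nonneg) auto
 have dom: "jb x powr q * (norm (x - y) powr (1 - ?N) * ?T y) \<le>
   4 powr q * (?T y + (?S (x - y) + ?c * ?T (x - y) + ?c * ?T y))" for x y :: 'a
 proof -
  have e1: "jb y powr q * ?T y = jb y powr (-1)"
   by (simp add: powr_add[symmetric] q_def field_simps)
  have e2: "norm (x - y) powr (2*q) * norm (x - y) powr (1 - ?N) \<le> 1"
   by (simp add: powr_add[symmetric] q_def field_simps)
  have "jb x powr q * (norm (x - y) powr (1 - ?N) * ?T y) \<le>
   (4 powr q * (norm (x - y) powr (2 * q) + jb y powr q)) * (norm (x - y) powr (1 - ?N) * ?T y)"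
   by (intro mult_right_mono jb_powr_le q) auto
  also have "\<dots> = 4 powr q * ((norm (x - y) powr (2*q) * norm (x - y) powr (1 - ?N)) * ?T y +
    norm (x - y) powr (1 - ?N) * (jb y powr q * ?T y))"
   by (simp add: algebra_simps)
  also have "\<dots> \<le> 4 powr q * (1 * ?T y + (?S (x - y) + ?c * ?T (x - y) + ?c * ?T y))"
   unfolding e1
   by (intro mult_left_mono add_mono mult_right_mono e2 singular_bound) auto
  finally show ?thesis by simp
 qed
 have idom: "LI (\<lambda>y. 4 powr q * (?T y + (?S (x - y) + ?c * ?T (x - y) + ?c * ?T y)))" for x
  by (intro Bochner_Integration.integrable_add integrable_mult_right iT
    lborel_integral_shift(2)[of ?S x, THEN iffD2] lborel_integral_shift(2)[of ?T x, THEN iffD2] iS)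
 have int1: "LI (\<lambda>y. jb x powr q * (norm (x - y) powr (1 - ?N) * ?T y))" for x
  by (rule integrable_dom[OF idom[of x]])
    (use dom in \<open>auto intro!: AE_I2 order_trans[OF dom] \<close>)
 have int2: "LI (\<lambda>y. norm (x - y) powr (1 - ?N) * ?T y)" for x
  using int1[of x] by simp
 have bd: "(LBINT y. norm (x - y) powr (1 - ?N) * ?T y) \<le> C * jb x powr (- (?N - 1)/2)" for x
 proof -
  have "jb x powr q * (LBINT y. norm (x - y) powr (1 - ?N) * ?T y) =
   (LBINT y. jb x powr q * (norm (x - y) powr (1 - ?N) * ?T y))" by simp
  also have "\<dots> \<le> (LBINT y. 4 powr q * (?T y + (?S (x - y) + ?c * ?T (x - y) + ?c * ?T y)))"
   by (intro integral_mono int1 idom dom)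
  also have "\<dots> = 4 powr q * (integral\<^sup>L lborel ?T + (integral\<^sup>L lborel ?S + ?c * integral\<^sup>L lborel ?T + ?c * integral\<^sup>L lborel ?T))"
   using iT iS lborel_integral_shift(2)[of ?S x] lborel_integral_shift(2)[of ?T x]
    lborel_integral_shift(1)[of ?S x] lborel_integral_shift(1)[of ?T x]
   by (simp add: Bochner_Integration.integral_add)
  also have "\<dots> \<le> C" by (simp add: C_def)
  finally have "(LBINT y. norm (x - y) powr (1 - ?N) * ?T y) \<le> C / jb x powr q"
   by (simp add: field_simps)
  also have "C / jb x powr q = C * jb x powr (- (?N - 1)/2)"
  proof -
   have "- (?N - 1)/2 = - q" unfolding q_def by (rule minus_divide_left[symmetric])
   then show ?thesis by (simp only: powr_minus_divide) simp
  qed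
  finally show ?thesis .
 qed
 show ?thesis by (rule that[OF C0 int2 bd])
qed

section \<open>Continuous functions with a power bound at infinity\<close>

definition dec :: "real \<Rightarrow> ('a::euclidean_space \<Rightarrow> real) \<Rightarrow> bool"
 where "dec b f \<longleftrightarrow> continuous_on UNIV f \<and> (\<exists>C. \<forall>x. \<bar>f x\<bar> \<le> C * jb x powr b)"

lemma decI:
 assumes "continuous_on UNIV f" "\<And>x. \<bar>f x\<bar> \<le> C * jb x powr b"
 shows "dec b f"
 using assms by (auto simp: dec_def)

lemma decE:
 assumes "dec b f"
 obtains C where "0 < C" "\<And>x. \<bar>f x\<bar> \<le> C * jb x powr b"
proof -
 obtain C where C: "\<And>x. \<bar>f x\<bar> \<le> C * jb x powr b"
  using assms by (auto simp: dec_def)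
 have "\<bar>f x\<bar> \<le> (max C 1) * jb x powr b" for x
  by (rule order_trans[OF C]) (intro mult_right_mono, auto)
 then show ?thesis using that[of "max C 1"] by simp
qed

lemma dec_continuous: "dec b f \<Longrightarrow> continuous_on UNIV f"
 by (simp add: dec_def)

lemma dec_mult:
 assumes "dec a f" "dec b g"
 shows "dec (a + b) (\<lambda>x. f x * g x)"
proof -
 obtain C where C: "0 < C" "\<And>x. \<bar>f x\<bar> \<le> C * jb x powr a" using decE[OF assms(1)] by blast
 obtain D where D: "0 < D" "\<And>x. \<bar>g x\<bar> \<le> D * jb x powr b" using decE[OF assms(2)] by blast
 show ?thesis
 proof (rule decI)
  show "continuous_on UNIV (\<lambda>x. f x * g x)"
   using assms by (intro continuous_intros) (auto simp: dec_def)
  fix x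
  have "\<bar>f x * g x\<bar> \<le> (C * jb x powr a) * (D * jb x powr b)"
   unfolding abs_mult using C D by (intro mult_mono) auto
  then show "\<bar>f x * g x\<bar> \<le> (C * D) * jb x powr (a + b)"
   by (simp add: powr_add algebra_simps)
 qed
qed

lemma dec_mult':
 "dec a f \<Longrightarrow> dec b g \<Longrightarrow> c = a + b \<Longrightarrow> dec c (\<lambda>x. f x * g x)"
 using dec_mult by blast

lemma dec_add:
 assumes "dec b f" "dec b g"
 shows "dec b (\<lambda>x. f x + g x)"
proof -
 obtain C where C: "0 < C" "\<And>x. \<bar>f x\<bar> \<le> C * jb x powr b" using decE[OF assms(1)] by blast
 obtain D where D: "0 < D" "\<And>x. \<bar>g x\<bar> \<le> D * jb x powr b" using decE[OF assms(2)] by blast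
 show ?thesis
 proof (rule decI)
  show "continuous_on UNIV (\<lambda>x. f x + g x)"
   using assms by (intro continuous_intros) (auto simp: dec_def)
  fix x
  show "\<bar>f x + g x\<bar> \<le> (C + D) * jb x powr b"
   using C(2)[of x] D(2)[of x] by (simp add: algebra_simps)
 qed
qed

lemma dec_mono:
 assumes "dec a f" "a \<le> b"
 shows "dec b f"
proof -
 obtain C where C: "0 < C" "\<And>x. \<bar>f x\<bar> \<le> C * jb x powr a" using decE[OF assms(1)] by blast
 show ?thesis
 proof (rule decI)
  show "continuous_on UNIV f" using assms by (simp add: dec_def)
  fix x :: 'a
  have "C * jb x powr a \<le> C * jb x powr b"
   using assms C by (intro mult_left_mono powr_mono) auto
  then show "\<bar>f x\<bar> \<le> C * jb x powr b" using C(2)[of x] by simp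
 qed
qed

lemma dec_jb [simp]: "dec b (\<lambda>x. jb x powr b)"
 by (rule decI[where C=1]) (auto intro!: continuous_intros)

lemma dec_const [simp]: "dec 0 (\<lambda>x. c)"
 by (rule decI[where C="\<bar>c\<bar>"]) auto

lemma dec_cmult: "dec b f \<Longrightarrow> dec b (\<lambda>x. c * f x)"
 using dec_mult[OF dec_const[of c]] by auto

lemma dec_uminus: "dec b f \<Longrightarrow> dec b (\<lambda>x. - f x)"
 using dec_cmult[of b f "-1"] by simp

lemma dec_diff: "dec b f \<Longrightarrow> dec b g \<Longrightarrow> dec b (\<lambda>x. f x - g x)"
 using dec_add[OF _ dec_uminus, of b f g] by simp

text \<open>Rates count powers of \<open>jb\<close>, which is quadratic: linear growth has rate 1/2,
  and integrability begins below the rate -n/2.\<close>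

lemma dec_inner: "dec (1/2) (\<lambda>x. x \<bullet> v)"
proof (rule decI)
 fix x :: 'a
 have "\<bar>x \<bullet> v\<bar> \<le> norm x * norm v" by (rule Cauchy_Schwarz_ineq2)
 also have "\<dots> \<le> jb x powr (1/2) * norm v"
  by (intro mult_right_mono norm_le_jb) auto
 finally show "\<bar>x \<bullet> v\<bar> \<le> norm v * jb x powr (1/2)" by (simp add: mult.commute)
qed (intro continuous_intros)

lemma dec_power: "dec b f \<Longrightarrow> dec (real k * b) (\<lambda>x. f x ^ k)"
proof (induction k)
 case (Suc k)
 then show ?case using dec_mult[of b f "real k * b" "\<lambda>x. f x ^ k"] by (simp add: algebra_simps)
qed simp

lemma dec_power0: "dec 0 f \<Longrightarrow> dec 0 (\<lambda>x. f x ^ k)"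
 using dec_power[of 0 f k] by simp

lemma dec_measurable: "dec b f \<Longrightarrow> f \<in> BM"
 by (auto simp: dec_def intro: borel_measurable_continuous_onI)

lemma dec_integrable:
 fixes f :: "'a::euclidean_space \<Rightarrow> real"
 assumes "dec b f" "b < - real DIM('a) / 2"
 shows "LI f"
proof -
 obtain C where C: "0 < C" "\<And>x. \<bar>f x\<bar> \<le> C * jb x powr b" using decE[OF assms(1)] by blast
 have "LI (\<lambda>x::'a. C * jb x powr b)"
  using integrable_jb_powr[where 'a='a, of "-b"] assms by simp
 then show ?thesis
  by (rule integrable_dom)
    (use C dec_measurable[OF assms(1)] in \<open>auto intro!: AE_I2\<close>)
qed

lemma dec_comparable:
 assumes g: "continuous_on UNIV g" and m: "0 < m" and g1: "\<And>x. m * jb x \<le> g x" and g2: "\<And>x. g x \<le> M * jb x"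
 shows "dec a (\<lambda>x. g x powr a)"
proof -
 have gp: "0 < g x" for x using g1[of x] m by (meson jb_pos less_le_trans mult_pos_pos)
 have M0: "0 < M" using g2[of undefined] gp[of undefined]
  by (metis jb_pos less_le_trans zero_less_mult_pos2)
 show ?thesis
 proof (rule decI)
  show "continuous_on UNIV (\<lambda>x. g x powr a)"
   using gp by (intro continuous_intros g) (auto simp: less_imp_neq[symmetric] dest: less_imp_neq)
  fix x
  show "\<bar>g x powr a\<bar> \<le> (M powr a + m powr a) * jb x powr a"
  proof (cases "0 \<le> a")
   case True
   have "g x powr a \<le> (M * jb x) powr a" using True gp[of x] g2 by (intro powr_mono2) auto
   also have "\<dots> = M powr a * jb x powr a" using M0 by (simp add: powr_mult)
   finally show ?thesis by (simp add: algebra_simps add_increasing2)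
  next
   case False
   have "g x powr a \<le> (m * jb x) powr a" using False m g1 by (intro powr_mono2') auto
   also have "\<dots> = m powr a * jb x powr a" using m by (simp add: powr_mult)
   finally show ?thesis by (simp add: algebra_simps add_increasing)
  qed
 qed
qed

text \<open>For fixed \<epsilon> > 0 the regularised squared distance is comparable with
  \<open>jb\<close>, so its powers inherit the decay of those of \<open>jb\<close>. The constants
  degenerate as \<epsilon> tends to 0; limits in \<epsilon> are therefore taken only after
  integrating by parts.\<close>

lemma dec_eps:
 fixes x :: "'a::euclidean_space"
 assumes "0 < \<epsilon>"
 shows "dec a (\<lambda>y. (\<epsilon>\<^sup>2 + (norm (y - x))\<^sup>2) powr a)"
proof -
 define m where "m = 1 / (2 * (1 + jb x / \<epsilon>\<^sup>2))"
 have e: "0 < \<epsilon>\<^sup>2" using assms by simp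
 have m: "0 < m" using e by (simp add: m_def add_pos_nonneg)
 show ?thesis
 proof (rule dec_comparable[OF _ m, where M = "\<epsilon>\<^sup>2 + 2 * jb x"])
  show "continuous_on UNIV (\<lambda>y. \<epsilon>\<^sup>2 + (norm (y - x))\<^sup>2)" by (intro continuous_intros)
  fix y :: 'a
  have h1: "jb y \<le> 2 * ((norm (y - x))\<^sup>2 + jb x)" by (rule jb_minus_le)
  have h2: "jb x \<le> (jb x / \<epsilon>\<^sup>2) * (\<epsilon>\<^sup>2 + (norm (y - x))\<^sup>2)"
   using e by (simp add: field_simps)
  have h3: "(norm (y - x))\<^sup>2 \<le> 1 * (\<epsilon>\<^sup>2 + (norm (y - x))\<^sup>2)" using e by simp
  have "jb y \<le> 2 * (1 * (\<epsilon>\<^sup>2 + (norm (y - x))\<^sup>2) + (jb x / \<epsilon>\<^sup>2) * (\<epsilon>\<^sup>2 + (norm (y - x))\<^sup>2))"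
   by (rule order_trans[OF h1 mult_left_mono[OF add_mono[OF h3 h2]]]) simp
  then have "jb y \<le> 2 * (1 + jb x / \<epsilon>\<^sup>2) * (\<epsilon>\<^sup>2 + (norm (y - x))\<^sup>2)"
   by (simp only: distrib_right mult.assoc)
  then show "m * jb y \<le> \<epsilon>\<^sup>2 + (norm (y - x))\<^sup>2"
   using e by (simp add: m_def divide_le_eq add_pos_nonneg mult.commute)
  have "jb (y - x) \<le> 2 * ((norm (y - x - (- x)))\<^sup>2 + jb (- x))" by (rule jb_minus_le)
  then have "(norm (y - x))\<^sup>2 \<le> 2 * (norm y)\<^sup>2 + 2 * jb x" by (simp add: jb_def)
  also have "\<dots> \<le> 2 * jb x * jb y"
  proof -
   have "(norm y)\<^sup>2 * 1 \<le> (norm y)\<^sup>2 * jb x" by (intro mult_left_mono) auto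
   then show ?thesis by (simp add: jb_def[of y] algebra_simps)
  qed
  finally show "\<epsilon>\<^sup>2 + (norm (y - x))\<^sup>2 \<le> (\<epsilon>\<^sup>2 + 2 * jb x) * jb y"
   using mult_left_mono[OF jb_ge1[of y], of "\<epsilon>\<^sup>2"] by (simp add: algebra_simps)
 qed
qed

lemma dec_shift:
 assumes "dec b f"
 shows "dec b (\<lambda>y. f (y - x))"
proof -
 obtain C where C: "0 < C" "\<And>x. \<bar>f x\<bar> \<le> C * jb x powr b" using decE[OF assms(1)] by blast
 have "dec b (\<lambda>y. (1\<^sup>2 + (norm (y - x))\<^sup>2) powr b)" by (rule dec_eps) simp
 then obtain D where D: "0 < D" "\<And>y. \<bar>(1\<^sup>2 + (norm (y - x))\<^sup>2) powr b\<bar> \<le> D * jb y powr b"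
  by (rule decE) blast
 show ?thesis
 proof (rule decI)
  show "continuous_on UNIV (\<lambda>y. f (y - x))"
   by (rule continuous_on_compose2[OF dec_continuous[OF assms]]) (auto intro!: continuous_intros)
  fix y
  have "\<bar>f (y - x)\<bar> \<le> C * jb (y - x) powr b" by (rule C)
  also have "\<dots> \<le> C * (D * jb y powr b)"
   using D(2)[of y] C by (intro mult_left_mono) (auto simp: jb_def)
  finally show "\<bar>f (y - x)\<bar> \<le> (C * D) * jb y powr b" by simp
 qed
qed

section \<open>Directional derivatives and integration by parts\<close>

definition pd :: "'a::euclidean_space \<Rightarrow> ('a \<Rightarrow> real) \<Rightarrow> ('a \<Rightarrow> real) \<Rightarrow> bool"
 where "pd i f f' \<longleftrightarrow> (\<forall>x. ((\<lambda>t. f (x + t *\<^sub>R i)) has_real_derivative f' x) (at 0))"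

lemma pd_at:
 assumes "pd i f f'"
 shows "((\<lambda>t. f (x + t *\<^sub>R i)) has_real_derivative f' (x + s *\<^sub>R i)) (at s)"
proof -
 have "((\<lambda>t. f ((x + s *\<^sub>R i) + t *\<^sub>R i)) has_real_derivative f' (x + s *\<^sub>R i)) (at 0)"
  using assms by (simp add: pd_def)
 then have "((\<lambda>t. f (x + (t + s) *\<^sub>R i)) has_real_derivative f' (x + s *\<^sub>R i)) (at 0)"
  by (simp add: algebra_simps)
 then show ?thesis
  using DERIV_shift[of "\<lambda>t. f (x + t *\<^sub>R i)" "f' (x + s *\<^sub>R i)" 0 s] by (simp add: add.commute)
qed

lemma pd_mult:
 assumes "pd i f f'" "pd i g g'"
 shows "pd i (\<lambda>x. f x * g x) (\<lambda>x. f' x * g x + f x * g' x)"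
 using assms unfolding pd_def
 by (auto intro!: derivative_eq_intros)

lemma pd_add:
 assumes "pd i f f'" "pd i g g'"
 shows "pd i (\<lambda>x. f x + g x) (\<lambda>x. f' x + g' x)"
 using assms unfolding pd_def by (auto intro!: derivative_eq_intros)

lemma pd_diff:
 assumes "pd i f f'" "pd i g g'"
 shows "pd i (\<lambda>x. f x - g x) (\<lambda>x. f' x - g' x)"
 using assms unfolding pd_def by (auto intro!: derivative_eq_intros)

lemma pd_const: "pd i (\<lambda>x. c) (\<lambda>x. 0)"
 unfolding pd_def by simp

lemma pd_cmult: "pd i f f' \<Longrightarrow> pd i (\<lambda>x. c * f x) (\<lambda>x. c * f' x)"
 using pd_mult[OF pd_const[of i c], of f f'] by simp

lemma pd_power:
 assumes "pd i f f'"
 shows "pd i (\<lambda>x. f x ^ k) (\<lambda>x. real k * f x ^ (k - 1) * f' x)"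
 using assms unfolding pd_def by (auto intro!: derivative_eq_intros)

lemma pd_powr:
 assumes "pd i f f'" "\<And>x. 0 < f x"
 shows "pd i (\<lambda>x. f x powr a) (\<lambda>x. a * f x powr (a - 1) * f' x)"
 unfolding pd_def
proof
 fix x
 show "((\<lambda>t. f (x + t *\<^sub>R i) powr a) has_real_derivative a * f x powr (a - 1) * f' x) (at 0)"
  using DERIV_fun_powr[of "\<lambda>t. f (x + t *\<^sub>R i)" "f' x" 0 a] assms
  unfolding pd_def by simp
qed

lemma pd_inner: "pd i (\<lambda>x. x \<bullet> v) (\<lambda>x. i \<bullet> v)"
 unfolding pd_def by (auto intro!: derivative_eq_intros simp: inner_add_left)

lemma pd_norm_sq: "pd i (\<lambda>y. (norm (y - x))\<^sup>2) (\<lambda>y. 2 * ((y - x) \<bullet> i))"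
 unfolding pd_def
proof
 fix y
 have "(\<lambda>t. (norm (y + t *\<^sub>R i - x))\<^sup>2) = (\<lambda>t. (norm (y - x))\<^sup>2 + 2 * t * ((y - x) \<bullet> i) + t\<^sup>2 * (i \<bullet> i))"
  unfolding power2_norm_eq_inner
  by (auto simp: inner_simps inner_commute power2_eq_square algebra_simps)
 then show "((\<lambda>t. (norm (y + t *\<^sub>R i - x))\<^sup>2) has_real_derivative 2 * ((y - x) \<bullet> i)) (at 0)"
  by (auto intro!: derivative_eq_intros)
qed

lemma pd_jb: "pd i jb (\<lambda>y. 2 * (y \<bullet> i))"
 using pd_add[OF pd_const[of i 1] pd_norm_sq[of i 0]] by (simp add: jb_def[abs_def])

lemma pd_cong: "pd i f f' \<Longrightarrow> (\<And>x. f x = g x) \<Longrightarrow> (\<And>x. f' x = g' x) \<Longrightarrow> pd i g g'"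
 by (metis ext)

text \<open>Integrate \<open>f' (x + t *\<^sub>R i)\<close> over t in [0, 1] and over all x.
  Translation invariance gives the integral of f'; the fundamental theorem of calculus in t gives
  the integral of f (x + i) - f x, which is 0. Only derivatives along lines in direction i enter,
  and these are what \<open>pd\<close> records.\<close>

lemma integral_pd_zero:
 fixes f :: "'a::euclidean_space \<Rightarrow> real"
 assumes pd: "pd i f f'" and f: "LI f" and f': "LI f'" "continuous_on UNIV f'"
 shows "(LBINT x. f' x) = 0"
proof -
 have [measurable]: "f' \<in> BM" using f' by simp
 let ?F = "\<lambda>(t::real, x). ind {0..1} t *\<^sub>R f' (x + t *\<^sub>R i)"
 have sh: "LI (\<lambda>x. f' (x + t *\<^sub>R i))" "(LBINT x. f' (x + t *\<^sub>R i)) = (LBINT x. f' x)"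
  for t
  using f'(1) lborel_integral_shift(3,4)[of f' "t *\<^sub>R i"] by (simp_all add: add.commute)
 have shn: "(LBINT x. \<bar>f' (x + t *\<^sub>R i)\<bar>) = (LBINT x. \<bar>f' x\<bar>)" for t
  using lborel_integral_shift(3)[of "\<lambda>x. \<bar>f' x\<bar>" "t *\<^sub>R i"] by (simp add: add.commute)
 have int: "integrable (lborel \<Otimes>\<^sub>M lborel) ?F"
 proof (rule lborel_pair.Fubini_integrable)
  show "?F \<in> borel_measurable (lborel \<Otimes>\<^sub>M lborel)" by measurable
  show "LI (\<lambda>t. (LBINT x. norm (?F (t, x))))"
  proof -
   have "(\<lambda>t::real. (LBINT x. norm (?F (t, x)))) = (\<lambda>t. ind {0..1} t * (LBINT x. \<bar>f' x\<bar>))"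
    by (auto simp: indicator_def shn)
   moreover have "LI (\<lambda>t::real. ind {0..1} t * (LBINT x. \<bar>f' x\<bar>))"
    by (intro integrable_mult_left) simp
   ultimately show ?thesis by simp
  qed
  show "AE t in lborel. LI (\<lambda>x. ?F (t, x))"
   using sh by (intro AE_I2) (simp add: integrable_scaleR_right)
 qed
 have "(LBINT t. (LBINT x. ?F (t, x))) = (LBINT t. ind {0..1::real} t * (LBINT x. f' x))"
  using sh by simp
 also have "\<dots> = (LBINT x. f' x)" by (simp add: content_real)
 finally have A: "(LBINT t. (LBINT x. ?F (t, x))) = (LBINT x. f' x)" .
 have ftc: "(LBINT t. ?F (t, x)) = f (x + i) - f x" for x
 proof -
  have "(LBINT t. f' (x + t *\<^sub>R i) * ind {0..1} t) = f (x + 1 *\<^sub>R i) - f (x + 0 *\<^sub>R i)"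
  proof (rule integral_FTC_Icc_real)
   show "(0::real) \<le> 1" by simp
   fix t :: real
   show "((\<lambda>t. f (x + t *\<^sub>R i)) has_real_derivative f' (x + t *\<^sub>R i)) (at t)"
    by (rule pd_at[OF pd])
   have "continuous_on UNIV (\<lambda>t. f' (x + t *\<^sub>R i))"
    by (rule continuous_on_compose2[OF f'(2)]) (auto intro!: continuous_intros)
   then show "isCont (\<lambda>t. f' (x + t *\<^sub>R i)) t"
    by (simp add: continuous_on_eq_continuous_at)
  qed
  then show ?thesis by (simp add: mult.commute)
 qed
 have "(LBINT t. (LBINT x. ?F (t, x))) = (LBINT x. (LBINT t. ?F (t, x)))"
  using lborel_pair.Fubini_integral[of "\<lambda>t x. ?F (t, x)"] int by simp
 also have "\<dots> = (LBINT x. f (x + i) - f x)" unfolding ftc ..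
 also have "\<dots> = 0"
  using f lborel_integral_shift(3,4)[of f i] by (simp add: add.commute)
 finally show ?thesis using A by simp
qed

lemma powr_mult_one: "0 < x \<Longrightarrow> a + b = 0 \<Longrightarrow> x powr a * x powr b = (1::real)"
 by (simp add: powr_add[symmetric])

section \<open>Smooth cut-off functions\<close>

definition es :: "nat \<Rightarrow> real" where "es k = 1 / real (Suc k)"

lemma es: "0 < es k" "es k \<le> 1" "es \<leadsto> 0"
 unfolding es_def[abs_def] using LIMSEQ_Suc[OF lim_1_over_n] by simp_all

text \<open>The functions \<open>exp (- 1 / t) / t ^ j\<close>, extended by \<open>0\<close>, form a family closed under differentiation.\<close>

definition hb :: "nat \<Rightarrow> real \<Rightarrow> real"
 where "hb j t = (if 0 < t then exp (- 1 / t) / t ^ j else 0)"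

lemma hb_tendsto_0: "(hb j \<longlongrightarrow> 0) (at_right 0)"
proof -
 have "((\<lambda>x::real. x ^ j / exp x) \<longlongrightarrow> 0) at_top" by (rule tendsto_power_div_exp_0)
 then have "((\<lambda>t. inverse t ^ j / exp (inverse t)) \<longlongrightarrow> (0::real)) (at_right 0)"
  by (rule filterlim_compose) (rule filterlim_inverse_at_top_right)
 then show ?thesis
 proof (rule Lim_transform_eventually)
  show "\<forall>\<^sub>F t in at_right 0. inverse t ^ j / exp (inverse t) = hb j t"
   unfolding eventually_at_right_field
   by (intro exI[of _ 1]) (auto simp: hb_def exp_minus field_simps)
 qed
qed

text \<open>At the origin the right difference quotient of \<open>hb j\<close> is
  \<open>hb (Suc j)\<close>, which tends to 0, so the formula valid away from 0 extends across
  it.\<close>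

lemma hb_deriv: "(hb j has_real_derivative (- real j * hb (Suc j) t + hb (j + 2) t)) (at t)"
proof -
 consider (less) "t < 0" | (greater) "0 < t" | (equal) "t = 0" by linarith
 then show ?thesis
 proof cases
 case less
 have "(hb j has_real_derivative 0) (at t)"
 proof (rule has_field_derivative_transform_within_open[where S="{..<0}" and f="\<lambda>t. 0"])
  show "0 = hb j x" if "x \<in> {..<0}" for x using that by (simp add: hb_def)
 qed (use less in auto)
 then show ?thesis using less by (simp add: hb_def)
next
 case greater
 have d: "((\<lambda>t. exp (- 1 / t) / t ^ j) has_real_derivative (- real j * hb (Suc j) t + hb (j + 2) t)) (at t)"
 proof -
  have "((\<lambda>t. exp (- inverse t) * (inverse t) ^ j) has_real_derivative
   (exp (- inverse t) * (inverse t * inverse t)) * (inverse t) ^ j + exp (- inverse t) * (real j * (inverse t) ^ (j - 1) * (- (inverse t * inverse t)))) (at t)"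
   using greater by (auto intro!: derivative_eq_intros simp: power2_eq_square)
  moreover have "(exp (- inverse t) * (inverse t * inverse t)) * (inverse t) ^ j + exp (- inverse t) * (real j * (inverse t) ^ (j - 1) * (- (inverse t * inverse t)))
   = - real j * hb (Suc j) t + hb (j + 2) t"
   using greater by (cases j) (auto simp: hb_def field_simps)
  ultimately show ?thesis by (simp add: inverse_eq_divide power_divide)
 qed
 show ?thesis
  by (rule has_field_derivative_transform_within_open[OF d, where S="{0<..}"]) (use greater in \<open>auto simp: hb_def\<close>)
next
 case equal
 have "((\<lambda>t. (hb j t - hb j 0) / (t - 0)) \<longlongrightarrow> 0) (at 0)"
 proof (subst filterlim_at_split, intro conjI)
  show "((\<lambda>t. (hb j t - hb j 0) / (t - 0)) \<longlongrightarrow> 0) (at_left 0)"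
  proof (rule tendsto_eventually)
   show "\<forall>\<^sub>F t in at_left 0. (hb j t - hb j 0) / (t - 0) = 0"
    unfolding eventually_at_left_field by (intro exI[of _ "-1"]) (auto simp: hb_def)
  qed
  show "((\<lambda>t. (hb j t - hb j 0) / (t - 0)) \<longlongrightarrow> 0) (at_right 0)"
   using hb_tendsto_0[of "Suc j"]
  proof (rule Lim_transform_eventually)
   show "\<forall>\<^sub>F t in at_right 0. hb (Suc j) t = (hb j t - hb j 0) / (t - 0)"
    unfolding eventually_at_right_field by (intro exI[of _ 1]) (auto simp: hb_def)
  qed
 qed
 then have "(hb j has_real_derivative 0) (at 0)" by (simp add: has_field_derivative_iff)
 then show ?thesis using equal by (simp add: hb_def)
 qed
qed

lemma hb_nonneg: "0 \<le> hb j t"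
 by (simp add: hb_def)

lemma hb0_le: "hb 0 t \<le> 1"
 by (simp add: hb_def)

lemma hb2_le: "hb 2 t \<le> 2"
proof (cases "0 < t")
 case True
 define s where "s = 1 / t"
 have s: "0 < s" using True by (simp add: s_def)
 have "s\<^sup>2 / 2 \<le> exp s" using exp_lower_Taylor_quadratic[of s] s by simp
 then have "s\<^sup>2 * exp (- s) \<le> 2" by (simp add: exp_minus field_simps)
 then show ?thesis using True by (simp add: hb_def s_def power_divide exp_minus field_simps)
qed (simp add: hb_def)

lemma hb0_deriv: "(hb 0 has_real_derivative hb 2 t) (at t)"
 using hb_deriv[of 0 t] by (simp add: numeral_2_eq_2)

lemma compact_support_dec:
 assumes c: "continuous_on UNIV f" and K: "compact K" "\<And>x. x \<notin> K \<Longrightarrow> f x = 0"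
 shows "dec b f"
proof -
 have "continuous_on K (\<lambda>x. f x * jb x powr (- b))"
  by (intro continuous_intros continuous_on_subset[OF c]) auto
 then have "compact ((\<lambda>x. f x * jb x powr (- b)) ` K)" using K(1) by (rule compact_continuous_image)
 then obtain C where C: "\<forall>y\<in>(\<lambda>x. f x * jb x powr (- b)) ` K. norm y \<le> C"
  using compact_imp_bounded bounded_iff by blast
 have "\<bar>f x\<bar> \<le> (max C 0) * jb x powr b" for x
 proof (cases "x \<in> K")
  case True
  then have "\<bar>f x\<bar> * jb x powr (- b) \<le> C" using C by (auto simp: abs_mult)
  then have "(\<bar>f x\<bar> * jb x powr (- b)) * jb x powr b \<le> max C 0 * jb x powr b" by (intro mult_right_mono) auto
  moreover have "jb x powr (- b) * jb x powr b = 1" by (rule powr_mult_one) auto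
  ultimately show ?thesis by (simp only: mult.assoc mult_1_right)
 qed (use K in simp)
 then show ?thesis by (rule decI[OF c])
qed

text \<open>The factor \<open>exp 1\<close> normalises the pointwise limit to 1. The functions are
  not constant near the origin, only uniformly bounded and convergent. The distance is written as
  \<open>norm (x - 0)\<close> so that the rules for \<open>norm (y - x)\<close> apply.\<close>

definition chi :: "nat \<Rightarrow> 'a::euclidean_space \<Rightarrow> real"
 where "chi k x = exp 1 * hb 0 (1 - es k * (norm (x - 0))\<^sup>2)"

lemma hb_cut:
 assumes "x \<notin> cball 0 (real (Suc k))"
 shows "hb j (1 - es k * (norm (x - 0))\<^sup>2) = 0"
proof -
 have "real (Suc k) * 1 \<le> real (Suc k) * real (Suc k)" by (intro mult_left_mono) auto
 also have "\<dots> \<le> norm x * norm x" using assms by (intro mult_mono) auto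
 finally have "1 \<le> es k * (norm x)\<^sup>2" by (simp add: es_def field_simps power2_eq_square)
 then show ?thesis by (simp add: hb_def)
qed

lemma hb_cut_continuous: "continuous_on UNIV (\<lambda>x::'a::euclidean_space. hb j (1 - es k * (norm (x - 0))\<^sup>2))"
proof (rule continuous_on_compose2[where g="hb j" and t=UNIV])
 show "continuous_on UNIV (hb j)" using hb_deriv by (meson DERIV_isCont continuous_at_imp_continuous_on)
qed (auto intro!: continuous_intros)

lemma pd_hb0: "pd i g g' \<Longrightarrow> pd i (\<lambda>x. hb 0 (g x)) (\<lambda>x. hb 2 (g x) * g' x)"
proof -
 assume g: "pd i g g'"
 show ?thesis unfolding pd_def
 proof
  fix x
  show "((\<lambda>t. hb 0 (g (x + t *\<^sub>R i))) has_real_derivative hb 2 (g x) * g' x) (at 0)"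
  proof (rule DERIV_chain2[where f="hb 0"])
   show "((\<lambda>t. g (x + t *\<^sub>R i)) has_real_derivative g' x) (at 0)" using g by (simp add: pd_def)
   show "(hb 0 has_real_derivative hb 2 (g x)) (at (g (x + 0 *\<^sub>R i)))" using hb0_deriv[of "g x"] by simp
  qed
 qed
qed

lemma chi_bound: "\<bar>chi k (x::'a::euclidean_space)\<bar> \<le> exp 1"
 using hb0_le hb_nonneg by (simp add: chi_def abs_mult)

lemma chi_limit: "(\<lambda>k. chi k (x::'a::euclidean_space)) \<leadsto> 1"
proof -
 have "(\<lambda>k. 1 - es k * (norm (x - 0))\<^sup>2) \<leadsto> 1 - 0 * (norm (x - 0))\<^sup>2"
  by (intro tendsto_intros es)
 then have "(\<lambda>k. 1 - es k * (norm (x - 0))\<^sup>2) \<leadsto> 1" by simp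
 moreover have "isCont (hb 0) 1" using hb0_deriv by (rule DERIV_isCont)
 ultimately have "(\<lambda>k. hb 0 (1 - es k * (norm (x - 0))\<^sup>2)) \<leadsto> hb 0 1" by (rule isCont_tendsto_compose[rotated])
 then have "(\<lambda>k. exp 1 * hb 0 (1 - es k * (norm (x - 0))\<^sup>2)) \<leadsto> exp 1 * hb 0 1" by (intro tendsto_intros)
 then show ?thesis by (simp add: chi_def hb_def exp_add[symmetric])
qed

definition chi' :: "nat \<Rightarrow> 'a::euclidean_space \<Rightarrow> 'a \<Rightarrow> real"
 where "chi' k i x = exp 1 * (hb 2 (1 - es k * (norm (x - 0))\<^sup>2) * (0 - es k * (2 * ((x - 0) \<bullet> i))))"

lemma pd_chi: "pd i (chi k) (chi' k i)"
 unfolding chi_def[abs_def] chi'_def[abs_def]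
 by (intro pd_cmult pd_hb0 pd_diff pd_const pd_norm_sq)

text \<open>On the support |x|^2 is at most k + 1, so the factor 1 / (k + 1) turns the growth |x| of
  the inner derivative into the decay 1 / |x|, uniformly in k. It is this uniformity that allows the
  cut-off error to be dominated.\<close>

lemma chi'_bound:
 assumes "i \<in> Basis"
 shows "\<bar>chi' k i x\<bar> \<le> 8 * exp 1 * jb x powr (-1/2)"
proof (cases "es k * (norm x)\<^sup>2 < 1")
 case True
 have "es k * norm x * jb x powr (1/2) \<le> es k * (jb x powr (1/2)) * jb x powr (1/2)"
  using es(1)[of k] by (intro mult_right_mono mult_left_mono norm_le_jb) auto
 also have "\<dots> = es k * jb x" by (simp add: powr_half_sqrt)
 also have "\<dots> \<le> 2" using es(2)[of k] True by (simp add: jb_def algebra_simps)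
 finally have "es k * norm x * jb x powr (1/2) * jb x powr (-1/2) \<le> 2 * jb x powr (-1/2)" by (intro mult_right_mono) auto
 moreover have "jb x powr (1/2) * jb x powr (-1/2) = 1" by (rule powr_mult_one) auto
 ultimately have 1: "es k * norm x \<le> 2 * jb x powr (-1/2)" by (simp only: mult.assoc mult_1_right)
 have "es k * \<bar>x \<bullet> i\<bar> \<le> es k * norm x" using es(1)[of k] Basis_le_norm[OF assms] by (intro mult_left_mono) auto
 with 1 have 2: "es k * (2 * \<bar>x \<bullet> i\<bar>) \<le> 4 * jb x powr (-1/2)" by simp
 have "\<bar>chi' k i x\<bar> = exp 1 * (hb 2 (1 - es k * (norm x)\<^sup>2) * (es k * (2 * \<bar>x \<bullet> i\<bar>)))"
  using es(1)[of k] hb_nonneg[of 2] by (simp add: chi'_def abs_mult)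
 also have "\<dots> \<le> exp 1 * (2 * (4 * jb x powr (-1/2)))"
  using es(1)[of k] hb_nonneg by (intro mult_left_mono mult_mono[OF hb2_le 2]) auto
 finally show ?thesis by simp
qed (simp add: chi'_def hb_def)

lemma chi'_limit: "(\<lambda>k. chi' k i x) \<leadsto> 0"
proof (rule tendsto_rabs_zero_cancel, rule tendsto_sandwich[OF _ _ tendsto_const])
 have "(\<lambda>k. es k * (exp 1 * (4 * \<bar>x \<bullet> i\<bar>))) \<leadsto> 0 * (exp 1 * (4 * \<bar>x \<bullet> i\<bar>))" by (intro tendsto_intros es)
 then show "(\<lambda>k. es k * (exp 1 * (4 * \<bar>x \<bullet> i\<bar>))) \<leadsto> 0" by simp
 have "\<bar>chi' k i x\<bar> \<le> es k * (exp 1 * (4 * \<bar>x \<bullet> i\<bar>))" for k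
 proof -
  have "\<bar>chi' k i x\<bar> = exp 1 * (hb 2 (1 - es k * (norm x)\<^sup>2) * (es k * (2 * \<bar>x \<bullet> i\<bar>)))"
   using es(1)[of k] hb_nonneg[of 2] by (simp add: chi'_def abs_mult)
  also have "\<dots> \<le> exp 1 * (2 * (es k * (2 * \<bar>x \<bullet> i\<bar>)))"
   using hb2_le es(1)[of k] by (intro mult_left_mono mult_right_mono) auto
  finally show ?thesis by (simp add: mult_ac)
 qed
 then show "\<forall>\<^sub>F k in sequentially. \<bar>chi' k i x\<bar> \<le> es k * (exp 1 * (4 * \<bar>x \<bullet> i\<bar>))" by simp
qed simp

lemma dec_chi: "dec b (chi k)" "dec b (chi' k i)"
proof -
 show "dec b (chi k)" unfolding chi_def[abs_def]
  by (rule compact_support_dec[OF _ compact_cball[of 0 "real (Suc k)"]])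
    (intro continuous_on_mult continuous_on_const hb_cut_continuous, metis hb_cut mult_zero_right)
 show "dec b (chi' k i)" unfolding chi'_def[abs_def]
  by (rule compact_support_dec[OF _ compact_cball[of 0 "real (Suc k)"]])
    (intro continuous_intros hb_cut_continuous, metis hb_cut mult_zero_right mult_zero_left)
qed

text \<open>The rate required of w is the borderline |x|^(1 - n) below which the flux through large
  spheres vanishes. Such a w may fail to be integrable; the derivative of the cut-off supplies the
  missing factor \<open>jb x powr (-1/2)\<close>.\<close>

lemma integral_pd_zero_dec:
 fixes w :: "'a::euclidean_space \<Rightarrow> real"
 assumes i: "i \<in> Basis" and pd: "pd i w w'" and w: "dec b w" "b < - (real DIM('a) - 1)/2"
  and w': "dec b' w'" "b' < - real DIM('a)/2"
 shows "(LBINT x. w' x) = 0"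
proof -
 have [measurable]: "w \<in> BM" "w' \<in> BM"
   "(chi k :: 'a \<Rightarrow> real) \<in> BM" "chi' k i \<in> BM" for k
  using w(1) w'(1) dec_chi[of 0] by (auto intro: dec_measurable)
 note cw = dec_continuous[OF w(1)] dec_continuous[OF w'(1)] dec_continuous[OF dec_chi(1)] dec_continuous[OF dec_chi(2)]
 have i1: "LI (\<lambda>x. w' x * chi k x)" for k
  by (rule dec_integrable[OF dec_mult[OF w'(1) dec_chi(1)[of 0]]]) (use w'(2) in auto)
 have i2: "LI (\<lambda>x. w x * chi' k i x)" and i3: "LI (\<lambda>x. w x * chi k x)" for k
  by (rule dec_integrable[OF dec_mult[OF w(1) dec_chi(2)[of "-1"]]] dec_integrable[OF dec_mult[OF w(1) dec_chi(1)[of "-1"]]];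
    use w(2) in \<open>auto simp: field_simps\<close>)+
 have z: "(LBINT x. w' x * chi k x + w x * chi' k i x) = 0" for k
  by (rule integral_pd_zero[OF pd_mult[OF pd pd_chi]])
    (intro i1 i2 i3 Bochner_Integration.integrable_add continuous_intros cw)+
 have key: "(LBINT x. w' x * chi k x) = - (LBINT x. w x * chi' k i x)" for k
  using z[of k] unfolding Bochner_Integration.integral_add[OF i1 i2] by simp
 have l1: "(\<lambda>k. (LBINT x. w' x * chi k x)) \<leadsto> (LBINT x. w' x * 1)"
 proof (rule integral_dct)
  show "AE x in lborel. (\<lambda>k. w' x * chi k x) \<leadsto> w' x * 1" by (intro AE_I2 tendsto_intros chi_limit)
  show "AE x in lborel. norm (w' x * chi k x) \<le> \<bar>w' x\<bar> * exp 1" for k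
   unfolding real_norm_def abs_mult by (intro AE_I2 mult_left_mono chi_bound) simp
  show "LI (\<lambda>x. \<bar>w' x\<bar> * exp 1)" using dec_integrable[OF w'] by simp
 qed measurable
 have l2: "(\<lambda>k. (LBINT x. w x * chi' k i x)) \<leadsto> (LBINT x. w x * 0)"
 proof (rule integral_dct)
  show "AE x in lborel. (\<lambda>k. w x * chi' k i x) \<leadsto> w x * 0" by (intro AE_I2 tendsto_intros chi'_limit)
  show "AE x in lborel. norm (w x * chi' k i x) \<le> \<bar>w x\<bar> * (8 * exp 1 * jb x powr (-1/2))" for k
   unfolding real_norm_def abs_mult by (intro AE_I2 mult_left_mono chi'_bound[OF i]) simp
  have "LI (\<lambda>x. w x * jb x powr (-1/2))"
   by (rule dec_integrable[OF dec_mult[OF w(1) dec_jb]]) (use w(2) in \<open>auto simp: field_simps\<close>)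
  from integrable_mult_right[OF integrable_abs[OF this], of "8 * exp 1"]
  show "LI (\<lambda>x. \<bar>w x\<bar> * (8 * exp 1 * jb x powr (-1/2)))" by (simp add: abs_mult mult_ac)
 qed measurable
 from LIMSEQ_unique[OF l1[unfolded key] tendsto_minus[OF l2]] show ?thesis by simp
qed

lemma sq_powr_half: "((x::real)\<^sup>2) powr (a / 2) = \<bar>x\<bar> powr a"
 by (simp add: sq_powr)

section \<open>Green's formula and the conformal integral operator\<close>

text \<open>This integral equals the volume of the unit ball. It enters as the mass of the
  approximate identity \<open>\<epsilon>\<^sup>2 * geps \<epsilon> x y powr Np T\<close>, which up
  to the factor n (n - 2) is minus the Laplacian of the regularised fundamental solution.\<close>

definition om0 :: "'a::euclidean_space itself \<Rightarrow> real"
 where "om0 _ = (LBINT z. jb (z::'a) powr (- (real DIM('a) + 2)/2))"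

text \<open>Inverse stereographic projection: the origin goes to the pole (0, 1) and infinity to (0,
  -1). The second component is (1 - |y|^2) / (1 + |y|^2).\<close>

definition stereo :: "'a::euclidean_space \<Rightarrow> 'a \<times> real"
 where "stereo y = ((2 / jb y) *\<^sub>R y, 2 / jb y - 1)"

text \<open>With U = jb^(-(n - 2)/2), a multiple of the standard bubble, this is up to normalisation
  1/U times the inverse of minus the Laplacian applied to U^p f. Conjugating with the bubble turns
  the Newtonian potential into an operator that commutes with the rotations of the sphere.\<close>

definition Kop :: "('a::euclidean_space \<Rightarrow> real) \<Rightarrow> 'a \<Rightarrow> real"
 where "Kop f x = jb x powr ((real DIM('a) - 2)/2) / om0 TYPE('a) *
   (LBINT y. norm (x - y) powr (2 - real DIM('a)) * (jb y powr (- (real DIM('a) + 2)/2) * f y))"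

locale dim_ge_3 =
 fixes T :: "'a::euclidean_space itself"
 assumes dim3: "3 \<le> DIM('a)"
begin

lemma N3: "3 \<le> N T"
 using dim3 by (metis of_nat_le_iff of_nat_numeral)

lemma om0_integrable: "LI (\<lambda>z::'a. jb z powr Np T)"
 by (rule dec_integrable[OF dec_jb]) (simp add: field_simps)

lemma om0_pos: "0 < om0 TYPE('a)"
proof -
 have "om0 TYPE('a) \<noteq> 0"
 proof
  assume "om0 TYPE('a) = 0"
  then have "AE z in lborel. jb (z::'a) powr Np T = 0"
   using integral_nonneg_eq_0_iff_AE[OF om0_integrable] by (simp add: om0_def)
  then have "AE z in (lborel::'a measure). False" by simp
  then have "emeasure lborel (UNIV::'a set) = 0"
   using ae_filter_eq_bot_iff[of "lborel::'a measure"] by (simp add: eventually_False)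
  then show False by simp
 qed
 moreover have "0 \<le> om0 TYPE('a)" unfolding om0_def by (intro integral_nonneg_AE) auto
 ultimately show ?thesis by simp
qed

text \<open>Above 1 the left side is at most 1, below 1 the more singular power dominates. Estimates
  for the kernel |x|^(1 - n) thus serve the Newtonian kernel too.\<close>

lemma newton_le: "(t::real) powr (2 - N T) \<le> 1 + t powr (1 - N T)" if "0 \<le> t"
proof (cases "1 \<le> t")
 case True
 then have "t powr (2 - N T) \<le> t powr 0" using N3 by (intro powr_mono) auto
 then show ?thesis using True by (simp add: add_increasing2)
next
 case False
 show ?thesis
 proof (cases "t = 0")
  case f: False
  have "t powr (2 - N T) \<le> t powr (1 - N T)" using False that f by (intro powr_mono') auto
  then show ?thesis by simp
 qed simp
qed

lemma newton_integrable:
 "LI (\<lambda>y. nk2 x y * jb (y::'a) powr Np T)"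
proof -
 obtain C where C: "LI (\<lambda>y. nk1 x y * jb (y::'a) powr (- (N T + 1)/2))"
  using riesz_bound[where 'a='a] by metis
 have i: "LI (\<lambda>y. jb (y::'a) powr (- (N T + 1)/2) + nk1 x y * jb (y::'a) powr (- (N T + 1)/2))"
  by (intro Bochner_Integration.integrable_add C dec_integrable[OF dec_jb]) (simp add: field_simps)
 show ?thesis
 proof (rule integrable_dom[OF i])
  show "AE y in lborel. norm (nk2 x y * jb y powr Np T) \<le>
    norm (jb y powr (- (N T + 1)/2) + nk1 x y * jb (y::'a) powr (- (N T + 1)/2))"
  proof (intro AE_I2)
   fix y :: 'a
   have "nk2 x y * jb y powr Np T \<le> (1 + nk1 x y) * jb y powr (- (N T + 1)/2)"
    by (intro mult_mono newton_le powr_mono) (auto simp: field_simps)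
   then show "norm (nk2 x y * jb y powr Np T) \<le>
    norm (jb y powr (- (N T + 1)/2) + nk1 x y * jb (y::'a) powr (- (N T + 1)/2))"
    by (simp add: algebra_simps)
  qed
 qed measurable
qed

lemma newton_dec_integrable:
 assumes "dec (Np T) L"
 shows "LI (\<lambda>y. nk2 x y * L (y::'a))"
proof -
 obtain C where C: "0 < C" "\<And>y. \<bar>L y\<bar> \<le> C * jb y powr Np T" using decE[OF assms] by blast
 have [measurable]: "L \<in> BM" using assms by (rule dec_measurable)
 show ?thesis
 proof (rule integrable_dom[OF integrable_mult_right[OF newton_integrable[of x], of C]])
  show "AE y in lborel. norm (nk2 x y * L y) \<le> norm (C * (nk2 x y * jb y powr Np T))"
  proof (intro AE_I2)
   fix y
   have "nk2 x y * \<bar>L y\<bar> \<le> nk2 x y * (C * jb y powr Np T)"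
    by (intro mult_left_mono C) auto
   then show "norm (nk2 x y * L y) \<le> norm (C * (nk2 x y * jb y powr Np T))"
    using C by (simp add: abs_mult algebra_simps)
  qed
 qed measurable
qed

section \<open>Regularised fundamental solutions and Green's formula\<close>

definition geps :: "real \<Rightarrow> 'a \<Rightarrow> 'a \<Rightarrow> real"
 where "geps \<epsilon> x y = \<epsilon>\<^sup>2 + (norm (y - x))\<^sup>2"

lemma geps_pos: "0 < \<epsilon> \<Longrightarrow> 0 < geps \<epsilon> x y"
 by (simp add: geps_def add_pos_nonneg)

lemma dec_geps: "0 < \<epsilon> \<Longrightarrow> dec a (\<lambda>y. geps \<epsilon> x y powr a)"
 unfolding geps_def by (rule dec_eps)

lemma pd_geps: "pd i (geps \<epsilon> x) (\<lambda>y. 2 * ((y - x) \<bullet> i))"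
 using pd_add[OF pd_const[of i "\<epsilon>\<^sup>2"] pd_norm_sq[of i x]] by (simp add: geps_def[abs_def])

text \<open>The fundamental solution with |y - x|^2 replaced by \<epsilon>^2 + |y - x|^2. It is
  itself a multiple of a bubble of width \<epsilon>, which is why its Laplacian is explicit.
  \<open>Ge2\<close> below is kept in the shape that the product rule produces.\<close>

definition Ge :: "real \<Rightarrow> 'a \<Rightarrow> 'a \<Rightarrow> real"
 where "Ge \<epsilon> x y = geps \<epsilon> x y powr Nm T"

definition Ge1 :: "real \<Rightarrow> 'a \<Rightarrow> 'a \<Rightarrow> 'a \<Rightarrow> real"
 where "Ge1 \<epsilon> x i y = - (N T - 2) * (geps \<epsilon> x y powr (- N T/2) * ((y - x) \<bullet> i))"

definition Ge2 :: "real \<Rightarrow> 'a \<Rightarrow> 'a \<Rightarrow> 'a \<Rightarrow> real"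
 where "Ge2 \<epsilon> x i y = - (N T - 2) * ((- N T/2 * geps \<epsilon> x y powr (- N T/2 - 1) * (2 * ((y - x) \<bullet> i))) * ((y - x) \<bullet> i)
   + geps \<epsilon> x y powr (- N T/2) * (i \<bullet> i))"

lemma pd_Ge: "0 < \<epsilon> \<Longrightarrow> pd i (Ge \<epsilon> x) (Ge1 \<epsilon> x i)"
 unfolding Ge_def[abs_def] Ge1_def[abs_def]
 by (rule pd_cong[OF pd_powr[OF pd_geps[of i \<epsilon> x], where a="- (N T - 2)/2"]])
   (auto simp: geps_pos field_simps)

lemma pd_Ge1: "0 < \<epsilon> \<Longrightarrow> pd i (Ge1 \<epsilon> x i) (Ge2 \<epsilon> x i)"
proof -
 assume e: "0 < \<epsilon>"
 have "pd i (\<lambda>y. (y - x) \<bullet> i) (\<lambda>y. i \<bullet> i)"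
  using pd_diff[OF pd_inner[of i i] pd_const[of i "x \<bullet> i"]] by (simp add: inner_diff_left)
 then show ?thesis
  unfolding Ge1_def[abs_def] Ge2_def[abs_def]
  by (intro pd_cmult pd_mult pd_powr pd_geps geps_pos[OF e])
qed

lemma dec_Ge: "0 < \<epsilon> \<Longrightarrow> dec (Nm T) (Ge \<epsilon> x)"
 unfolding Ge_def[abs_def] by (rule dec_geps)

lemma dec_Ge1: "0 < \<epsilon> \<Longrightarrow> dec (Nh T) (Ge1 \<epsilon> x i)"
 unfolding Ge1_def[abs_def]
 by (intro dec_cmult dec_mult'[OF dec_geps dec_shift[OF dec_inner]]) (auto simp: field_simps)

lemma dec_Ge2: "0 < \<epsilon> \<Longrightarrow> dec (- N T/2) (Ge2 \<epsilon> x i)"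
proof -
 assume e: "0 < \<epsilon>"
 have A: "dec (- N T/2) (\<lambda>y. (- N T/2 * geps \<epsilon> x y powr (- N T/2 - 1) * (2 * ((y - x) \<bullet> i))) * ((y - x) \<bullet> i))"
  by (rule dec_mult'[OF dec_mult[OF dec_cmult[OF dec_geps[OF e]] dec_cmult[OF dec_shift[OF dec_inner]]] dec_shift[OF dec_inner]])
    simp
 have B: "dec (- N T/2) (\<lambda>y. geps \<epsilon> x y powr (- N T/2) * (i \<bullet> i))"
  by (rule dec_mult'[OF dec_geps[OF e] dec_const]) simp
 show ?thesis unfolding Ge2_def[abs_def] by (intro dec_cmult dec_add A B)
qed

lemma sum_Basis_sq: "(\<Sum>i\<in>Basis. (y \<bullet> i)\<^sup>2) = (norm (y::'a))\<^sup>2"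
 unfolding power2_norm_eq_inner by (subst euclidean_inner) (simp only: power2_eq_square)

text \<open>The terms n |y - x|^2 and n (\<epsilon>^2 + |y - x|^2) cancel up to n \<epsilon>^2. What
  remains is, up to sign, a positive density that concentrates at x as \<epsilon> tends to
  0.\<close>

lemma lap_Ge:
 assumes e: "0 < \<epsilon>"
 shows "(\<Sum>i\<in>Basis. Ge2 \<epsilon> x i y) = - (N T * (N T - 2)) * \<epsilon>\<^sup>2 * geps \<epsilon> x y powr Np T"
proof -
 let ?g = "geps \<epsilon> x y"
 have g: "0 < ?g" using e by (rule geps_pos)
 have ex: "- (N T+2)/2 = - N T/2 - 1" by (simp add: field_simps)
 have p: "?g powr (- N T/2) = ?g * ?g powr (- N T/2 - 1)"
  using g by (simp add: powr_diff)
 have "(\<Sum>i\<in>Basis. Ge2 \<epsilon> x i y) = (\<Sum>i\<in>Basis. (N T - 2) * N T * ?g powr (- N T/2 - 1) * ((y - x) \<bullet> i)\<^sup>2 - (N T - 2) * ?g powr (- N T/2))"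
 proof (intro sum.cong refl)
  fix i :: 'a assume "i \<in> Basis"
  then have i: "i \<bullet> i = 1" by simp
  have "- (N T - 2) * ((- N T/2 * p * (2 * d)) * d + q * 1) = (N T - 2) * N T * p * d\<^sup>2 - (N T - 2) * q" for p q d :: real
   by (simp add: algebra_simps power2_eq_square)
  then show "Ge2 \<epsilon> x i y = (N T - 2) * N T * ?g powr (- N T/2 - 1) * ((y - x) \<bullet> i)\<^sup>2 - (N T - 2) * ?g powr (- N T/2)"
   unfolding Ge2_def i .
 qed
 also have "\<dots> = (N T - 2) * N T * ?g powr (- N T/2 - 1) * (norm (y - x))\<^sup>2 - N T * ((N T - 2) * ?g powr (- N T/2))"
  by (simp add: sum_subtractf sum_distrib_left[symmetric] sum_Basis_sq)
 also have "(norm (y - x))\<^sup>2 = ?g - \<epsilon>\<^sup>2" by (simp add: geps_def)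
 finally show ?thesis unfolding ex p by (simp add: algebra_simps)
qed

lemma green_eps:
 fixes F :: "'a \<Rightarrow> real"
 assumes e: "0 < \<epsilon>"
  and F: "dec (Nm T) F"
  and F1: "\<And>i. i \<in> Basis \<Longrightarrow> pd i F (F1 i)" "\<And>i. i \<in> Basis \<Longrightarrow> dec (Nh T) (F1 i)"
  and F2: "\<And>i. i \<in> Basis \<Longrightarrow> pd i (F1 i) (F2 i)" "\<And>i. i \<in> Basis \<Longrightarrow> dec (- N T/2) (F2 i)"
 shows "(LBINT y. Ge \<epsilon> x y * (- (\<Sum>i\<in>Basis. F2 i y))) =
   N T * (N T - 2) * (LBINT y. \<epsilon>\<^sup>2 * geps \<epsilon> x y powr Np T * F y)"
proof -
 have z: "(LBINT y. Ge \<epsilon> x y * F2 i y - F y * Ge2 \<epsilon> x i y) = 0" if i: "i \<in> Basis" for i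
 \<comment> \<open>The exponents are the sums of the rates of the factors: -(n - 2)/2 together with
   -(n - 1)/2, and with -n/2. They are admissible because n > 2.\<close>
 proof (rule integral_pd_zero_dec[OF i, where b="3/2 - N T" and b'="1 - N T"])
  show "pd i (\<lambda>y. Ge \<epsilon> x y * F1 i y - F y * Ge1 \<epsilon> x i y) (\<lambda>y. Ge \<epsilon> x y * F2 i y - F y * Ge2 \<epsilon> x i y)"
   by (rule pd_cong[OF pd_diff[OF pd_mult[OF pd_Ge[OF e] F2(1)] pd_mult[OF F1(1) pd_Ge1[OF e]]]])
     (use i in \<open>auto simp: algebra_simps\<close>)
  show "dec (3/2 - N T) (\<lambda>y. Ge \<epsilon> x y * F1 i y - F y * Ge1 \<epsilon> x i y)"
   by (intro dec_diff dec_mult'[OF dec_Ge[OF e] F1(2)[OF i]] dec_mult'[OF F dec_Ge1[OF e]]) (auto simp: field_simps)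
  show "dec (1 - N T) (\<lambda>y. Ge \<epsilon> x y * F2 i y - F y * Ge2 \<epsilon> x i y)"
   by (intro dec_diff dec_mult'[OF dec_Ge[OF e] F2(2)[OF i]] dec_mult'[OF F dec_Ge2[OF e]]) (auto simp: field_simps)
 qed (use N3 in \<open>auto simp: field_simps\<close>)
 have i1: "LI (\<lambda>y. Ge \<epsilon> x y * F2 i y)" if "i \<in> Basis" for i
  by (rule dec_integrable[OF dec_mult[OF dec_Ge[OF e] F2(2)[OF that]]]) (use N3 in \<open>auto simp: field_simps\<close>)
 have i2: "LI (\<lambda>y. F y * Ge2 \<epsilon> x i y)" for i
  by (rule dec_integrable[OF dec_mult[OF F dec_Ge2[OF e]]]) (use N3 in \<open>auto simp: field_simps\<close>)
 have "(LBINT y. Ge \<epsilon> x y * (- (\<Sum>i\<in>Basis. F2 i y))) = (LBINT y. - (\<Sum>i\<in>Basis. Ge \<epsilon> x y * F2 i y))"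
  by (simp add: sum_distrib_left)
 also have "\<dots> = - (\<Sum>i\<in>Basis. (LBINT y. Ge \<epsilon> x y * F2 i y))"
  using i1 by (simp add: Bochner_Integration.integral_sum)
 also have "\<dots> = - (\<Sum>i\<in>(Basis::'a set). (LBINT y. F y * Ge2 \<epsilon> x i y))"
  using z i1 i2 by (simp add: Bochner_Integration.integral_diff)
 also have "\<dots> = - (LBINT y. (\<Sum>i\<in>(Basis::'a set). F y * Ge2 \<epsilon> x i y))"
  using i2 by (simp add: Bochner_Integration.integral_sum)
 also have "\<dots> = - (LBINT y. (- (N T * (N T - 2))) * (\<epsilon>\<^sup>2 * geps \<epsilon> x y powr Np T * F y))"
  by (simp add: sum_distrib_left[symmetric] lap_Ge[OF e] algebra_simps)
 also have "\<dots> = N T * (N T - 2) * (LBINT y. \<epsilon>\<^sup>2 * geps \<epsilon> x y powr Np T * F y)"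
  by simp
 finally show ?thesis .
qed

text \<open>Under y = x + \<epsilon> z all powers of \<epsilon> cancel, so the density found in
  \<open>lap_Ge\<close> is an approximate identity of fixed mass \<open>om0\<close>.\<close>

lemma mollify:
 fixes f :: "'a \<Rightarrow> real"
 assumes e: "0 < \<epsilon>"
 shows "(LBINT y. \<epsilon>\<^sup>2 * geps \<epsilon> x y powr Np T * f y) =
   (LBINT z. jb z powr Np T * f (x + \<epsilon> *\<^sub>R z))"
proof -
 have "(LBINT y. \<epsilon>\<^sup>2 * geps \<epsilon> x y powr Np T * f y) =
   \<bar>\<epsilon>\<bar> ^ DIM('a) *\<^sub>R (LBINT z. \<epsilon>\<^sup>2 * geps \<epsilon> x (x + \<epsilon> *\<^sub>R z) powr Np T * f (x + \<epsilon> *\<^sub>R z))"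
  by (rule lborel_integral_affine) (use e in auto)
 also have "\<dots> = (LBINT z. \<epsilon> ^ DIM('a) * (\<epsilon>\<^sup>2 * geps \<epsilon> x (x + \<epsilon> *\<^sub>R z) powr Np T * f (x + \<epsilon> *\<^sub>R z)))"
  using e by simp
 also have "\<dots> = (LBINT z. jb z powr Np T * f (x + \<epsilon> *\<^sub>R z))"
 proof (intro Bochner_Integration.integral_cong refl)
  fix z :: 'a
  have "geps \<epsilon> x (x + \<epsilon> *\<^sub>R z) = \<epsilon>\<^sup>2 * jb z"
   by (simp add: geps_def jb_def power_mult_distrib algebra_simps)
  then have "geps \<epsilon> x (x + \<epsilon> *\<^sub>R z) powr Np T = (\<epsilon>\<^sup>2) powr Np T * jb z powr Np T"
   by (simp add: powr_mult)
  also have "(\<epsilon>\<^sup>2) powr Np T = \<epsilon> powr (- (N T + 2))"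
   using e by (simp only: sq_powr_half abs_of_pos)
  finally have g: "geps \<epsilon> x (x + \<epsilon> *\<^sub>R z) powr Np T = \<epsilon> powr (- (N T + 2)) * jb z powr Np T" .
  have "\<epsilon> ^ DIM('a) * \<epsilon>\<^sup>2 * \<epsilon> powr (- (N T + 2)) = \<epsilon> powr N T * \<epsilon> powr 2 * \<epsilon> powr (- (N T + 2))"
   using e by (simp add: powr_realpow)
  also have "\<dots> = 1" using e by (simp only: powr_add[symmetric]) simp
  finally have 1: "\<epsilon> ^ DIM('a) * \<epsilon>\<^sup>2 * \<epsilon> powr (- (N T + 2)) = 1" .
  have "\<epsilon> ^ DIM('a) * (\<epsilon>\<^sup>2 * geps \<epsilon> x (x + \<epsilon> *\<^sub>R z) powr Np T * f (x + \<epsilon> *\<^sub>R z))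
   = (\<epsilon> ^ DIM('a) * \<epsilon>\<^sup>2 * \<epsilon> powr (- (N T + 2))) * (jb z powr Np T * f (x + \<epsilon> *\<^sub>R z))"
   unfolding g by (simp add: algebra_simps)
  then show "\<epsilon> ^ DIM('a) * (\<epsilon>\<^sup>2 * geps \<epsilon> x (x + \<epsilon> *\<^sub>R z) powr Np T * f (x + \<epsilon> *\<^sub>R z))
   = jb z powr Np T * f (x + \<epsilon> *\<^sub>R z)"
   unfolding 1 by simp
 qed
 finally show ?thesis .
qed

lemma dec_bounded:
 assumes "dec b f" "b \<le> 0"
 obtains C where "0 < C" "\<And>y::'a. \<bar>f y\<bar> \<le> C"
proof -
 obtain C where "0 < C" "\<And>x. \<bar>f x\<bar> \<le> C * jb x powr 0" using decE[OF dec_mono[OF assms]] by blast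
 then show thesis using that by simp
qed

lemma mollify_lim:
 fixes F :: "'a \<Rightarrow> real"
 assumes F: "dec b F" "b \<le> 0"
 shows "(\<lambda>k. (LBINT z. jb z powr Np T * F (x + es k *\<^sub>R z))) \<leadsto> om0 TYPE('a) * F x"
proof -
 have [measurable]: "F \<in> BM" using F(1) by (rule dec_measurable)
 obtain C where C1: "0 < C" "\<And>y. \<bar>F y\<bar> \<le> C" using dec_bounded[OF F] by blast
 have "(\<lambda>k. (LBINT z. jb z powr Np T * F (x + es k *\<^sub>R z))) \<leadsto> (\<integral>z. jb z powr Np T * F x \<partial>(lborel::'a measure))"
 proof (rule integral_dct[where w="\<lambda>z. C * jb z powr Np T"])
  show "AE z in lborel. (\<lambda>k. jb z powr Np T * F (x + es k *\<^sub>R z)) \<leadsto> jb z powr Np T * F x"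
  proof (intro AE_I2 tendsto_mult tendsto_const)
   fix z
   have "isCont F (x + 0 *\<^sub>R z)" using dec_continuous[OF F(1)] by (simp add: continuous_on_eq_continuous_at)
   then have "(\<lambda>k. F (x + es k *\<^sub>R z)) \<leadsto> F (x + 0 *\<^sub>R z)"
    by (rule isCont_tendsto_compose) (intro tendsto_intros es)
   then show "(\<lambda>k. F (x + es k *\<^sub>R z)) \<leadsto> F x" by simp
  qed
  show "AE z in lborel. norm (jb z powr Np T * F (x + es k *\<^sub>R z)) \<le> C * jb z powr Np T" for k
   using C1(2) by (intro AE_I2) (simp add: abs_mult mult.commute mult_right_mono)
  show "LI (\<lambda>z::'a. C * jb z powr Np T)"
   by (intro integrable_mult_right om0_integrable)
 qed measurable
 then show ?thesis unfolding om0_def by (simp only: integral_mult_left_zero)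
qed

lemma Ge_le: "0 < \<epsilon> \<Longrightarrow> Ge \<epsilon> x y \<le> nk2 x y" if "x \<noteq> y"
proof -
 have "geps \<epsilon> x y powr Nm T \<le> ((norm (x - y))\<^sup>2) powr Nm T"
  using that N3 by (intro powr_mono2') (auto simp: geps_def norm_minus_commute)
 then show ?thesis unfolding Ge_def sq_powr_half by (simp only: abs_norm_cancel minus_diff_eq)
qed

lemma Ge_lim: "(\<lambda>k. Ge (es k) x y) \<leadsto> nk2 x y" if "x \<noteq> y"
proof -
 have "(\<lambda>k. geps (es k) x y powr Nm T) \<leadsto> (0\<^sup>2 + (norm (y - x))\<^sup>2) powr Nm T"
  unfolding geps_def using that by (intro tendsto_intros es) auto
 then have "(\<lambda>k. geps (es k) x y powr Nm T) \<leadsto> ((norm (y - x))\<^sup>2) powr Nm T"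
  by (simp only: zero_power2 add_0)
 then show ?thesis unfolding Ge_def sq_powr_half by (simp only: abs_norm_cancel minus_diff_eq norm_minus_commute[of y x])
qed

lemma AE_neq: "AE y in lborel. x \<noteq> (y::'a)"
 using AE_lborel_singleton[of x] by eventually_elim auto

text \<open>The limit \<epsilon> \<rightarrow> 0 of \<open>green_eps\<close> recovers F from its
  Laplacian. The decay |x|^(2 - n) of F leaves no room for an additional harmonic function.\<close>

lemma green:
 fixes F :: "'a \<Rightarrow> real"
 assumes F: "dec (Nm T) F"
  and F1: "\<And>i. i \<in> Basis \<Longrightarrow> pd i F (F1 i)" "\<And>i. i \<in> Basis \<Longrightarrow> dec (Nh T) (F1 i)"
  and F2: "\<And>i. i \<in> Basis \<Longrightarrow> pd i (F1 i) (F2 i)" "\<And>i. i \<in> Basis \<Longrightarrow> dec (- N T/2) (F2 i)"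
  and L: "\<And>y. L y = - (\<Sum>i\<in>Basis. F2 i y)" "dec (Np T) L"
 shows "(LBINT y. nk2 x y * L y) = N T * (N T - 2) * om0 TYPE('a) * F x"
proof -
 have [measurable]: "L \<in> BM" "F \<in> BM"
  using L(2) F by (auto dest: dec_measurable)
 have [measurable]: "Ge (es k) x \<in> BM" for k
  using dec_Ge[OF es(1)] by (rule dec_measurable)
 have key: "(LBINT y. Ge (es k) x y * L y) = N T * (N T - 2) * (LBINT z. jb z powr Np T * F (x + es k *\<^sub>R z))" for k
  unfolding L(1) mollify[OF es(1), symmetric] by (rule green_eps[OF es(1) F F1 F2])
 have l1: "(\<lambda>k. (LBINT y. Ge (es k) x y * L y)) \<leadsto> (LBINT y. nk2 x y * L y)"
 proof (rule integral_dct[where w="\<lambda>y. norm (nk2 x y * L y)"])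
  show "LI (\<lambda>y. norm (nk2 x y * L y))"
   using newton_dec_integrable[OF L(2)] by (rule integrable_norm)
  show "AE y in lborel. (\<lambda>k. Ge (es k) x y * L y) \<leadsto> nk2 x y * L y"
   using AE_neq[of x] by eventually_elim (intro tendsto_mult Ge_lim tendsto_const)
  show "AE y in lborel. norm (Ge (es k) x y * L y) \<le> norm (nk2 x y * L y)" for k
   using AE_neq[of x]
  proof eventually_elim
   case (elim y)
   have "0 \<le> Ge (es k) x y" by (simp add: Ge_def)
   then show ?case using Ge_le[OF elim es(1), of k]
    by (simp add: abs_mult mult_right_mono)
  qed
 qed measurable
 have "(\<lambda>k. (LBINT y. Ge (es k) x y * L y)) \<leadsto> N T * (N T - 2) * (om0 TYPE('a) * F x)"
  unfolding key using N3 by (intro tendsto_mult mollify_lim[OF F] tendsto_const) simp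
 from LIMSEQ_unique[OF l1 this] show ?thesis by (simp only: mult.assoc)
qed

section \<open>Linear forms on the sphere and their powers\<close>

definition ell :: "'a \<times> real \<Rightarrow> 'a \<Rightarrow> real"
 where "ell z y = 2 * ((y \<bullet> fst z + snd z) * jb y powr (-1)) - snd z"

lemma stereo_inner: "stereo y \<bullet> z = ell z y"
 by (cases z) (simp add: stereo_def ell_def powr_minus_divide inner_prod_def field_simps)

lemma norm_stereo: "norm (stereo (y::'a)) = 1"
proof -
 have n: "(norm y)\<^sup>2 = jb y - 1" by (simp add: jb_def)
 have "(norm (stereo y))\<^sup>2 = (2 / jb y)\<^sup>2 * (norm y)\<^sup>2 + (2 / jb y - 1)\<^sup>2"
  by (simp add: stereo_def norm_Pair power_mult_distrib power_divide)
 also have "\<dots> = 1" unfolding n by (simp add: field_simps power2_eq_square)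
 finally show ?thesis by (metis norm_ge_zero one_power2 power2_eq_iff_nonneg zero_le_one)
qed

definition ell1 :: "'a \<times> real \<Rightarrow> 'a \<Rightarrow> 'a \<Rightarrow> real"
 where "ell1 z i y = 2 * ((i \<bullet> fst z) * jb y powr (-1) + (y \<bullet> fst z + snd z) * ((-1) * jb y powr (-2) * (2 * (y \<bullet> i))))"

definition ell2 :: "'a \<times> real \<Rightarrow> 'a \<Rightarrow> 'a \<Rightarrow> real"
 where "ell2 z i y = 2 * ((i \<bullet> fst z) * ((-1) * jb y powr (-2) * (2 * (y \<bullet> i))) +
   ((i \<bullet> fst z) * ((-1) * jb y powr (-2) * (2 * (y \<bullet> i))) +
   (y \<bullet> fst z + snd z) * ((-1) * ((-2) * jb y powr (-3) * (2 * (y \<bullet> i))) * (2 * (y \<bullet> i)) + (-1) * jb y powr (-2) * (2 * (i \<bullet> i)))))"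

lemma pd_jb_powr: "pd i (\<lambda>y. jb y powr a) (\<lambda>y. a * jb y powr (a - 1) * (2 * (y \<bullet> i)))"
 by (rule pd_powr[OF pd_jb jb_pos])

lemma pd_lin: "pd i (\<lambda>y. y \<bullet> v + t) (\<lambda>y. i \<bullet> v)"
 using pd_add[OF pd_inner[of i v] pd_const[of i t]] by simp

lemma pd_ell: "pd i (ell z) (ell1 z i)"
proof -
 have "pd i (\<lambda>y. 2 * ((y \<bullet> fst z + snd z) * jb y powr (-1)) - snd z)
  (\<lambda>y. 2 * ((i \<bullet> fst z) * jb y powr (-1) + (y \<bullet> fst z + snd z) * ((-1) * jb y powr (-1 - 1) * (2 * (y \<bullet> i)))) - 0)"
  by (intro pd_diff pd_const pd_cmult pd_mult pd_lin pd_jb_powr)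
 then show ?thesis unfolding ell_def[abs_def] ell1_def[abs_def] by simp
qed

lemma pd_ell1: "pd i (ell1 z i) (ell2 z i)"
proof -
 have A: "pd i (\<lambda>y. (i \<bullet> fst z) * jb y powr (-1)) (\<lambda>y. (i \<bullet> fst z) * ((-1) * jb y powr (-1 - 1) * (2 * (y \<bullet> i))))"
  by (intro pd_cmult pd_jb_powr)
 have B: "pd i (\<lambda>y. (-1) * jb y powr (-2) * (2 * (y \<bullet> i)))
   (\<lambda>y. (-1) * ((-2) * jb y powr (-2 - 1) * (2 * (y \<bullet> i))) * (2 * (y \<bullet> i)) + (-1) * jb y powr (-2) * (2 * (i \<bullet> i)))"
  by (intro pd_mult pd_cmult pd_jb_powr pd_inner)
 have "pd i (\<lambda>y. 2 * ((i \<bullet> fst z) * jb y powr (-1) + (y \<bullet> fst z + snd z) * ((-1) * jb y powr (-2) * (2 * (y \<bullet> i)))))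
  (\<lambda>y. 2 * ((i \<bullet> fst z) * ((-1) * jb y powr (-1 - 1) * (2 * (y \<bullet> i))) +
   ((i \<bullet> fst z) * ((-1) * jb y powr (-2) * (2 * (y \<bullet> i))) +
   (y \<bullet> fst z + snd z) * ((-1) * ((-2) * jb y powr (-2 - 1) * (2 * (y \<bullet> i))) * (2 * (y \<bullet> i)) + (-1) * jb y powr (-2) * (2 * (i \<bullet> i))))))"
  by (intro pd_cmult pd_add A pd_mult pd_lin B)
 then show ?thesis unfolding ell1_def[abs_def] ell2_def[abs_def] by simp
qed

lemma dec_lin: "dec (1/2) (\<lambda>y::'a. y \<bullet> v + t)"
 by (intro dec_add dec_inner dec_mono[OF dec_const]) simp

lemma dec_ell: "dec 0 (ell z)"
 unfolding ell_def[abs_def]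
 by (intro dec_diff dec_cmult dec_const dec_mono[OF dec_mult[OF dec_lin dec_jb]]) simp

lemma dec_neg_jb: "dec b (\<lambda>y. (-1) * jb y powr b)"
 by (intro dec_cmult dec_jb)

lemma dec_ell1: "dec (-1/2) (ell1 z i)"
proof -
 have A: "dec (-1/2) (\<lambda>y. (i \<bullet> fst z) * jb y powr (-1))"
  by (rule dec_mono[OF dec_cmult[OF dec_jb[of "-1"]]]) simp
 have B: "dec (-1) (\<lambda>y. (y \<bullet> fst z + snd z) * ((-1) * jb y powr (-2) * (2 * (y \<bullet> i))))"
  by (rule dec_mult'[OF dec_lin dec_mult[OF dec_neg_jb dec_cmult[OF dec_inner]]]) simp
 show ?thesis unfolding ell1_def[abs_def]
  by (rule dec_cmult[OF dec_add[OF A dec_mono[OF B]]]) simp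
qed

lemma dec_ell2: "dec (-1) (ell2 z i)"
proof -
 have A: "dec (-3/2) (\<lambda>y. (-1) * jb y powr (-2) * (2 * (y \<bullet> i)))"
  by (rule dec_mult'[OF dec_neg_jb dec_cmult[OF dec_inner]]) simp
 have B1: "dec (-2) (\<lambda>y. (-1) * ((-2) * jb y powr (-3) * (2 * (y \<bullet> i))) * (2 * (y \<bullet> i)))"
  by (rule dec_mult'[OF dec_cmult[OF dec_mult[OF dec_cmult[OF dec_jb] dec_cmult[OF dec_inner]]] dec_cmult[OF dec_inner]]) simp
 have B2: "dec (-2) (\<lambda>y. (-1) * jb y powr (-2) * (2 * (i \<bullet> i)))"
  by (rule dec_mult'[OF dec_neg_jb dec_const]) simp
 show ?thesis
  unfolding ell2_def[abs_def]
  by (intro dec_cmult dec_add dec_mono[OF dec_cmult[OF A]] dec_mono[OF dec_mult[OF dec_lin dec_add[OF B1 B2]]]) auto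
qed

lemma jb_inverse:
 "jb y powr (-1) = inverse (jb y)" "jb y powr (-2) = (inverse (jb y))\<^sup>2" "jb y powr (-3) = (inverse (jb y)) ^ 3"
 using powr_realpow[OF jb_pos, of y 2] powr_realpow[OF jb_pos, of y 3]
 by (simp_all add: powr_minus power_inverse)

lemma norm_sq_jb: "(norm y)\<^sup>2 * inverse (jb y) = 1 - inverse (jb y)"
 by (simp add: jb_def field_simps add_nonneg_eq_0_iff)

lemma sum_Basis_inner: "(\<Sum>i\<in>Basis. (v \<bullet> i) * (y \<bullet> i)) = v \<bullet> (y::'a)"
 by (simp add: euclidean_inner[of v y])

lemma quad_sum:
 fixes y v :: 'a
 shows "(\<Sum>i\<in>Basis. c0 + c1 * (y \<bullet> i)\<^sup>2 + c2 * ((v \<bullet> i) * (y \<bullet> i)) + c3 * (v \<bullet> i)\<^sup>2) =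
  N T * c0 + c1 * (norm y)\<^sup>2 + c2 * (v \<bullet> y) + c3 * (norm v)\<^sup>2"
 by (simp add: sum.distrib sum_distrib_left[symmetric] sum_Basis_sq sum_Basis_inner)

text \<open>Conformality of the projection: the squared gradient is the squared conformal factor (2
  / jb y)^2 times |z|^2 - (w \<bullet> z)^2, the squared spherical gradient of the linear form z at
  the point w = \<open>stereo y\<close>.\<close>

lemma sum_ell1_sq:
 fixes y :: 'a
 shows "(\<Sum>i\<in>Basis. (ell1 z i y)\<^sup>2) = 4 * (inverse (jb y))\<^sup>2 * ((norm z)\<^sup>2 - (ell z y)\<^sup>2)"
proof -
 define j where "j = inverse (jb y)"
 define v where "v = fst z" define t where "t = snd z" define P where "P = y \<bullet> v + t"
 define Y where "Y = (norm y)\<^sup>2"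
 have Yj: "Y * j = 1 - j" unfolding Y_def j_def by (rule norm_sq_jb)
 have nz: "(norm z)\<^sup>2 = (norm v)\<^sup>2 + t\<^sup>2"
  by (cases z) (simp add: norm_Pair v_def t_def)
 have e1: "ell1 z i y = 2 * j * (v \<bullet> i) - 4 * P * j\<^sup>2 * (y \<bullet> i)" for i
  by (simp add: ell1_def jb_inverse j_def v_def t_def P_def inner_commute algebra_simps divide_inverse)
 have "(\<Sum>i\<in>Basis. (ell1 z i y)\<^sup>2) = (\<Sum>i\<in>Basis. 0 + (16 * P\<^sup>2 * j^4) * (y \<bullet> i)\<^sup>2 + (- 16 * P * j^3) * ((v \<bullet> i) * (y \<bullet> i)) + (4 * j\<^sup>2) * (v \<bullet> i)\<^sup>2)"
  by (intro sum.cong refl) (unfold e1, algebra)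
 also have "\<dots> = 16 * P\<^sup>2 * j^4 * Y - 16 * P * j^3 * (P - t) + 4 * j\<^sup>2 * (norm v)\<^sup>2"
  unfolding quad_sum by (simp add: Y_def P_def inner_commute algebra_simps)
 also have "\<dots> = 16 * P\<^sup>2 * j^3 * (Y * j) - 16 * P * j^3 * (P - t) + 4 * j\<^sup>2 * (norm v)\<^sup>2"
  by algebra
 also have "\<dots> = 4 * j\<^sup>2 * ((norm v)\<^sup>2 + t\<^sup>2 - (2 * (P * j) - t)\<^sup>2)"
  unfolding Yj by algebra
 finally show ?thesis
  unfolding nz j_def ell_def jb_inverse P_def v_def t_def .
qed

text \<open>The spherical Laplacian of a linear form is -n times the form. In the plane it appears
  with the squared conformal factor, once the drift that comes from differentiating jb^(-(n - 2)/2)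
  is included; the sum is this combination.\<close>

lemma sum_ell2:
 fixes y :: 'a
 shows "(\<Sum>i\<in>Basis. - 2 * (N T - 2) * inverse (jb y) * (y \<bullet> i) * ell1 z i y + ell2 z i y)
   = - 4 * N T * (inverse (jb y))\<^sup>2 * ell z y"
proof -
 define j where "j = inverse (jb y)"
 define v where "v = fst z" define t where "t = snd z" define P where "P = y \<bullet> v + t"
 define Y where "Y = (norm y)\<^sup>2"
 have Yj: "Y * j = 1 - j" unfolding Y_def j_def by (rule norm_sq_jb)
 have e1: "ell1 z i y = 2 * j * (v \<bullet> i) - 4 * P * j\<^sup>2 * (y \<bullet> i)" for i
  by (simp add: ell1_def jb_inverse j_def v_def t_def P_def inner_commute algebra_simps divide_inverse)
 have e2: "ell2 z i y = - 8 * j\<^sup>2 * ((v \<bullet> i) * (y \<bullet> i)) - 4 * P * j\<^sup>2 + 16 * P * j^3 * (y \<bullet> i)\<^sup>2" if "i \<in> Basis" for i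
  using that by (simp add: ell2_def jb_inverse j_def v_def t_def P_def inner_commute algebra_simps power2_eq_square)
 have "(\<Sum>i\<in>Basis. - 2 * (N T - 2) * inverse (jb y) * (y \<bullet> i) * ell1 z i y + ell2 z i y)
  = (\<Sum>i\<in>Basis. (- 4 * P * j\<^sup>2) + (8 * (N T - 2) * P * j^3 + 16 * P * j^3) * (y \<bullet> i)\<^sup>2 + (- 4 * (N T - 2) * j\<^sup>2 - 8 * j\<^sup>2) * ((v \<bullet> i) * (y \<bullet> i)) + 0 * (v \<bullet> i)\<^sup>2)"
 proof (intro sum.cong refl)
  fix i :: 'a assume i: "i \<in> Basis"
  show "- 2 * (N T - 2) * inverse (jb y) * (y \<bullet> i) * ell1 z i y + ell2 z i y
   = (- 4 * P * j\<^sup>2) + (8 * (N T - 2) * P * j^3 + 16 * P * j^3) * (y \<bullet> i)\<^sup>2 + (- 4 * (N T - 2) * j\<^sup>2 - 8 * j\<^sup>2) * ((v \<bullet> i) * (y \<bullet> i)) + 0 * (v \<bullet> i)\<^sup>2"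
   unfolding e1 e2[OF i] j_def[symmetric] by algebra
 qed
 also have "\<dots> = N T * (- 4 * P * j\<^sup>2) + 8 * N T * P * j^3 * Y - 4 * N T * j\<^sup>2 * (P - t)"
  unfolding quad_sum by (simp add: Y_def P_def inner_commute algebra_simps)
 also have "\<dots> = N T * (- 4 * P * j\<^sup>2) + 8 * N T * P * j\<^sup>2 * (Y * j) - 4 * N T * j\<^sup>2 * (P - t)"
  by algebra
 also have "\<dots> = - 4 * N T * j\<^sup>2 * (2 * (P * j) - t)"
  unfolding Yj by algebra
 finally show ?thesis
  unfolding j_def ell_def jb_inverse P_def v_def t_def .
qed

text \<open>Green's formula for F = jb^(-(n - 2)/2) ell^k. Four times the conformal Laplacian of the
  sphere sends ell^k to (2k + n)(2k + n - 2) ell^k - 4k(k - 1) |z|^2 ell^(k - 2). For k = 0 and k =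
  1 the coefficient of the last term vanishes, so the truncated exponent k - 2 is harmless.\<close>

lemma Kop_ell_power:
 "Kop (\<lambda>y. (2 * real k + N T) * (2 * real k + N T - 2) * ell z y ^ k - 4 * real k * real (k - 1) * (norm z)\<^sup>2 * ell z y ^ (k - 2)) x
  = N T * (N T - 2) * ell z x ^ k"
proof -
 define a where "a = - (N T - 2)/2"
 let ?A = "\<lambda>y::'a. jb y powr a"
 let ?A1 = "\<lambda>i (y::'a). a * jb y powr (a - 1) * (2 * (y \<bullet> i))"
 let ?A2 = "\<lambda>i (y::'a). a * ((a - 1) * jb y powr (a - 1 - 1) * (2 * (y \<bullet> i))) * (2 * (y \<bullet> i)) + a * jb y powr (a - 1) * (2 * (i \<bullet> i))"
 let ?q = "\<lambda>y. ell z y ^ k"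
 let ?q1 = "\<lambda>y. real k * ell z y ^ (k - 1)"
 let ?q2 = "\<lambda>y. real k * (real (k - 1) * ell z y ^ (k - 1 - 1))"
 define F where "F y = ?A y * ?q y" for y
 define F1 where "F1 i y = ?A1 i y * ?q y + ?A y * (?q1 y * ell1 z i y)" for i y
 define F2 where "F2 i y = (?A2 i y * ?q y + ?A1 i y * (?q1 y * ell1 z i y)) +
   (?A1 i y * (?q1 y * ell1 z i y) + ?A y * (?q2 y * ell1 z i y * ell1 z i y + ?q1 y * ell2 z i y))" for i y
 define L where "L y = jb y powr Np T * ((2 * real k + N T) * (2 * real k + N T - 2) * ell z y ^ k - 4 * real k * real (k - 1) * (norm z)\<^sup>2 * ell z y ^ (k - 2))" for y
 have pA1: "pd i (?A1 i) (?A2 i)" for i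
  by (intro pd_mult pd_cmult pd_jb_powr pd_inner)
 have pq: "pd i ?q (\<lambda>y. ?q1 y * ell1 z i y)" for i by (rule pd_power[OF pd_ell])
 have pq1: "pd i ?q1 (\<lambda>y. ?q2 y * ell1 z i y)" for i
  by (rule pd_cong[OF pd_cmult[OF pd_power[OF pd_ell, of _ _ "k - 1"]]]) auto
 have dA1: "dec (a - 1/2) (?A1 i)" for i
  by (rule dec_mult'[OF dec_cmult[OF dec_jb] dec_cmult[OF dec_inner]]) simp
 have dA2: "dec (a - 1) (?A2 i)" for i
  by (intro dec_add dec_mult'[OF dec_cmult[OF dec_mult[OF dec_cmult[OF dec_jb] dec_cmult[OF dec_inner]]] dec_cmult[OF dec_inner]]
    dec_mult'[OF dec_cmult[OF dec_jb] dec_const]) auto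
 have dq: "dec 0 ?q" "dec 0 ?q1" "dec 0 ?q2"
  by (intro dec_cmult dec_power0 dec_ell)+
 have "(LBINT y. nk2 x y * L y) = N T * (N T - 2) * om0 TYPE('a) * F x"
 proof (rule green[where ?F1.0=F1 and ?F2.0=F2])
  show "dec (Nm T) F"
   unfolding F_def[abs_def] by (rule dec_mult'[OF dec_jb dq(1)]) (simp add: a_def)
  show "pd i F (F1 i)" for i
   unfolding F_def[abs_def] F1_def[abs_def] by (intro pd_mult pd_jb_powr pq)
  show "pd i (F1 i) (F2 i)" for i
   unfolding F1_def[abs_def] F2_def[abs_def] by (intro pd_add pd_mult[OF pA1 pq] pd_mult[OF pd_jb_powr pd_mult[OF pq1 pd_ell1]])
  show "dec (Nh T) (F1 i)" for i
   unfolding F1_def[abs_def]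
   by (intro dec_add dec_mult'[OF dA1 dq(1)] dec_mult'[OF dec_jb dec_mult[OF dq(2) dec_ell1]]) (auto simp: a_def field_simps)
  show "dec (- N T/2) (F2 i)" for i
   unfolding F2_def[abs_def]
   by (intro dec_add[OF dec_add dec_add] dec_mult'[OF dA2 dq(1)] dec_mult'[OF dA1 dec_mult[OF dq(2) dec_ell1]]
     dec_mult'[OF dec_jb, of "-1"] dec_add dec_mult'[OF dec_mult[OF dq(3) dec_ell1] dec_ell1] dec_mult'[OF dq(2) dec_ell2])
     (auto simp: a_def field_simps)
  show "dec (Np T) L"
   unfolding L_def[abs_def]
   by (rule dec_mult'[OF dec_jb, of 0]) (auto intro!: dec_diff dec_cmult dec_power0 dec_ell)
  show "L y = - (\<Sum>i\<in>Basis. F2 i y)" for y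
  proof -
   define j where "j = inverse (jb y)"
   define l where "l = ell z y"
   have Yj: "(norm y)\<^sup>2 * j = 1 - j" unfolding j_def by (rule norm_sq_jb)
   have p1: "jb y powr (a - 1) = ?A y * j" and p2: "jb y powr (a - 1 - 1) = ?A y * j\<^sup>2"
    by (simp_all add: powr_diff j_def power2_eq_square field_simps)
   have p3: "jb y powr Np T = ?A y * j\<^sup>2"
   proof -
    have "- (N T + 2)/2 = a - 1 - 1" by (simp add: a_def field_simps)
    then show ?thesis using p2 by (simp only:)
   qed
   have s1: "(\<Sum>i\<in>(Basis::'a set). ?A2 i y) = - (N T * (N T - 2)) * ?A y * j\<^sup>2"
   proof -
    have "(\<Sum>i\<in>(Basis::'a set). ?A2 i y) = (\<Sum>i\<in>(Basis::'a set). (2 * a * ?A y * j) + (4 * a * (a - 1) * ?A y * j\<^sup>2) * (y \<bullet> i)\<^sup>2 + 0 * ((y \<bullet> i) * (y \<bullet> i)) + 0 * (y \<bullet> i)\<^sup>2)"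
     by (intro sum.cong refl) (simp only: p1 p2, simp add: algebra_simps power2_eq_square)
    also have "\<dots> = N T * (2 * a * ?A y * j) + 4 * a * (a - 1) * ?A y * j\<^sup>2 * (norm y)\<^sup>2"
     unfolding quad_sum by simp
    also have "\<dots> = N T * (2 * a * ?A y * j) + 4 * a * (a - 1) * ?A y * j * ((norm y)\<^sup>2 * j)"
     by algebra
    also have "\<dots> = - (N T * (N T - 2)) * ?A y * j\<^sup>2"
     unfolding Yj a_def by (simp add: field_simps power2_eq_square)
    finally show ?thesis .
   qed
   \<comment> \<open>The two mixed products of first derivatives are merged with the second
     derivative of \<open>ell\<close>, so that \<open>sum_ell2\<close> applies to the last
     summand.\<close>
   have F2e: "F2 i y = ?A2 i y * ?q y + ?A y * ?q2 y * (ell1 z i y)\<^sup>2 + ?A y * ?q1 y * (- 2 * (N T - 2) * j * (y \<bullet> i) * ell1 z i y + ell2 z i y)" for i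
    unfolding F2_def p1 by (simp add: a_def power2_eq_square field_simps)
   have lin: "(\<Sum>i\<in>(Basis::'a set). f i * p + c * g i + d * h i) = (\<Sum>i\<in>Basis. f i) * p + c * (\<Sum>i\<in>Basis. g i) + d * (\<Sum>i\<in>Basis. h i)"
    for f g h :: "'a \<Rightarrow> real" and p c d
    by (simp only: sum.distrib sum_distrib_left sum_distrib_right)
   have "(\<Sum>i\<in>Basis. F2 i y) = (\<Sum>i\<in>(Basis::'a set). ?A2 i y) * ?q y + ?A y * ?q2 y * (\<Sum>i\<in>Basis. (ell1 z i y)\<^sup>2)
     + ?A y * ?q1 y * (\<Sum>i\<in>Basis. - 2 * (N T - 2) * j * (y \<bullet> i) * ell1 z i y + ell2 z i y)"
    unfolding F2e by (rule lin)
   also have "\<dots> = (- (N T * (N T - 2)) * ?A y * j\<^sup>2) * l ^ k + ?A y * (real k * (real (k - 1) * l ^ (k - 1 - 1))) * (4 * j\<^sup>2 * ((norm z)\<^sup>2 - l\<^sup>2))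
     + ?A y * (real k * l ^ (k - 1)) * (- 4 * N T * j\<^sup>2 * l)"
    unfolding s1 sum_ell1_sq j_def sum_ell2 l_def ..
   finally have S: "(\<Sum>i\<in>Basis. F2 i y) = \<dots>" .
   \<comment> \<open>The subtractions in the exponents are genuine only from k = 2 on.\<close>
   consider "k = 0" | "k = 1" | m where "k = Suc (Suc m)"
    by (metis One_nat_def not0_implies_Suc)
   then show ?thesis
   proof cases
    case 1
    then show ?thesis unfolding S L_def p3 l_def[symmetric] by (simp add: algebra_simps)
   next
    case 2
    then show ?thesis unfolding S L_def p3 l_def[symmetric] by (simp add: algebra_simps power2_eq_square)
   next
    case 3
    then show ?thesis unfolding S L_def p3 l_def[symmetric] by (simp add: algebra_simps power2_eq_square)
   qed
  qed
 qed
 then have I: "(LBINT y. nk2 x y * L y) = N T * (N T - 2) * om0 TYPE('a) * (?A x * ell z x ^ k)"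
  unfolding F_def .
 have A: "jb x powr ((N T - 2)/2) * ?A x = 1"
  by (rule powr_mult_one) (auto simp: a_def field_simps)
 have gen: "u / w * (c * w * (v * q)) = (u * v) * (c * q)" if "w \<noteq> 0" for u v w c q :: real
  using that by simp
 have O: "om0 TYPE('a) \<noteq> 0" using om0_pos by simp
 show ?thesis
  unfolding Kop_def L_def[symmetric] I gen[OF O] A by simp
qed

end

section \<open>The integral operator on the sphere\<close>

definition m0 :: "'a::euclidean_space itself \<Rightarrow> real"
 where "m0 _ = (LBINT z. jb (z::'a) powr (- real DIM('a)))"

text \<open>The pull-back of the normalised surface measure of the sphere under stereographic projection.\<close>

definition mm :: "'a::euclidean_space measure"
 where "mm = density lborel (\<lambda>y. ennreal (jb y powr (- real DIM('a)) / m0 TYPE('a)))"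

abbreviation mean :: "('a::euclidean_space \<Rightarrow> 'b::{banach, second_countable_topology}) \<Rightarrow> 'b" (binder "\<E>" 10)
 where "mean f \<equiv> integral\<^sup>L mm f"

text \<open>A constant times the power 2 - n of the chordal distance, because |stereo x - stereo
  y|^2 = 4 |x - y|^2 / (jb x jb y). It is the kernel of \<open>Kop\<close> with respect to
  \<open>mm\<close>.\<close>

definition ker :: "'a::euclidean_space \<Rightarrow> 'a \<Rightarrow> real"
 where "ker x y = m0 TYPE('a) / om0 TYPE('a) * (jb x powr ((real DIM('a) - 2)/2) *
   (jb y powr ((real DIM('a) - 2)/2) * norm (x - y) powr (2 - real DIM('a))))"

definition bb :: "('a::euclidean_space \<Rightarrow> real) \<Rightarrow> bool"
 where "bb f \<longleftrightarrow> f \<in> BM \<and> (\<exists>B. \<forall>x. \<bar>f x\<bar> \<le> B)"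

lemma bbI: "f \<in> BM \<Longrightarrow> (\<And>x. \<bar>f x\<bar> \<le> B) \<Longrightarrow> bb f"
 by (auto simp: bb_def)

lemma bbE:
 assumes "bb f"
 obtains B where "0 < B" "\<And>x. \<bar>f x\<bar> \<le> B"
proof -
 obtain B where "\<And>x. \<bar>f x\<bar> \<le> B" using assms by (auto simp: bb_def)
 then have "\<bar>f x\<bar> \<le> max B 1" for x by (meson max.coboundedI1)
 then show ?thesis using that[of "max B 1"] by simp
qed

lemma bb_measurable [measurable_dest]: "bb f \<Longrightarrow> f \<in> BM"
 by (simp add: bb_def)

lemma bb_const: "bb (\<lambda>x. c)"
 by (rule bbI[of _ "\<bar>c\<bar>"]) auto

lemma bb_add:
 assumes "bb f" "bb g" shows "bb (\<lambda>x. f x + g x)"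
proof -
 obtain B where B: "\<And>x. \<bar>f x\<bar> \<le> B" using bbE[OF assms(1)] by blast
 obtain C where C: "\<And>x. \<bar>g x\<bar> \<le> C" using bbE[OF assms(2)] by blast
 show ?thesis
 proof (rule bbI[of _ "B + C"])
  show "(\<lambda>x. f x + g x) \<in> BM" using assms by (auto simp: bb_def)
  show "\<bar>f x + g x\<bar> \<le> B + C" for x using B[of x] C[of x] by linarith
 qed
qed

lemma bb_mult:
 assumes "bb f" "bb g" shows "bb (\<lambda>x. f x * g x)"
proof -
 obtain B where B: "0 < B" "\<And>x. \<bar>f x\<bar> \<le> B" using bbE[OF assms(1)] by blast
 obtain C where C: "0 < C" "\<And>x. \<bar>g x\<bar> \<le> C" using bbE[OF assms(2)] by blast
 show ?thesis
 proof (rule bbI[of _ "B * C"])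
  show "(\<lambda>x. f x * g x) \<in> BM" using assms by (auto simp: bb_def)
  show "\<bar>f x * g x\<bar> \<le> B * C" for x unfolding abs_mult using B C by (intro mult_mono) (auto intro: less_imp_le)
 qed
qed

lemma bb_cmult: "bb f \<Longrightarrow> bb (\<lambda>x. c * f x)"
 by (rule bb_mult[OF bb_const])

lemma bb_uminus: "bb f \<Longrightarrow> bb (\<lambda>x. - f x)"
 using bb_cmult[of f "-1"] by simp

lemma bb_diff: "bb f \<Longrightarrow> bb g \<Longrightarrow> bb (\<lambda>x. f x - g x)"
 using bb_add[OF _ bb_uminus, of f g] by simp

lemma bb_power: "bb f \<Longrightarrow> bb (\<lambda>x. f x ^ k)"
 by (induction k) (auto intro: bb_const bb_mult)

lemma bb_abs: "bb f \<Longrightarrow> bb (\<lambda>x. \<bar>f x\<bar>)"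
 unfolding bb_def by auto

lemma bb_sum: "(\<And>i. i \<in> I \<Longrightarrow> bb (f i)) \<Longrightarrow> bb (\<lambda>x. \<Sum>i\<in>I. f i x)"
proof (induction I rule: infinite_finite_induct)
 case (insert i F)
 then show ?case using bb_add[of "f i" "\<lambda>x. \<Sum>i\<in>F. f i x"] by simp
qed (auto intro: bb_const)

lemma bb_indicator: "A \<in> sets borel \<Longrightarrow> bb (ind A)"
 by (rule bbI[of _ 1]) (auto simp: indicator_def)

lemmas bb_intros = bb_const bb_add bb_mult bb_diff bb_uminus bb_power bb_abs bb_sum

lemma sets_mm [simp, measurable_cong]: "sets mm = sets borel"
 by (simp add: mm_def)

lemma space_mm [simp]: "space mm = UNIV"
 by (simp add: mm_def)

lemma borel_measurable_mm [simp]: "borel_measurable mm = BM"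
 by (rule measurable_cong_sets) simp_all

lemma quadratic_nonneg_disc:
 fixes A B C :: real
 assumes "\<And>s. 0 \<le> s\<^sup>2 * A + 2 * s * B + C"
 shows "B\<^sup>2 \<le> A * C"
proof (cases "A = 0")
 case True
 show ?thesis
 proof (cases "B = 0")
  case False
  then show ?thesis using assms[of "- (C + 1)/(2 * B)"] True by (simp add: field_simps)
 qed (use True in simp)
next
 case False
 have A: "0 \<le> A"
 proof (rule ccontr)
  assume "\<not> 0 \<le> A"
  then have Aneg: "A < 0" by simp
  \<comment> \<open>At this s the negative term s^2 A already outweighs the two other terms.\<close>
  define s where "s = 1 + (2 * \<bar>B\<bar> + \<bar>C\<bar>) / (- A)"
  have "0 \<le> (2 * \<bar>B\<bar> + \<bar>C\<bar>) / (- A)" using Aneg by (intro divide_nonneg_pos) auto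
  then have s1: "1 \<le> s" unfolding s_def by linarith
  have "s * A = A - (2 * \<bar>B\<bar> + \<bar>C\<bar>)" using Aneg by (simp add: s_def field_simps)
  then have "s\<^sup>2 * A = s * (A - (2 * \<bar>B\<bar> + \<bar>C\<bar>))" by (simp add: power2_eq_square)
  then have "s\<^sup>2 * A + 2 * s * B + C = s * A + s * (2 * (B - \<bar>B\<bar>)) + (C - s * \<bar>C\<bar>)" by (simp add: algebra_simps)
  moreover have "s * A < 0" using s1 Aneg by (simp add: mult_pos_neg)
  moreover have "s * (2 * (B - \<bar>B\<bar>)) \<le> 0" using s1 by (intro mult_nonneg_nonpos) auto
  moreover have "C - s * \<bar>C\<bar> \<le> 0" using mult_right_mono[OF s1, of "\<bar>C\<bar>"] by linarith
  ultimately show False using assms[of s] by linarith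
 qed
 with False have "0 < A" by simp
 then show ?thesis using assms[of "- B / A"] by (simp add: field_simps power2_eq_square)
qed

context dim_ge_3
begin

lemma m0_integrable: "LI (\<lambda>z::'a. jb z powr (- N T))"
 by (rule dec_integrable[OF dec_jb]) (use N3 in simp)

lemma m0_pos: "0 < m0 TYPE('a)"
proof -
 have "m0 TYPE('a) \<noteq> 0"
 proof
  assume "m0 TYPE('a) = 0"
  then have "AE z in lborel. jb (z::'a) powr (- N T) = 0"
   using integral_nonneg_eq_0_iff_AE[OF m0_integrable] by (simp add: m0_def)
  then have "AE z in (lborel::'a measure). False" by simp
  then have "emeasure lborel (UNIV::'a set) = 0"
   using ae_filter_eq_bot_iff[of "lborel::'a measure"] by (simp add: eventually_False)
  then show False by simp
 qed
 moreover have "0 \<le> m0 TYPE('a)" unfolding m0_def by (intro integral_nonneg_AE) auto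
 ultimately show ?thesis by simp
qed

lemma mm_integral:
 fixes f :: "'a \<Rightarrow> 'b::{banach, second_countable_topology}"
 assumes [measurable]: "f \<in> BM"
 shows "integral\<^sup>L mm f = (LBINT y. (jb y powr (- N T) / m0 TYPE('a)) *\<^sub>R f y)"
  and "integrable mm f \<longleftrightarrow> LI (\<lambda>y. (jb y powr (- N T) / m0 TYPE('a)) *\<^sub>R f y)"
proof -
 have m: "(\<lambda>y::'a. jb y powr (- N T) / m0 TYPE('a)) \<in> borel_measurable lborel" by measurable
 have n: "AE y in lborel. 0 \<le> jb (y::'a) powr (- N T) / m0 TYPE('a)" using m0_pos by simp
 have f: "f \<in> borel_measurable lborel" by simp
 show "integral\<^sup>L mm f = (LBINT y. (jb y powr (- N T) / m0 TYPE('a)) *\<^sub>R f y)"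
  unfolding mm_def by (rule integral_density[OF f m n])
 show "integrable mm f \<longleftrightarrow> LI (\<lambda>y. (jb y powr (- N T) / m0 TYPE('a)) *\<^sub>R f y)"
  unfolding mm_def by (rule integrable_density[OF f m n])
qed

lemma emeasure_mm: "emeasure mm (UNIV::'a set) = 1"
proof -
 have "emeasure mm (UNIV::'a set) = (\<integral>\<^sup>+y. ennreal (jb (y::'a) powr (- N T) / m0 TYPE('a)) \<partial>lborel)"
  by (simp add: mm_def emeasure_density)
 also have "\<dots> = ennreal (LBINT y. jb (y::'a) powr (- N T) / m0 TYPE('a))"
  using m0_pos m0_integrable by (intro nn_integral_eq_integral) auto
 also have "(LBINT y. jb (y::'a) powr (- N T) / m0 TYPE('a)) = 1"
  using m0_pos by (simp add: m0_def)
 finally show ?thesis by simp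
qed

sublocale mm: finite_measure "mm :: 'a measure"
 by standard (simp add: emeasure_mm)

lemma measure_mm: "measure mm (UNIV::'a set) = 1"
 by (simp add: measure_def emeasure_mm)

lemma bb_integrable: "bb f \<Longrightarrow> integrable mm (f :: 'a \<Rightarrow> real)"
proof -
 assume f: "bb f"
 obtain B where B: "\<And>x. \<bar>f x\<bar> \<le> B" using bbE[OF f] by blast
 show ?thesis
  by (rule mm.integrable_const_bound[where B=B]) (use B bb_measurable[OF f] in auto)
qed

lemma ker_nonneg [simp]: "0 \<le> ker (x::'a) (y::'a)"
 using m0_pos om0_pos by (simp add: ker_def)

lemma ker_sym: "ker x y = ker y (x::'a)"
 by (simp add: ker_def norm_minus_commute mult_ac)

lemma ker_measurable [measurable]: "(\<lambda>(x, y::'a). ker x y) \<in> borel_measurable (borel \<Otimes>\<^sub>M borel)"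
 unfolding ker_def by measurable

lemma ker_measurable' [measurable (raw)]:
 assumes [measurable]: "f \<in> M \<rightarrow>\<^sub>M borel" "g \<in> M \<rightarrow>\<^sub>M borel"
 shows "(\<lambda>x. ker (f x) (g x :: 'a)) \<in> borel_measurable M"
 unfolding ker_def by measurable

lemma ker_lborel:
 "(jb y powr (- N T) / m0 TYPE('a)) * (ker x y * c) = jb x powr ((N T - 2)/2) / om0 TYPE('a) * (nk2 x y * (jb (y::'a) powr Np T * c))"
proof -
 have e: "jb y powr Np T = jb y powr (- N T) * jb y powr ((N T - 2)/2)"
  by (simp add: powr_add[symmetric] field_simps)
 show ?thesis unfolding e ker_def using m0_pos om0_pos by (simp add: field_simps)
qed

lemma Kop_mm:
 assumes [measurable]: "f \<in> BM"
 shows "Kop f x = (\<E> y. ker x y * f (y::'a))"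
proof -
 have "(\<E> y. ker x y * f y) = (LBINT y. (jb y powr (- N T) / m0 TYPE('a)) *\<^sub>R (ker x y * f y))"
  by (rule mm_integral(1)) measurable
 then show ?thesis unfolding real_scaleR_def ker_lborel Kop_def by simp
qed

lemma ker_integrable: "integrable mm (\<lambda>y::'a. ker x y)"
proof -
 have m: "(\<lambda>y::'a. ker x y * 1) \<in> BM" by measurable
 have "integrable mm (\<lambda>y::'a. ker x y * 1)"
  unfolding mm_integral(2)[OF m]
  unfolding real_scaleR_def
  unfolding ker_lborel
  unfolding mult_1_right
  by (intro integrable_mult_right newton_integrable)
 then show ?thesis by simp
qed

text \<open>The case k = 0 says that jb^(-(n - 2)/2) solves the critical equation up to a constant.
  As \<open>ker\<close> is nonnegative, \<open>Kop\<close> is therefore an averaging operator; the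
  sup bounds and Jensen's inequality below rest on this.\<close>

lemma Kop_1: "Kop (\<lambda>y. 1) x = (1::real)" for x :: 'a
proof -
 have "Kop (\<lambda>y. N T * (N T - 2)) x = N T * (N T - 2)"
  using Kop_ell_power[of 0 0 x] by (simp add: algebra_simps)
 moreover have "Kop (\<lambda>y. N T * (N T - 2)) x = N T * (N T - 2) * Kop (\<lambda>y. 1) x"
  by (simp add: Kop_mm)
 ultimately show ?thesis using N3 by simp
qed

lemma Kint: "bb f \<Longrightarrow> integrable mm (\<lambda>y::'a. ker x y * f y)"
proof -
 assume f: "bb f"
 then have [measurable]: "f \<in> BM" by (simp add: bb_def)
 obtain B where B: "0 < B" "\<And>x. \<bar>f x\<bar> \<le> B" using bbE[OF f] by blast
 show ?thesis
 proof (rule integrable_dom[OF integrable_mult_right[OF ker_integrable[of x], of B]])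
  show "AE y in mm. norm (ker x y * f y) \<le> norm (B * ker x y)"
  proof (rule AE_I2)
   fix y
   have "ker x y * \<bar>f y\<bar> \<le> ker x y * B" by (intro mult_left_mono B(2)) simp
   then show "norm (ker x y * f y) \<le> norm (B * ker x y)" using B(1) by (simp add: abs_mult mult_ac)
  qed
 qed measurable
qed

lemma Kop_add: "bb f \<Longrightarrow> bb g \<Longrightarrow> Kop (\<lambda>y. f y + g y) x = Kop f x + Kop g (x::'a)"
 using Kint[of f x] Kint[of g x]
 by (subst (1 2 3) Kop_mm) (auto simp: bb_def distrib_left intro!: Bochner_Integration.integral_add)

lemma Kop_cmult: "bb f \<Longrightarrow> Kop (\<lambda>y. c * f y) x = c * Kop f (x::'a)"
 by (subst (1 2) Kop_mm) (auto simp: bb_def mult.left_commute)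

lemma Kop_diff: "bb f \<Longrightarrow> bb g \<Longrightarrow> Kop (\<lambda>y. f y - g y) x = Kop f x - Kop g (x::'a)"
 using Kop_add[of f "\<lambda>y. (-1) * g y" x] Kop_cmult[of g "-1" x] bb_cmult[of g "-1"] by simp

lemma Kop_const: "Kop (\<lambda>y. c) x = (c::real)" for x :: 'a
 using Kop_cmult[OF bb_const[of 1], of c x] by (simp add: Kop_1)

lemma Kop_sum: "(\<And>i. i \<in> I \<Longrightarrow> bb (f i)) \<Longrightarrow> Kop (\<lambda>y. \<Sum>i\<in>I. f i y) x = (\<Sum>i\<in>I. Kop (f i) (x::'a))"
proof (induction I rule: infinite_finite_induct)
 case (insert i F)
 then show ?case by (simp add: Kop_add bb_sum)
qed (auto simp: Kop_const)

lemma Kop_mono: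
 assumes "bb f" "bb g" "\<And>y. f y \<le> g y"
 shows "Kop f x \<le> Kop g (x::'a)"
proof -
 have [measurable]: "f \<in> BM" "g \<in> BM" using assms by (auto simp: bb_def)
 show ?thesis
  by (subst (1 2) Kop_mm) (auto intro!: integral_mono Kint assms mult_left_mono)
qed

lemma Kop_abs_le:
 assumes "bb f" "bb g" "\<And>y. \<bar>f y\<bar> \<le> g y"
 shows "\<bar>Kop f x\<bar> \<le> Kop g (x::'a)"
proof -
 have "Kop f x \<le> Kop g x" by (intro Kop_mono assms) (use assms(3) in \<open>auto intro: order_trans[OF abs_ge_self]\<close>)
 moreover have "Kop (\<lambda>y. (-1) * f y) x \<le> Kop g x"
  by (intro Kop_mono assms bb_cmult) (use assms(3) in \<open>auto intro: order_trans[OF abs_ge_minus_self]\<close>)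
 ultimately show ?thesis using Kop_cmult[OF assms(1), of "-1" x] by linarith
qed

lemma Kop_bound: "bb f \<Longrightarrow> (\<And>y. \<bar>f y\<bar> \<le> B) \<Longrightarrow> \<bar>Kop f x\<bar> \<le> (B::real)" for x :: 'a
 using Kop_abs_le[of f "\<lambda>_. B" x] by (simp add: Kop_const bb_const)

section \<open>Uniform integrability of the kernel and continuity of potentials\<close>

lemma ker_q_bound:
 obtains C where "0 < C" "\<And>x. integrable mm (\<lambda>y::'a. ker x y powr ((N T - 1)/(N T - 2)))"
  "\<And>x. (\<E> y. ker x (y::'a) powr ((N T - 1)/(N T - 2))) \<le> C"
proof -
 obtain C where C: "0 < C"
  "\<And>x::'a. LI (\<lambda>y. nk1 x y * jb y powr (- (N T + 1)/2))"
  "\<And>x::'a. (LBINT y. nk1 x y * jb y powr (- (N T + 1)/2)) \<le> C * jb x powr Nh T"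
  by (rule riesz_bound[where 'a='a]) (rule that)
 \<comment> \<open>This exponent turns |x - y|^(2 - n) into |x - y|^(1 - n), the kernel of
   \<open>riesz_bound\<close>; the weights in x then cancel, so the bound is uniform in x.\<close>
 define q where "q = (N T - 1)/(N T - 2)"
 have q1: "(N T - 2)/2 * q = (N T - 1)/2" "(2 - N T) * q = 1 - N T"
  using N3 by (simp_all add: q_def field_simps)
 define D where "D = (m0 TYPE('a) / om0 TYPE('a)) powr q / m0 TYPE('a)"
 have D: "0 < D" using m0_pos om0_pos by (simp add: D_def)
 have e: "jb y powr (- (N T + 1)/2) = jb y powr (- N T) * jb y powr ((N T - 1)/2)" for y :: 'a
  by (simp add: powr_add[symmetric] field_simps)
 have kq: "(jb y powr (- N T) / m0 TYPE('a)) *\<^sub>R (ker x y powr q) = D * jb x powr ((N T - 1)/2) * (nk1 x y * jb y powr (- (N T + 1)/2))" for x y :: 'a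
 proof -
  have "ker x y powr q = (m0 TYPE('a) / om0 TYPE('a)) powr q * (jb x powr ((N T - 1)/2) * (jb y powr ((N T - 1)/2) * nk1 x y))"
   unfolding ker_def powr_mult powr_powr q1 ..
  then show ?thesis unfolding e D_def by simp
 qed
 have i: "integrable mm (\<lambda>y::'a. ker x y powr q)" for x
  by (subst mm_integral(2)) (auto simp only: kq intro!: integrable_mult_right C(2), measurable)
 have "(\<E> y. ker x (y::'a) powr q) \<le> D * C" for x
 proof -
  have "(\<E> y. ker x (y::'a) powr q) = D * jb x powr ((N T - 1)/2) * (LBINT y. nk1 x y * jb y powr (- (N T + 1)/2))"
   by (subst mm_integral(1)) (simp_all only: kq integral_mult_right_zero, measurable)
  also have "\<dots> \<le> D * jb x powr ((N T - 1)/2) * (C * jb x powr Nh T)"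
   using D by (intro mult_left_mono C(3)) auto
  also have "\<dots> = D * C * (jb x powr ((N T - 1)/2) * jb x powr Nh T)" by simp
  also have "jb x powr ((N T - 1)/2) * jb x powr Nh T = 1"
   unfolding powr_add[symmetric] by (simp add: field_simps)
  finally show ?thesis by simp
 qed
 then show ?thesis using that[of "D * C"] i D C(1) by (simp add: q_def)
qed

text \<open>Above the level M the kernel is at most M^(1 - q) times its q-th power, and q > 1. The
  level is determined by M^(1 - q) C = e.\<close>

lemma ker_tail:
 assumes e: "0 < e"
 obtains M where "0 < M" "\<And>x. (\<E> y. ker x (y::'a) - min (ker x y) M) \<le> e"
proof -
 obtain C where C: "0 < C" "\<And>x. integrable mm (\<lambda>y::'a. ker x y powr ((N T - 1)/(N T - 2)))"
  "\<And>x. (\<E> y. ker x (y::'a) powr ((N T - 1)/(N T - 2))) \<le> C" by (rule ker_q_bound) (rule that)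
 define q where "q = (N T - 1)/(N T - 2)"
 have q: "1 < q" using N3 by (simp add: q_def field_simps)
 define M where "M = (C / e) powr (1/(q - 1))"
 have M: "0 < M" using C(1) e by (simp add: M_def)
 have Mq: "M powr (1 - q) = e / C"
 proof -
  have "M powr (1 - q) = (C / e) powr (1/(q - 1) * (1 - q))" by (simp add: M_def powr_powr)
  also have "1/(q - 1) * (1 - q) = -1" using q by (simp add: field_simps)
  finally show ?thesis using C(1) e by (simp add: powr_minus_divide)
 qed
 have pw: "t - min t M \<le> M powr (1 - q) * t powr q" if "0 \<le> t" for t
 proof (cases "t \<le> M")
  case True then show ?thesis by simp
 next
  case False
  then have "t powr (1 - q) \<le> M powr (1 - q)" using q M by (intro powr_mono2') auto
  then have "t powr (1 - q) * t powr q \<le> M powr (1 - q) * t powr q" by (intro mult_right_mono) auto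
  moreover have "t powr (1 - q) * t powr q = t" using False M by (simp add: powr_add[symmetric])
  ultimately show ?thesis using False M by simp
 qed
 have "(\<E> y. ker x (y::'a) - min (ker x y) M) \<le> e" for x
 proof -
  have "(\<E> y. ker x (y::'a) - min (ker x y) M) \<le> (\<E> y. M powr (1 - q) * ker x (y::'a) powr q)"
  proof (rule integral_mono)
   show "integrable mm (\<lambda>y::'a. ker x y - min (ker x y) M)"
    by (rule integrable_dom[OF ker_integrable[of x]])
      (use M in \<open>auto simp: min_def\<close>)
   show "integrable mm (\<lambda>y::'a. M powr (1 - q) * ker x y powr q)"
    using C(2) by (simp add: q_def)
  qed (use pw in auto)
  also have "\<dots> = M powr (1 - q) * (\<E> y. ker x (y::'a) powr q)" by simp
  also have "\<dots> \<le> M powr (1 - q) * C" using C(3) by (intro mult_left_mono) (auto simp: q_def)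
  also have "\<dots> = e" using C(1) by (simp add: Mq)
  finally show ?thesis .
 qed
 then show ?thesis using that M by blast
qed

lemma kmin_integrable: "0 < M \<Longrightarrow> bb f \<Longrightarrow> integrable mm (\<lambda>y::'a. min (ker x y) M * f y)"
proof -
 assume M: "0 < M" and f: "bb f"
 have [measurable]: "f \<in> BM" using f by (simp add: bb_def)
 show ?thesis
  by (rule integrable_dom[OF Kint[OF f, of x]])
    (use M in \<open>auto simp: abs_mult intro!: mult_right_mono\<close>)
qed

lemma Kop_split:
 assumes M: "0 < M" and f: "bb f" and B: "\<And>y. \<bar>f y\<bar> \<le> B"
  and e: "(\<E> y. ker x (y::'a) - min (ker x y) M) \<le> e"
 shows "\<bar>Kop f x - (\<E> y. min (ker x y) M * f y)\<bar> \<le> e * B"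
proof -
 have [measurable]: "f \<in> BM" using f by (simp add: bb_def)
 have B0: "0 \<le> B" using B[of undefined] by linarith
 have i1: "integrable mm (\<lambda>y::'a. ker x y - min (ker x y) M)"
  using kmin_integrable[OF M bb_const[of 1], of x] ker_integrable[of x] by simp
 have "Kop f x - (\<E> y. min (ker x y) M * f y) = (\<E> y. (ker x y - min (ker x y) M) * f y)"
  using Kint[OF f, of x] kmin_integrable[OF M f, of x]
  by (subst Kop_mm) (auto simp: left_diff_distrib)
 also have "\<bar>\<dots>\<bar> \<le> (\<E> y. \<bar>(ker x y - min (ker x y) M) * f y\<bar>)" by (rule integral_abs_bound)
 also have "\<dots> \<le> (\<E> y. (ker x y - min (ker x y) M) * B)"
 proof (rule integral_mono)
  show "integrable mm (\<lambda>y. \<bar>(ker x y - min (ker x y) M) * f y\<bar>)"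
   using Kint[OF f, of x] kmin_integrable[OF M f, of x]
   by (intro integrable_abs) (auto simp: left_diff_distrib)
  show "integrable mm (\<lambda>y. (ker x y - min (ker x y) M) * B)" using i1 by simp
  show "\<bar>(ker x y - min (ker x y) M) * f y\<bar> \<le> (ker x y - min (ker x y) M) * B" for y
   unfolding abs_mult using B[of y] by (intro mult_mono) auto
 qed
 also have "\<dots> = (\<E> y. ker x y - min (ker x y) M) * B" by simp
 also have "\<dots> \<le> e * B" using e B0 by (rule mult_right_mono)
 finally show ?thesis .
qed

text \<open>Cut the kernel at a height M: the tail costs a small multiple of the sup norm, the
  bounded part only the mean of |f|. This does the work of compactness: it trades sup norms for
  mean-square norms and shows that sets of small mass have small potentials.\<close>

lemma Kop_eps:
 assumes e: "0 < e"
 obtains C where "0 < C"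
  "\<And>f B x. bb f \<Longrightarrow> (\<And>y. \<bar>f y\<bar> \<le> B) \<Longrightarrow> \<bar>Kop f (x::'a)\<bar> \<le> e * B + C * (\<E> y. \<bar>f y\<bar>)"
proof -
 obtain M where M: "0 < M" "\<And>x. (\<E> y. ker x (y::'a) - min (ker x y) M) \<le> e" using ker_tail[OF e] by blast
 have "\<bar>Kop f (x::'a)\<bar> \<le> e * B + M * (\<E> y. \<bar>f y\<bar>)" if f: "bb f" and B: "\<And>y. \<bar>f y\<bar> \<le> B" for f B x
 proof -
  have "\<bar>\<integral>y. min (ker x y) M * f y \<partial>mm\<bar> \<le> (\<E> y. \<bar>min (ker x y) M * f y\<bar>)" by (rule integral_abs_bound)
  also have "\<dots> \<le> (\<E> y. M * \<bar>f y\<bar>)"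
   using M(1) f
   by (intro integral_mono integrable_abs kmin_integrable integrable_mult_right bb_integrable bb_intros)
     (auto simp: abs_mult intro!: mult_right_mono)
  also have "\<dots> = M * (\<E> y. \<bar>f y\<bar>)" by simp
  finally show ?thesis using Kop_split[OF M(1) f B M(2)[of x]] by linarith
 qed
 then show ?thesis using that M(1) by blast
qed

text \<open>Truncated kernels give continuous functions by dominated convergence, and by
  \<open>ker_tail\<close> the truncations converge uniformly.\<close>

lemma Kop_continuous:
 assumes f: "bb f"
 shows "continuous_on UNIV (Kop f :: 'a \<Rightarrow> real)"
proof -
 have [measurable]: "f \<in> BM" using f by (simp add: bb_def)
 obtain B where B: "0 < B" "\<And>x. \<bar>f x\<bar> \<le> B" using bbE[OF f] by blast
 define KM where "KM M x = (\<E> y. min (ker x y) M * f y)" for M and x :: 'a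
 have cM: "continuous_on UNIV (KM M)" if M: "0 < M" for M
  unfolding continuous_on_sequentially o_def
 proof (intro allI ballI impI, elim conjE)
  fix X :: "nat \<Rightarrow> 'a" and x
  assume X: "X \<leadsto> x"
  show "(\<lambda>n. KM M (X n)) \<leadsto> KM M x"
   unfolding KM_def
  proof (rule integral_dct[where w="\<lambda>y. M * B"])
   have "AE y in lborel. x \<noteq> y" by (rule AE_neq)
   then have "AE y in mm. x \<noteq> y" unfolding mm_def by (subst AE_density) auto
   then show "AE y in mm. (\<lambda>n. min (ker (X n) y) M * f y) \<leadsto> min (ker x y) M * f y"
   proof eventually_elim
    case (elim y)
    have "(\<lambda>n. ker (X n) y) \<leadsto> ker x y"
     unfolding ker_def jb_def
     by (intro tendsto_intros X) (use elim in \<open>auto simp: add_nonneg_eq_0_iff\<close>)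
    then show ?case by (intro tendsto_intros)
   qed
   show "AE y in mm. norm (min (ker (X n) y) M * f y) \<le> M * B" for n
    using B M by (intro AE_I2) (auto simp: abs_mult intro!: mult_mono)
  qed auto
 qed
 show ?thesis
 proof (rule uniform_limit_theorem[where f="\<lambda>n x. KM (SOME M. 0 < M \<and> (\<forall>x. (\<E> y. ker x (y::'a) - min (ker x y) M) \<le> es n)) x" and F=sequentially])
  let ?M = "\<lambda>n. SOME M. 0 < M \<and> (\<forall>x. (\<E> y. ker x (y::'a) - min (ker x y) M) \<le> es n)"
  have M: "0 < ?M n \<and> (\<forall>x. (\<E> y. ker x (y::'a) - min (ker x y) (?M n)) \<le> es n)" for n
   by (rule someI_ex) (use ker_tail[OF es(1)[of n]] in blast)
  show "\<forall>\<^sub>F n in sequentially. continuous_on UNIV (KM (?M n))"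
   using cM M by (intro always_eventually) blast
  show "uniform_limit UNIV (\<lambda>n x. KM (?M n) x) (Kop f) sequentially"
  proof (rule uniform_limitI)
   fix e :: real assume e: "0 < e"
   have "(\<lambda>n. es n * B) \<leadsto> 0 * B" by (intro tendsto_mult es tendsto_const)
   then have "\<forall>\<^sub>F n in sequentially. es n * B < e" using e by (simp add: order_tendsto_iff)
   then show "\<forall>\<^sub>F n in sequentially. \<forall>x\<in>UNIV. dist (KM (?M n) x) (Kop f x) < e"
   proof eventually_elim
    case (elim n)
    have "\<bar>Kop f x - KM (?M n) x\<bar> \<le> es n * B" for x
     unfolding KM_def using M by (intro Kop_split f B(2)) auto
    then show ?case using elim by (auto simp: dist_real_def abs_minus_commute intro: le_less_trans)
   qed
  qed
 qed simp
qed

lemma bb_Kop: "bb f \<Longrightarrow> bb (Kop f :: 'a \<Rightarrow> real)"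
proof -
 assume f: "bb f"
 obtain B where B: "0 < B" "\<And>x. \<bar>f x\<bar> \<le> B" using bbE[OF f] by blast
 show ?thesis
  by (rule bbI[OF borel_measurable_continuous_onI[OF Kop_continuous[OF f]] Kop_bound[OF f B(2)]])
qed

lemma Kop_symmetric:
 assumes f: "bb f" and g: "bb g"
 shows "(\<E> x. Kop f x * g x) = (\<E> x. f (x::'a) * Kop g x)"
proof -
 have [measurable]: "f \<in> BM" "g \<in> BM" using f g by (auto simp: bb_def)
 obtain B where B: "0 < B" "\<And>x. \<bar>f x\<bar> \<le> B" using bbE[OF f] by blast
 obtain D where D: "0 < D" "\<And>x. \<bar>g x\<bar> \<le> D" using bbE[OF g] by blast
 interpret P: pair_sigma_finite "mm :: 'a measure" "mm :: 'a measure" ..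
 have int: "integrable (mm \<Otimes>\<^sub>M mm) (\<lambda>(x, y::'a). ker x y * f y * g x)"
 proof (rule P.Fubini_integrable)
  show "(\<lambda>(x, y::'a). ker x y * f y * g x) \<in> borel_measurable (mm \<Otimes>\<^sub>M mm)" by measurable
  show "integrable mm (\<lambda>x::'a. (\<E> y. norm (case (x, y) of (x, y) \<Rightarrow> ker x y * f y * g x)))"
  proof (rule mm.integrable_const_bound[where B="B * D"])
   show "AE x in mm. norm (\<E> y. norm (case (x, y) of (x, y) \<Rightarrow> ker x y * f y * g x)) \<le> B * D"
   proof (intro AE_I2)
    fix x :: 'a
    have "(\<E> y. norm (case (x, y) of (x, y) \<Rightarrow> ker x y * f y * g x)) = (\<E> y. ker x y * \<bar>f y\<bar>) * \<bar>g x\<bar>"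
     by (simp add: abs_mult)
    also have "(\<E> y. ker x y * \<bar>f y\<bar>) = Kop (\<lambda>y. \<bar>f y\<bar>) x" by (simp add: Kop_mm)
    finally have "norm (\<E> y. norm (case (x, y) of (x, y) \<Rightarrow> ker x y * f y * g x)) = \<bar>Kop (\<lambda>y. \<bar>f y\<bar>) x\<bar> * \<bar>g x\<bar>"
     using Kop_mono[of "\<lambda>_. 0" "\<lambda>y. \<bar>f y\<bar>" x] by (simp add: abs_mult Kop_const bb_const bb_abs f)
    also have "\<dots> \<le> B * D"
     using B D f by (intro mult_mono Kop_bound bb_abs) auto
    finally show "norm (\<E> y. norm (case (x, y) of (x, y) \<Rightarrow> ker x y * f y * g x)) \<le> B * D" .
   qed
  qed measurable
  show "AE x in mm. integrable mm (\<lambda>y::'a. case (x, y) of (x, y) \<Rightarrow> ker x y * f y * g x)"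
   using Kint[OF f] by (intro AE_I2) auto
 qed
 have "(\<E> x. Kop f x * g x) = (\<E> x. (\<E> y. ker (x::'a) y * f y * g x))"
  by (simp add: Kop_mm)
 also have "\<dots> = (\<E> y. (\<E> x. ker x (y::'a) * f y * g x))"
  using P.Fubini_integral[of "\<lambda>x y. ker x y * f y * g x"] int by simp
 also have "\<dots> = (\<E> y. (\<E> x. f (y::'a) * (ker y x * g x)))"
  by (simp add: ker_sym mult_ac)
 also have "\<dots> = (\<E> y. f y * Kop g y)"
  by (simp add: Kop_mm)
 finally show ?thesis .
qed

lemma Kop_integral: "bb f \<Longrightarrow> (\<E> x. Kop f x) = (\<E> x. f (x::'a))"
 using Kop_symmetric[of f "\<lambda>_. 1"] by (simp add: bb_const Kop_1)

text \<open>The kernel is a probability density in y, so the variance of f under it is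
  nonnegative.\<close>

lemma Kop_Jensen: "bb f \<Longrightarrow> (Kop f x)\<^sup>2 \<le> Kop (\<lambda>y. (f y)\<^sup>2) (x::'a)"
proof -
 assume f: "bb f"
 let ?m = "Kop f x"
 have "0 \<le> Kop (\<lambda>y. (f y - ?m)\<^sup>2) x"
  using Kop_mono[of "\<lambda>_. 0" "\<lambda>y. (f y - ?m)\<^sup>2" x] f by (simp add: Kop_const bb_intros)
 also have "(\<lambda>y. (f y - ?m)\<^sup>2) = (\<lambda>y. ((f y)\<^sup>2 + (- 2 * ?m) * f y) + ?m\<^sup>2)"
  by (auto simp: power2_diff algebra_simps)
 also have "Kop \<dots> x = Kop (\<lambda>y. (f y)\<^sup>2) x + (- 2 * ?m) * ?m + ?m\<^sup>2"
  by (subst Kop_add, (intro bb_intros f)+, subst Kop_add, (intro bb_intros f)+, subst Kop_cmult, (intro bb_intros f)+, simp only: Kop_const)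
 finally show ?thesis by (simp add: power2_eq_square)
qed

section \<open>The mean-square norm on the sphere\<close>

definition nl :: "('a \<Rightarrow> real) \<Rightarrow> real"
 where "nl f = sqrt (\<E> x. (f x)\<^sup>2)"

lemma nl_nonneg [simp]: "0 \<le> nl f"
 by (simp add: nl_def)

lemma nl_sq: "(nl f)\<^sup>2 = (\<E> x. (f x)\<^sup>2)"
 by (simp add: nl_def)

lemma nl_CS:
 assumes "bb f" "bb g"
 shows "\<bar>\<integral>x. f x * g x \<partial>mm\<bar> \<le> nl f * nl g"
proof -
 let ?A = "(\<E> x. (f x)\<^sup>2)" let ?B = "(\<E> x. f x * g x)" let ?C = "(\<E> x. (g x)\<^sup>2)"
 have "0 \<le> s\<^sup>2 * ?A + 2 * s * ?B + ?C" for s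
 proof -
  have "0 \<le> (\<E> x. (s * f x + g x)\<^sup>2)" by simp
  also have "(\<lambda>x. (s * f x + g x)\<^sup>2) = (\<lambda>x. (s\<^sup>2 * (f x)\<^sup>2 + (2 * s) * (f x * g x)) + (g x)\<^sup>2)"
   by (auto simp: power2_sum power_mult_distrib algebra_simps)
  also have "integral\<^sup>L mm \<dots> = s\<^sup>2 * ?A + 2 * s * ?B + ?C"
   using assms by (simp add: bb_integrable bb_intros)
  finally show ?thesis .
 qed
 then have "?B\<^sup>2 \<le> ?A * ?C" by (rule quadratic_nonneg_disc)
 also have "\<dots> = (nl f * nl g)\<^sup>2" by (simp add: nl_sq power_mult_distrib)
 finally show ?thesis by (simp add: abs_le_square_iff[symmetric] abs_mult)
qed

lemma nl_triangle:
 assumes "bb f" "bb g"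
 shows "nl (\<lambda>x. f x + g x) \<le> nl f + nl g"
proof -
 have "(nl (\<lambda>x. f x + g x))\<^sup>2 = (\<E> x. ((f x)\<^sup>2 + 2 * (f x * g x)) + (g x)\<^sup>2)"
  by (simp add: nl_sq power2_sum algebra_simps)
 also have "\<dots> = (nl f)\<^sup>2 + 2 * (\<E> x. f x * g x) + (nl g)\<^sup>2"
  using assms by (simp add: nl_sq bb_integrable bb_intros)
 also have "\<dots> \<le> (nl f)\<^sup>2 + 2 * (nl f * nl g) + (nl g)\<^sup>2" using nl_CS[OF assms] by simp
 also have "\<dots> = (nl f + nl g)\<^sup>2" by (simp add: power2_sum)
 finally show ?thesis by (rule power2_le_imp_le) simp
qed

lemma nl_cmult: "nl (\<lambda>x. c * f x) = \<bar>c\<bar> * nl f"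
 by (simp add: nl_def power_mult_distrib real_sqrt_mult)

lemma nl_le:
 assumes "bb f" "bb g" "\<And>x. \<bar>f x\<bar> \<le> \<bar>g x\<bar>"
 shows "nl f \<le> nl g"
 unfolding nl_def
 by (intro real_sqrt_le_mono integral_mono bb_integrable bb_intros assms)
   (use assms(3) in \<open>simp add: abs_le_square_iff\<close>)

lemma nl_le_bound: "bb f \<Longrightarrow> 0 \<le> B \<Longrightarrow> (\<And>x. \<bar>f x\<bar> \<le> B) \<Longrightarrow> nl f \<le> B"
 using nl_le[of f "\<lambda>_. B"] by (simp add: bb_const nl_def measure_mm)

lemma int_abs_le_nl: "bb f \<Longrightarrow> (\<E> x. \<bar>f x\<bar>) \<le> nl f"
 using nl_CS[of "\<lambda>x. \<bar>f x\<bar>" "\<lambda>_. 1"] by (simp add: bb_intros nl_def measure_mm)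

lemma nl_Kop: "bb f \<Longrightarrow> nl (Kop f) \<le> nl f"
proof -
 assume f: "bb f"
 have "(\<E> x. (Kop f x)\<^sup>2) \<le> (\<E> x. Kop (\<lambda>y. (f y)\<^sup>2) x)"
  by (intro integral_mono bb_integrable bb_intros bb_Kop f Kop_Jensen)
 also have "\<dots> = (\<E> x. (f x)\<^sup>2)" by (intro Kop_integral bb_intros f)
 finally show ?thesis by (simp add: nl_def)
qed

end

section \<open>The spectral gap\<close>

text \<open>A product of exponentials of linear forms is the exponential of one linear form. Hence
  the power series involve only powers of a single form, on which the action of \<open>Kop\<close>
  is explicit, and mixed products of different forms never appear.\<close>

inductive_set exp_alg :: "('b::real_inner \<Rightarrow> real) set" where
 exp_alg_exp: "(\<lambda>w. c * exp (w \<bullet> z)) \<in> exp_alg"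
| exp_alg_add: "f \<in> exp_alg \<Longrightarrow> g \<in> exp_alg \<Longrightarrow> (\<lambda>w. f w + g w) \<in> exp_alg"

lemma exp_alg_mult1:
 assumes "g \<in> exp_alg"
 shows "(\<lambda>w. (c * exp (w \<bullet> z)) * g w) \<in> exp_alg"
 using assms
proof (induction rule: exp_alg.induct)
 case (exp_alg_exp d y)
 have "(\<lambda>w. (c * exp (w \<bullet> z)) * (d * exp (w \<bullet> y))) = (\<lambda>w. (c * d) * exp (w \<bullet> (z + y)))"
  by (auto simp: inner_add_right exp_add)
 then show ?case by (metis exp_alg.exp_alg_exp)
next
 case (exp_alg_add f g)
 then show ?case by (simp add: distrib_left exp_alg.exp_alg_add)
qed

lemma exp_alg_mult:
 assumes "f \<in> exp_alg" "g \<in> exp_alg"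
 shows "(\<lambda>w. f w * g w) \<in> exp_alg"
 using assms(1)
proof (induction rule: exp_alg.induct)
 case (exp_alg_exp c z)
 show ?case by (rule exp_alg_mult1[OF assms(2)])
next
 case (exp_alg_add f1 f2)
 then show ?case by (simp add: distrib_right exp_alg.exp_alg_add)
qed

lemma exp_alg_dense:
 fixes F :: "'b::euclidean_space \<Rightarrow> real"
 assumes "continuous_on (sphere 0 1) F" "0 < e"
 shows "\<exists>r\<in>exp_alg. \<forall>w\<in>sphere 0 1. \<bar>F w - r w\<bar> < e"
proof -
 interpret R: function_ring_on "exp_alg" "sphere (0::'b) 1"
 proof
  show "compact (sphere (0::'b) 1)" by simp
  show "continuous_on (sphere 0 1) f" if "f \<in> exp_alg" for f :: "'b \<Rightarrow> real"
   using that by (induction rule: exp_alg.induct) (auto intro!: continuous_intros)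
  show "(\<lambda>_::'b. c) \<in> exp_alg" for c :: real
   using exp_alg_exp[of c "0::'b"] by simp
  show "\<exists>f\<in>exp_alg. f x \<noteq> f y" if "x \<noteq> y" for x y :: 'b
  proof (rule bexI[OF _ exp_alg_exp[of 1 "x - y"]])
   have "0 < (norm (x - y))\<^sup>2" using that by simp
   then have "x \<bullet> (x - y) \<noteq> y \<bullet> (x - y)"
    by (auto simp: power2_norm_eq_inner inner_diff_left)
   then show "1 * exp (x \<bullet> (x - y)) \<noteq> 1 * exp (y \<bullet> (x - y))" by simp
  qed
 qed (auto intro: exp_alg_add exp_alg_mult)
 show ?thesis using R.Stone_Weierstrass_basic[OF assms] by simp
qed

context dim_ge_3
begin

section \<open>Eigenvalues and sums of eigenfunctions\<close>

definition lam :: "nat \<Rightarrow> real"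
 where "lam k = N T * (N T - 2) / ((2 * real k + N T) * (2 * real k + N T - 2))"

lemma lam_pos: "0 < lam k"
 unfolding lam_def using N3 by (intro divide_pos_pos mult_pos_pos) auto

lemma lam_less: "i < j \<Longrightarrow> lam j < lam i"
 unfolding lam_def using N3
 by (intro divide_strict_left_mono mult_strict_mono mult_pos_pos) auto

lemma lam_le: "i \<le> j \<Longrightarrow> lam j \<le> lam i"
 using lam_less[of i j] by (cases "i = j") auto

lemma lam_0: "lam 0 = 1"
 using N3 by (simp add: lam_def)

lemma ell_bound: "\<bar>ell z y\<bar> \<le> norm z"
 unfolding stereo_inner[symmetric]
 using Cauchy_Schwarz_ineq2[of "stereo y" z] by (simp add: norm_stereo)

lemma bb_ell: "bb (ell z)"
 by (rule bbI[OF dec_measurable[OF dec_ell] ell_bound])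

text \<open>For j = 0 and j = 1 the shape of the eigenfunction is recorded as well. It is what
  allows orthogonality to constants and linear forms to annihilate these two components in
  \<open>gap\<close>.\<close>

definition eig :: "nat \<Rightarrow> ('a \<Rightarrow> real) \<Rightarrow> bool"
 where "eig j g \<longleftrightarrow> bb g \<and> (\<forall>x. Kop g x = lam j * g x) \<and>
   (j = 0 \<longrightarrow> (\<exists>c. \<forall>x. g x = c)) \<and> (j = 1 \<longrightarrow> (\<exists>z. \<forall>x. g x = ell z x))"

lemma ell_0: "ell 0 x = 0"
 by (simp add: stereo_inner[symmetric])

lemma ell_add: "ell (z + z') x = ell z x + ell z' x"
 by (simp add: stereo_inner[symmetric] inner_add_right)

lemma ell_scale: "ell (c *\<^sub>R z) x = c * ell z x"
 by (simp add: stereo_inner[symmetric])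

lemma eig_add:
 assumes "eig j f" "eig j g" shows "eig j (\<lambda>x. f x + g x)"
proof -
 have "Kop (\<lambda>x. f x + g x) x = lam j * (f x + g x)" for x
  using assms by (subst Kop_add) (auto simp: eig_def distrib_left)
 moreover have "\<exists>z. \<forall>x. f x + g x = ell z x" if "j = 1"
  using assms that unfolding eig_def by (metis ell_add)
 moreover have "\<exists>c. \<forall>x. f x + g x = c" if "j = 0"
  using assms that unfolding eig_def by metis
 ultimately show ?thesis using assms by (simp add: eig_def bb_add)
qed

lemma eig_cmult:
 assumes "eig j f" shows "eig j (\<lambda>x. c * f x)"
proof -
 have "Kop (\<lambda>x. c * f x) x = lam j * (c * f x)" for x
  using assms by (subst Kop_cmult) (auto simp: eig_def)
 moreover have "\<exists>z. \<forall>x. c * f x = ell z x" if "j = 1"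
  using assms that unfolding eig_def by (metis ell_scale)
 moreover have "\<exists>d. \<forall>x. c * f x = d" if "j = 0"
  using assms that unfolding eig_def by metis
 ultimately show ?thesis using assms by (simp add: eig_def bb_cmult)
qed

lemma eig_0: "eig j (\<lambda>x. 0)"
proof -
 have "\<exists>z. \<forall>x::'a. 0 = ell z x" by (rule exI[of _ 0]) (simp add: ell_0)
 then show ?thesis unfolding eig_def by (simp add: bb_const Kop_const)
qed

definition eigsum :: "nat \<Rightarrow> ('a \<Rightarrow> real) \<Rightarrow> bool"
 where "eigsum n P \<longleftrightarrow> (\<exists>g. (\<forall>j\<le>n. eig j (g j)) \<and> (\<forall>x. P x = (\<Sum>j\<le>n. g j x)))"

lemma eigsum_mono:
 assumes "eigsum n P" "n \<le> m" shows "eigsum m P"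
proof -
 obtain g where g: "\<forall>j\<le>n. eig j (g j)" "\<And>x. P x = (\<Sum>j\<le>n. g j x)" using assms by (auto simp: eigsum_def)
 define h where "h j = (if j \<le> n then g j else (\<lambda>x. 0))" for j
 have "(\<Sum>j\<le>m. h j x) = (\<Sum>j\<le>n. g j x)" for x
 proof -
  have "(\<Sum>j\<le>m. h j x) = (\<Sum>j\<le>n. h j x)"
   using assms(2) by (intro sum.mono_neutral_right) (auto simp: h_def)
  then show ?thesis by (simp add: h_def)
 qed
 then show ?thesis unfolding eigsum_def using g by (intro exI[of _ h]) (auto simp: h_def eig_0)
qed

lemma eigsum_add:
 assumes "eigsum n P" "eigsum m Q" shows "eigsum (max n m) (\<lambda>x. P x + Q x)"
proof -
 obtain g where g: "\<forall>j\<le>max n m. eig j (g j)" "\<And>x. P x = (\<Sum>j\<le>max n m. g j x)"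
  using eigsum_mono[OF assms(1), of "max n m"] by (auto simp: eigsum_def)
 obtain h where h: "\<forall>j\<le>max n m. eig j (h j)" "\<And>x. Q x = (\<Sum>j\<le>max n m. h j x)"
  using eigsum_mono[OF assms(2), of "max n m"] by (auto simp: eigsum_def)
 show ?thesis unfolding eigsum_def
  by (rule exI[of _ "\<lambda>j x. g j x + h j x"]) (use g h in \<open>auto simp: eig_add sum.distrib\<close>)
qed

lemma eigsum_cmult:
 assumes "eigsum n P" shows "eigsum n (\<lambda>x. c * P x)"
proof -
 obtain g where g: "\<forall>j\<le>n. eig j (g j)" "\<And>x. P x = (\<Sum>j\<le>n. g j x)"
  using assms by (auto simp: eigsum_def)
 show ?thesis unfolding eigsum_def
  by (rule exI[of _ "\<lambda>j x. c * g j x"]) (use g in \<open>auto simp: eig_cmult sum_distrib_left\<close>)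
qed

lemma eigsum_bb: "eigsum n P \<Longrightarrow> bb P"
proof -
 assume "eigsum n P"
 then obtain g where g: "\<forall>j\<le>n. eig j (g j)" "\<And>x. P x = (\<Sum>j\<le>n. g j x)" by (auto simp: eigsum_def)
 have "bb (\<lambda>x. \<Sum>j\<le>n. g j x)" using g(1) by (intro bb_sum) (auto simp: eig_def)
 moreover have "P = (\<lambda>x. \<Sum>j\<le>n. g j x)" using g(2) by auto
 ultimately show ?thesis by simp
qed

lemma Kop_ell_rec:
 "Kop (\<lambda>y. ell z y ^ k) x = lam k * ell z x ^ k +
  4 * real k * real (k - 1) * (norm z)\<^sup>2 / ((2 * real k + N T) * (2 * real k + N T - 2)) * Kop (\<lambda>y. ell z y ^ (k - 2)) x"
proof -
 let ?m = "(2 * real k + N T) * (2 * real k + N T - 2)"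
 let ?c = "4 * real k * real (k - 1) * (norm z)\<^sup>2"
 have m: "0 < ?m" using N3 by (intro mult_pos_pos) auto
 have "Kop (\<lambda>y. ?m * ell z y ^ k - ?c * ell z y ^ (k - 2)) x = N T * (N T - 2) * ell z x ^ k"
  using Kop_ell_power[of k z x] by (simp only: mult.assoc)
 moreover have "Kop (\<lambda>y. ?m * ell z y ^ k - ?c * ell z y ^ (k - 2)) x = ?m * Kop (\<lambda>y. ell z y ^ k) x - ?c * Kop (\<lambda>y. ell z y ^ (k - 2)) x"
  by (subst Kop_diff, (intro bb_intros bb_ell)+, subst (1 2) Kop_cmult, (intro bb_intros bb_ell)+, rule refl)
 ultimately have "?m * Kop (\<lambda>y. ell z y ^ k) x = N T * (N T - 2) * ell z x ^ k + ?c * Kop (\<lambda>y. ell z y ^ (k - 2)) x"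
  by linarith
 then have "Kop (\<lambda>y. ell z y ^ k) x = (N T * (N T - 2) * ell z x ^ k + ?c * Kop (\<lambda>y. ell z y ^ (k - 2)) x) / ?m"
  using m by (metis less_numeral_extra(3) nonzero_mult_div_cancel_left)
 then show ?thesis by (simp add: lam_def add_divide_distrib)
qed

lemma Kop_ell: "Kop (ell z) x = lam 1 * ell z x"
 using Kop_ell_rec[of z 1 x] by simp

lemma eig_1_ell: "eig 1 (ell z)"
proof -
 have "\<exists>w. \<forall>x. ell z x = ell w x" by blast
 then show ?thesis unfolding eig_def using bb_ell Kop_ell by simp
qed

text \<open>By \<open>Kop_ell_rec\<close> the operator acts on ell^k, ell^(k - 2), ... through a
  triangular matrix whose diagonal entries \<open>lam\<close> are distinct, so it can be
  diagonalised; the induction carries this out.\<close>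

lemma eigsum_ell_power: "eigsum k (\<lambda>y. ell z y ^ k)"
proof (induction k rule: less_induct)
 case (less k)
 consider "k = 0" | "k = 1" | m where "k = Suc (Suc m)" by (metis One_nat_def not0_implies_Suc)
 then show ?case
 proof cases
  case 1
  have "eig 0 (\<lambda>x. 1)" by (simp add: eig_def bb_const Kop_const lam_0)
  then show ?thesis using 1 by (auto simp: eigsum_def intro!: exI[of _ "\<lambda>j x. 1"])
 next
  case 2
  define g where "g j = (if j = 0 then (\<lambda>x::'a. 0) else ell z)" for j :: nat
  have "eig j (g j)" if "j \<le> 1" for j
  proof (cases "j = 0")
   case True then show ?thesis by (simp add: g_def eig_0)
  next
   case False
   with that have "j = 1" by simp
   then show ?thesis using eig_1_ell by (simp add: g_def)
  qed
  then show ?thesis using 2 by (auto simp: eigsum_def g_def intro!: exI[of _ g])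
 next
  case 3
  obtain h where h: "\<forall>j\<le>m. eig j (h j)" "\<And>x. ell z x ^ m = (\<Sum>j\<le>m. h j x)"
   using less.IH[of m] 3 by (auto simp: eigsum_def)
  define c where "c = 4 * real k * real (k - 1) * (norm z)\<^sup>2 / ((2 * real k + N T) * (2 * real k + N T - 2))"
  \<comment> \<open>Chosen so that \<open>gk\<close> below is an eigenvector: this amounts to d j
    (lam j - lam k) = c lam j.\<close>
  define d where "d j = c * lam j / (lam j - lam k)" for j
  have bbh: "bb (h j)" if "j \<le> m" for j using h that by (simp add: eig_def)
  have hp: "Kop (\<lambda>y. ell z y ^ m) x = (\<Sum>j\<le>m. lam j * h j x)" for x
  proof -
   have "Kop (\<lambda>y. ell z y ^ m) x = Kop (\<lambda>y. \<Sum>j\<le>m. h j y) x" by (simp add: h(2))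
   also have "\<dots> = (\<Sum>j\<le>m. Kop (h j) x)" by (rule Kop_sum) (simp add: bbh)
   also have "\<dots> = (\<Sum>j\<le>m. lam j * h j x)" using h(1) by (intro sum.cong) (auto simp: eig_def)
   finally show ?thesis .
  qed
  define gk where "gk x = ell z x ^ k - (\<Sum>j\<le>m. d j * h j x)" for x
  have bbS: "bb (\<lambda>x. \<Sum>j\<le>m. d j * h j x)" by (intro bb_intros) (simp add: bbh)
  have bbgk: "bb gk" unfolding gk_def[abs_def] by (intro bb_diff bb_power bb_ell bbS)
  have "Kop gk x = lam k * gk x" for x
  proof -
   have "Kop gk x = Kop (\<lambda>y. ell z y ^ k) x - Kop (\<lambda>x. \<Sum>j\<le>m. d j * h j x) x"
    unfolding gk_def[abs_def] by (intro Kop_diff bb_power bb_ell bbS)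
   also have "Kop (\<lambda>x. \<Sum>j\<le>m. d j * h j x) x = (\<Sum>j\<le>m. d j * (lam j * h j x))"
   proof -
    have "Kop (\<lambda>x. \<Sum>j\<le>m. d j * h j x) x = (\<Sum>j\<le>m. Kop (\<lambda>x. d j * h j x) x)"
     by (rule Kop_sum) (intro bb_intros, simp add: bbh)
    also have "\<dots> = (\<Sum>j\<le>m. d j * (lam j * h j x))"
     using h(1) by (intro sum.cong refl) (auto simp: Kop_cmult bbh eig_def)
    finally show ?thesis .
   qed
   also have "Kop (\<lambda>y. ell z y ^ k) x = lam k * ell z x ^ k + c * (\<Sum>j\<le>m. lam j * h j x)"
    unfolding Kop_ell_rec[of z k] using 3 by (simp add: c_def hp)
   also have "lam k * ell z x ^ k + c * (\<Sum>j\<le>m. lam j * h j x) - (\<Sum>j\<le>m. d j * (lam j * h j x))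
    = lam k * ell z x ^ k + (\<Sum>j\<le>m. (c * lam j - d j * lam j) * h j x)"
    by (simp add: sum_distrib_left sum_subtractf algebra_simps)
   also have "(\<Sum>j\<le>m. (c * lam j - d j * lam j) * h j x) = (\<Sum>j\<le>m. (- lam k * d j) * h j x)"
   proof (intro sum.cong refl)
    fix j assume "j \<in> {..m}"
    then have "lam k < lam j" using 3 by (intro lam_less) auto
    then have "d j * (lam j - lam k) = c * lam j" by (simp add: d_def)
    then have "c * lam j - d j * lam j = - lam k * d j" by (simp add: algebra_simps)
    then show "(c * lam j - d j * lam j) * h j x = (- lam k * d j) * h j x" by simp
   qed
   also have "lam k * ell z x ^ k + (\<Sum>j\<le>m. (- lam k * d j) * h j x) = lam k * gk x"
    by (simp add: gk_def right_diff_distrib sum_distrib_left sum_negf mult.assoc)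
   finally show ?thesis .
  qed
  then have eg: "eig k gk" using 3 bbgk by (simp add: eig_def)
  \<comment> \<open>Here k = m + 2, and the slot m + 1 stays empty: powers of one parity contain
    only harmonics of that parity.\<close>
  define g where "g j = (if j = k then gk else if j \<le> m then (\<lambda>x. d j * h j x) else (\<lambda>x. 0))" for j
  have "\<forall>j\<le>k. eig j (g j)" using eg h(1) by (auto simp: g_def eig_cmult eig_0)
  moreover have "ell z x ^ k = (\<Sum>j\<le>k. g j x)" for x
  proof -
   have "(\<Sum>j\<le>k. g j x) = (\<Sum>j\<le>m. g j x) + g (Suc m) x + g k x" unfolding 3 by simp
   moreover have "(\<Sum>j\<le>m. g j x) = (\<Sum>j\<le>m. d j * h j x)" using 3 by (intro sum.cong) (auto simp: g_def)
   moreover have "g (Suc m) x = 0" "g k x = gk x" using 3 by (auto simp: g_def)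
   ultimately show ?thesis by (simp add: gk_def)
  qed
  ultimately show ?thesis unfolding eigsum_def by blast
 qed
qed

definition approx :: "('a \<Rightarrow> real) \<Rightarrow> bool"
 where "approx f \<longleftrightarrow> (\<forall>e>0. \<exists>n P. eigsum n P \<and> (\<forall>x. \<bar>f x - P x\<bar> \<le> e))"

text \<open>The exponential series of a linear form converges uniformly because |ell| \<le> |z| on
  the sphere, and its partial sums are sums of eigenfunctions.\<close>

lemma approx_exp_alg:
 assumes "r \<in> exp_alg"
 shows "approx (\<lambda>y. r (stereo y))"
 using assms
proof (induction rule: exp_alg.induct)
 case (exp_alg_exp c z)
 show ?case unfolding approx_def
 proof (intro allI impI)
  fix e :: real assume e: "0 < e"
  let ?f = "\<lambda>k y. ell z y ^ k /\<^sub>R fact k"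
  have "uniform_limit UNIV (\<lambda>n y. \<Sum>k<n. ?f k y) (\<lambda>y. \<Sum>k. ?f k y) sequentially"
  proof (rule Weierstrass_m_test)
   show "norm (?f k y) \<le> norm z ^ k /\<^sub>R fact k" for k y
    using power_mono[OF ell_bound[of z y] abs_ge_zero, of k] by (simp add: power_abs abs_mult mult_left_mono divide_right_mono)
   show "summable (\<lambda>k. norm z ^ k /\<^sub>R fact k)" by (rule summable_exp_generic)
  qed
  \<comment> \<open>Dividing by |c| + 1 covers c = 0 too.\<close>
  then have "\<forall>\<^sub>F n in sequentially. \<forall>y\<in>UNIV. dist (\<Sum>k<n. ?f k y) (\<Sum>k. ?f k y) < e / (\<bar>c\<bar> + 1)"
   using e by (intro uniform_limitD) auto
  then obtain n where n: "\<And>y. dist (\<Sum>k<n. ?f k y) (\<Sum>k. ?f k y) < e / (\<bar>c\<bar> + 1)"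
   unfolding eventually_sequentially by auto
  have P: "eigsum n (\<lambda>y. \<Sum>k<n. ?f k y)"
  proof -
   have "eigsum m (\<lambda>y. \<Sum>k<m. ?f k y)" for m
   proof (induction m)
    case 0
    show ?case unfolding eigsum_def by (intro exI[of _ "\<lambda>j x. 0"]) (auto simp: eig_0)
   next
    case (Suc m)
    have "eigsum m (\<lambda>y. ?f m y)"
     using eigsum_cmult[OF eigsum_ell_power[of m z], of "inverse (fact m)"] by simp
    from eigsum_mono[OF eigsum_add[OF Suc this], of "Suc m"] show ?case by simp
   qed
   then show ?thesis .
  qed
  show "\<exists>n P. eigsum n P \<and> (\<forall>x. \<bar>c * exp (stereo x \<bullet> z) - P x\<bar> \<le> e)"
  proof (intro exI conjI allI)
   show "eigsum n (\<lambda>y. c * (\<Sum>k<n. ?f k y))" by (rule eigsum_cmult[OF P])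
   fix x
   have "\<bar>c * exp (stereo x \<bullet> z) - c * (\<Sum>k<n. ?f k x)\<bar> = \<bar>c\<bar> * \<bar>exp (ell z x) - (\<Sum>k<n. ?f k x)\<bar>"
    by (simp add: stereo_inner right_diff_distrib[symmetric] abs_mult)
   also have "\<dots> \<le> \<bar>c\<bar> * (e / (\<bar>c\<bar> + 1))"
    using n[of x] by (intro mult_left_mono) (auto simp: exp_def dist_real_def)
   also have "\<dots> \<le> e" using e by (simp add: field_simps)
   finally show "\<bar>c * exp (stereo x \<bullet> z) - c * (\<Sum>k<n. ?f k x)\<bar> \<le> e" .
  qed
 qed
next
 case (exp_alg_add f g)
 show ?case unfolding approx_def
 proof (intro allI impI)
  fix e :: real assume e: "0 < e"
  obtain n P where P: "eigsum n P" "\<And>x. \<bar>f (stereo x) - P x\<bar> \<le> e/2"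
   using exp_alg_add.IH(1) e unfolding approx_def by (metis half_gt_zero)
  obtain m Q where Q: "eigsum m Q" "\<And>x. \<bar>g (stereo x) - Q x\<bar> \<le> e/2"
   using exp_alg_add.IH(2) e unfolding approx_def by (metis half_gt_zero)
  show "\<exists>n P. eigsum n P \<and> (\<forall>x. \<bar>f (stereo x) + g (stereo x) - P x\<bar> \<le> e)"
  proof (intro exI conjI allI)
   show "eigsum (max n m) (\<lambda>x. P x + Q x)" by (rule eigsum_add[OF P(1) Q(1)])
   show "\<bar>f (stereo x) + g (stereo x) - (P x + Q x)\<bar> \<le> e" for x using P(2)[of x] Q(2)[of x] by linarith
  qed
 qed
qed

text \<open>A bounded continuous function of y may fail to extend continuously to the pole that
  represents infinity. Stone-Weierstrass is therefore applied after a cut-off near this pole; the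
  part removed is small in mean square, though not uniformly.\<close>

lemma dens:
 assumes f: "continuous_on UNIV f" "bb f" and e: "0 < e"
 obtains n P where "eigsum n P" "nl (\<lambda>x. f x - P x) \<le> e"
proof -
 obtain B where B: "0 < B" "\<And>x. \<bar>f x\<bar> \<le> B" using bbE[OF f(2)] by blast
 have [measurable]: "f \<in> BM" using f(2) by (simp add: bb_def)
 \<comment> \<open>The number 1 + s is the height above the pole at infinity. The cut-off vanishes
   up to the height 1 / (k + 1) and equals 1 from 2 / (k + 1) on.\<close>
 define ct where "ct k s = min 1 (max 0 (real (Suc k) * (1 + s) - 1))" for k and s :: real
 have ct: "0 \<le> ct k s" "ct k s \<le> 1" for k s by (auto simp: ct_def)
 define s where "s y = 2 / jb y - 1" for y :: 'a
 have s1: "-1 < s y" for y by (simp add: s_def)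
 have [measurable]: "s \<in> BM" unfolding s_def[abs_def] by measurable
 have lim: "(\<lambda>k. (\<E> y. ((1 - ct k (s y)) * f y)\<^sup>2)) \<leadsto> (\<integral>y. 0 \<partial>(mm :: 'a measure))"
 proof (rule integral_dct[where w="\<lambda>y. B\<^sup>2"])
  show "AE y in mm. (\<lambda>k. ((1 - ct k (s y)) * f y)\<^sup>2) \<leadsto> 0"
  proof (intro AE_I2)
   fix y
   have "1 + s y > 0" using s1[of y] by simp
   then obtain K where K: "2 / (1 + s y) < real K" using reals_Archimedean2 by blast
   have "ct k (s y) = 1" if "K \<le> k" for k
   proof -
    have "2 / (1 + s y) \<le> real (Suc k)" using K that by linarith
    then have "2 \<le> real (Suc k) * (1 + s y)" using \<open>1 + s y > 0\<close> by (simp add: field_simps)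
    then show ?thesis by (simp add: ct_def)
   qed
   then have "\<forall>\<^sub>F k in sequentially. ((1 - ct k (s y)) * f y)\<^sup>2 = 0"
    unfolding eventually_sequentially by (intro exI[of _ K]) auto
   then show "(\<lambda>k. ((1 - ct k (s y)) * f y)\<^sup>2) \<leadsto> 0" by (rule tendsto_eventually)
  qed
  show "AE y in mm. norm (((1 - ct k (s y)) * f y)\<^sup>2) \<le> B\<^sup>2" for k
  proof (intro AE_I2)
   fix y
   have "\<bar>(1 - ct k (s y)) * f y\<bar> \<le> 1 * B" unfolding abs_mult
    using ct[of k "s y"] B by (intro mult_mono) auto
   then have "\<bar>(1 - ct k (s y)) * f y\<bar>\<^sup>2 \<le> B\<^sup>2" by (intro power_mono) auto
   then show "norm (((1 - ct k (s y)) * f y)\<^sup>2) \<le> B\<^sup>2" by simp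
  qed
  show "(\<lambda>y. ((1 - ct k (s y)) * f y)\<^sup>2) \<in> borel_measurable mm" for k
   unfolding ct_def by measurable
 qed auto
 have "\<forall>\<^sub>F k in sequentially. (\<E> y. ((1 - ct k (s y)) * f y)\<^sup>2) < (e/2)\<^sup>2"
  using lim e by (simp add: order_tendsto_iff)
 then obtain k where k: "(\<E> y. ((1 - ct k (s y)) * f y)\<^sup>2) < (e/2)\<^sup>2"
  unfolding eventually_sequentially by auto
 have nk: "nl (\<lambda>y. (1 - ct k (s y)) * f y) \<le> e/2"
  unfolding nl_def using k e by (intro real_le_lsqrt) auto
 \<comment> \<open>The projection back to the plane is \<open>fst w\<close> divided by 1 +
   \<open>snd w\<close>. The maximum keeps the denominator positive and changes it only where the
   cut-off vanishes.\<close>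
 define F where "F w = ct k (snd w) * f ((1 / max (1 + snd w) (1 / real (Suc k))) *\<^sub>R fst w)" for w :: "'a \<times> real"
 have "continuous_on UNIV F"
 proof -
  have "max (1 + snd w) (1 / real (Suc k)) \<noteq> 0" for w :: "'a \<times> real"
   by (smt (verit) of_nat_0_less_iff zero_less_Suc zero_less_divide_1_iff)
  then have "continuous_on UNIV (\<lambda>w::'a \<times> real. (1 / max (1 + snd w) (1 / real (Suc k))) *\<^sub>R fst w)"
   by (intro continuous_intros) auto
  then have "continuous_on UNIV (\<lambda>w::'a \<times> real. f ((1 / max (1 + snd w) (1 / real (Suc k))) *\<^sub>R fst w))"
   by (rule continuous_on_compose2[OF f(1)]) auto
  then show ?thesis unfolding F_def[abs_def] ct_def by (intro continuous_intros)
 qed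
 then have "continuous_on (sphere 0 1) F" by (rule continuous_on_subset) auto
 from exp_alg_dense[OF this, of "e/4"] obtain r where r: "r \<in> exp_alg" "\<And>w. w \<in> sphere 0 1 \<Longrightarrow> \<bar>F w - r w\<bar> < e/4"
  using e by auto
 obtain n P where P: "eigsum n P" "\<And>x. \<bar>r (stereo x) - P x\<bar> \<le> e/4"
  using approx_exp_alg[OF r(1)] e unfolding approx_def by (metis zero_less_divide_iff zero_less_numeral)
 have Fs: "F (stereo y) = ct k (s y) * f y" for y
 proof (cases "1 / real (Suc k) \<le> 1 + s y")
  case True
  then have "max (1 + s y) (1 / real (Suc k)) = 2 / jb y" by (simp add: s_def max_def)
  then have "F (stereo y) = ct k (s y) * f ((1 / (2 / jb y)) *\<^sub>R ((2 / jb y) *\<^sub>R y))"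
   by (simp add: F_def stereo_def s_def)
  then show ?thesis by simp
 next
  case False
  then have "real (Suc k) * (1 + s y) < 1" by (simp add: field_simps)
  then have "ct k (s y) = 0" by (simp add: ct_def)
  then show ?thesis by (simp add: F_def stereo_def s_def)
 qed
 have bbP: "bb P" by (rule eigsum_bb[OF P(1)])
 have bbc: "bb (\<lambda>y. ct k (s y))"
  by (rule bbI[where B=1]) (use ct in \<open>auto simp: ct_def\<close>)
 have d: "\<bar>ct k (s y) * f y - P y\<bar> \<le> e/2" for y
 proof -
  have "\<bar>F (stereo y) - r (stereo y)\<bar> < e/4" by (rule r(2)) (simp add: norm_stereo)
  then show ?thesis using P(2)[of y] unfolding Fs by linarith
 qed
 have "nl (\<lambda>y. f y - P y) = nl (\<lambda>y. (1 - ct k (s y)) * f y + (ct k (s y) * f y - P y))"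
  by (simp add: left_diff_distrib)
 also have "\<dots> \<le> nl (\<lambda>y. (1 - ct k (s y)) * f y) + nl (\<lambda>y. ct k (s y) * f y - P y)"
  by (intro nl_triangle bb_intros bbc bbP f(2))
 also have "\<dots> \<le> e/2 + e/2"
  using e by (intro add_mono nk nl_le_bound bb_intros bbc bbP f(2) d) auto
 finally show ?thesis using that[OF P(1)] by simp
qed

lemma eig_orth:
 assumes "eig i g" "eig j h" "i \<noteq> j"
 shows "(\<E> x. g x * h x) = 0"
proof -
 have bbg: "bb g" and bbh: "bb h" using assms by (auto simp: eig_def)
 have "(\<E> x. Kop g x * h x) = (\<E> x. g x * Kop h x)" by (rule Kop_symmetric[OF bbg bbh])
 then have "(\<E> x. lam i * (g x * h x)) = (\<E> x. lam j * (g x * h x))"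
  using assms by (simp add: eig_def mult_ac)
 then have "lam i * (\<E> x. g x * h x) = lam j * (\<E> x. g x * h x)" by simp
 moreover have "lam i \<noteq> lam j" using assms(3) lam_less[of i j] lam_less[of j i] by (metis less_irrefl nat_neq_iff)
 ultimately show ?thesis by simp
qed

lemma sum_orth_sq:
 assumes "finite I" and g: "\<And>j. j \<in> I \<Longrightarrow> eig j (g j)"
 shows "(\<E> x. (\<Sum>j\<in>I. c j * g j x)\<^sup>2) = (\<Sum>j\<in>I. (c j)\<^sup>2 * (\<E> x. (g j x)\<^sup>2))"
 using assms
proof (induction I rule: finite_induct)
 case (insert i I)
 have bbg: "bb (g j)" if "j \<in> insert i I" for j using insert.prems that by (simp add: eig_def)
 have b: "bb (\<lambda>x. \<Sum>j\<in>I. c j * g j x)" by (intro bb_intros) (simp add: bbg)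
 have o: "(\<E> x. g i x * (\<Sum>j\<in>I. c j * g j x)) = 0"
 proof -
  have "(\<E> x. g i x * (\<Sum>j\<in>I. c j * g j x)) = (\<E> x. (\<Sum>j\<in>I. c j * (g i x * g j x)))"
   by (simp add: sum_distrib_left mult_ac)
  also have "\<dots> = (\<Sum>j\<in>I. c j * (\<E> x. g i x * g j x))"
   by (subst Bochner_Integration.integral_sum) (auto intro!: bb_integrable bb_intros bbg)
  also have "\<dots> = 0" using insert.hyps insert.prems by (intro sum.neutral) (auto intro!: eig_orth)
  finally show ?thesis .
 qed
 have "(\<E> x. (\<Sum>j\<in>insert i I. c j * g j x)\<^sup>2) = (\<E> x. (c i)\<^sup>2 * (g i x)\<^sup>2 + (2 * c i) * (g i x * (\<Sum>j\<in>I. c j * g j x)) + (\<Sum>j\<in>I. c j * g j x)\<^sup>2)"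
  using insert.hyps by (simp add: power2_sum power_mult_distrib algebra_simps)
 also have "\<dots> = (c i)\<^sup>2 * (\<E> x. (g i x)\<^sup>2) + (2 * c i) * (\<E> x. g i x * (\<Sum>j\<in>I. c j * g j x)) + (\<E> x. (\<Sum>j\<in>I. c j * g j x)\<^sup>2)"
  by (simp add: bb_integrable bb_intros b bbg)
 finally show ?case using insert o by simp
qed simp

text \<open>An approximating sum of eigenfunctions splits into R of degree at most 1 and Q of degree
  at least 2. As R is orthogonal to f and to Q, dropping it can only improve the approximation, and
  on Q the operator contracts by \<open>lam 2\<close>.\<close>

proposition gap:
 assumes f: "continuous_on UNIV f" "bb f"
  and o: "(\<E> x. f x) = 0" "\<And>z. (\<E> x. f x * ell z x) = 0"
 shows "nl (Kop f) \<le> lam 2 * nl f"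
proof -
 have "nl (Kop f) \<le> lam 2 * nl f + e" if e: "0 < e" for e
 proof -
  \<comment> \<open>The errors are \<open>lam 2\<close> e' from replacing f by Q and e' from
    applying \<open>Kop\<close> to the difference; together they make e.\<close>
  define e' where "e' = e / (lam 2 + 1)"
  have l2: "0 < lam 2" by (rule lam_pos)
  have e': "0 < e'" using e l2 by (simp add: e'_def)
  obtain n P where P: "eigsum n P" "nl (\<lambda>x. f x - P x) \<le> e'" using dens[OF f e'] by blast
  obtain g where g: "\<And>j. j \<le> n + 2 \<Longrightarrow> eig j (g j)" "\<And>x. P x = (\<Sum>j\<le>n + 2. g j x)"
   using eigsum_mono[OF P(1), of "n + 2"] by (auto simp: eigsum_def)
  define I where "I = {2..n+2}"
  have Isub: "finite I" "\<And>j. j \<in> I \<Longrightarrow> j \<le> Suc (Suc n)" by (auto simp: I_def)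
  define Q where "Q x = (\<Sum>j\<in>I. g j x)" for x
  define R where "R x = g 0 x + g 1 x" for x
  have PQ: "P x = R x + Q x" for x
  proof -
   have "{..n + 2} = {0, 1} \<union> I" by (auto simp: I_def)
   then have "(\<Sum>j\<le>n + 2. g j x) = (\<Sum>j\<in>{0,1}. g j x) + (\<Sum>j\<in>I. g j x)"
    by (simp only:) (rule sum.union_disjoint, auto simp: I_def)
   then show ?thesis by (simp add: g(2) Q_def R_def)
  qed
  have bbg: "bb (g j)" if "j \<le> n + 2" for j using g(1)[OF that] by (simp add: eig_def)
  have bbQ: "bb Q" unfolding Q_def[abs_def] by (intro bb_sum bbg) (auto simp: I_def)
  have bbR: "bb R" unfolding R_def[abs_def] by (intro bb_add bbg) auto
  have fR: "(\<E> x. f x * R x) = 0"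
  proof -
   obtain c where c: "\<And>x. g 0 x = c" using g(1)[of 0] by (auto simp: eig_def)
   obtain z where z: "\<And>x. g 1 x = ell z x" using g(1)[of 1] by (auto simp: eig_def)
   have "(\<E> x. f x * R x) = (\<E> x. c * f x + f x * ell z x)"
    by (simp add: R_def c z[simplified] algebra_simps)
   also have "\<dots> = c * (\<E> x. f x) + (\<E> x. f x * ell z x)"
    by (simp add: bb_integrable bb_intros f(2) bb_ell)
   finally show ?thesis using o by simp
  qed
  have QR: "(\<E> x. Q x * R x) = 0"
  proof -
   have "(\<E> x. Q x * R x) = (\<E> x. (\<Sum>j\<in>I. g j x * g 0 x + g j x * g 1 x))"
    by (simp add: Q_def R_def sum_distrib_right distrib_left sum.distrib)
   also have "\<dots> = (\<Sum>j\<in>I. (\<E> x. g j x * g 0 x) + (\<E> x. g j x * g 1 x))"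
    by (subst Bochner_Integration.integral_sum) (auto simp: Isub intro!: bb_integrable bb_intros bbg sum.cong Bochner_Integration.integral_add)
   also have "\<dots> = 0"
   proof (rule sum.neutral, rule ballI)
    fix j assume j: "j \<in> I"
    have "(\<E> x. g j x * g 0 x) = 0" using j by (intro eig_orth[of j _ 0] g) (auto simp: I_def)
    moreover have "(\<E> x. g j x * g 1 x) = 0" using j by (intro eig_orth[of j _ 1] g) (auto simp: I_def)
    ultimately show "(\<E> x. g j x * g 0 x) + (\<E> x. g j x * g 1 x) = 0" by simp
   qed
   finally show ?thesis .
  qed
  have a: "nl (\<lambda>x. f x - Q x) \<le> e'"
  proof -
   have "(\<E> x. (f x - P x)\<^sup>2) = (\<E> x. (((f x - Q x)\<^sup>2 + (R x)\<^sup>2) - 2 * (f x * R x)) + 2 * (Q x * R x))"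
    by (intro Bochner_Integration.integral_cong refl) (simp add: PQ power2_eq_square algebra_simps)
   also have "\<dots> = (\<E> x. (f x - Q x)\<^sup>2) + (\<E> x. (R x)\<^sup>2) - 2 * (\<E> x. f x * R x) + 2 * (\<E> x. Q x * R x)"
    by (simp add: bb_integrable bb_intros f(2) bbQ bbR)
   also have "\<dots> = (\<E> x. (f x - Q x)\<^sup>2) + (\<E> x. (R x)\<^sup>2)" using fR QR by simp
   finally have "(\<E> x. (f x - Q x)\<^sup>2) \<le> (\<E> x. (f x - P x)\<^sup>2)" by simp
   then have "nl (\<lambda>x. f x - Q x) \<le> nl (\<lambda>x. f x - P x)" by (simp add: nl_def)
   then show ?thesis using P(2) by simp
  qed
  have KQ: "nl (Kop Q) \<le> lam 2 * nl Q"
  proof -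
   have "Kop Q x = (\<Sum>j\<in>I. lam j * g j x)" for x
   proof -
    have "Kop Q x = (\<Sum>j\<in>I. Kop (g j) x)"
     unfolding Q_def[abs_def] by (rule Kop_sum) (simp add: bbg I_def)
    also have "\<dots> = (\<Sum>j\<in>I. lam j * g j x)"
     using g(1) by (intro sum.cong) (auto simp: eig_def I_def)
    finally show ?thesis .
   qed
   then have "(\<E> x. (Kop Q x)\<^sup>2) = (\<Sum>j\<in>I. (lam j)\<^sup>2 * (\<E> x. (g j x)\<^sup>2))"
    using sum_orth_sq[of I g lam] g(1) by (simp add: Isub)
   also have "\<dots> \<le> (\<Sum>j\<in>I. (lam 2)\<^sup>2 * (\<E> x. (g j x)\<^sup>2))"
    using lam_pos by (intro sum_mono mult_right_mono power_mono lam_le) (auto intro: less_imp_le simp: I_def)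
   also have "\<dots> = (lam 2)\<^sup>2 * (\<E> x. (Q x)\<^sup>2)"
    using sum_orth_sq[of I g "\<lambda>_. 1"] g(1) by (simp add: Q_def sum_distrib_left[symmetric] Isub)
   finally have "(nl (Kop Q))\<^sup>2 \<le> (lam 2 * nl Q)\<^sup>2" by (simp add: nl_sq power_mult_distrib)
   then show ?thesis by (rule power2_le_imp_le) (use l2 in simp)
  qed
  have "nl (Kop f) = nl (\<lambda>x. Kop Q x + Kop (\<lambda>y. f y - Q y) x)"
   by (simp add: Kop_diff f(2) bbQ)
  also have "\<dots> \<le> nl (Kop Q) + nl (Kop (\<lambda>y. f y - Q y))"
   by (intro nl_triangle bb_Kop bb_diff f(2) bbQ)
  also have "\<dots> \<le> lam 2 * nl Q + e'"
   using KQ nl_Kop[OF bb_diff[OF f(2) bbQ]] a by linarith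
  also have "nl Q \<le> nl f + e'"
  proof -
   have "nl Q = nl (\<lambda>x. f x + (-1) * (f x - Q x))" by simp
   also have "\<dots> \<le> nl f + nl (\<lambda>x. (-1) * (f x - Q x))" by (intro nl_triangle bb_intros f(2) bbQ)
   also have "nl (\<lambda>x. (-1) * (f x - Q x)) \<le> e'" unfolding nl_cmult using a by simp
   finally show ?thesis by simp
  qed
  also have "lam 2 * (nl f + e') + e' = lam 2 * nl f + (lam 2 + 1) * e'" by (simp add: algebra_simps)
  also have "(lam 2 + 1) * e' = e" using l2 by (simp add: e'_def)
  finally show ?thesis using l2 by simp
 qed
 then show ?thesis by (rule field_le_epsilon)
qed

section \<open>Moments of linear forms\<close>

lemma ell_integral: "(\<E> x. ell z x) = 0"
proof -
 have "eig 0 (\<lambda>x. 1)" by (simp add: eig_def bb_const Kop_const lam_0)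
 moreover have "eig 1 (ell z)" by (rule eig_1_ell)
 ultimately show ?thesis using eig_orth[of 0 "\<lambda>x. 1" 1 "ell z"] by simp
qed

text \<open>\<open>Kop\<close> preserves the mean, so integrating the recursion for k = 2 gives a
  linear equation for the unknown integral.\<close>

lemma ell_sq_integral: "(\<E> x. (ell z x)\<^sup>2) = (norm z)\<^sup>2 / (N T + 1)"
proof -
 let ?I = "\<integral>x. (ell z x)\<^sup>2 \<partial>mm"
 let ?m = "(4 + N T) * (2 + N T)"
 have m: "0 < ?m" using N3 by simp
 have "Kop (\<lambda>y. (ell z y)\<^sup>2) x = lam 2 * (ell z x)\<^sup>2 + 8 * (norm z)\<^sup>2 / ?m" for x
  using Kop_ell_rec[of z 2 x] by (simp add: Kop_const algebra_simps)
 then have "?I = (\<E> x. lam 2 * (ell z x)\<^sup>2 + 8 * (norm z)\<^sup>2 / ?m)"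
  using Kop_integral[of "\<lambda>y. (ell z y)\<^sup>2"] by (simp add: bb_intros bb_ell)
 also have "\<dots> = lam 2 * ?I + 8 * (norm z)\<^sup>2 / ?m"
  by (simp add: bb_integrable bb_intros bb_ell measure_mm)
 finally have "?m * ?I = ?m * (lam 2 * ?I + 8 * (norm z)\<^sup>2 / ?m)" by simp
 also have "\<dots> = (?m * lam 2) * ?I + 8 * (norm z)\<^sup>2" using m by (simp add: distrib_left)
 also have "?m * lam 2 = N T * (N T - 2)"
 proof -
  have "lam 2 = N T * (N T - 2) / ?m" by (simp add: lam_def)
  then show ?thesis using m by simp
 qed
 finally have "8 * (N T + 1) * ?I = 8 * (norm z)\<^sup>2" by (simp add: algebra_simps)
 then show ?thesis using N3 by (simp add: field_simps)
qed

lemma ell_ell_integral: "(\<E> x. ell z x * ell w x) = (z \<bullet> w) / (N T + 1)"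
proof -
 let ?I = "\<integral>x. ell z x * ell w x \<partial>mm"
 have "(norm (z + w))\<^sup>2 / (N T + 1) = (\<E> x. ((ell z x)\<^sup>2 + 2 * (ell z x * ell w x)) + (ell w x)\<^sup>2)"
  unfolding ell_sq_integral[symmetric] by (simp add: ell_add power2_sum algebra_simps)
 also have "\<dots> = (norm z)\<^sup>2 / (N T + 1) + 2 * ?I + (norm w)\<^sup>2 / (N T + 1)"
  by (simp add: bb_integrable bb_intros bb_ell ell_sq_integral)
 finally have "2 * ?I = ((norm (z + w))\<^sup>2 - (norm z)\<^sup>2 - (norm w)\<^sup>2) / (N T + 1)"
  by (simp add: diff_divide_distrib)
 also have "(norm (z + w))\<^sup>2 - (norm z)\<^sup>2 - (norm w)\<^sup>2 = 2 * (z \<bullet> w)"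
  by (simp add: power2_norm_eq_inner inner_add_left inner_add_right inner_commute)
 finally show ?thesis by simp
qed

section \<open>The equation modulo first harmonics\<close>

lemma continuous_stereo: "continuous_on UNIV (stereo :: 'a \<Rightarrow> 'a \<times> real)"
 unfolding stereo_def by (intro continuous_intros) auto

lemma stereo_measurable [measurable]: "(stereo :: 'a \<Rightarrow> 'a \<times> real) \<in> BM"
 by (rule borel_measurable_continuous_onI[OF continuous_stereo])

text \<open>The vector of all first-harmonic coefficients at once: \<open>mv f \<bullet> z\<close>
  is the integral of f against \<open>ell z\<close>. For an indicator it is the unnormalised
  barycentre of the set on the sphere.\<close>

definition mv :: "('a \<Rightarrow> real) \<Rightarrow> 'a \<times> real"
 where "mv f = (\<E> y. f y *\<^sub>R stereo y)"

lemma mv_integrable: "bb f \<Longrightarrow> integrable mm (\<lambda>y::'a. f y *\<^sub>R stereo y)"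
proof -
 assume f: "bb f"
 obtain B where B: "\<And>x. \<bar>f x\<bar> \<le> B" using bbE[OF f] by blast
 have [measurable]: "f \<in> BM" using f by (simp add: bb_def)
 show ?thesis
  by (rule mm.integrable_const_bound[where B=B]) (use B in \<open>auto simp: norm_stereo\<close>)
qed

lemma mv_inner: "bb f \<Longrightarrow> mv f \<bullet> z = (\<E> y. f y * ell z y)"
 unfolding mv_def by (subst integral_inner_left[symmetric]) (auto simp: mv_integrable stereo_inner)

lemma mv_add: "bb f \<Longrightarrow> bb g \<Longrightarrow> mv (\<lambda>x. f x + g x) = mv f + mv g"
 unfolding mv_def by (simp add: scaleR_left_distrib mv_integrable)

lemma mv_diff: "bb f \<Longrightarrow> bb g \<Longrightarrow> mv (\<lambda>x. f x - g x) = mv f - mv g"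
 unfolding mv_def by (simp add: scaleR_left_diff_distrib mv_integrable)

lemma mv_cmult: "mv (\<lambda>x. c * f x) = c *\<^sub>R mv f"
 unfolding mv_def by (simp only: scaleR_scaleR[symmetric] integral_scaleR_right)

lemma mv_eqI: "bb f \<Longrightarrow> (\<And>z. (\<E> y. f y * ell z y) = v \<bullet> z) \<Longrightarrow> mv f = v"
 using mv_inner[of f] by (metis inner_commute vector_eq_rdot)

lemma mv_const: "mv (\<lambda>y. c) = 0"
 by (rule mv_eqI) (auto simp: bb_const ell_integral)

lemma mv_ell: "mv (ell w) = (1 / (N T + 1)) *\<^sub>R w"
 by (rule mv_eqI) (auto simp: bb_ell ell_ell_integral)

lemma mv_Kop: "bb f \<Longrightarrow> mv (Kop f) = lam 1 *\<^sub>R mv f"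
proof (rule mv_eqI)
 assume f: "bb f"
 show "bb (Kop f)" by (rule bb_Kop[OF f])
 fix z
 have "(\<E> y. Kop f y * ell z y) = (\<E> y. f y * Kop (ell z) y)"
  by (rule Kop_symmetric[OF f bb_ell])
 also have "\<dots> = lam 1 * (\<E> y. f y * ell z y)"
  by (simp only: Kop_ell mult.left_commute[of _ "lam 1"] integral_mult_right_zero)
 finally show "(\<E> y. Kop f y * ell z y) = (lam 1 *\<^sub>R mv f) \<bullet> z"
  using f by (simp add: mv_inner)
qed

lemma mv_norm: "bb f \<Longrightarrow> norm (mv f) \<le> (\<E> x. \<bar>f x\<bar>)"
proof -
 assume f: "bb f"
 have "norm (mv f) \<le> (\<E> y. norm (f y *\<^sub>R stereo y))"
  unfolding mv_def by (rule integral_norm_bound)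
 then show ?thesis by (simp add: norm_stereo)
qed

lemma mv_norm_nl: "bb f \<Longrightarrow> norm (mv f) \<le> nl f"
 using mv_norm[of f] int_abs_le_nl[of f] by linarith

section \<open>The linearised equation\<close>

definition pp :: real where "pp = (N T + 2) / (N T - 2)"

lemma pp1: "1 < pp"
 using N3 by (simp add: pp_def)

text \<open>This identity is the degeneracy of the linearisation: first harmonics are the
  infinitesimal translations and dilations of the bubble.\<close>

lemma pp_lam1: "pp * lam 1 = 1"
proof -
 have "lam 1 = N T * (N T - 2) / ((N T + 2) * N T)" by (simp add: lam_def add.commute)
 moreover have "b / a * (n * a / (b * n)) = 1" if "a \<noteq> 0" "b \<noteq> 0" "n \<noteq> 0" for a b n :: real
  using that by simp
 ultimately show ?thesis unfolding pp_def using N3 by simp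
qed

definition th :: real where "th = pp * lam 2"

text \<open>The contraction factor is n / (n + 4).\<close>

lemma th: "0 < th" "th < 1"
proof -
 have "lam 2 = N T * (N T - 2) / ((N T + 4) * (N T + 2))" by (simp add: lam_def add.commute)
 moreover have "b / a * (n * a / (c * b)) = n / c" if "a \<noteq> 0" "b \<noteq> 0" for a b c n :: real
  using that by simp
 ultimately have "th = N T / (N T + 4)" unfolding th_def pp_def using N3 by simp
 then show "0 < th" "th < 1" using N3 by auto
qed

lemma bb_bcontfun: "bb (bc (f :: 'a \<Rightarrow>\<^sub>C real))"
proof (rule bbI[where B="norm f"])
 show "bc f \<in> BM" by (rule borel_measurable_continuous_onI) simp
 show "\<bar>f x\<bar> \<le> norm f" for x using norm_bounded[of f x] by simp
qed

lemma bcontfun_abs: "\<bar>bc (f :: 'a \<Rightarrow>\<^sub>C real) x\<bar> \<le> norm f"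
 using norm_bounded[of f x] by simp

lemma bc_apply:
 assumes "continuous_on UNIV h" "bb h"
 shows "bc (Bcontfun h) = (h :: 'a \<Rightarrow> real)"
proof -
 obtain B where "\<And>x. \<bar>h x\<bar> \<le> B" using bbE[OF assms(2)] by blast
 then have "h \<in> bcontfun" using assms(1) by (intro bcontfun_normI[where b=B]) auto
 then show ?thesis by (rule Bcontfun_inverse)
qed

definition KB :: "('a \<Rightarrow> real) \<Rightarrow> 'a \<Rightarrow>\<^sub>C real"
 where "KB f = Bcontfun (Kop f)"

lemma KB_apply: "bb f \<Longrightarrow> bc (KB f) = Kop f"
 unfolding KB_def by (intro bc_apply Kop_continuous bb_Kop)

lemma norm_KB_le: "bb f \<Longrightarrow> (\<And>x. \<bar>Kop f x\<bar> \<le> B) \<Longrightarrow> norm (KB f) \<le> B"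
 by (rule norm_bound) (simp add: KB_apply)

definition perp :: "('a \<Rightarrow> real) \<Rightarrow> bool"
 where "perp f \<longleftrightarrow> (\<E> x. f x) = 0 \<and> mv f = 0"

lemma perp_Kop: "bb f \<Longrightarrow> perp f \<Longrightarrow> perp (\<lambda>x. c * Kop f x)"
 by (simp add: perp_def mv_cmult mv_Kop Kop_integral)

lemma perp_gap:
 assumes "continuous_on UNIV f" "bb f" "perp f"
 shows "nl (\<lambda>x. pp * Kop f x) \<le> th * nl f"
proof -
 have "(\<E> x. f x * ell z x) = 0" for z
  using assms mv_inner[of f z] by (simp add: perp_def)
 then have "nl (Kop f) \<le> lam 2 * nl f" using assms by (intro gap) (auto simp: perp_def)
 then have "pp * nl (Kop f) \<le> pp * (lam 2 * nl f)" using pp1 by (intro mult_left_mono) auto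
 then show ?thesis using pp1 by (simp add: nl_cmult th_def)
qed

text \<open>The tail parameter 1 / (2 pp) in \<open>Kop_eps\<close> makes the sup norm return with
  the factor 1/2, which can be absorbed.\<close>

lemma sup_l2:
 obtains C where "0 < C" "\<And>f x. pp * \<bar>Kop (bc f) x\<bar> \<le> norm f / 2 + C * nl (bc f)"
proof -
 have e: "0 < 1 / (2 * pp)" using pp1 by simp
 obtain C where C: "0 < C" "\<And>f B x. bb f \<Longrightarrow> (\<And>y. \<bar>f y\<bar> \<le> B) \<Longrightarrow> \<bar>Kop f (x::'a)\<bar> \<le> 1 / (2 * pp) * B + C * (\<E> y. \<bar>f y\<bar>)"
  by (rule Kop_eps[OF e]) (rule that; blast)
 have "pp * \<bar>Kop (bc f) x\<bar> \<le> norm f / 2 + (pp * C) * nl (bc f)" for f :: "'a \<Rightarrow>\<^sub>C real" and x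
 proof -
  have "\<bar>Kop (bc f) x\<bar> \<le> 1 / (2 * pp) * norm f + C * (\<E> y. \<bar>f y\<bar>)"
   by (intro C(2) bb_bcontfun bcontfun_abs)
  also have "\<dots> \<le> 1 / (2 * pp) * norm f + C * nl (bc f)"
   using C(1) by (intro add_left_mono mult_left_mono int_abs_le_nl bb_bcontfun) auto
  finally have "pp * \<bar>Kop (bc f) x\<bar> \<le> pp * (1 / (2 * pp) * norm f + C * nl (bc f))"
   using pp1 by (intro mult_left_mono) auto
  also have "\<dots> = norm f / 2 + (pp * C) * nl (bc f)" using pp1 by (simp add: field_simps)
  finally show ?thesis .
 qed
 moreover have "0 < pp * C" using C(1) pp1 by simp
 ultimately show ?thesis using that by blast
qed

lemma bcontfun_linear_Kop: "bounded_linear (\<lambda>g :: 'a \<Rightarrow>\<^sub>C real. KB (\<lambda>x. pp * bc g x))"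
proof (rule bounded_linear_intro[where K=pp])
 fix f g :: "'a \<Rightarrow>\<^sub>C real" and r :: real
 have b: "bb (\<lambda>x. pp * bc g x)" for g :: "'a \<Rightarrow>\<^sub>C real" by (intro bb_intros bb_bcontfun)
 show "KB (\<lambda>x. pp * bc (f + g) x) = KB (\<lambda>x. pp * bc f x) + KB (\<lambda>x. pp * bc g x)"
 proof (rule bcontfun_eqI)
  fix x
  have "Kop (\<lambda>x. pp * (f x + g x)) x = Kop (\<lambda>x. pp * f x + pp * g x) x" by (simp add: distrib_left)
  also have "\<dots> = Kop (\<lambda>x. pp * f x) x + Kop (\<lambda>x. pp * g x) x" by (rule Kop_add[OF b b])
  finally show "KB (\<lambda>x. pp * bc (f + g) x) x = (KB (\<lambda>x. pp * bc f x) + KB (\<lambda>x. pp * bc g x)) x"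
   using b[of "f + g"] by (simp add: KB_apply b)
 qed
 show "KB (\<lambda>x. pp * bc (r *\<^sub>R f) x) = r *\<^sub>R KB (\<lambda>x. pp * bc f x)"
 proof (rule bcontfun_eqI)
  fix x
  have "Kop (\<lambda>x. pp * (r * f x)) x = Kop (\<lambda>x. r * (pp * f x)) x" by (simp add: mult.left_commute)
  also have "\<dots> = r * Kop (\<lambda>x. pp * f x) x" by (rule Kop_cmult[OF b])
  finally show "KB (\<lambda>x. pp * bc (r *\<^sub>R f) x) x = (r *\<^sub>R KB (\<lambda>x. pp * bc f x)) x"
   using b[of "r *\<^sub>R f"] by (simp add: KB_apply b)
 qed
 show "norm (KB (\<lambda>x. pp * bc f x)) \<le> norm f * pp"
 proof (rule norm_KB_le[OF b], rule Kop_bound[OF b])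
  show "\<bar>pp * f y\<bar> \<le> norm f * pp" for y
   using bcontfun_abs[of f y] pp1 by (simp add: abs_mult mult.commute)
 qed
qed

text \<open>In the sup norm the available bound for \<open>pp * Kop\<close> is pp > 1; in mean
  square the operator contracts on \<open>perp\<close>, but bounded continuous functions are not
  complete in that norm. The mixed norm \<open>nn\<close> has both properties, so the Neumann series
  converges.\<close>

lemma neumann:
 fixes f :: "'a \<Rightarrow>\<^sub>C real"
 assumes f: "perp (bc f)"
 shows "\<exists>g :: 'a \<Rightarrow>\<^sub>C real. \<forall>x. bc g x = f x + pp * Kop (bc g) x"
proof -
 obtain C where C: "0 < C" "\<And>f x. pp * \<bar>Kop (bc f) x\<bar> \<le> norm f / 2 + C * nl (bc f)"
  by (rule sup_l2) (rule that)
 \<comment> \<open>M and t are balanced so that C + M th = t M, while 1/2 \<le> t takes care of the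
   sup norm.\<close>
 define M where "M = 2 * C / (1 - th)"
 define t where "t = (1 + th) / 2"
 have M: "0 < M" using C(1) th by (simp add: M_def)
 have t: "1/2 \<le> t" "t < 1" using th by (auto simp: t_def)
 define nn where "nn g = norm g + M * nl (bc g)" for g :: "'a \<Rightarrow>\<^sub>C real"
 define TB where "TB g = KB (\<lambda>x. pp * bc g x)" for g :: "'a \<Rightarrow>\<^sub>C real"
 have TBa: "TB g x = pp * Kop (bc g) x" for g x
  unfolding TB_def by (simp add: KB_apply Kop_cmult bb_intros bb_bcontfun)
 have TBf: "bc (TB g) = (\<lambda>x. pp * Kop (bc g) x)" for g using TBa by auto
 have step: "perp (bc (TB g)) \<and> nn (TB g) \<le> t * nn g" if g: "perp (bc g)" for g
 proof
  show "perp (bc (TB g))" unfolding TBf by (rule perp_Kop[OF bb_bcontfun g])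
  have 1: "norm (TB g) \<le> norm g / 2 + C * nl (bc g)"
   by (rule norm_bound) (use C(2)[of g] pp1 in \<open>simp add: TBa abs_mult\<close>)
  have 2: "nl (bc (TB g)) \<le> th * nl (bc g)"
   unfolding TBf by (rule perp_gap[OF _ bb_bcontfun g]) simp
  have "nn (TB g) \<le> norm g / 2 + C * nl (bc g) + M * (th * nl (bc g))"
   unfolding nn_def using 1 2 M by (intro add_mono mult_left_mono) auto
  also have "\<dots> = norm g / 2 + (C + M * th) * nl (bc g)" by (simp add: algebra_simps)
  also have "C = M * (1 - th) / 2" using th by (simp add: M_def)
  also have "norm g / 2 + (M * (1 - th) / 2 + M * th) * nl (bc g) = norm g / 2 + t * (M * nl (bc g))"
   by (simp add: t_def field_simps)
  also have "\<dots> \<le> t * norm g + t * (M * nl (bc g))"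
   using mult_right_mono[OF t(1), of "norm g"] by simp
  finally show "nn (TB g) \<le> t * nn g" by (simp add: nn_def distrib_left)
 qed
 define a where "a j = (TB ^^ j) f" for j
 have a: "perp (bc (a j)) \<and> nn (a j) \<le> t ^ j * nn f" for j
 proof (induction j)
  case 0
  then show ?case using f by (simp add: a_def)
 next
  case (Suc j)
  then have s: "perp (bc (TB (a j)))" "nn (TB (a j)) \<le> t * nn (a j)" using step by auto
  have "t * nn (a j) \<le> t * (t ^ j * nn f)" using Suc t by (intro mult_left_mono) auto
  then show ?case using s by (simp add: a_def)
 qed
 have na: "norm (a j) \<le> t ^ j * nn f" for j
 proof -
  have "norm (a j) \<le> nn (a j)" using M by (simp add: nn_def)
  then show ?thesis using a[of j] by linarith
 qed
 have sa: "summable a"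
 proof (rule summable_comparison_test')
  show "summable (\<lambda>j. t ^ j * nn f)" using t by (intro summable_mult2 summable_geometric) auto
 qed (use na in auto)
 have "bounded_linear TB" unfolding TB_def[abs_def] by (rule bcontfun_linear_Kop)
 then have "TB (suminf a) = (\<Sum>j. TB (a j))" using sa by (rule bounded_linear.suminf)
 also have "\<dots> = (\<Sum>j. a (Suc j))" by (simp add: a_def)
 also have "\<dots> = suminf a - a 0" using suminf_split_head[OF sa] by simp
 finally have "suminf a = f + TB (suminf a)" by (simp add: a_def)
 then have "bc (suminf a) x = f x + pp * Kop (bc (suminf a)) x" for x
  by (metis TBa plus_bcontfun.rep_eq)
 then show ?thesis by blast
qed

text \<open>Three components are estimated separately. Pairing with first harmonics determines w,
  since the left side has none; the mean is multiplied by 1 - pp, which is not 0; the remainder lies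
  in \<open>perp\<close>, where \<open>perp_gap\<close> applies. The sup norm then follows from
  \<open>sup_l2\<close>.\<close>

lemma apriori:
 obtains C where "0 < C"
  "\<And>(g :: 'a \<Rightarrow>\<^sub>C real) (f :: 'a \<Rightarrow>\<^sub>C real) w. mv (bc g) = 0 \<Longrightarrow> (\<And>x. bc g x - pp * Kop (bc g) x = bc f x - ell w x) \<Longrightarrow>
   norm g \<le> C * norm f \<and> nl (bc g) \<le> C * nl (bc f)"
proof -
 obtain C where C: "0 < C" "\<And>f x. pp * \<bar>Kop (bc f) x\<bar> \<le> norm f / 2 + C * nl (bc f)"
  by (rule sup_l2) (rule that)
 define D where "D = (N T + 3) / (1 - th) + 1 / (pp - 1)"
 have D: "0 < D" using th pp1 N3 by (simp add: D_def add_pos_pos)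
 define C' where "C' = D + 2 * (C * D + (N T + 2))"
 have C': "0 < C'" using D C(1) N3 by (simp add: C'_def add_pos_pos)
 have main: "norm g \<le> C' * norm f \<and> nl (bc g) \<le> C' * nl (bc f)"
  if g: "mv (bc g) = 0" and eq: "\<And>x. bc g x - pp * Kop (bc g) x = bc f x - ell w x"
  for g f :: "'a \<Rightarrow>\<^sub>C real" and w
 proof -
  let ?g = "bc g" and ?f = "bc f"
  note bbs = bb_bcontfun bb_Kop bb_ell bb_intros
  have fe: "?f = (\<lambda>x. (?g x - pp * Kop ?g x) + ell w x)" using eq by (auto simp: algebra_simps)
  have "mv ?f = (mv ?g - pp *\<^sub>R mv (Kop ?g)) + mv (ell w)"
   by (subst fe, subst mv_add, (intro bbs)+, subst mv_diff, (intro bbs)+, simp only: mv_cmult)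
  \<comment> \<open>By \<open>mv_ell\<close> the form \<open>ell w\<close> has the coefficient
    vector w / (n + 1), whence the factor n + 1.\<close>
  then have w: "w = (N T + 1) *\<^sub>R mv ?f" using g N3 by (simp add: mv_Kop bb_bcontfun mv_ell)
  have nw: "norm w \<le> (N T + 1) * nl ?f"
   unfolding w using mv_norm_nl[OF bb_bcontfun, of f] by (simp add: mult_left_mono)
  define c where "c = (\<E> x. ?g x)"
  have "(\<E> x. ?f x) = c - pp * c"
   by (subst fe) (simp add: bb_integrable bbs Kop_integral ell_integral c_def)
  then have c: "c = - (\<E> x. ?f x) / (pp - 1)" using pp1 by (simp add: field_simps)
  have P0: "\<bar>\<integral>x. ?f x \<partial>mm\<bar> \<le> nl ?f"
   using integral_abs_bound[of mm ?f] int_abs_le_nl[OF bb_bcontfun, of f] by linarith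
  have nc: "\<bar>c\<bar> \<le> 1 / (pp - 1) * nl ?f"
   unfolding c using P0 pp1 by (simp add: divide_right_mono)
  define h where "h x = ?g x - c" for x
  have bh: "bb h" unfolding h_def[abs_def] by (intro bbs)
  have ph: "perp h" unfolding perp_def h_def[abs_def]
   by (simp add: bb_integrable bbs measure_mm c_def mv_diff mv_const g)
  have ch: "continuous_on UNIV h" unfolding h_def[abs_def] by (intro continuous_intros) simp
  have hK: "Kop h x = Kop ?g x - c" for x
   unfolding h_def[abs_def] by (simp add: Kop_diff bbs Kop_const)
  define F where "F x = ?f x - (c - pp * c) - ell w x" for x
  have bF: "bb F" unfolding F_def[abs_def] by (intro bbs)
  have hF: "h x = F x + pp * Kop h x" for x
   using eq[of x] unfolding hK h_def F_def by (simp add: algebra_simps)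
  have cf: "c - pp * c = (\<E> x. ?f x)" using \<open>(\<E> x. ?f x) = c - pp * c\<close> by simp
  have nF: "nl F \<le> (N T + 3) * nl ?f"
  proof -
   have "nl F = nl (\<lambda>x. ?f x + (- (c - pp * c) + - ell w x))" by (simp add: F_def[abs_def] algebra_simps)
   also have "\<dots> \<le> nl ?f + nl (\<lambda>x. - (c - pp * c) + - ell w x)" by (intro nl_triangle bbs)
   also have "nl (\<lambda>x. - (c - pp * c) + - ell w x) \<le> \<bar>c - pp * c\<bar> + norm w"
    proof (intro nl_le_bound bbs)
     show "\<bar>- (c - pp * c) + - ell w x\<bar> \<le> \<bar>c - pp * c\<bar> + norm w" for x
      using ell_bound[of w x] by linarith
    qed simp
   also have "nl ?f + (\<bar>c - pp * c\<bar> + norm w) \<le> nl ?f + (nl ?f + (N T + 1) * nl ?f)"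
    using P0 nw by (simp add: cf)
   also have "\<dots> = (N T + 3) * nl ?f" by (simp add: algebra_simps)
   finally show ?thesis by simp
  qed
  have "nl h \<le> nl F + nl (\<lambda>x. pp * Kop h x)"
   using nl_triangle[OF bF bb_cmult[OF bb_Kop[OF bh]], of pp] hF by (metis (no_types, lifting) ext)
  also have "\<dots> \<le> nl F + th * nl h" using perp_gap[OF ch bh ph] by simp
  finally have "(1 - th) * nl h \<le> (N T + 3) * nl ?f" using nF by (simp add: algebra_simps)
  then have nh: "nl h \<le> (N T + 3) / (1 - th) * nl ?f" using th by (simp add: field_simps)
  have ng: "nl ?g \<le> D * nl ?f"
  proof -
   have "nl ?g = nl (\<lambda>x. h x + c)" by (simp add: h_def)
   also have "\<dots> \<le> nl h + nl (\<lambda>x. c)" by (intro nl_triangle bbs bh)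
   also have "nl (\<lambda>x. c) \<le> \<bar>c\<bar>" by (intro nl_le_bound bbs) auto
   finally show ?thesis using nh nc by (simp add: D_def algebra_simps)
  qed
  have nff: "nl ?f \<le> norm f" by (intro nl_le_bound bb_bcontfun bcontfun_abs) auto
  have nl0: "0 \<le> nl ?f" by simp
  have "norm g \<le> norm g / 2 + C * nl ?g + (norm f + norm w)"
  proof (rule norm_bound)
   fix x
   have "?g x = f x - ell w x + pp * Kop ?g x" using eq[of x] by simp
   then have "\<bar>?g x\<bar> \<le> \<bar>f x\<bar> + \<bar>ell w x\<bar> + pp * \<bar>Kop ?g x\<bar>"
   proof -
    have "\<bar>pp * Kop ?g x\<bar> = pp * \<bar>Kop ?g x\<bar>" using pp1 by (simp add: abs_mult)
    with \<open>?g x = f x - ell w x + pp * Kop ?g x\<close> show ?thesis by linarith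
   qed
   also have "\<dots> \<le> norm f + norm w + (norm g / 2 + C * nl ?g)"
    by (intro add_mono bcontfun_abs ell_bound C(2))
   finally show "norm (?g x) \<le> norm g / 2 + C * nl ?g + (norm f + norm w)" by simp
  qed
  then have "norm g \<le> 2 * (C * nl ?g + (norm f + norm w))" by simp
  also have "\<dots> \<le> 2 * (C * (D * norm f) + (norm f + (N T + 1) * norm f))"
  proof -
   have "nl ?g \<le> D * norm f" using ng mult_left_mono[OF nff, of D] D by linarith
   moreover have "norm w \<le> (N T + 1) * norm f" using nw mult_left_mono[OF nff, of "N T + 1"] by linarith
   ultimately show ?thesis using C(1) by (intro mult_left_mono add_mono) auto
  qed
  also have "\<dots> = 2 * (C * D + (N T + 2)) * norm f" by (simp add: algebra_simps)
  also have "\<dots> \<le> C' * norm f" unfolding C'_def using D by (intro mult_right_mono) auto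
  finally have R1: "norm g \<le> C' * norm f" .
  have "D * nl ?f \<le> C' * nl ?f" unfolding C'_def using C(1) D N3 nl0 by (intro mult_right_mono) auto
  then show ?thesis using R1 ng by linarith
 qed
 show ?thesis by (rule that[OF C' main])
qed

text \<open>Mean and first harmonics are removed and the rest is solved by \<open>neumann\<close>.
  Subtracting the first harmonics of that solution does not disturb the equation because pp
  \<open>lam 1\<close> = 1, and a constant d with (1 - pp) d = c restores the mean.\<close>

lemma lin_solve:
 fixes f :: "'a \<Rightarrow>\<^sub>C real"
 shows "\<exists>g :: 'a \<Rightarrow>\<^sub>C real. mv (bc g) = 0 \<and> (\<forall>x. bc g x - pp * Kop (bc g) x = bc f x - ell ((N T + 1) *\<^sub>R mv f) x)"
proof -
 let ?f = "bc f"
 let ?w = "(N T + 1) *\<^sub>R mv ?f"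
 note bbs = bb_bcontfun bb_Kop bb_ell bb_intros
 define c where "c = (\<E> x. ?f x)"
 define F where "F x = ?f x - c - ell ?w x" for x
 have bF: "bb F" unfolding F_def[abs_def] by (intro bbs)
 have cF: "continuous_on UNIV F" unfolding F_def[abs_def]
  by (intro continuous_intros dec_continuous[OF dec_ell]) simp
 have "(\<E> x. F x) = 0"
  unfolding F_def by (simp add: bb_integrable bbs ell_integral c_def measure_mm)
 moreover have "mv F = 0"
  unfolding F_def[abs_def] using N3
  by (subst mv_diff, (intro bbs)+, subst mv_diff, (intro bbs)+, simp add: mv_const mv_ell)
 ultimately have "perp F" by (simp add: perp_def)
 then have "perp (bc (Bcontfun F))" by (simp add: bc_apply[OF cF bF])
 from neumann[OF this] obtain g :: "'a \<Rightarrow>\<^sub>C real" where g: "\<And>x. g x = F x + pp * Kop (bc g) x"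
  by (auto simp: bc_apply[OF cF bF])
 let ?g = "bc g"
 let ?v = "(N T + 1) *\<^sub>R mv ?g"
 define d where "d = c / (1 - pp)"
 have dc: "(1 - pp) * d = c" using pp1 by (simp add: d_def)
 define h where "h x = ?g x - ell ?v x + d" for x
 have bh: "bb h" unfolding h_def[abs_def] by (intro bbs)
 have ch: "continuous_on UNIV h" unfolding h_def[abs_def]
  by (intro continuous_intros dec_continuous[OF dec_ell]) simp
 have mh: "mv h = 0"
  unfolding h_def[abs_def] using N3
  by (subst mv_add, (intro bbs)+, subst mv_diff, (intro bbs)+, simp add: mv_const mv_ell)
 have Kh: "Kop h x = Kop ?g x - lam 1 * ell ?v x + d" for x
  unfolding h_def[abs_def]
  by (subst Kop_add, (intro bbs)+, subst Kop_diff, (intro bbs)+, simp only: Kop_ell Kop_const)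
 have "h x - pp * Kop h x = ?f x - ell ?w x" for x
 proof -
  have "h x - pp * Kop h x = (?g x - pp * Kop ?g x) - (1 - pp * lam 1) * ell ?v x + (1 - pp) * d"
   unfolding Kh h_def[of x] by (simp add: algebra_simps)
  also have "\<dots> = F x + c" unfolding pp_lam1 dc using g[of x] by simp
  finally show ?thesis by (simp add: F_def)
 qed
 then show ?thesis using mh by (intro exI[of _ "Bcontfun h"]) (simp add: bc_apply[OF ch bh])
qed

section \<open>The nonlinearity and the fixed point argument\<close>

definition qf :: "real \<Rightarrow> real" where "qf a = (1 + a) powr pp - 1 - pp * a"
definition fp :: "real \<Rightarrow> real" where "fp a = (1 + a) powr pp"

text \<open>For |a| \<le> 1/2 the base 1 + a stays in [1/2, 3/2], where the power is smooth for
  every exponent, also when pp < 2 as in high dimensions. Applying the mean value theorem twice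
  gives the quadratic bound for \<open>qf\<close>.\<close>

lemma scalar_bounds:
 obtains L where "1 \<le> L"
  "\<And>a b. \<bar>a\<bar> \<le> 1/2 \<Longrightarrow> \<bar>b\<bar> \<le> 1/2 \<Longrightarrow> \<bar>fp a - fp b\<bar> \<le> L * \<bar>a - b\<bar>"
  "\<And>a b. \<bar>a\<bar> \<le> 1/2 \<Longrightarrow> \<bar>b\<bar> \<le> 1/2 \<Longrightarrow> \<bar>qf a - qf b\<bar> \<le> L * max \<bar>a\<bar> \<bar>b\<bar> * \<bar>a - b\<bar>"
  "\<And>a. \<bar>a\<bar> \<le> 1/2 \<Longrightarrow> \<bar>fp a\<bar> \<le> L"
proof -
 have dpow: "((\<lambda>x. (1 + x) powr s) has_real_derivative s * (1 + t) powr (s - 1)) (at t)" if "\<bar>t\<bar> \<le> 1/2" for s t :: real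
  using that by (auto intro!: derivative_eq_intros)
 have mvt: "\<exists>t. \<bar>t\<bar> \<le> max \<bar>a\<bar> \<bar>b\<bar> \<and> F a - F b = (a - b) * F' t"
  if "\<bar>a\<bar> \<le> 1/2" "\<bar>b\<bar> \<le> 1/2" and d: "\<And>t. \<bar>t\<bar> \<le> 1/2 \<Longrightarrow> (F has_real_derivative F' t) (at t)" for F F' :: "real \<Rightarrow> real" and a b
 proof (rule linorder_cases[of a b])
  assume "a = b" then show ?thesis by (intro exI[of _ a]) auto
 next
  assume ab: "a < b"
  have "\<exists>z>a. z < b \<and> F b - F a = (b - a) * F' z"
   by (rule MVT2[OF ab]) (use that in \<open>auto intro!: d\<close>)
  then obtain z where "a < z" "z < b" "F b - F a = (b - a) * F' z" by blast
  then show ?thesis by (intro exI[of _ z]) (auto simp: algebra_simps)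
 next
  assume ab: "b < a"
  have "\<exists>z>b. z < a \<and> F a - F b = (a - b) * F' z"
   by (rule MVT2[OF ab]) (use that in \<open>auto intro!: d\<close>)
  then obtain z where "b < z" "z < a" "F a - F b = (a - b) * F' z" by blast
  then show ?thesis by (intro exI[of _ z]) auto
 qed
 \<comment> \<open>A bound for (1 + t)^s valid for all s from -2 to pp, which includes the exponents
   of the power and of its first two derivatives.\<close>
 define B where "B = 2 powr (pp + 2)"
 have pB: "(1 + t) powr s \<le> B" if t: "\<bar>t\<bar> \<le> 1/2" and s: "- 2 \<le> s" "s \<le> pp" for t s :: real
 proof (cases "0 \<le> s")
  case True
  have "(1 + t) powr s \<le> 2 powr s" using t True by (intro powr_mono2) auto
  also have "\<dots> \<le> B" unfolding B_def using s by (intro powr_mono) auto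
  finally show ?thesis .
 next
  case False
  have "(1 + t) powr s \<le> (1/2) powr s" using t False by (intro powr_mono2') auto
  also have "\<dots> = 2 powr (- s)" by (simp add: powr_divide powr_minus_divide)
  also have "\<dots> \<le> B" unfolding B_def using s pp1 by (intro powr_mono) auto
  finally show ?thesis .
 qed
 have B0: "1 \<le> B" unfolding B_def using pp1 by (simp add: ge_one_powr_ge_zero)
 define L where "L = pp * pp * B + pp * B + B"
 have L: "1 \<le> L" "B \<le> L" "pp * B \<le> L" "pp * (pp - 1) * B \<le> L"
 proof -
  have "0 \<le> pp * pp * B" "0 \<le> pp * B" using pp1 B0 by auto
  then show "1 \<le> L" "B \<le> L" "pp * B \<le> L" using B0 unfolding L_def by linarith+
  have "pp * (pp - 1) * B \<le> pp * pp * B" using pp1 B0 by (intro mult_right_mono mult_left_mono) auto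
  then show "pp * (pp - 1) * B \<le> L" using \<open>0 \<le> pp * B\<close> B0 by (simp add: L_def)
 qed
 show ?thesis
 proof (rule that[OF L(1)])
  fix a :: real assume "\<bar>a\<bar> \<le> 1/2"
  then show "\<bar>fp a\<bar> \<le> L" using pB[of a pp] pp1 L(2) by (simp add: fp_def)
 next
  fix a b :: real assume ab: "\<bar>a\<bar> \<le> 1/2" "\<bar>b\<bar> \<le> 1/2"
  obtain t where t: "\<bar>t\<bar> \<le> max \<bar>a\<bar> \<bar>b\<bar>" "fp a - fp b = (a - b) * (pp * (1 + t) powr (pp - 1))"
   using mvt[OF ab, of fp "\<lambda>t. pp * (1 + t) powr (pp - 1)"] dpow unfolding fp_def[abs_def] by blast
  have "\<bar>fp a - fp b\<bar> = \<bar>a - b\<bar> * (pp * (1 + t) powr (pp - 1))"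
   unfolding t(2) abs_mult using pp1 by simp
  also have "\<dots> \<le> \<bar>a - b\<bar> * (pp * B)"
   using t(1) ab pp1 by (intro mult_left_mono pB) auto
  also have "\<dots> \<le> \<bar>a - b\<bar> * L" using L by (intro mult_left_mono) auto
  finally show "\<bar>fp a - fp b\<bar> \<le> L * \<bar>a - b\<bar>" by (simp add: mult.commute)
  have dq: "(qf has_real_derivative pp * (1 + t) powr (pp - 1) - pp) (at t)" if "\<bar>t\<bar> \<le> 1/2" for t
   unfolding qf_def[abs_def] using that by (auto intro!: derivative_eq_intros)
  obtain s where s: "\<bar>s\<bar> \<le> max \<bar>a\<bar> \<bar>b\<bar>" "qf a - qf b = (a - b) * (pp * (1 + s) powr (pp - 1) - pp)"
   using mvt[OF ab dq] by blast
  have s2: "\<bar>s\<bar> \<le> 1/2" using s(1) ab by auto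
  have z2: "\<bar>0::real\<bar> \<le> 1/2" by simp
  obtain r where r: "\<bar>r\<bar> \<le> max \<bar>s\<bar> \<bar>0\<bar>" "(1 + s) powr (pp - 1) - (1 + 0) powr (pp - 1) = (s - 0) * ((pp - 1) * (1 + r) powr (pp - 1 - 1))"
   using mvt[OF s2 z2 dpow[of _ "pp - 1"]] by blast
  have "\<bar>pp * (1 + s) powr (pp - 1) - pp\<bar> = pp * \<bar>(1 + s) powr (pp - 1) - (1 + 0) powr (pp - 1)\<bar>"
  proof -
   have "pp * (1 + s) powr (pp - 1) - pp = pp * ((1 + s) powr (pp - 1) - 1)" by (simp add: algebra_simps)
   then show ?thesis using pp1 by (simp add: abs_mult)
  qed
  also have "\<dots> = pp * (\<bar>s\<bar> * ((pp - 1) * (1 + r) powr (pp - 1 - 1)))"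
   unfolding r(2) abs_mult using pp1 by simp
  also have "\<dots> \<le> pp * (\<bar>s\<bar> * ((pp - 1) * B))"
   using r(1) s2 pp1 by (intro mult_left_mono pB) auto
  also have "\<dots> = (pp * (pp - 1) * B) * \<bar>s\<bar>" by simp
  also have "\<dots> \<le> L * max \<bar>a\<bar> \<bar>b\<bar>" using L s(1) by (intro mult_mono) auto
  finally have q: "\<bar>pp * (1 + s) powr (pp - 1) - pp\<bar> \<le> L * max \<bar>a\<bar> \<bar>b\<bar>" .
  have "\<bar>qf a - qf b\<bar> = \<bar>a - b\<bar> * \<bar>pp * (1 + s) powr (pp - 1) - pp\<bar>" unfolding s(2) abs_mult ..
  also have "\<dots> \<le> \<bar>a - b\<bar> * (L * max \<bar>a\<bar> \<bar>b\<bar>)" using q by (intro mult_left_mono) auto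
  finally show "\<bar>qf a - qf b\<bar> \<le> L * max \<bar>a\<bar> \<bar>b\<bar> * \<bar>a - b\<bar>" by (simp add: mult.commute)
 qed
qed

lemma qf_0 [simp]: "qf 0 = 0" and fp_0 [simp]: "fp 0 = 1"
 by (simp_all add: qf_def fp_def)

lemma bb_fp:
 assumes g: "bb g" and le: "\<And>x. \<bar>g x\<bar> \<le> 1/2"
 shows "bb (\<lambda>x. fp (g x))"
proof (rule bbI[where B="2 powr pp"])
 have [measurable]: "g \<in> BM" using g by (simp add: bb_def)
 show "(\<lambda>x. fp (g x)) \<in> BM" unfolding fp_def by measurable
 fix x
 have "(1 + g x) powr pp \<le> 2 powr pp"
  using le[of x] pp1 by (intro powr_mono2) (auto simp: abs_le_iff)
 then show "\<bar>fp (g x)\<bar> \<le> 2 powr pp" unfolding fp_def by simp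
qed

lemma bb_qf:
 assumes "bb g" "\<And>x. \<bar>g x\<bar> \<le> 1/2"
 shows "bb (\<lambda>x. qf (g x))"
proof -
 have "bb (\<lambda>x. fp (g x) - 1 - pp * g x)" by (intro bb_intros bb_fp assms)
 then show ?thesis by (simp add: qf_def fp_def)
qed

text \<open>What (1 - 2 1_A)(1 + \<psi>)^p contains beyond 1 + p \<psi>. Since K 1 = 1, the equation
  becomes \<psi> - p K \<psi> = K (Gh A \<psi>).\<close>

definition Gh :: "'a set \<Rightarrow> ('a \<Rightarrow> real) \<Rightarrow> 'a \<Rightarrow> real"
 where "Gh A \<psi> y = qf (\<psi> y) - 2 * (ind A y * fp (\<psi> y))"

lemma bb_Gh:
 assumes "A \<in> sets borel" "bb g" "\<And>x. \<bar>g x\<bar> \<le> 1/2"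
 shows "bb (Gh A g)"
 unfolding Gh_def[abs_def] by (intro bb_intros bb_indicator bb_qf bb_fp assms)

lemma small_Kop_indicator:
 assumes "0 < \<eta>"
 obtains m where "0 < m" "\<And>A x. A \<in> sets borel \<Longrightarrow> measure mm A \<le> m \<Longrightarrow> Kop (ind A) (x::'a) \<le> \<eta>"
proof -
 have e: "0 < \<eta> / 2" using assms by simp
 obtain C where C: "0 < C" "\<And>f B x. bb f \<Longrightarrow> (\<And>y. \<bar>f y\<bar> \<le> B) \<Longrightarrow> \<bar>Kop f (x::'a)\<bar> \<le> \<eta> / 2 * B + C * (\<E> y. \<bar>f y\<bar>)"
  by (rule Kop_eps[OF e]) (rule that; blast)
 have "Kop (ind A) (x::'a) \<le> \<eta>" if A: "A \<in> sets borel" "measure mm A \<le> \<eta> / (2 * C)" for A x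
 proof -
  have "\<bar>Kop (ind A) x\<bar> \<le> \<eta> / 2 * 1 + C * (\<E> y. \<bar>ind A y\<bar>)"
   by (rule C(2)) (auto simp: bb_indicator A indicator_def)
  also have "(\<E> y. \<bar>ind A y :: real\<bar>) = measure mm A" using A by simp
  also have "C * measure mm A \<le> C * (\<eta> / (2 * C))" using A C(1) by (intro mult_left_mono) auto
  also have "\<dots> = \<eta> / 2" using C(1) by simp
  finally show ?thesis by linarith
 qed
 moreover have "0 < \<eta> / (2 * C)" using assms C(1) by simp
 ultimately show ?thesis using that by blast
qed

text \<open>A choice of solution of the projected linear problem. Differences of chosen solutions
  solve the problem for the difference of the data, so \<open>apriori\<close> makes the choice
  Lipschitz.\<close>

definition Sol :: "('a \<Rightarrow>\<^sub>C real) \<Rightarrow> 'a \<Rightarrow>\<^sub>C real"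
 where "Sol f = (SOME g. mv (bc g) = 0 \<and>
   (\<forall>x. bc g x - pp * Kop (bc g) x = bc f x - ell ((N T + 1) *\<^sub>R mv (bc f)) x))"

lemma Sol:
 "mv (bc (Sol f)) = 0"
 "bc (Sol f) x - pp * Kop (bc (Sol f)) x = bc f x - ell ((N T + 1) *\<^sub>R mv (bc f)) x"
 using someI_ex[OF lin_solve[of f]] unfolding Sol_def[symmetric] by auto

lemma ell_diff: "ell z x - ell w x = ell (z - w) x"
 by (simp add: stereo_inner[symmetric] inner_diff_right)

lemma Sol_bounds:
 obtains C where "1 \<le> C" "\<And>f g. norm (Sol f - Sol g) \<le> C * norm (f - g)"
  "\<And>f. norm (Sol f) \<le> C * norm f"
  "\<And>f. nl (bc (Sol f)) \<le> C * nl (bc f)"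
proof -
 obtain C where C: "0 < C"
  "\<And>(g :: 'a \<Rightarrow>\<^sub>C real) (f :: 'a \<Rightarrow>\<^sub>C real) w. mv (bc g) = 0 \<Longrightarrow> (\<And>x. bc g x - pp * Kop (bc g) x = bc f x - ell w x) \<Longrightarrow>
   norm g \<le> C * norm f \<and> nl (bc g) \<le> C * nl (bc f)"
  by (rule apriori) (rule that; blast)
 have 1: "norm (Sol f) \<le> C * norm f" "nl (bc (Sol f)) \<le> C * nl (bc f)" for f
  using C(2)[OF Sol(1) Sol(2), of f] by auto
 have 2: "norm (Sol f - Sol g) \<le> C * norm (f - g)" for f g
 proof -
  have s: "bc (Sol f - Sol g) = (\<lambda>x. Sol f x - Sol g x)" by auto
  have "mv (bc (Sol f - Sol g)) = 0"
   unfolding s by (simp add: mv_diff bb_bcontfun Sol(1))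
  moreover have "bc (Sol f - Sol g) x - pp * Kop (bc (Sol f - Sol g)) x
   = bc (f - g) x - ell ((N T + 1) *\<^sub>R mv (bc f) - (N T + 1) *\<^sub>R mv (bc g)) x" for x
   unfolding s using Sol(2)[of f x] Sol(2)[of g x]
   by (simp add: Kop_diff bb_bcontfun ell_diff[symmetric] algebra_simps)
  ultimately show ?thesis using C(2)[of "Sol f - Sol g" "f - g"] by blast
 qed
 have mx: "C * t \<le> max C 1 * t" if "0 \<le> t" for t using that by (intro mult_right_mono) auto
 show ?thesis
 proof (rule that[of "max C 1"])
  show "norm (Sol f - Sol g) \<le> max C 1 * norm (f - g)" for f g
   using 2[of f g] mx[of "norm (f - g)"] by simp
  show "norm (Sol f) \<le> max C 1 * norm f" for f
   using 1(1)[of f] mx[of "norm f"] by simp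
  show "nl (bc (Sol f)) \<le> max C 1 * nl (bc f)" for f
   using 1(2)[of f] mx[of "nl (bc f)"] by simp
 qed simp
qed

text \<open>The error is measured against the mass of A because the barycentre itself is of that
  order; a bound by a small constant would be useless after rescaling.\<close>

definition bary :: "('a set \<Rightarrow> 'a \<times> real) \<Rightarrow> bool"
 where "bary b \<longleftrightarrow> (\<forall>\<eta>>0. \<exists>m>0. \<forall>A\<in>sets borel. measure mm A \<le> m \<longrightarrow> norm (b A - mv (ind A)) \<le> \<eta> * measure mm A)"

text \<open>Distances of sets are measured by the mass of the symmetric difference, the quantity
  that is controlled when the parameters move.\<close>

definition bary_cont :: "real \<Rightarrow> ('a set \<Rightarrow> 'a \<times> real) \<Rightarrow> bool"
 where "bary_cont m1 b \<longleftrightarrow> (\<forall>\<eta>>0. \<exists>d>0. \<forall>A\<in>sets borel. \<forall>B\<in>sets borel. measure mm A \<le> m1 \<longrightarrow> measure mm B \<le> m1 \<longrightarrow>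
  measure mm (sym_diff A B) \<le> d \<longrightarrow> norm (b A - b B) \<le> \<eta>)"

text \<open>A contraction for \<psi> = Sol (K (Gh A \<psi>)) on a small ball. Its fixed point solves
  the full equation as soon as the first harmonics of Gh A \<psi> vanish, and b measures
  these.\<close>

proposition auxiliary_problem:
 obtains m1 :: real and \<Psi> :: "'a set \<Rightarrow> 'a \<Rightarrow>\<^sub>C real" and b :: "'a set \<Rightarrow> 'a \<times> real"
 where "0 < m1"
  "\<And>A x. A \<in> sets borel \<Longrightarrow> measure mm A \<le> m1 \<Longrightarrow> \<bar>bc (\<Psi> A) x\<bar> \<le> 1/2"
  "\<And>A x. A \<in> sets borel \<Longrightarrow> measure mm A \<le> m1 \<Longrightarrow> b A = 0 \<Longrightarrow>
    1 + bc (\<Psi> A) x = Kop (\<lambda>y. (1 - 2 * ind A y) * (1 + bc (\<Psi> A) y) powr pp) x"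
  "bary b" "bary_cont m1 b"
  "\<And>\<eta>. 0 < \<eta> \<Longrightarrow> \<exists>m>0. \<forall>A\<in>sets borel. measure mm A \<le> m \<longrightarrow> norm (\<Psi> A) \<le> \<eta>"
proof -
 obtain L where L: "1 \<le> L"
  "\<And>a b. \<bar>a\<bar> \<le> 1/2 \<Longrightarrow> \<bar>b\<bar> \<le> 1/2 \<Longrightarrow> \<bar>fp a - fp b\<bar> \<le> L * \<bar>a - b\<bar>"
  "\<And>a b. \<bar>a\<bar> \<le> 1/2 \<Longrightarrow> \<bar>b\<bar> \<le> 1/2 \<Longrightarrow> \<bar>qf a - qf b\<bar> \<le> L * max \<bar>a\<bar> \<bar>b\<bar> * \<bar>a - b\<bar>"
  "\<And>a. \<bar>a\<bar> \<le> 1/2 \<Longrightarrow> \<bar>fp a\<bar> \<le> L" by (rule scalar_bounds) (rule that; blast)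
 obtain C where C: "1 \<le> C" "\<And>f g. norm (Sol f - Sol g) \<le> C * norm (f - g)"
  "\<And>f. norm (Sol f) \<le> C * norm f"
  "\<And>f. nl (bc (Sol f)) \<le> C * nl (bc f)" by (rule Sol_bounds) (rule that; blast)
 note bbs = bb_bcontfun bb_intros bb_indicator
 \<comment> \<open>The Lipschitz constant has the contributions C L r from the quadratic remainder
   and 2 C L \<eta>0 from the indicator. With r and \<eta>0 as chosen they are 1/8 and at most
   1/32.\<close>
 define r where "r = 1 / (8 * C * L)"
 have CL: "1 \<le> C * L" using C(1) L(1) mult_mono[of 1 C 1 L] by simp
 have r: "0 < r" "r \<le> 1/8" "C * L * r = 1/8"
  using CL C(1) L(1) by (auto simp: r_def field_simps)
 define \<eta>0 where "\<eta>0 = r / (8 * C * L)"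
 have \<eta>0: "0 < \<eta>0" "\<eta>0 \<le> 1/64" "C * L * \<eta>0 = r / 8"
 proof -
  show "0 < \<eta>0" using r C(1) L(1) by (simp add: \<eta>0_def)
  show e: "C * L * \<eta>0 = r / 8" using C(1) L(1) by (simp add: \<eta>0_def)
  have "1 * \<eta>0 \<le> C * L * \<eta>0" using CL \<open>0 < \<eta>0\<close> by (intro mult_right_mono) auto
  then show "\<eta>0 \<le> 1/64" using e r by simp
 qed
 have ball: "\<bar>bc g x\<bar> \<le> 1/2" if "norm g \<le> r" for g :: "'a \<Rightarrow>\<^sub>C real" and x
  using bcontfun_abs[of g x] that r by linarith
 \<comment> \<open>Smallness is imposed on the potential of A, which is what the estimates use;
   small mass implies it by \<open>small_Kop_indicator\<close>.\<close>
 define ok where "ok \<eta> A \<longleftrightarrow> A \<in> sets borel \<and> (\<forall>x. Kop (ind A) x \<le> \<eta>)" for \<eta> and A :: "'a set"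
 have okb: "A \<in> sets borel" if "ok \<eta> A" for \<eta> A using that by (simp add: ok_def)
 have bG: "bb (Gh A (bc g))" if "A \<in> sets borel" "norm g \<le> r" for A g
  by (intro bb_Gh bb_bcontfun ball that)
 have Kind: "0 \<le> Kop (ind A) x" if "A \<in> sets borel" for A :: "'a set" and x
  using Kop_mono[of "\<lambda>_. 0" "ind A" x] that by (simp add: bbs Kop_const)
 have Gdiff: "norm (KB (Gh A (bc g)) - KB (Gh A (bc h))) \<le> L * (r + 2 * \<eta>) * norm (g - h)"
  if A: "ok \<eta> A" and g: "norm g \<le> r" and h: "norm h \<le> r" for A g h \<eta>
 proof (rule norm_bound)
  fix x
  note Ab = okb[OF A]
  let ?d = "norm (g - h)"
  have pw: "\<bar>Gh A (bc g) y - Gh A (bc h) y\<bar> \<le> L * r * ?d + (2 * L * ?d) * ind A y" for y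
  proof -
   have d: "\<bar>g y - h y\<bar> \<le> ?d" using bcontfun_abs[of "g - h" y] by simp
   have mx: "max \<bar>g y\<bar> \<bar>h y\<bar> \<le> r" using bcontfun_abs[of g y] bcontfun_abs[of h y] g h by linarith
   have "\<bar>qf (g y) - qf (h y)\<bar> \<le> L * max \<bar>g y\<bar> \<bar>h y\<bar> * \<bar>g y - h y\<bar>" by (intro L ball g h)
   also have "\<dots> \<le> L * r * ?d" using mx d L(1) r by (intro mult_mono) auto
   finally have 1: "\<bar>qf (g y) - qf (h y)\<bar> \<le> L * r * ?d" .
   have "\<bar>fp (g y) - fp (h y)\<bar> \<le> L * \<bar>g y - h y\<bar>" by (intro L ball g h)
   also have "\<dots> \<le> L * ?d" using d L(1) by (intro mult_left_mono) auto
   finally have 2: "\<bar>fp (g y) - fp (h y)\<bar> \<le> L * ?d" .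
   have "Gh A (bc g) y - Gh A (bc h) y = (qf (g y) - qf (h y)) - 2 * (ind A y * (fp (g y) - fp (h y)))"
    by (simp add: Gh_def algebra_simps)
   also have "\<bar>\<dots>\<bar> \<le> \<bar>qf (g y) - qf (h y)\<bar> + \<bar>2 * (ind A y * (fp (g y) - fp (h y)))\<bar>" by (rule abs_triangle_ineq4)
   also have "\<bar>2 * (ind A y * (fp (g y) - fp (h y)))\<bar> \<le> (2 * L * ?d) * ind A y"
    using 2 by (auto simp: indicator_def)
   finally show ?thesis using 1 by linarith
  qed
  have "(KB (Gh A (bc g)) - KB (Gh A (bc h))) x = Kop (\<lambda>y. Gh A (bc g) y - Gh A (bc h) y) x"
   by (simp add: KB_apply bG Ab g h Kop_diff)
  also have "\<bar>\<dots>\<bar> \<le> Kop (\<lambda>y. L * r * ?d + (2 * L * ?d) * ind A y) x"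
   by (intro Kop_abs_le bbs bG Ab g h pw)
  also have "\<dots> = L * r * ?d + (2 * L * ?d) * Kop (ind A) x"
   by (subst Kop_add, (intro bbs Ab)+, subst Kop_cmult, (intro bbs Ab)+, simp only: Kop_const)
  also have "\<dots> \<le> L * r * ?d + (2 * L * ?d) * \<eta>"
   using A L(1) by (intro add_left_mono mult_left_mono) (auto simp: ok_def)
  finally show "norm ((KB (Gh A (bc g)) - KB (Gh A (bc h))) x) \<le> L * (r + 2 * \<eta>) * ?d"
   by (simp add: algebra_simps)
 qed
 define TA where "TA A g = Sol (KB (Gh A (bc g)))" for A g
 have Tdiff: "norm (TA A g - TA A h) \<le> 1/2 * norm (g - h)"
  if A: "ok \<eta>0 A" and g: "norm g \<le> r" and h: "norm h \<le> r" for A g h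
 proof -
  have "norm (TA A g - TA A h) \<le> C * norm (KB (Gh A (bc g)) - KB (Gh A (bc h)))"
   unfolding TA_def by (rule C)
  also have "\<dots> \<le> C * (L * (r + 2 * \<eta>0) * norm (g - h))"
   using Gdiff[OF A g h] C(1) by (intro mult_left_mono) auto
  also have "\<dots> = (C * L * r + 2 * (C * L * \<eta>0)) * norm (g - h)" by (simp add: algebra_simps)
  also have "\<dots> \<le> 1/2 * norm (g - h)" unfolding r(3) \<eta>0(3) using r by (intro mult_right_mono) auto
  finally show ?thesis .
 qed
 have T0: "norm (TA A 0) \<le> C * (2 * \<eta>)" if A: "ok \<eta> A" for A \<eta>
 proof -
  note Ab = okb[OF A]
  have "norm (TA A 0) \<le> C * norm (KB (Gh A (bc 0)))" unfolding TA_def by (rule C)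
  also have "norm (KB (Gh A (bc 0))) \<le> 2 * \<eta>"
  proof (rule norm_KB_le)
   show "bb (Gh A (bc 0))" using r by (intro bG Ab) simp
   fix x
   have "Gh A (bc 0) = (\<lambda>y. (-2) * ind A y)" by (auto simp: Gh_def)
   then have "Kop (Gh A (bc 0)) x = (-2) * Kop (ind A) x"
    by (simp only:) (intro Kop_cmult bbs Ab)
   then show "\<bar>Kop (Gh A (bc 0)) x\<bar> \<le> 2 * \<eta>"
    using Kind[OF Ab, of x] A by (simp add: ok_def)
  qed
  finally show ?thesis using C(1) by simp
 qed
 have C2: "C * (2 * \<eta>0) \<le> r / 2"
 proof -
  have "C * \<eta>0 * 1 \<le> C * \<eta>0 * L" using C(1) L(1) \<eta>0 by (intro mult_left_mono) auto
  then show ?thesis using \<eta>0(3) r by (simp add: algebra_simps)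
 qed
 have ex: "\<exists>!g. g \<in> cball 0 r \<and> TA A g = g" if A: "ok \<eta>0 A" for A
 proof -
  have "\<exists>!g\<in>cball 0 r. TA A g = g"
  proof (rule Banach_fix[where c="1/2"])
   show "complete (cball (0 :: 'a \<Rightarrow>\<^sub>C real) r)" by (simp add: complete_eq_closed)
   show "cball (0 :: 'a \<Rightarrow>\<^sub>C real) r \<noteq> {}" using r by auto
   show "TA A ` cball 0 r \<subseteq> cball 0 r"
   proof safe
    fix g :: "'a \<Rightarrow>\<^sub>C real" assume "g \<in> cball 0 r"
    then have g: "norm g \<le> r" by simp
    have "norm (TA A g) \<le> norm (TA A g - TA A 0) + norm (TA A 0)" by (metis diff_add_cancel norm_triangle_ineq)
    also have "\<dots> \<le> 1/2 * norm (g - 0) + r / 2"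
     using Tdiff[OF A g, of 0] T0[OF A] C2 r by (intro add_mono) auto
    finally show "TA A g \<in> cball 0 r" using g by simp
   qed
   show "\<And>x y. x \<in> cball 0 r \<Longrightarrow> y \<in> cball 0 r \<Longrightarrow> dist (TA A x) (TA A y) \<le> 1/2 * dist x y"
    using Tdiff[OF A] by (simp add: dist_norm)
  qed auto
  then show ?thesis by auto
 qed
 define \<Psi> where "\<Psi> A = (THE g. g \<in> cball 0 r \<and> TA A g = g)" for A
 have \<Psi>: "norm (\<Psi> A) \<le> r" "TA A (\<Psi> A) = \<Psi> A" if "ok \<eta>0 A" for A
  using theI'[OF ex[OF that]] unfolding \<Psi>_def[symmetric] by auto
 \<comment> \<open>\<open>Gh\<close> contains -2 times the indicator, so the factor -1/2 makes the
   barycentre of A the leading term.\<close>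
 define b where "b A = (- 1/2) *\<^sub>R mv (Gh A (bc (\<Psi> A)))" for A
 have b: "b A = (\<E> y. (ind A y * fp (\<Psi> A y)) *\<^sub>R stereo y) - (1/2) *\<^sub>R mv (\<lambda>y. qf (\<Psi> A y))" if A: "ok \<eta>0 A" for A
 proof -
  note P = ball[OF \<Psi>(1)[OF A]]
  note Ab = okb[OF A]
  have g: "mv (Gh A (bc (\<Psi> A))) = mv (\<lambda>y. qf (\<Psi> A y)) - 2 *\<^sub>R mv (\<lambda>y. ind A y * fp (\<Psi> A y))"
   unfolding Gh_def[abs_def]
   by (subst mv_diff, (intro bbs Ab bb_qf bb_fp P)+, simp only: mv_cmult)
  have lin: "(- 1/2) *\<^sub>R (u - 2 *\<^sub>R v) = v - (1/2) *\<^sub>R u" for u v :: "'a \<times> real"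
   by (simp add: scaleR_right_diff_distrib)
  show ?thesis unfolding b_def g lin by (simp add: mv_def)
 qed
 obtain m1 where m1: "0 < m1" "\<And>A x. A \<in> sets borel \<Longrightarrow> measure mm A \<le> m1 \<Longrightarrow> Kop (ind A) (x::'a) \<le> \<eta>0"
  by (rule small_Kop_indicator[OF \<eta>0(1)]) (rule that; blast)
 have okm: "ok \<eta>0 A" if "A \<in> sets borel" "measure mm A \<le> m1" for A using m1(2) that by (simp add: ok_def)
 have sup: "norm (\<Psi> A) \<le> 4 * C * \<eta>" if A0: "ok \<eta>0 A" and A: "ok \<eta> A" for A \<eta>
 proof -
  have "norm (\<Psi> A) \<le> norm (TA A (\<Psi> A) - TA A 0) + norm (TA A 0)"
   using \<Psi>(2)[OF A0] by (metis diff_add_cancel norm_triangle_ineq)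
  also have "norm (TA A (\<Psi> A) - TA A 0) \<le> 1/2 * norm (\<Psi> A)"
   using Tdiff[OF A0 \<Psi>(1)[OF A0], of 0] r by simp
  also have "norm (TA A 0) \<le> C * (2 * \<eta>)" by (rule T0[OF A])
  finally show ?thesis by simp
 qed
 \<comment> \<open>The quadratic remainder enters b through the integral of \<psi>^2, which must be
   o(mass of A). The sup bound does not give this. In mean square it follows from (K 1_A)^2 \<le>
   \<eta> K 1_A and the fact that K preserves the mean.\<close>
 have l2: "(nl (bc (\<Psi> A)))\<^sup>2 \<le> (4 * C * L)\<^sup>2 * (\<eta> * measure mm A)" if A0: "ok \<eta>0 A" and A: "ok \<eta> A" for A \<eta>
 proof -
  let ?p = "bc (\<Psi> A)"
  note P = ball[OF \<Psi>(1)[OF A0]]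
  note Ab = okb[OF A0]
  have bq: "bb (\<lambda>y. qf (?p y))" by (intro bbs bb_qf P)
  have bf: "bb (\<lambda>y. ind A y * fp (?p y))" by (intro bbs Ab bb_fp P)
  have "nl ?p \<le> C * nl (Kop (Gh A ?p))"
   using C(4)[of "KB (Gh A ?p)"] \<Psi>(2)[OF A0] bG[OF Ab \<Psi>(1)[OF A0]]
   by (simp add: TA_def KB_apply)
  also have "Kop (Gh A ?p) = (\<lambda>x. Kop (\<lambda>y. qf (?p y)) x + (-2) * Kop (\<lambda>y. ind A y * fp (?p y)) x)"
  proof
   fix x
   show "Kop (Gh A ?p) x = Kop (\<lambda>y. qf (?p y)) x + (-2) * Kop (\<lambda>y. ind A y * fp (?p y)) x"
    unfolding Gh_def[abs_def] by (subst Kop_diff, (intro bbs bq bf)+, subst Kop_cmult, (intro bf)+, simp)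
  qed
  also have "nl \<dots> \<le> nl (Kop (\<lambda>y. qf (?p y))) + nl (\<lambda>x. (-2) * Kop (\<lambda>y. ind A y * fp (?p y)) x)"
   by (intro nl_triangle bbs bb_Kop bq bf)
  also have "\<dots> = nl (Kop (\<lambda>y. qf (?p y))) + 2 * nl (Kop (\<lambda>y. ind A y * fp (?p y)))"
   unfolding nl_cmult by simp
  also have "nl (Kop (\<lambda>y. qf (?p y))) \<le> L * r * nl ?p"
  proof -
   have "nl (Kop (\<lambda>y. qf (?p y))) \<le> nl (\<lambda>y. qf (?p y))" by (rule nl_Kop[OF bq])
   also have "\<dots> \<le> nl (\<lambda>y. (L * r) * ?p y)"
   proof (intro nl_le bq bbs)
    fix y
    have "\<bar>qf (?p y) - qf 0\<bar> \<le> L * max \<bar>?p y\<bar> \<bar>0\<bar> * \<bar>?p y - 0\<bar>" by (intro L P) simp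
    also have "\<dots> = L * \<bar>?p y\<bar> * \<bar>?p y\<bar>" by simp
    also have "\<dots> \<le> L * r * \<bar>?p y\<bar>"
     using bcontfun_abs[of "\<Psi> A" y] \<Psi>(1)[OF A0] L(1) by (intro mult_right_mono mult_left_mono) auto
    finally show "\<bar>qf (?p y)\<bar> \<le> \<bar>L * r * ?p y\<bar>" using L(1) r by (simp add: abs_mult)
   qed
   also have "\<dots> = L * r * nl ?p" unfolding nl_cmult using L(1) r by simp
   finally show ?thesis .
  qed
  also have "nl (Kop (\<lambda>y. ind A y * fp (?p y))) \<le> L * nl (Kop (ind A))"
  proof -
   have "nl (Kop (\<lambda>y. ind A y * fp (?p y))) \<le> nl (\<lambda>x. L * Kop (ind A) x)"
   proof (intro nl_le bb_Kop bf bbs Ab)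
    fix x
    have "\<bar>Kop (\<lambda>y. ind A y * fp (?p y)) x\<bar> \<le> Kop (\<lambda>y. L * ind A y) x"
    proof (intro Kop_abs_le bf bbs Ab)
     show "\<bar>ind A y * fp (?p y)\<bar> \<le> L * ind A y" for y
      using L(4)[OF P, of y] by (auto simp: indicator_def)
    qed
    also have "\<dots> = L * Kop (ind A) x" by (intro Kop_cmult bbs Ab)
    finally show "\<bar>Kop (\<lambda>y. ind A y * fp (?p y)) x\<bar> \<le> \<bar>L * Kop (ind A) x\<bar>" by linarith
   qed
   also have "\<dots> = L * nl (Kop (ind A))" unfolding nl_cmult using L(1) by simp
   finally show ?thesis .
  qed
  finally have "nl ?p \<le> C * (L * r * nl ?p + 2 * (L * nl (Kop (ind A))))"
   using C(1) by simp
  also have "\<dots> = (C * L * r) * nl ?p + 2 * (C * L * nl (Kop (ind A)))" by (simp add: algebra_simps)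
  also have "\<dots> \<le> 1/2 * nl ?p + 2 * (C * L * nl (Kop (ind A)))" unfolding r(3) by (simp add: mult_right_mono)
  finally have n: "nl ?p \<le> 4 * C * L * nl (Kop (ind A))" by simp
  have "(nl (Kop (ind A)))\<^sup>2 \<le> (\<E> x. \<eta> * Kop (ind A) x)"
   unfolding nl_sq
  proof (intro integral_mono bb_integrable bbs bb_Kop Ab)
   fix x
   show "(Kop (ind A) x)\<^sup>2 \<le> \<eta> * Kop (ind A) x"
    unfolding power2_eq_square using A Kind[OF Ab, of x] by (intro mult_right_mono) (auto simp: ok_def)
  qed
  also have "\<dots> = \<eta> * measure mm A" using Ab by (simp add: Kop_integral bbs)
  finally have "(nl (Kop (ind A)))\<^sup>2 \<le> \<eta> * measure mm A" .
  then have "(4 * C * L)\<^sup>2 * (nl (Kop (ind A)))\<^sup>2 \<le> (4 * C * L)\<^sup>2 * (\<eta> * measure mm A)"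
   by (intro mult_left_mono) auto
  moreover have "(nl ?p)\<^sup>2 \<le> (4 * C * L * nl (Kop (ind A)))\<^sup>2" using n by (intro power_mono) auto
  ultimately show ?thesis by (simp add: power_mult_distrib)
 qed
 have expand: "norm (b A - mv (ind A)) \<le> (4 * C * L + L * (4 * C * L)\<^sup>2) * \<eta> * measure mm A"
  if A0: "ok \<eta>0 A" and A: "ok \<eta> A" for A \<eta>
 proof -
  let ?p = "bc (\<Psi> A)"
  note P = ball[OF \<Psi>(1)[OF A0]]
  note Ab = okb[OF A0]
  have b1: "bb (\<lambda>y. ind A y * fp (?p y))" by (intro bbs Ab bb_fp P)
  have b2: "bb (\<lambda>y. ind A y * (fp (?p y) - 1))" by (intro bbs Ab bb_fp P)
  have bq: "bb (\<lambda>y. qf (?p y))" by (intro bbs bb_qf P)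
  have "b A - mv (ind A) = mv (\<lambda>y. ind A y * fp (?p y)) - mv (ind A) - (1/2) *\<^sub>R mv (\<lambda>y. qf (?p y))"
   unfolding b[OF A0] mv_def by simp
  also have "mv (\<lambda>y. ind A y * fp (?p y)) - mv (ind A) = mv (\<lambda>y. ind A y * (fp (?p y) - 1))"
   using mv_diff[OF b1 bb_indicator[OF Ab]] by (simp add: algebra_simps)
  finally have "norm (b A - mv (ind A)) \<le> norm (mv (\<lambda>y. ind A y * (fp (?p y) - 1))) + norm ((1/2) *\<^sub>R mv (\<lambda>y. qf (?p y)))"
   by (simp only:) (rule norm_triangle_ineq4)
  also have "norm (mv (\<lambda>y. ind A y * (fp (?p y) - 1))) \<le> (\<E> y. \<bar>ind A y * (fp (?p y) - 1)\<bar>)"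
   by (rule mv_norm[OF b2])
  also have "\<dots> \<le> (\<E> y. (L * (4 * C * \<eta>)) * ind A y)"
  proof (intro integral_mono bb_integrable bbs b2 Ab bb_fp P)
   fix y
   have "\<bar>fp (?p y) - fp 0\<bar> \<le> L * \<bar>?p y - 0\<bar>" by (intro L P) simp
   also have "\<dots> \<le> L * (4 * C * \<eta>)" using bcontfun_abs[of "\<Psi> A" y] sup[OF A0 A] L(1) by (intro mult_left_mono) auto
   finally show "\<bar>ind A y * (fp (?p y) - 1)\<bar> \<le> L * (4 * C * \<eta>) * ind A y" by (auto simp: indicator_def)
  qed
  also have "\<dots> = L * (4 * C * \<eta>) * measure mm A" using Ab by simp
  also have "norm ((1/2) *\<^sub>R mv (\<lambda>y. qf (?p y))) \<le> L * ((4 * C * L)\<^sup>2 * (\<eta> * measure mm A))"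
  proof -
   have "norm (mv (\<lambda>y. qf (?p y))) \<le> (\<E> y. \<bar>qf (?p y)\<bar>)" by (rule mv_norm[OF bq])
   also have "\<dots> \<le> (\<E> y. L * (?p y)\<^sup>2)"
   proof (intro integral_mono bb_integrable bbs bq)
    fix y
    have "\<bar>qf (?p y) - qf 0\<bar> \<le> L * max \<bar>?p y\<bar> \<bar>0\<bar> * \<bar>?p y - 0\<bar>" by (intro L P) simp
    then show "\<bar>qf (?p y)\<bar> \<le> L * (?p y)\<^sup>2" by (simp add: power2_eq_square abs_mult_self_eq mult.assoc)
   qed
   also have "\<dots> = L * (nl ?p)\<^sup>2" by (simp add: nl_sq)
   also have "\<dots> \<le> L * ((4 * C * L)\<^sup>2 * (\<eta> * measure mm A))" using l2[OF A0 A] L(1) by (intro mult_left_mono) auto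
   finally have h: "norm (mv (\<lambda>y. qf (?p y))) \<le> L * ((4 * C * L)\<^sup>2 * (\<eta> * measure mm A))" .
   show ?thesis using h norm_ge_zero[of "mv (\<lambda>y. qf (?p y))"] unfolding norm_scaleR by linarith
  qed
  finally show ?thesis by (simp add: algebra_simps)
 qed
 \<comment> \<open>Comparison of two fixed points: the contraction returns half of their difference,
   and the two maps themselves differ only on the symmetric difference of the sets.\<close>
 have cont: "norm (b A - b B) \<le> L * measure mm (sym_diff A B) + 2 * L * (4 * C * L * \<eta>)"
  if A: "ok \<eta>0 A" and B: "ok \<eta>0 B" and D: "ok \<eta> (sym_diff A B)" for A B \<eta>
 proof -
  let ?p = "bc (\<Psi> A)" and ?q = "bc (\<Psi> B)"
  note P = ball[OF \<Psi>(1)[OF A]] and Q = ball[OF \<Psi>(1)[OF B]]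
  note Ab = okb[OF A] and Bb = okb[OF B] and Db = okb[OF D]
  have ind: "\<bar>ind A y - ind B y\<bar> = (ind (sym_diff A B) y :: real)" for y by (auto simp: indicator_def)
  have TAB: "norm (TA A (\<Psi> B) - TA B (\<Psi> B)) \<le> C * (2 * L * \<eta>)"
  proof -
   have "norm (TA A (\<Psi> B) - TA B (\<Psi> B)) \<le> C * norm (KB (Gh A ?q) - KB (Gh B ?q))" unfolding TA_def by (rule C)
   also have "norm (KB (Gh A ?q) - KB (Gh B ?q)) \<le> 2 * L * \<eta>"
   proof (rule norm_bound)
    fix x
    have "(KB (Gh A ?q) - KB (Gh B ?q)) x = Kop (\<lambda>y. Gh A ?q y - Gh B ?q y) x"
     by (simp add: KB_apply bG Ab Bb \<Psi>(1)[OF B] Kop_diff)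
    also have "\<bar>\<dots>\<bar> \<le> Kop (\<lambda>y. 2 * L * ind (sym_diff A B) y) x"
    proof (intro Kop_abs_le bbs bG Ab Bb Db \<Psi>(1)[OF B])
     fix y
     have "\<bar>Gh A ?q y - Gh B ?q y\<bar> = 2 * (\<bar>ind A y - ind B y\<bar> * \<bar>fp (?q y)\<bar>)"
     proof -
      have "Gh A ?q y - Gh B ?q y = (- 2) * ((ind A y - ind B y) * fp (?q y))"
       by (simp add: Gh_def algebra_simps)
      then show ?thesis unfolding abs_mult by (simp add: abs_mult)
     qed
     also have "\<dots> \<le> 2 * (ind (sym_diff A B) y * L)"
      unfolding ind using L(4)[OF Q] by (intro mult_left_mono) auto
     finally show "\<bar>Gh A ?q y - Gh B ?q y\<bar> \<le> 2 * L * ind (sym_diff A B) y" by (simp only: mult_ac)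
    qed
    also have "\<dots> = 2 * L * Kop (ind (sym_diff A B)) x" by (intro Kop_cmult bbs Db)
    also have "\<dots> \<le> 2 * L * \<eta>" using D L(1) by (intro mult_left_mono) (auto simp: ok_def)
    finally show "norm ((KB (Gh A ?q) - KB (Gh B ?q)) x) \<le> 2 * L * \<eta>" by simp
   qed
   finally show ?thesis using C(1) by simp
  qed
  have "norm (\<Psi> A - \<Psi> B) \<le> norm (TA A (\<Psi> A) - TA A (\<Psi> B)) + norm (TA A (\<Psi> B) - TA B (\<Psi> B))"
   using \<Psi>(2)[OF A] \<Psi>(2)[OF B] norm_triangle_ineq[of "TA A (\<Psi> A) - TA A (\<Psi> B)" "TA A (\<Psi> B) - TA B (\<Psi> B)"] by simp
  also have "\<dots> \<le> 1/2 * norm (\<Psi> A - \<Psi> B) + C * (2 * L * \<eta>)"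
   by (intro add_mono Tdiff TAB A \<Psi>(1)[OF A] \<Psi>(1)[OF B])
  finally have pq: "norm (\<Psi> A - \<Psi> B) \<le> 4 * C * L * \<eta>" by simp
  have d: "\<bar>?p y - ?q y\<bar> \<le> 4 * C * L * \<eta>" for y using bcontfun_abs[of "\<Psi> A - \<Psi> B" y] pq by simp
  have "b A - b B = (1/2) *\<^sub>R mv (\<lambda>y. Gh B ?q y - Gh A ?p y)"
   unfolding b_def by (subst mv_diff) (auto simp: bG Ab Bb \<Psi>(1) A B algebra_simps)
  then have "norm (b A - b B) \<le> 1/2 * (\<E> y. \<bar>Gh B ?q y - Gh A ?p y\<bar>)"
   using mv_norm[of "\<lambda>y. Gh B ?q y - Gh A ?p y"] by (simp add: bb_diff bG Ab Bb \<Psi>(1) A B)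
  also have "(\<E> y. \<bar>Gh B ?q y - Gh A ?p y\<bar>) \<le> (\<E> y. 3 * L * (4 * C * L * \<eta>) + 2 * L * ind (sym_diff A B) y)"
  proof (intro integral_mono bb_integrable bbs bG Ab Bb Db \<Psi>(1) A B)
   fix y
   have "\<bar>qf (?q y) - qf (?p y)\<bar> \<le> L * max \<bar>?q y\<bar> \<bar>?p y\<bar> * \<bar>?q y - ?p y\<bar>" by (intro L P Q)
   also have "\<dots> \<le> L * 1 * (4 * C * L * \<eta>)" using L(1) P[of y] Q[of y] d[of y] by (intro mult_mono) auto
   finally have 1: "\<bar>qf (?q y) - qf (?p y)\<bar> \<le> L * (4 * C * L * \<eta>)" by simp
   have "\<bar>fp (?q y) - fp (?p y)\<bar> \<le> L * \<bar>?q y - ?p y\<bar>" by (intro L P Q)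
   also have "\<dots> \<le> L * (4 * C * L * \<eta>)" using L(1) d[of y] by (intro mult_left_mono) auto
   finally have 2: "\<bar>fp (?q y) - fp (?p y)\<bar> \<le> L * (4 * C * L * \<eta>)" .
   have f: "\<bar>fp (?q y)\<bar> \<le> L" "\<bar>fp (?p y)\<bar> \<le> L" by (intro L P Q)+
   show "\<bar>Gh B ?q y - Gh A ?p y\<bar> \<le> 3 * L * (4 * C * L * \<eta>) + 2 * L * ind (sym_diff A B) y"
    unfolding Gh_def using 1 2 f by (cases "y \<in> A"; cases "y \<in> B") (auto simp: abs_le_iff)
  qed
  also have "\<dots> = 3 * L * (4 * C * L * \<eta>) + 2 * L * measure mm (sym_diff A B)"
   using Db by (simp add: bb_integrable bbs measure_mm)
  finally have f: "norm (b A - b B) \<le> 1/2 * (3 * L * (4 * C * L * \<eta>) + 2 * L * measure mm (sym_diff A B))" by simp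
  have "1/2 * (3 * L * X + 2 * L * m) = 3/2 * (L * X) + L * m" for X m :: real by (simp add: algebra_simps)
  with f have "norm (b A - b B) \<le> 3/2 * (L * (4 * C * L * \<eta>)) + L * measure mm (sym_diff A B)" by (simp only:)
  moreover have "0 \<le> L * (4 * C * L * \<eta>)" using L(1) order_trans[OF abs_ge_zero d] by simp
  ultimately show ?thesis by linarith
 qed
 show ?thesis
 proof (rule that[of m1 \<Psi> b])
  show "0 < m1" by (rule m1)
  show "\<bar>bc (\<Psi> A) x\<bar> \<le> 1/2" if "A \<in> sets borel" "measure mm A \<le> m1" for A x
   by (rule ball[OF \<Psi>(1)[OF okm[OF that]]])
  show "1 + bc (\<Psi> A) x = Kop (\<lambda>y. (1 - 2 * ind A y) * (1 + bc (\<Psi> A) y) powr pp) x"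
   if "A \<in> sets borel" "measure mm A \<le> m1" and b0: "b A = 0" for A x
  proof -
   let ?p = "bc (\<Psi> A)"
   have A: "ok \<eta>0 A" using that okm by blast
   note P = ball[OF \<Psi>(1)[OF A]]
   note Ab = okb[OF A]
   have bGA: "bb (Gh A ?p)" by (rule bG[OF Ab \<Psi>(1)[OF A]])
   have "mv (Gh A ?p) = 0" using b0 by (simp add: b_def)
   \<comment> \<open>The linear form subtracted by \<open>Sol\<close> is built from
     \<open>mv (Kop (Gh A ?p))\<close>, which is \<open>lam 1\<close> times
     \<open>mv (Gh A ?p)\<close>; the condition on b removes it.\<close>
   then have "mv (Kop (Gh A ?p)) = 0" by (simp add: mv_Kop bGA)
   then have "?p x - pp * Kop ?p x = Kop (Gh A ?p) x"
    using Sol(2)[of "KB (Gh A ?p)" x] \<Psi>(2)[OF A] by (simp add: TA_def KB_apply bGA ell_0)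
   then have "1 + ?p x = Kop (\<lambda>y. 1) x + (Kop (\<lambda>y. pp * ?p y) x + Kop (Gh A ?p) x)"
    by (simp add: Kop_cmult bb_bcontfun Kop_const)
   also have "\<dots> = Kop (\<lambda>y. 1 + (pp * ?p y + Gh A ?p y)) x"
    by (subst Kop_add, (intro bbs bGA)+, subst Kop_add, (intro bbs bGA)+, rule refl)
   also have "(\<lambda>y. 1 + (pp * ?p y + Gh A ?p y)) = (\<lambda>y. (1 - 2 * ind A y) * (1 + ?p y) powr pp)"
    by (auto simp: Gh_def qf_def fp_def algebra_simps)
   finally show ?thesis .
  qed
  show "bary b"
   unfolding bary_def
  proof (intro allI impI)
   fix \<eta> :: real assume e: "0 < \<eta>"
   define c where "c = 4 * C * L + L * (4 * C * L)\<^sup>2"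
   have c: "0 < c" using C(1) L(1) by (simp add: c_def add_pos_nonneg)
   have pos: "0 < \<eta> / c" using e c by simp
   obtain m where m: "0 < m" "\<And>A x. A \<in> sets borel \<Longrightarrow> measure mm A \<le> m \<Longrightarrow> Kop (ind A) (x::'a) \<le> \<eta> / c"
    by (rule small_Kop_indicator[OF pos]) (rule that; blast)
   show "\<exists>m>0. \<forall>A\<in>sets borel. measure mm A \<le> m \<longrightarrow> norm (b A - mv (ind A)) \<le> \<eta> * measure mm A"
   proof (intro exI[of _ "min m m1"] conjI ballI impI)
    fix A :: "'a set" assume A: "A \<in> sets borel" "measure mm A \<le> min m m1"
    have "ok (\<eta> / c) A" using A m(2) by (simp add: ok_def)
    from expand[OF okm this] A have "norm (b A - mv (ind A)) \<le> c * (\<eta> / c) * measure mm A"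
     by (simp add: c_def)
    then show "norm (b A - mv (ind A)) \<le> \<eta> * measure mm A" using c by simp
   qed (use m m1 in auto)
  qed
  show "bary_cont m1 b"
   unfolding bary_cont_def
  proof (intro allI impI)
   fix \<eta> :: real assume e: "0 < \<eta>"
   define c where "c = 2 * L * (4 * C * L)"
   have c: "0 < c" using C(1) L(1) by (simp add: c_def)
   have pos: "0 < \<eta> / (2 * c)" using e c by simp
   obtain m where m: "0 < m" "\<And>A x. A \<in> sets borel \<Longrightarrow> measure mm A \<le> m \<Longrightarrow> Kop (ind A) (x::'a) \<le> \<eta> / (2 * c)"
    by (rule small_Kop_indicator[OF pos]) (rule that; blast)
   show "\<exists>d>0. \<forall>A\<in>sets borel. \<forall>B\<in>sets borel. measure mm A \<le> m1 \<longrightarrow> measure mm B \<le> m1 \<longrightarrow>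
    measure mm (sym_diff A B) \<le> d \<longrightarrow> norm (b A - b B) \<le> \<eta>"
   proof (intro exI[of _ "min m (\<eta> / (2 * L))"] conjI ballI impI)
    show "0 < min m (\<eta> / (2 * L))" using m e L(1) by simp
    fix A B :: "'a set" assume A: "A \<in> sets borel" "B \<in> sets borel" "measure mm A \<le> m1" "measure mm B \<le> m1"
     "measure mm (sym_diff A B) \<le> min m (\<eta> / (2 * L))"
    have D: "ok (\<eta> / (2 * c)) (sym_diff A B)" using A m(2) by (simp add: ok_def)
    have "norm (b A - b B) \<le> L * measure mm (sym_diff A B) + c * (\<eta> / (2 * c))"
     using cont[OF okm[OF A(1,3)] okm[OF A(2,4)] D] unfolding c_def by (simp only: mult.assoc)
    also have "L * measure mm (sym_diff A B) \<le> L * (\<eta> / (2 * L))" using A(5) L(1) by (intro mult_left_mono) auto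
    also have "L * (\<eta> / (2 * L)) + c * (\<eta> / (2 * c)) = \<eta>" using c L(1) by (simp add: field_simps)
    finally show "norm (b A - b B) \<le> \<eta>" by simp
   qed
  qed
  show "\<exists>m>0. \<forall>A\<in>sets borel. measure mm A \<le> m \<longrightarrow> norm (\<Psi> A) \<le> \<eta>" if e: "0 < \<eta>" for \<eta>
  proof -
   have pos: "0 < \<eta> / (4 * C)" using e C(1) by simp
   obtain m where m: "0 < m" "\<And>A x. A \<in> sets borel \<Longrightarrow> measure mm A \<le> m \<Longrightarrow> Kop (ind A) (x::'a) \<le> \<eta> / (4 * C)"
    by (rule small_Kop_indicator[OF pos]) (rule that; blast)
   show ?thesis
   proof (intro exI[of _ "min m m1"] conjI ballI impI)
    fix A :: "'a set" assume A: "A \<in> sets borel" "measure mm A \<le> min m m1"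
    have "ok (\<eta> / (4 * C)) A" using A m(2) by (simp add: ok_def)
    from sup[OF okm this] A have "norm (\<Psi> A) \<le> 4 * C * (\<eta> / (4 * C))" by simp
    then show "norm (\<Psi> A) \<le> \<eta>" using C(1) by simp
   qed (use m m1 in auto)
  qed
 qed
qed

section \<open>The reduced problem\<close>

lemma stereo_at_infinity: "((stereo :: 'a \<Rightarrow> 'a \<times> real) \<longlongrightarrow> (0, -1)) at_infinity"
 unfolding tendsto_iff eventually_at_infinity
proof (intro allI impI)
 fix e :: real assume e: "0 < e"
 show "\<exists>b. \<forall>y::'a. b \<le> norm y \<longrightarrow> dist (stereo y) (0, -1) < e"
 proof (intro exI allI impI)
  fix y :: 'a assume y: "2 / e \<le> norm y"
  have "(dist (stereo y) (0, -1))\<^sup>2 = (norm ((2 / jb y) *\<^sub>R y))\<^sup>2 + (2 / jb y)\<^sup>2"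
   by (simp add: dist_norm stereo_def norm_Pair)
  also have "norm ((2 / jb y) *\<^sub>R y) = (2 / jb y) * norm y" by simp
  also have "((2 / jb y) * norm y)\<^sup>2 + (2 / jb y)\<^sup>2 = (2 / jb y)\<^sup>2 * jb y"
   unfolding power_mult_distrib jb_def[of y] by (simp only: distrib_left mult_1_right add.commute)
  also have "\<dots> = 4 / jb y" by (simp add: power2_eq_square)
  also have "\<dots> < e\<^sup>2"
  proof -
   have "(2 / e)\<^sup>2 \<le> (norm y)\<^sup>2" using y e by (intro power_mono) auto
   then have "4 / e\<^sup>2 < jb y" by (simp add: jb_def power_divide)
   then show ?thesis using e by (simp add: field_simps)
  qed
  finally show "dist (stereo y) (0, -1) < e" using e by (simp add: power_less_imp_less_base)
 qed
qed

section \<open>The two components of the set A and their leading masses\<close>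

definition AAs :: "'a set \<Rightarrow> real \<Rightarrow> 'a \<Rightarrow> 'a set"
 where "AAs E \<delta> \<eta> = {y. \<delta> *\<^sub>R (y + \<eta>) \<in> E}"

lemma AAs_borel: "E \<in> sets borel \<Longrightarrow> AAs E \<delta> \<eta> \<in> sets borel"
 using measurable_sets[of "\<lambda>y. \<delta> *\<^sub>R (y + \<eta>)" borel borel E] by (simp add: AAs_def vimage_def)

definition vB :: real where "vB = measure lborel (cball (0::'a) 1)"

lemma vB: "0 < vB"
 unfolding vB_def by (rule content_cball_pos) simp

text \<open>The coefficient of \<delta>^n in the unnormalised mass of the complement of \<Omega>:
  there the rescaled density (\<delta>^2 + |x|^2)^(-n) tends to |x|^(-2n). The singularity at 0 lies
  inside \<Omega>.\<close>

definition Aint :: "'a set \<Rightarrow> real"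
 where "Aint \<Omega> = (LBINT x. ind (- \<Omega>) x * ((norm (x::'a))\<^sup>2) powr (- N T))"

lemma outer_bound:
 assumes "ball 0 r \<subseteq> \<Omega>" "0 < r" "x \<notin> \<Omega>"
 shows "((norm (x::'a))\<^sup>2) powr (- N T) \<le> (1 + 1 / r\<^sup>2) powr N T * jb x powr (- N T)"
proof -
 have rx: "r \<le> norm x" using assms by (auto simp: subset_iff not_less[symmetric])
 then have x0: "0 < norm x" using assms by linarith
 have "r\<^sup>2 \<le> (norm x)\<^sup>2" using rx assms by (intro power_mono) auto
 then have "1 \<le> (norm x)\<^sup>2 / r\<^sup>2" using assms by simp
 then have j: "jb x \<le> (1 + 1 / r\<^sup>2) * (norm x)\<^sup>2" by (simp add: jb_def algebra_simps)
 have p: "0 < 1 + 1 / r\<^sup>2" by (simp add: add_pos_nonneg)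
 have "((1 + 1 / r\<^sup>2) * (norm x)\<^sup>2) powr (- N T) \<le> jb x powr (- N T)" using j by (intro powr_mono2') auto
 then have "(1 + 1 / r\<^sup>2) powr (- N T) * ((norm x)\<^sup>2) powr (- N T) \<le> jb x powr (- N T)" by (simp only: powr_mult)
 then have "(1 + 1 / r\<^sup>2) powr N T * ((1 + 1 / r\<^sup>2) powr (- N T) * ((norm x)\<^sup>2) powr (- N T)) \<le> (1 + 1 / r\<^sup>2) powr N T * jb x powr (- N T)"
  by (intro mult_left_mono) auto
 moreover have "(1 + 1 / r\<^sup>2) powr N T * (1 + 1 / r\<^sup>2) powr (- N T) = 1" by (rule powr_mult_one[OF p]) simp
 ultimately show ?thesis by (simp only: mult.assoc[symmetric] mult_1_left)
qed

lemma Aint_integrable: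
 assumes "open \<Omega>" "0 \<in> \<Omega>"
 shows "LI (\<lambda>x. ind (- \<Omega>) x * ((norm (x::'a))\<^sup>2) powr (- N T))"
proof -
 obtain r where r: "0 < r" "ball 0 r \<subseteq> \<Omega>" using assms by (auto simp: open_contains_ball)
 have [measurable]: "\<Omega> \<in> sets borel" using assms by simp
 have i: "LI (\<lambda>x::'a. (1 + 1 / r\<^sup>2) powr N T * jb x powr (- N T))"
  by (intro integrable_mult_right m0_integrable)
 show ?thesis
  by (rule integrable_dom[OF i])
    (use outer_bound[OF r(2,1)] in \<open>auto simp: indicator_def\<close>)
qed

text \<open>A bounded set cannot have a null complement.\<close>

lemma Aint_pos:
 assumes "open \<Omega>" "bounded \<Omega>" "0 \<in> \<Omega>"
 shows "0 < Aint \<Omega>"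
proof -
 have [measurable]: "\<Omega> \<in> sets borel" using assms by simp
 have "Aint \<Omega> \<noteq> 0"
 proof
  assume "Aint \<Omega> = 0"
  then have "AE x in lborel. ind (- \<Omega>) x * ((norm (x::'a))\<^sup>2) powr (- N T) = 0"
   using integral_nonneg_eq_0_iff_AE[OF Aint_integrable[OF assms(1,3)]] by (simp add: Aint_def)
  then have "AE x in lborel. x \<notin> - \<Omega>"
  proof eventually_elim
   case (elim x)
   then show ?case using assms(3) by (auto simp: indicator_def split: if_splits)
  qed
  then have "emeasure lborel (- \<Omega>) = 0" by (subst (asm) AE_iff_measurable[of "- \<Omega>"]) auto
  moreover have "emeasure lborel \<Omega> < \<infinity>" using assms(2) by (rule emeasure_bounded_finite)
  moreover have "emeasure lborel (UNIV::'a set) \<le> emeasure lborel \<Omega> + emeasure lborel (- \<Omega>)"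
   using emeasure_subadditive[of \<Omega> lborel "- \<Omega>"] by simp
  ultimately show False by simp
 qed
 moreover have "0 \<le> Aint \<Omega>" unfolding Aint_def by (intro integral_nonneg_AE) auto
 ultimately show ?thesis by simp
qed

lemma mm_integral_density:
 fixes f :: "'a \<Rightarrow> 'c::euclidean_space"
 assumes "f \<in> BM"
 shows "integral\<^sup>L mm f = (1 / m0 TYPE('a)) *\<^sub>R (LBINT y. jb y powr (- N T) *\<^sub>R f y)"
 unfolding mm_integral(1)[OF assms]
 by (simp only: integral_scaleR_right[symmetric] scaleR_scaleR mult_1_left times_divide_eq_left)

lemma jb_scale:
 assumes "0 < \<delta>"
 shows "jb (- \<eta> + (1/\<delta>) *\<^sub>R x) powr (- N T) = \<delta> ^ DIM('a) * \<delta> ^ DIM('a) * (\<delta>\<^sup>2 + (norm (x - \<delta> *\<^sub>R (\<eta>::'a)))\<^sup>2) powr (- N T)"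
proof -
 have "- \<eta> + (1/\<delta>) *\<^sub>R x = (1/\<delta>) *\<^sub>R (x - \<delta> *\<^sub>R \<eta>)" using assms by (simp add: algebra_simps)
 then have n: "norm (- \<eta> + (1/\<delta>) *\<^sub>R x) = (1/\<delta>) * norm (x - \<delta> *\<^sub>R \<eta>)" using assms by simp
 have "jb (- \<eta> + (1/\<delta>) *\<^sub>R x) = (1/\<delta>)\<^sup>2 * (\<delta>\<^sup>2 + (norm (x - \<delta> *\<^sub>R \<eta>))\<^sup>2)"
  unfolding jb_def n power_mult_distrib distrib_left using assms by (simp add: power_divide)
 then have "jb (- \<eta> + (1/\<delta>) *\<^sub>R x) powr (- N T) = ((1/\<delta>)\<^sup>2) powr (- N T) * (\<delta>\<^sup>2 + (norm (x - \<delta> *\<^sub>R \<eta>))\<^sup>2) powr (- N T)"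
  by (simp only: powr_mult)
 also have "((1/\<delta>)\<^sup>2) powr (- N T) = (\<delta> * \<delta>) powr N T"
  using assms by (simp add: powr_minus_divide powr_divide power2_eq_square)
 also have "(\<delta> * \<delta>) powr N T = \<delta> ^ DIM('a) * \<delta> ^ DIM('a)"
  using assms by (simp add: powr_mult powr_realpow)
 finally show ?thesis .
qed

text \<open>In x = \<delta> (y + \<eta>) the weight becomes \<delta>^(2n) (\<delta>^2 + |x -
  \<delta> \<eta>|^2)^(-n) and the Jacobian \<delta>^(-n). A fixed x outside \<Omega> corresponds to
  points y that run to infinity, so W contributes only its limit. The cases W = 1 and W =
  \<open>stereo\<close> give mass and barycentre.\<close>

lemma outer_limit:
 fixes W :: "'a \<Rightarrow> 'c::euclidean_space"
 assumes \<Omega>: "open \<Omega>" "0 \<in> \<Omega>"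
  and W: "continuous_on UNIV W" "\<And>y. norm (W y) \<le> B" "(W \<longlongrightarrow> Winf) at_infinity"
  and \<delta>: "\<And>k. 0 < \<delta> k" "\<delta> \<leadsto> 0" and \<eta>: "\<eta> \<leadsto> \<eta>0"
 shows "(\<lambda>k. (1 / \<delta> k ^ DIM('a)) *\<^sub>R (LBINT y. ind (AAs (- \<Omega>) (\<delta> k) (\<eta> k)) y *\<^sub>R (jb y powr (- N T) *\<^sub>R W y)))
   \<leadsto> Aint \<Omega> *\<^sub>R Winf"
proof -
 have [measurable]: "\<Omega> \<in> sets borel" using \<Omega> by simp
 have [measurable]: "W \<in> BM" by (rule borel_measurable_continuous_onI[OF W(1)])
 obtain r where r: "0 < r" "ball 0 r \<subseteq> \<Omega>" using \<Omega> by (auto simp: open_contains_ball)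
 have B: "0 \<le> B" using norm_ge_zero order_trans[OF _ W(2)] by blast
 let ?g = "\<lambda>k x. (\<delta> k)\<^sup>2 + (norm (x - \<delta> k *\<^sub>R \<eta> k))\<^sup>2"
 let ?F = "\<lambda>k x. ind (- \<Omega>) x *\<^sub>R (?g k x powr (- N T) *\<^sub>R W (- \<eta> k + (1 / \<delta> k) *\<^sub>R x))"
 have e: "(1 / \<delta> k ^ DIM('a)) *\<^sub>R (LBINT y. ind (AAs (- \<Omega>) (\<delta> k) (\<eta> k)) y *\<^sub>R (jb y powr (- N T) *\<^sub>R W y)) = (LBINT x. ?F k x)" for k
 proof -
  have dk: "0 < \<delta> k" by (rule \<delta>)
  have "(LBINT y. ind (AAs (- \<Omega>) (\<delta> k) (\<eta> k)) y *\<^sub>R (jb y powr (- N T) *\<^sub>R W y))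
   = \<bar>1 / \<delta> k\<bar> ^ DIM('a) *\<^sub>R (LBINT x. ind (AAs (- \<Omega>) (\<delta> k) (\<eta> k)) (- \<eta> k + (1 / \<delta> k) *\<^sub>R x) *\<^sub>R (jb (- \<eta> k + (1 / \<delta> k) *\<^sub>R x) powr (- N T) *\<^sub>R W (- \<eta> k + (1 / \<delta> k) *\<^sub>R x)))"
   by (rule lborel_integral_affine(1)) (use dk in auto)
  also have "(\<lambda>x. ind (AAs (- \<Omega>) (\<delta> k) (\<eta> k)) (- \<eta> k + (1 / \<delta> k) *\<^sub>R x) *\<^sub>R (jb (- \<eta> k + (1 / \<delta> k) *\<^sub>R x) powr (- N T) *\<^sub>R W (- \<eta> k + (1 / \<delta> k) *\<^sub>R x)))
    = (\<lambda>x. (\<delta> k ^ DIM('a) * \<delta> k ^ DIM('a)) *\<^sub>R ?F k x)"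
  proof
   fix x
   have "ind (AAs (- \<Omega>) (\<delta> k) (\<eta> k)) (- \<eta> k + (1 / \<delta> k) *\<^sub>R x) = (ind (- \<Omega>) x :: real)"
    using dk by (simp add: AAs_def indicator_def)
   then show "ind (AAs (- \<Omega>) (\<delta> k) (\<eta> k)) (- \<eta> k + (1 / \<delta> k) *\<^sub>R x) *\<^sub>R (jb (- \<eta> k + (1 / \<delta> k) *\<^sub>R x) powr (- N T) *\<^sub>R W (- \<eta> k + (1 / \<delta> k) *\<^sub>R x))
    = (\<delta> k ^ DIM('a) * \<delta> k ^ DIM('a)) *\<^sub>R ?F k x"
    unfolding jb_scale[OF dk] by (simp add: mult_ac)
  qed
  also have "(LBINT x. (\<delta> k ^ DIM('a) * \<delta> k ^ DIM('a)) *\<^sub>R ?F k x) = (\<delta> k ^ DIM('a) * \<delta> k ^ DIM('a)) *\<^sub>R (LBINT x. ?F k x)"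
   by (rule integral_scaleR_right)
  finally have I: "(LBINT y. ind (AAs (- \<Omega>) (\<delta> k) (\<eta> k)) y *\<^sub>R (jb y powr (- N T) *\<^sub>R W y))
   = \<bar>1 / \<delta> k\<bar> ^ DIM('a) *\<^sub>R (\<delta> k ^ DIM('a) * \<delta> k ^ DIM('a)) *\<^sub>R (LBINT x. ?F k x)" .
  have c: "1 / \<delta> k ^ DIM('a) * (\<bar>1 / \<delta> k\<bar> ^ DIM('a) * (\<delta> k ^ DIM('a) * \<delta> k ^ DIM('a))) = 1"
   using dk by (simp add: power_divide)
  have lin: "p *\<^sub>R q *\<^sub>R s *\<^sub>R v = v" if "p * (q * s) = 1" for p q s and v :: 'c
   using that by (simp add: mult.assoc)
  show ?thesis unfolding I by (rule lin[OF c])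
 qed
 have "(\<lambda>k. (LBINT x. ?F k x)) \<leadsto> (LBINT x. ind (- \<Omega>) x *\<^sub>R (((norm x)\<^sup>2) powr (- N T) *\<^sub>R Winf))"
 proof -
  have de: "(\<lambda>k. \<delta> k *\<^sub>R \<eta> k) \<leadsto> 0" using tendsto_scaleR[OF \<delta>(2) \<eta>] by simp
  have "\<forall>\<^sub>F k in sequentially. dist (\<delta> k *\<^sub>R \<eta> k) 0 < r / 2" by (rule tendstoD[OF de]) (use r in simp)
  then have "\<forall>\<^sub>F k in sequentially. norm (\<delta> k *\<^sub>R \<eta> k) < r / 2" by (simp only: dist_norm diff_zero)
  \<comment> \<open>The majorant is valid only once \<delta> \<eta> is shorter than r / 2, so the
    sequence is shifted by K.\<close>
  then obtain K where K: "\<And>k. K \<le> k \<Longrightarrow> norm (\<delta> k *\<^sub>R \<eta> k) < r / 2" by (auto simp: eventually_sequentially)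
  let ?C = "(1/4) powr (- N T) * (1 + 1 / r\<^sup>2) powr N T * B"
  have "(\<lambda>k. (LBINT x. ?F (k + K) x)) \<leadsto> (LBINT x. ind (- \<Omega>) x *\<^sub>R (((norm x)\<^sup>2) powr (- N T) *\<^sub>R Winf))"
  proof (rule integral_dct[where w="\<lambda>x. ?C * jb x powr (- N T)"])
   show "LI (\<lambda>x::'a. ?C * jb x powr (- N T))" by (intro integrable_mult_right m0_integrable)
   show "AE x in lborel. norm (?F (k + K) x) \<le> ?C * jb x powr (- N T)" for k
   proof (intro AE_I2)
    fix x :: 'a
    show "norm (?F (k + K) x) \<le> ?C * jb x powr (- N T)"
    proof (cases "x \<in> \<Omega>")
     case True then show ?thesis using B by simp
    next
     case False
     have rx: "r \<le> norm x" using r False by (auto simp: subset_iff not_less[symmetric])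
     have "norm x \<le> norm (x - \<delta> (k + K) *\<^sub>R \<eta> (k + K)) + norm (\<delta> (k + K) *\<^sub>R \<eta> (k + K))"
      by (metis diff_add_cancel norm_triangle_ineq)
     then have "norm x / 2 \<le> norm (x - \<delta> (k + K) *\<^sub>R \<eta> (k + K))" using K[of "k + K"] rx by simp
     then have "(norm x / 2)\<^sup>2 \<le> (norm (x - \<delta> (k + K) *\<^sub>R \<eta> (k + K)))\<^sup>2" by (intro power_mono) auto
     then have "(1/4) * (norm x)\<^sup>2 \<le> ?g (k + K) x" by (simp add: power_divide add_increasing)
     then have "?g (k + K) x powr (- N T) \<le> ((1/4) * (norm x)\<^sup>2) powr (- N T)"
      using rx r by (intro powr_mono2') auto
     also have "\<dots> = (1/4) powr (- N T) * ((norm x)\<^sup>2) powr (- N T)" by (rule powr_mult)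
     also have "\<dots> \<le> (1/4) powr (- N T) * ((1 + 1 / r\<^sup>2) powr N T * jb x powr (- N T))"
      by (intro mult_left_mono outer_bound[OF r(2,1) False]) auto
     finally have "?g (k + K) x powr (- N T) * norm (W (- \<eta> (k + K) + (1 / \<delta> (k + K)) *\<^sub>R x)) \<le> (1/4) powr (- N T) * ((1 + 1 / r\<^sup>2) powr N T * jb x powr (- N T)) * B"
      by (intro mult_mono W(2)) auto
     then show ?thesis using False by (simp add: mult_ac)
    qed
   qed
   show "AE x in lborel. (\<lambda>k. ?F (k + K) x) \<leadsto> ind (- \<Omega>) x *\<^sub>R (((norm x)\<^sup>2) powr (- N T) *\<^sub>R Winf)"
   proof (intro AE_I2)
    fix x :: 'a
    show "(\<lambda>k. ?F (k + K) x) \<leadsto> ind (- \<Omega>) x *\<^sub>R (((norm x)\<^sup>2) powr (- N T) *\<^sub>R Winf)"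
    proof (cases "x \<in> \<Omega>")
     case False
     then have x0: "x \<noteq> 0" using \<Omega> by auto
     have n: "(\<lambda>k. norm (x - \<delta> k *\<^sub>R \<eta> k)) \<leadsto> norm (x - 0)" by (intro tendsto_intros de)
     have "filterlim (\<lambda>k. norm (x - \<delta> k *\<^sub>R \<eta> k) / \<delta> k) at_top sequentially"
      by (rule LIM_at_top_divide[OF n]) (use x0 \<delta> in auto)
     moreover have "norm (x - \<delta> k *\<^sub>R \<eta> k) / \<delta> k = norm (- \<eta> k + (1 / \<delta> k) *\<^sub>R x)" for k
     proof -
      have "- \<eta> k + (1/\<delta> k) *\<^sub>R x = (1/\<delta> k) *\<^sub>R (x - \<delta> k *\<^sub>R \<eta> k)" using \<delta>(1)[of k] by (simp add: algebra_simps)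
      then show ?thesis using \<delta>(1)[of k] by simp
     qed
     ultimately have "filterlim (\<lambda>k. - \<eta> k + (1 / \<delta> k) *\<^sub>R x) at_infinity sequentially"
      by (simp add: filterlim_at_infinity_conv_norm_at_top)
     then have w: "(\<lambda>k. W (- \<eta> k + (1 / \<delta> k) *\<^sub>R x)) \<leadsto> Winf" by (rule filterlim_compose[OF W(3)])
     have "(\<lambda>k. ?g k x powr (- N T)) \<leadsto> (0\<^sup>2 + (norm (x - 0))\<^sup>2) powr (- N T)"
      by (intro tendsto_intros \<delta> n) (use x0 in auto)
     then have g: "(\<lambda>k. ?g k x powr (- N T)) \<leadsto> ((norm x)\<^sup>2) powr (- N T)" by simp
     have "(\<lambda>k. ?F k x) \<leadsto> ind (- \<Omega>) x *\<^sub>R (((norm x)\<^sup>2) powr (- N T) *\<^sub>R Winf)"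
      by (intro tendsto_scaleR tendsto_const g w)
     then show ?thesis by (rule LIMSEQ_ignore_initial_segment)
    qed simp
   qed
  qed measurable
  then show ?thesis by (rule LIMSEQ_offset)
 qed
 moreover have "(LBINT x. ind (- \<Omega>) x *\<^sub>R (((norm x)\<^sup>2) powr (- N T) *\<^sub>R Winf)) = Aint \<Omega> *\<^sub>R Winf"
  unfolding Aint_def scaleR_scaleR by (rule integral_scaleR_left) (intro Aint_integrable[OF \<Omega>])
 ultimately show ?thesis unfolding e by simp
qed

text \<open>Rescaling the shrinking ball about -\<eta> to the unit ball reduces the claim to
  continuity of f.\<close>

lemma inner_limit:
 fixes f :: "'a \<Rightarrow> 'c::euclidean_space"
 assumes f: "continuous_on UNIV f" "\<And>y. norm (f y) \<le> B"
  and r: "\<And>k. 0 < r k" "r \<leadsto> 0" and \<eta>: "\<eta> \<leadsto> \<eta>0"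
 shows "(\<lambda>k. (1 / r k ^ DIM('a)) *\<^sub>R (LBINT y. ind {y. norm (y + \<eta> k) \<le> r k} y *\<^sub>R f y)) \<leadsto> vB *\<^sub>R f (- \<eta>0)"
proof -
 have [measurable]: "f \<in> BM" by (rule borel_measurable_continuous_onI[OF f(1)])
 have cb: "cball (0::'a) 1 \<in> sets borel" by simp
 note [measurable] = cb
 have fin: "emeasure lborel (cball (0::'a) 1) < \<infinity>" by (rule emeasure_bounded_finite) simp
 have e: "(1 / r k ^ DIM('a)) *\<^sub>R (LBINT y. ind {y. norm (y + \<eta> k) \<le> r k} y *\<^sub>R f y)
   = (LBINT z. ind (cball 0 1) z *\<^sub>R f (- \<eta> k + r k *\<^sub>R z))" for k
 proof -
  have rk: "0 < r k" by (rule r)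
  have "(LBINT y. ind {y. norm (y + \<eta> k) \<le> r k} y *\<^sub>R f y)
    = \<bar>r k\<bar> ^ DIM('a) *\<^sub>R (LBINT z. ind {y. norm (y + \<eta> k) \<le> r k} (- \<eta> k + r k *\<^sub>R z) *\<^sub>R f (- \<eta> k + r k *\<^sub>R z))"
   by (rule lborel_integral_affine(1)) (use rk in auto)
  also have "(\<lambda>z. ind {y. norm (y + \<eta> k) \<le> r k} (- \<eta> k + r k *\<^sub>R z) *\<^sub>R f (- \<eta> k + r k *\<^sub>R z)) = (\<lambda>z. ind (cball 0 1) z *\<^sub>R f (- \<eta> k + r k *\<^sub>R z))"
   using rk by (auto simp: indicator_def)
  finally show ?thesis using rk by simp
 qed
 have "(\<lambda>k. (LBINT z. ind (cball 0 1) z *\<^sub>R f (- \<eta> k + r k *\<^sub>R z))) \<leadsto> (LBINT z. ind (cball (0::'a) 1) z *\<^sub>R f (- \<eta>0))"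
 proof (rule integral_dct[where w="\<lambda>z. B * ind (cball 0 1) z"])
  show "LI (\<lambda>z::'a. B * ind (cball 0 1) z)" using fin by (intro integrable_mult_right) simp
  show "AE z in lborel. (\<lambda>k. ind (cball 0 1) z *\<^sub>R f (- \<eta> k + r k *\<^sub>R z)) \<leadsto> ind (cball 0 1) z *\<^sub>R f (- \<eta>0)"
  proof (intro AE_I2 tendsto_scaleR tendsto_const)
   fix z
   have "isCont f (- \<eta>0 + 0 *\<^sub>R z)" using f(1) by (simp add: continuous_on_eq_continuous_at)
   then have "(\<lambda>k. f (- \<eta> k + r k *\<^sub>R z)) \<leadsto> f (- \<eta>0 + 0 *\<^sub>R z)"
    by (rule isCont_tendsto_compose) (intro tendsto_intros r \<eta>)
   then show "(\<lambda>k. f (- \<eta> k + r k *\<^sub>R z)) \<leadsto> f (- \<eta>0)" by simp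
  qed
  show "AE z in lborel. norm (ind (cball 0 1) z *\<^sub>R f (- \<eta> k + r k *\<^sub>R z)) \<le> B * ind (cball 0 1) z" for k
   using f(2) by (intro AE_I2) (auto simp: indicator_def)
 qed auto
 moreover have "(LBINT z. ind (cball (0::'a) 1) z *\<^sub>R f (- \<eta>0)) = vB *\<^sub>R f (- \<eta>0)"
  using fin by (simp add: vB_def)
 ultimately show ?thesis unfolding e by simp
qed

text \<open>The limit of the mean of W over A divided by \<rho>^(n/2). The parameter x = (\<eta>, s)
  stands for \<delta> = D e^s sqrt \<rho>; the exponential keeps \<delta> positive and makes the
  parameter space linear. The summands come from the neighbourhood of infinity and from the ball
  about -\<eta>.\<close>

definition Hlim :: "'a set \<Rightarrow> real \<Rightarrow> ('a \<Rightarrow> 'c::euclidean_space) \<Rightarrow> 'c \<Rightarrow> 'a \<times> real \<Rightarrow> 'c"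
 where "Hlim \<Omega> D W Winf x = (1 / m0 TYPE('a)) *\<^sub>R ((D * exp (snd x)) ^ DIM('a) *\<^sub>R (Aint \<Omega> *\<^sub>R Winf)
   + (1 / (D * exp (snd x)) ^ DIM('a)) *\<^sub>R (vB *\<^sub>R (jb (fst x) powr (- N T) *\<^sub>R W (- fst x))))"

definition Ax :: "'a set \<Rightarrow> real \<Rightarrow> real \<Rightarrow> 'a \<times> real \<Rightarrow> 'a set"
 where "Ax \<Omega> D \<rho> x = AAs (- Omega_rho \<Omega> \<rho>) (D * exp (snd x) * sqrt \<rho>) (fst x)"

lemma Omega_rho_open: "open \<Omega> \<Longrightarrow> open (Omega_rho \<Omega> \<rho>)"
proof -
 assume "open \<Omega>"
 moreover have "Omega_rho \<Omega> \<rho> = \<Omega> \<inter> - cball 0 \<rho>" by (auto simp: Omega_rho_def)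
 ultimately show ?thesis by (simp add: open_Int open_Compl)
qed

lemma Ax_borel: "open \<Omega> \<Longrightarrow> Ax \<Omega> D \<rho> x \<in> sets borel"
 unfolding Ax_def by (intro AAs_borel) (simp add: Omega_rho_open borel_open)

text \<open>Once \<rho> is smaller than the radius of a ball about 0 inside \<Omega>, the two
  components of A are disjoint. For \<delta> of order sqrt \<rho> the radius \<rho> / \<delta> of
  the inner one is of the same order, so both masses scale like \<rho>^(n/2); this is what dictates
  the size of \<delta>.\<close>

lemma seq_limit:
 fixes W :: "'a \<Rightarrow> 'c::euclidean_space"
 assumes \<Omega>: "open \<Omega>" "0 \<in> \<Omega>" and D: "0 < D"
  and W: "continuous_on UNIV W" "\<And>y. norm (W y) \<le> B" "(W \<longlongrightarrow> Winf) at_infinity"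
  and \<rho>: "\<And>k. 0 < \<rho> k" "\<rho> \<leadsto> 0" and x: "x \<leadsto> x0"
 shows "(\<lambda>k. (1 / sqrt (\<rho> k) ^ DIM('a)) *\<^sub>R (\<E> y. ind (Ax \<Omega> D (\<rho> k) (x k)) y *\<^sub>R W y)) \<leadsto> Hlim \<Omega> D W Winf x0"
proof -
 have Wm [measurable]: "W \<in> BM" by (rule borel_measurable_continuous_onI[OF W(1)])
 have [measurable]: "\<Omega> \<in> sets borel" using \<Omega> by simp
 obtain r0 where r0: "0 < r0" "ball 0 r0 \<subseteq> \<Omega>" using \<Omega> by (auto simp: open_contains_ball)
 define \<eta> where "\<eta> k = fst (x k)" for k
 define E where "E k = D * exp (snd (x k))" for k
 define \<delta> where "\<delta> k = E k * sqrt (\<rho> k)" for k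
 define r where "r k = sqrt (\<rho> k) / E k" for k
 have E: "0 < E k" for k using D by (simp add: E_def)
 have \<eta>l: "\<eta> \<leadsto> fst x0" unfolding \<eta>_def by (rule tendsto_fst[OF x])
 have El: "E \<leadsto> D * exp (snd x0)" unfolding E_def by (intro tendsto_intros tendsto_snd[OF x])
 have sl: "(\<lambda>k. sqrt (\<rho> k)) \<leadsto> 0" using tendsto_real_sqrt[OF \<rho>(2)] by simp
 have \<delta>l: "\<delta> \<leadsto> 0" unfolding \<delta>_def using tendsto_mult[OF El sl] by simp
 have rl: "r \<leadsto> 0" unfolding r_def using tendsto_divide[OF sl El] D by simp
 have \<delta>p: "0 < \<delta> k" and rp: "0 < r k" for k using E \<rho> by (auto simp: \<delta>_def r_def)
 let ?f = "\<lambda>y::'a. jb y powr (- N T) *\<^sub>R W y"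
 have fb: "norm (?f y) \<le> B" for y
 proof -
  have "jb y powr (- N T) \<le> 1" using powr_mono[of "- N T" 0 "jb y"] by simp
  then have "jb y powr (- N T) * norm (W y) \<le> 1 * B" by (intro mult_mono W(2)) auto
  then show ?thesis by simp
 qed
 have fc: "continuous_on UNIV ?f" by (intro continuous_intros W(1)) auto
 have fi: "LI ?f"
 proof (rule integrable_dom[OF integrable_mult_right[OF m0_integrable, of B]])
  show "AE y in lborel. norm (?f y) \<le> norm (B * jb y powr (- N T))"
  proof (intro AE_I2)
   fix y :: 'a
   have "jb y powr (- N T) * norm (W y) \<le> jb y powr (- N T) * B" by (intro mult_left_mono W(2)) auto
   also have "\<dots> \<le> norm (B * jb y powr (- N T))" by (simp add: abs_mult mult.commute mult_right_mono)
   finally show "norm (?f y) \<le> norm (B * jb y powr (- N T))" by simp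
  qed
 qed simp
 let ?O = "\<lambda>k. AAs (- \<Omega>) (\<delta> k) (\<eta> k)" and ?I = "\<lambda>k. {y. norm (y + \<eta> k) \<le> r k}"
 have Om: "?O k \<in> sets borel" for k by (rule AAs_borel) simp
 have Im: "?I k \<in> sets borel" for k by measurable
 have iO: "LI (\<lambda>y. ind (?O k) y *\<^sub>R ?f y)" for k
  using Om fi by (intro integrable_mult_indicator) auto
 have iI: "LI (\<lambda>y. ind (?I k) y *\<^sub>R ?f y)" for k
  using Im fi by (intro integrable_mult_indicator) auto
 have split: "\<forall>\<^sub>F k in sequentially. (1 / sqrt (\<rho> k) ^ DIM('a)) *\<^sub>R (\<E> y. ind (Ax \<Omega> D (\<rho> k) (x k)) y *\<^sub>R W y)
   = (1 / m0 TYPE('a)) *\<^sub>R (E k ^ DIM('a) *\<^sub>R ((1 / \<delta> k ^ DIM('a)) *\<^sub>R (LBINT y. ind (?O k) y *\<^sub>R ?f y))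
    + (1 / E k ^ DIM('a)) *\<^sub>R ((1 / r k ^ DIM('a)) *\<^sub>R (LBINT y. ind (?I k) y *\<^sub>R ?f y)))"
 proof -
  have "\<forall>\<^sub>F k in sequentially. \<rho> k < r0" using \<rho>(2) r0 by (simp add: order_tendsto_iff)
  then show ?thesis
  proof eventually_elim
   case (elim k)
   have sq: "sqrt (\<rho> k) * sqrt (\<rho> k) = \<rho> k" using \<rho>(1)[of k] by (simp add: less_imp_le)
   have nI: "norm (\<delta> k *\<^sub>R (y + \<eta> k)) \<le> \<rho> k \<longleftrightarrow> y \<in> ?I k" for y
   proof -
    have "norm (\<delta> k *\<^sub>R (y + \<eta> k)) = \<delta> k * norm (y + \<eta> k)" using \<delta>p[of k] by simp
    moreover have "\<rho> k = \<delta> k * r k" using E[of k] sq by (simp add: \<delta>_def r_def)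
    ultimately show ?thesis using \<delta>p[of k] by simp
   qed
   have ind: "ind (Ax \<Omega> D (\<rho> k) (x k)) y = (ind (?O k) y + ind (?I k) y :: real)" for y
   proof -
    have "y \<in> Ax \<Omega> D (\<rho> k) (x k) \<longleftrightarrow> y \<in> ?O k \<or> norm (\<delta> k *\<^sub>R (y + \<eta> k)) \<le> \<rho> k"
     by (auto simp: Ax_def AAs_def Omega_rho_def \<delta>_def E_def \<eta>_def)
    moreover have "\<not> (y \<in> ?O k \<and> norm (\<delta> k *\<^sub>R (y + \<eta> k)) \<le> \<rho> k)"
     using r0(2) elim by (auto simp: AAs_def subset_iff)
    ultimately show ?thesis unfolding nI by (auto simp: indicator_def)
   qed
   have m: "(\<lambda>y. ind (Ax \<Omega> D (\<rho> k) (x k)) y *\<^sub>R W y) \<in> BM"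
    using Ax_borel[OF \<Omega>(1)] by measurable
   have "(\<E> y. ind (Ax \<Omega> D (\<rho> k) (x k)) y *\<^sub>R W y) = (1 / m0 TYPE('a)) *\<^sub>R (LBINT y. ind (?O k) y *\<^sub>R ?f y + ind (?I k) y *\<^sub>R ?f y)"
    unfolding mm_integral_density[OF m] by (simp add: ind scaleR_left_distrib scaleR_right_distrib mult.commute)
   also have "(LBINT y. ind (?O k) y *\<^sub>R ?f y + ind (?I k) y *\<^sub>R ?f y) = (LBINT y. ind (?O k) y *\<^sub>R ?f y) + (LBINT y. ind (?I k) y *\<^sub>R ?f y)"
    by (rule Bochner_Integration.integral_add[OF iO iI])
   finally have *: "(\<E> y. ind (Ax \<Omega> D (\<rho> k) (x k)) y *\<^sub>R W y) = (1 / m0 TYPE('a)) *\<^sub>R ((LBINT y. ind (?O k) y *\<^sub>R ?f y) + (LBINT y. ind (?I k) y *\<^sub>R ?f y))" .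
   have c1: "E k ^ DIM('a) * (1 / \<delta> k ^ DIM('a)) = 1 / sqrt (\<rho> k) ^ DIM('a)"
    using E[of k] by (simp add: \<delta>_def power_mult_distrib)
   have c2: "(1 / E k ^ DIM('a)) * (1 / r k ^ DIM('a)) = 1 / sqrt (\<rho> k) ^ DIM('a)"
    using E[of k] by (simp add: r_def power_divide)
   show ?case unfolding * scaleR_scaleR c1 c2 by (simp add: scaleR_right_distrib mult.commute)
  qed
 qed
 have L1: "(\<lambda>k. (1 / \<delta> k ^ DIM('a)) *\<^sub>R (LBINT y. ind (?O k) y *\<^sub>R ?f y)) \<leadsto> Aint \<Omega> *\<^sub>R Winf"
  by (rule outer_limit[OF \<Omega> W \<delta>p \<delta>l \<eta>l])
 have L2: "(\<lambda>k. (1 / r k ^ DIM('a)) *\<^sub>R (LBINT y. ind (?I k) y *\<^sub>R ?f y)) \<leadsto> vB *\<^sub>R ?f (- fst x0)"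
  by (rule inner_limit[OF fc fb rp rl \<eta>l])
 have "(\<lambda>k. (1 / m0 TYPE('a)) *\<^sub>R (E k ^ DIM('a) *\<^sub>R ((1 / \<delta> k ^ DIM('a)) *\<^sub>R (LBINT y. ind (?O k) y *\<^sub>R ?f y))
    + (1 / E k ^ DIM('a)) *\<^sub>R ((1 / r k ^ DIM('a)) *\<^sub>R (LBINT y. ind (?I k) y *\<^sub>R ?f y))))
   \<leadsto> (1 / m0 TYPE('a)) *\<^sub>R ((D * exp (snd x0)) ^ DIM('a) *\<^sub>R (Aint \<Omega> *\<^sub>R Winf) + (1 / (D * exp (snd x0)) ^ DIM('a)) *\<^sub>R (vB *\<^sub>R ?f (- fst x0)))"
  by (intro tendsto_intros L1 L2 El) (use D in auto)
 then have "(\<lambda>k. (1 / m0 TYPE('a)) *\<^sub>R (E k ^ DIM('a) *\<^sub>R ((1 / \<delta> k ^ DIM('a)) *\<^sub>R (LBINT y. ind (?O k) y *\<^sub>R ?f y))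
    + (1 / E k ^ DIM('a)) *\<^sub>R ((1 / r k ^ DIM('a)) *\<^sub>R (LBINT y. ind (?I k) y *\<^sub>R ?f y))))
   \<leadsto> Hlim \<Omega> D W Winf x0"
  by (simp add: Hlim_def jb_def)
 then show ?thesis by (rule Lim_transform_eventually) (use split in eventually_elim, simp)
qed

text \<open>Convergence along all convergent parameter sequences, compactness of the ball and
  continuity of the limit give uniform convergence: a sequence of counterexamples would have a
  convergent subsequence.\<close>

lemma unif_limit:
 fixes W :: "'a \<Rightarrow> 'c::euclidean_space"
 assumes \<Omega>: "open \<Omega>" "0 \<in> \<Omega>" and D: "0 < D"
  and W: "continuous_on UNIV W" "\<And>y. norm (W y) \<le> B" "(W \<longlongrightarrow> Winf) at_infinity"
  and e: "0 < e"
 shows "\<exists>\<rho>1>0. \<forall>\<rho> x. 0 < \<rho> \<longrightarrow> \<rho> < \<rho>1 \<longrightarrow> x \<in> cball 0 R \<longrightarrow>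
  norm ((1 / sqrt \<rho> ^ DIM('a)) *\<^sub>R (\<E> y. ind (Ax \<Omega> D \<rho> x) y *\<^sub>R W y) - Hlim \<Omega> D W Winf x) < e"
proof (rule ccontr)
 let ?M = "\<lambda>\<rho> x. (1 / sqrt \<rho> ^ DIM('a)) *\<^sub>R (\<E> y. ind (Ax \<Omega> D \<rho> x) y *\<^sub>R W y)"
 assume "\<not> ?thesis"
 then have neg: "\<exists>\<rho> x. 0 < \<rho> \<and> \<rho> < \<rho>1 \<and> x \<in> cball 0 R \<and> \<not> norm (?M \<rho> x - Hlim \<Omega> D W Winf x) < e" if "0 < \<rho>1" for \<rho>1
  using that by blast
 define bad where "bad k z \<longleftrightarrow> 0 < fst z \<and> fst z < es k \<and> snd z \<in> cball 0 R \<and>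
  \<not> norm (?M (fst z) (snd z) - Hlim \<Omega> D W Winf (snd z)) < e" for k and z :: "real \<times> ('a \<times> real)"
 have "\<exists>z. bad k z" for k
 proof -
  obtain \<rho> x where "0 < \<rho>" "\<rho> < es k" "x \<in> cball 0 R" "\<not> norm (?M \<rho> x - Hlim \<Omega> D W Winf x) < e"
   using neg[OF es(1)[of k]] by blast
  then have "bad k (\<rho>, x)" unfolding bad_def fst_conv snd_conv by (intro conjI)
  then show ?thesis by (rule exI)
 qed
 then have "\<forall>k. \<exists>z. bad k z" by (rule allI)
 from choice[OF this] obtain p where p: "\<forall>k. bad k (p k)" by (rule exE)
 define \<rho> where "\<rho> k = fst (p k)" for k
 define x where "x k = snd (p k)" for k
 have s: "0 < \<rho> k" "\<rho> k < es k" "x k \<in> cball 0 R"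
  "\<not> norm (?M (\<rho> k) (x k) - Hlim \<Omega> D W Winf (x k)) < e" for k
  using p[rule_format, of k] unfolding bad_def \<rho>_def x_def by blast+
 have "seq_compact (cball (0 :: 'a \<times> real) R)" by (simp add: compact_imp_seq_compact)
 then obtain x0 g where g: "strict_mono (g :: nat \<Rightarrow> nat)" "(x \<circ> g) \<leadsto> x0"
  using s(3) unfolding seq_compact_def by blast
 have r0: "\<rho> \<leadsto> 0"
  by (rule tendsto_sandwich[OF _ _ tendsto_const es(3)])
    (rule always_eventually, rule allI, rule less_imp_le, rule s)+
 have r1: "(\<rho> \<circ> g) \<leadsto> 0" by (rule LIMSEQ_subseq_LIMSEQ[OF r0 g(1)])
 have l1: "(\<lambda>k. ?M ((\<rho> \<circ> g) k) ((x \<circ> g) k)) \<leadsto> Hlim \<Omega> D W Winf x0"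
  by (rule seq_limit[OF \<Omega> D W _ r1 g(2)]) (simp add: s)
 have "continuous_on UNIV (Hlim \<Omega> D W Winf)"
  unfolding Hlim_def[abs_def] using D
  by (intro continuous_intros continuous_on_compose2[OF W(1)]) auto
 then have "isCont (Hlim \<Omega> D W Winf) x0" by (simp add: continuous_on_eq_continuous_at del: split_paired_All)
 then have l2: "(\<lambda>k. Hlim \<Omega> D W Winf ((x \<circ> g) k)) \<leadsto> Hlim \<Omega> D W Winf x0"
  using g(2) by (rule isCont_tendsto_compose)
 have "(\<lambda>k. norm (?M ((\<rho> \<circ> g) k) ((x \<circ> g) k) - Hlim \<Omega> D W Winf ((x \<circ> g) k))) \<leadsto> norm (Hlim \<Omega> D W Winf x0 - Hlim \<Omega> D W Winf x0)"
  by (intro tendsto_intros l1 l2)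
 then have "\<forall>\<^sub>F k in sequentially. norm (?M ((\<rho> \<circ> g) k) ((x \<circ> g) k) - Hlim \<Omega> D W Winf ((x \<circ> g) k)) < e"
  using e by (simp add: order_tendsto_iff)
 then obtain k where "norm (?M ((\<rho> \<circ> g) k) ((x \<circ> g) k) - Hlim \<Omega> D W Winf ((x \<circ> g) k)) < e"
  by (auto simp: eventually_sequentially)
 then show False using s(4) by simp
qed

section \<open>Continuous dependence of the set on its parameters\<close>

lemma mm_AAs:
 assumes E: "E \<in> sets borel" and d: "0 < \<delta>"
 shows "measure mm (AAs E \<delta> \<eta>) = (1 / m0 TYPE('a)) * ((1/\<delta>) ^ DIM('a) * (LBINT x. ind E x * jb (- \<eta> + (1/\<delta>) *\<^sub>R (x::'a)) powr (- N T)))"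
proof -
 have [measurable]: "AAs E \<delta> \<eta> \<in> sets borel" by (rule AAs_borel[OF E])
 have "measure mm (AAs E \<delta> \<eta>) = (\<E> y. ind (AAs E \<delta> \<eta>) y)" by simp
 also have "\<dots> = (1 / m0 TYPE('a)) *\<^sub>R (LBINT y. jb y powr (- N T) *\<^sub>R ind (AAs E \<delta> \<eta>) y)"
  by (rule mm_integral_density) measurable
 also have "(LBINT y. jb y powr (- N T) *\<^sub>R (ind (AAs E \<delta> \<eta>) y :: real))
  = \<bar>1/\<delta>\<bar> ^ DIM('a) *\<^sub>R (LBINT x. jb (- \<eta> + (1/\<delta>) *\<^sub>R x) powr (- N T) *\<^sub>R ind (AAs E \<delta> \<eta>) (- \<eta> + (1/\<delta>) *\<^sub>R x))"
  by (rule lborel_integral_affine(1)) (use d in simp)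
 also have "(\<lambda>x. jb (- \<eta> + (1/\<delta>) *\<^sub>R x) powr (- N T) *\<^sub>R (ind (AAs E \<delta> \<eta>) (- \<eta> + (1/\<delta>) *\<^sub>R x) :: real))
  = (\<lambda>x. ind E x * jb (- \<eta> + (1/\<delta>) *\<^sub>R x) powr (- N T))"
  using d by (auto simp: AAs_def indicator_def)
 finally show ?thesis using d by simp
qed

lemma jb_affine_bound:
 assumes "0 < \<delta>"
 shows "jb x \<le> (1 + 2 * \<delta>\<^sup>2 * (1 + (norm \<eta>)\<^sup>2)) * jb (- \<eta> + (1/\<delta>) *\<^sub>R (x::'a))"
proof -
 define u where "u = - \<eta> + (1/\<delta>) *\<^sub>R x"
 have x: "x = \<delta> *\<^sub>R (u + \<eta>)" using assms by (simp add: u_def)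
 have "(norm (u + \<eta>))\<^sup>2 \<le> (norm u + norm \<eta>)\<^sup>2" by (intro power_mono norm_triangle_ineq) auto
 also have "\<dots> \<le> 2 * (norm u)\<^sup>2 + 2 * (norm \<eta>)\<^sup>2"
  using sum_squares_bound[of "norm u" "norm \<eta>"] by (simp add: power2_sum)
 finally have "(norm (u + \<eta>))\<^sup>2 \<le> 2 * (norm u)\<^sup>2 + 2 * (norm \<eta>)\<^sup>2" .
 then have "\<delta>\<^sup>2 * (norm (u + \<eta>))\<^sup>2 \<le> \<delta>\<^sup>2 * (2 * (norm u)\<^sup>2 + 2 * (norm \<eta>)\<^sup>2)" by (intro mult_left_mono) auto
 moreover have "(norm x)\<^sup>2 = \<delta>\<^sup>2 * (norm (u + \<eta>))\<^sup>2"
  by (subst x) (simp only: norm_scaleR power_mult_distrib power2_abs)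
 ultimately have "jb x \<le> 1 + 2 * \<delta>\<^sup>2 * (norm u)\<^sup>2 + 2 * \<delta>\<^sup>2 * (norm \<eta>)\<^sup>2"
  by (simp add: jb_def distrib_left)
 also have "\<dots> \<le> (1 + 2 * \<delta>\<^sup>2 * (1 + (norm \<eta>)\<^sup>2)) * jb u"
  by (simp add: jb_def algebra_simps)
 finally show ?thesis unfolding u_def .
qed

text \<open>Convergent parameters are bounded, so \<open>jb_affine_bound\<close> dominates all
  rescaled densities by one multiple of jb^(-n).\<close>

lemma mm_AAs_tendsto:
 assumes E: "closed E" and d: "\<And>k. 0 < \<delta> k" "0 < \<delta>0" "\<delta> \<leadsto> \<delta>0" and \<eta>: "\<eta> \<leadsto> \<eta>0"
 shows "(\<lambda>k. measure mm (AAs E (\<delta> k) (\<eta> k))) \<leadsto> measure mm (AAs E \<delta>0 (\<eta>0::'a))"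
proof -
 have Eb [measurable]: "E \<in> sets borel" using E by simp
 have l: "(\<lambda>k. 1 + 2 * (\<delta> k)\<^sup>2 * (1 + (norm (\<eta> k))\<^sup>2)) \<leadsto> 1 + 2 * \<delta>0\<^sup>2 * (1 + (norm \<eta>0)\<^sup>2)"
  by (intro tendsto_intros d \<eta>)
 then have "Bseq (\<lambda>k. 1 + 2 * (\<delta> k)\<^sup>2 * (1 + (norm (\<eta> k))\<^sup>2))" by (intro convergent_imp_Bseq convergentI)
 then obtain M where M: "0 < M" "\<And>k. norm (1 + 2 * (\<delta> k)\<^sup>2 * (1 + (norm (\<eta> k))\<^sup>2)) \<le> M" by (auto simp: Bseq_def)
 have "(\<lambda>k. (LBINT x. ind E x * jb (- \<eta> k + (1/\<delta> k) *\<^sub>R x) powr (- N T)))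
   \<leadsto> (LBINT x. ind E x * jb (- \<eta>0 + (1/\<delta>0) *\<^sub>R (x::'a)) powr (- N T))"
 proof (rule integral_dct[where w="\<lambda>x. M powr N T * jb x powr (- N T)"])
  show "LI (\<lambda>x::'a. M powr N T * jb x powr (- N T))" by (intro integrable_mult_right m0_integrable)
  show "AE x in lborel. (\<lambda>k. ind E x * jb (- \<eta> k + (1/\<delta> k) *\<^sub>R x) powr (- N T)) \<leadsto> ind E x * jb (- \<eta>0 + (1/\<delta>0) *\<^sub>R (x::'a)) powr (- N T)"
   unfolding jb_def
   by (intro AE_I2 tendsto_intros d \<eta>) (use d in \<open>auto simp: add_nonneg_eq_0_iff\<close>)
  show "AE x in lborel. norm (ind E x * jb (- \<eta> k + (1/\<delta> k) *\<^sub>R (x::'a)) powr (- N T)) \<le> M powr N T * jb x powr (- N T)" for k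
  proof (intro AE_I2)
   fix x :: 'a
   let ?u = "- \<eta> k + (1/\<delta> k) *\<^sub>R x"
   have "jb x \<le> (1 + 2 * (\<delta> k)\<^sup>2 * (1 + (norm (\<eta> k))\<^sup>2)) * jb ?u" by (rule jb_affine_bound[OF d(1)])
   also have "\<dots> \<le> M * jb ?u" using M(2)[of k] by (intro mult_right_mono) auto
   finally have "(M * jb ?u) powr (- N T) \<le> jb x powr (- N T)" by (intro powr_mono2') auto
   then have "M powr (- N T) * jb ?u powr (- N T) \<le> jb x powr (- N T)" by (simp only: powr_mult)
   then have "M powr N T * (M powr (- N T) * jb ?u powr (- N T)) \<le> M powr N T * jb x powr (- N T)" by (intro mult_left_mono) auto
   moreover have "M powr N T * M powr (- N T) = 1" using M(1) by (intro powr_mult_one) auto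
   ultimately have "jb ?u powr (- N T) \<le> M powr N T * jb x powr (- N T)" by (simp only: mult.assoc[symmetric] mult_1_left)
   then show "norm (ind E x * jb ?u powr (- N T)) \<le> M powr N T * jb x powr (- N T)"
    by (auto simp: indicator_def)
  qed
 qed measurable
 then have "(\<lambda>k. (1 / m0 TYPE('a)) * ((1/\<delta> k) ^ DIM('a) * (LBINT x. ind E x * jb (- \<eta> k + (1/\<delta> k) *\<^sub>R x) powr (- N T))))
  \<leadsto> (1 / m0 TYPE('a)) * ((1/\<delta>0) ^ DIM('a) * (LBINT x. ind E x * jb (- \<eta>0 + (1/\<delta>0) *\<^sub>R (x::'a)) powr (- N T)))"
  by (intro tendsto_intros d) (use d in auto)
 then show ?thesis using mm_AAs[OF Eb] d by simp
qed

text \<open>As E is closed, a point outside the limit set is eventually outside the approximating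
  sets, so the excess over the limit set vanishes in measure. Convergence of the masses then forces
  the deficit to vanish too.\<close>

lemma mm_sym_diff_tendsto:
 assumes E: "closed E" and d: "\<And>k. 0 < \<delta> k" "0 < \<delta>0" "\<delta> \<leadsto> \<delta>0" and \<eta>: "\<eta> \<leadsto> \<eta>0"
 shows "(\<lambda>k. measure mm (sym_diff (AAs E (\<delta> k) (\<eta> k)) (AAs E \<delta>0 (\<eta>0::'a)))) \<leadsto> 0"
proof -
 let ?A = "\<lambda>k. AAs E (\<delta> k) (\<eta> k)" and ?B = "AAs E \<delta>0 \<eta>0"
 have Ab [measurable]: "?A k \<in> sets borel" "?B \<in> sets borel" for k using E by (auto intro: AAs_borel)
 have "(\<lambda>k. (\<E> y. (ind (?A k - ?B) y :: real))) \<leadsto> (\<integral>y. 0 \<partial>(mm::'a measure))"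
 proof (rule integral_dct[where w="\<lambda>y. 1"])
  show "AE y in mm. (\<lambda>k. ind (?A k - ?B) y) \<leadsto> (0::real)"
  proof (intro AE_I2)
   fix y
   show "(\<lambda>k. ind (?A k - ?B) y) \<leadsto> (0::real)"
   proof (cases "y \<in> ?B")
    case False
    have l: "(\<lambda>k. \<delta> k *\<^sub>R (y + \<eta> k)) \<leadsto> \<delta>0 *\<^sub>R (y + \<eta>0)" by (intro tendsto_intros d \<eta>)
    have "\<forall>\<^sub>F k in sequentially. \<delta> k *\<^sub>R (y + \<eta> k) \<in> - E"
     by (rule topological_tendstoD[OF l]) (use E False in \<open>auto simp: AAs_def\<close>)
    then have "\<forall>\<^sub>F k in sequentially. ind (?A k - ?B) y = (0::real)"
     by eventually_elim (auto simp: AAs_def)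
    then show ?thesis by (rule tendsto_eventually)
   qed simp
  qed
  show "AE y in mm. norm (ind (?A k - ?B) y :: real) \<le> 1" for k by (auto simp: indicator_def)
 qed auto
 then have l1: "(\<lambda>k. measure mm (?A k - ?B)) \<leadsto> 0" by simp
 have l2: "(\<lambda>k. measure mm (?A k)) \<leadsto> measure mm ?B" by (rule mm_AAs_tendsto[OF E d \<eta>])
 have e: "measure mm (sym_diff (?A k) ?B) = 2 * measure mm (?A k - ?B) + measure mm ?B - measure mm (?A k)" for k
 proof -
  have m: "measure mm (X \<union> Y) = measure mm X + measure mm Y" if "X \<in> sets borel" "Y \<in> sets borel" "X \<inter> Y = {}" for X Y :: "'a set"
   by (rule mm.finite_measure_Union) (use that in auto)
  have "measure mm (sym_diff (?A k) ?B) = measure mm (?A k - ?B) + measure mm (?B - ?A k)" by (rule m) auto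
  moreover have "measure mm ?B = measure mm (?B - ?A k) + measure mm (?B \<inter> ?A k)"
  proof -
   have d: "(?B - ?A k) \<inter> (?B \<inter> ?A k) = {}" and u: "(?B - ?A k) \<union> (?B \<inter> ?A k) = ?B" by auto
   show ?thesis using m[OF _ _ d] unfolding u by simp
  qed
  moreover have "measure mm (?A k) = measure mm (?A k - ?B) + measure mm (?B \<inter> ?A k)"
  proof -
   have d: "(?A k - ?B) \<inter> (?B \<inter> ?A k) = {}" and u: "(?A k - ?B) \<union> (?B \<inter> ?A k) = ?A k" by auto
   show ?thesis using m[OF _ _ d] unfolding u by simp
  qed
  ultimately show ?thesis by simp
 qed
 have "(\<lambda>k. 2 * measure mm (?A k - ?B) + measure mm ?B - measure mm (?A k)) \<leadsto> 2 * 0 + measure mm ?B - measure mm ?B"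
  by (intro tendsto_intros l1 l2)
 then show ?thesis unfolding e by simp
qed

section \<open>The limiting map and its zero\<close>

definition Pm :: "'a \<times> real \<Rightarrow> 'a \<times> real"
 where "Pm z = ((exp (- N T * snd z) * (1 / (1 + fst z \<bullet> fst z)) ^ Suc DIM('a)) *\<^sub>R fst z,
   (exp (N T * snd z) - exp (- N T * snd z) * (1 / (1 + fst z \<bullet> fst z)) ^ DIM('a) * (2 * (1 / (1 + fst z \<bullet> fst z)) - 1)) / (2 * N T))"

text \<open>The factors that depend on |fst z|^2 are flat at 0. In the last component both
  exponentials contribute the slope n, which explains the division by 2n in
  \<open>Pm\<close>.\<close>

lemma Pm_deriv: "(Pm has_derivative (\<lambda>z. z)) (at 0)"
proof -
 define j where "j z = 1 / (1 + fst z \<bullet> fst z)" for z :: "'a \<times> real"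
 have "((\<lambda>z. 1 / (1 + fst z \<bullet> fst z)) has_derivative (\<lambda>z. 0)) (at (0 :: 'a \<times> real))"
  by (auto intro!: derivative_eq_intros)
 then have j: "(j has_derivative (\<lambda>z. 0)) (at 0)" by (simp add: j_def[abs_def])
 have j0: "j 0 = 1" by (simp add: j_def)
 have jk: "((\<lambda>z. j z ^ k) has_derivative (\<lambda>z. 0)) (at 0)" for k
  using has_derivative_power[OF j, of k] by simp
 have e1: "((\<lambda>z::'a \<times> real. exp (c * snd z)) has_derivative (\<lambda>z. c * snd z)) (at 0)" for c
  by (auto intro!: derivative_eq_intros)
 have f: "((\<lambda>z::'a \<times> real. fst z) has_derivative fst) (at 0)" by (auto intro!: derivative_eq_intros)
 have A: "((\<lambda>z. exp (- N T * snd z) * j z ^ Suc DIM('a)) has_derivative (\<lambda>z. - N T * snd z)) (at 0)"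
  using has_derivative_mult[OF e1[of "- N T"] jk[of "Suc DIM('a)"]] by (simp add: j0)
 have B: "((\<lambda>z. (exp (- N T * snd z) * j z ^ Suc DIM('a)) *\<^sub>R fst z) has_derivative (\<lambda>z. fst z)) (at 0)"
  using has_derivative_scaleR[OF A f] by (simp add: j0)
 have C: "((\<lambda>z. exp (- N T * snd z) * j z ^ DIM('a)) has_derivative (\<lambda>z. - N T * snd z)) (at 0)"
  using has_derivative_mult[OF e1[of "- N T"] jk[of "DIM('a)"]] by (simp add: j0)
 have j2: "((\<lambda>z. 2 * j z - 1) has_derivative (\<lambda>z. 0)) (at 0)"
  by (rule has_derivative_eq_rhs[OF has_derivative_diff[OF has_derivative_mult_right[OF j, of 2] has_derivative_const[of 1]]]) simp
 have D: "((\<lambda>z. exp (- N T * snd z) * j z ^ DIM('a) * (2 * j z - 1)) has_derivative (\<lambda>z. - N T * snd z)) (at 0)"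
  using has_derivative_mult[OF C j2] by (simp add: j0)
 have E: "((\<lambda>z. exp (N T * snd z) - exp (- N T * snd z) * j z ^ DIM('a) * (2 * j z - 1)) has_derivative (\<lambda>z. N T * snd z - (- N T * snd z))) (at 0)"
  by (rule has_derivative_diff[OF e1 D])
 have F: "((\<lambda>z. (exp (N T * snd z) - exp (- N T * snd z) * j z ^ DIM('a) * (2 * j z - 1)) / (2 * N T)) has_derivative (\<lambda>z. (N T * snd z - (- N T * snd z)) / (2 * N T))) (at 0)"
  using has_derivative_divide[OF E has_derivative_const[of "2 * N T"]] N3 by (simp add: field_simps power2_eq_square)
 have "((\<lambda>z. ((exp (- N T * snd z) * j z ^ Suc DIM('a)) *\<^sub>R fst z, (exp (N T * snd z) - exp (- N T * snd z) * j z ^ DIM('a) * (2 * j z - 1)) / (2 * N T)))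
   has_derivative (\<lambda>z. (fst z, (N T * snd z - (- N T * snd z)) / (2 * N T)))) (at 0)"
  by (rule has_derivative_Pair[OF B F])
 then show ?thesis using N3 by (simp add: Pm_def[abs_def] j_def)
qed

text \<open>Undoes the factor -2 with which \<open>stereo\<close> moves away from the pole at
  -\<eta>, and the slope -2n of the vertical component, so that the limiting map has the identity as
  derivative at 0.\<close>

definition Lam :: "real \<Rightarrow> 'a \<times> real \<Rightarrow> 'a \<times> real"
 where "Lam c v = c *\<^sub>R ((- 1/2) *\<^sub>R fst v, (- 1 / (2 * N T)) * snd v)"

lemma Lam_linear: "bounded_linear (Lam c)"
 unfolding Lam_def
 by (intro bounded_linear_scaleR_right[THEN bounded_linear_compose, of _ c, simplified] bounded_linear_Pair
   bounded_linear_const_mult bounded_linear_fst bounded_linear_snd bounded_linear_const_scaleR)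

text \<open>The two conditions on \<kappa> say that D gives both components the same leading mass,
  so that at z = 0 the contributions of the two poles cancel.\<close>

lemma Lam_Hlim:
 assumes D: "0 < D" and \<kappa>: "Aint \<Omega> * D ^ DIM('a) = \<kappa>" "vB / D ^ DIM('a) = \<kappa>" "0 < \<kappa>"
 shows "Lam (m0 TYPE('a) / \<kappa>) (Hlim \<Omega> D stereo (0, -1) z) = Pm z"
proof -
 define q where "q = exp (snd z) ^ DIM('a)"
 have q: "0 < q" "exp (N T * snd z) = q" "exp (- N T * snd z) = 1 / q"
 proof -
  show "0 < q" by (simp add: q_def)
  show e: "exp (N T * snd z) = q" unfolding q_def by (rule exp_of_nat_mult)
  have "exp (- N T * snd z) = inverse (exp (N T * snd z))" by (simp add: exp_minus)
  then show "exp (- N T * snd z) = 1 / q" unfolding e by (simp add: inverse_eq_divide)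
 qed
 define J where "J = jb (fst z)"
 have J: "0 < J" "1 + fst z \<bullet> fst z = J" unfolding J_def by (rule jb_pos) (simp add: jb_def power2_norm_eq_inner)
 have Jp: "J powr (- N T) = (1 / J) ^ DIM('a)"
  using J(1) by (simp add: powr_minus_divide powr_realpow power_divide)
 have jm: "jb (- fst z) = J" by (simp add: J_def jb_def)
 have m: "m0 TYPE('a) \<noteq> 0" using m0_pos by simp
 have A: "(D * exp (snd z)) ^ DIM('a) * Aint \<Omega> = \<kappa> * q" using \<kappa>(1) by (simp add: power_mult_distrib q_def mult_ac)
 have B: "(1 / (D * exp (snd z)) ^ DIM('a)) * vB = \<kappa> * (1 / q)" using \<kappa>(2) by (simp add: power_mult_distrib q_def field_simps)
 have "Hlim \<Omega> D stereo (0, -1) z = (\<kappa> / m0 TYPE('a)) *\<^sub>R (q *\<^sub>R (0, -1) + ((1 / q) * (1 / J) ^ DIM('a)) *\<^sub>R stereo (- fst z))"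
  unfolding Hlim_def scaleR_scaleR mult.assoc[symmetric] A B J_def[symmetric] Jp
  by (simp add: scaleR_right_distrib mult_ac)
 also have "stereo (- fst z) = (- (2 / J) *\<^sub>R fst z, 2 / J - 1)" by (simp add: stereo_def jm)
 finally have H: "Hlim \<Omega> D stereo (0, -1) z = (\<kappa> / m0 TYPE('a)) *\<^sub>R (q *\<^sub>R (0, -1) + ((1 / q) * (1 / J) ^ DIM('a)) *\<^sub>R (- (2 / J) *\<^sub>R fst z, 2 / J - 1))" .
 show ?thesis
  unfolding H Lam_def Pm_def J(2) q(2,3) using m \<kappa>(3)
  by (simp add: scaleR_right_distrib field_simps)
qed

text \<open>Divided by \<rho>^(n/2) and transformed by \<open>Lam\<close>, the obstruction is a
  small continuous perturbation of \<open>Pm\<close>, hence close to the identity on small balls. So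
  it has zeros in every ball about 0 once \<rho> is small enough.\<close>

proposition reduced_problem:
 fixes b :: "'a set \<Rightarrow> 'a \<times> real"
 assumes \<Omega>: "open \<Omega>" "bounded \<Omega>" "0 \<in> \<Omega>" and m1: "0 < m1"
  and b1: "bary b" and b2: "bary_cont m1 b"
 obtains \<rho>0 D :: real and x :: "real \<Rightarrow> 'a \<times> real" where "0 < \<rho>0" "0 < D" "(x \<longlongrightarrow> 0) (at_right 0)"
  "\<And>\<rho>. 0 < \<rho> \<Longrightarrow> \<rho> < \<rho>0 \<Longrightarrow> measure mm (Ax \<Omega> D \<rho> (x \<rho>)) \<le> m1 \<and> b (Ax \<Omega> D \<rho> (x \<rho>)) = 0"
  "((\<lambda>\<rho>. measure mm (Ax \<Omega> D \<rho> (x \<rho>))) \<longlongrightarrow> 0) (at_right 0)"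
proof -
 have Ap: "0 < Aint \<Omega>" by (rule Aint_pos[OF \<Omega>])
 \<comment> \<open>The solution of \<open>Aint \<Omega>\<close> D^n = \<open>vB\<close> / D^n; it
   becomes the constant d of the theorem.\<close>
 define D where "D = (vB / Aint \<Omega>) powr (1 / (2 * N T))"
 have D: "0 < D" using vB Ap by (simp add: D_def)
 have DD: "D ^ DIM('a) * D ^ DIM('a) = vB / Aint \<Omega>"
 proof -
  have "D ^ DIM('a) * D ^ DIM('a) = D powr N T * D powr N T" using D by (simp add: powr_realpow)
  also have "\<dots> = (vB / Aint \<Omega>) powr (1 / (2 * N T) * N T + 1 / (2 * N T) * N T)"
   unfolding D_def by (simp only: powr_powr powr_add)
  also have "1 / (2 * N T) * N T + 1 / (2 * N T) * N T = 1" using N3 by simp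
  finally show ?thesis using vB Ap by simp
 qed
 define \<kappa> where "\<kappa> = Aint \<Omega> * D ^ DIM('a)"
 have \<kappa>: "0 < \<kappa>" using Ap D by (simp add: \<kappa>_def)
 have \<kappa>2: "vB / D ^ DIM('a) = \<kappa>" using DD D Ap by (simp add: \<kappa>_def field_simps)
 have Ab: "Ax \<Omega> D \<rho> x \<in> sets borel" for \<rho> x by (rule Ax_borel[OF \<Omega>(1)])
 let ?L = "Lam (m0 TYPE('a) / \<kappa>)"
 obtain cL where cL: "0 < cL" "\<And>v. norm (?L v) \<le> norm v * cL"
  using bounded_linear.pos_bounded[OF Lam_linear] by blast
 define H1 where "H1 = Hlim \<Omega> D (\<lambda>y::'a. 1::real) 1"
 have H1c: "continuous_on UNIV H1"
  unfolding H1_def Hlim_def[abs_def] using D by (intro continuous_intros) auto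
 then have "compact (H1 ` cball 0 1)" by (intro compact_continuous_image) (auto intro: continuous_on_subset)
 then have "bounded (H1 ` cball 0 1)" by (rule compact_imp_bounded)
 then obtain Mh where "\<forall>y\<in>H1 ` cball 0 1. norm y \<le> Mh" unfolding bounded_iff by blast
 then have Mh: "\<And>x. x \<in> cball 0 1 \<Longrightarrow> norm (H1 x) \<le> Mh" by blast
 have Mh0: "0 \<le> Mh" using Mh[of 0] norm_ge_zero[of "H1 0"] by simp
 have sq: "0 < sqrt \<rho> ^ DIM('a)" if "0 < \<rho>" for \<rho> :: real using that by simp
 obtain \<rho>a where \<rho>a: "0 < \<rho>a" "\<And>\<rho> x. 0 < \<rho> \<Longrightarrow> \<rho> < \<rho>a \<Longrightarrow> x \<in> cball 0 1 \<Longrightarrow> measure mm (Ax \<Omega> D \<rho> x) \<le> sqrt \<rho> ^ DIM('a) * (Mh + 1)"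
 proof -
  have "\<exists>\<rho>1>0. \<forall>\<rho> x. 0 < \<rho> \<longrightarrow> \<rho> < \<rho>1 \<longrightarrow> x \<in> cball 0 1 \<longrightarrow>
   norm ((1 / sqrt \<rho> ^ DIM('a)) *\<^sub>R (\<E> y. ind (Ax \<Omega> D \<rho> x) y *\<^sub>R (1::real)) - H1 x) < 1"
   unfolding H1_def by (rule unif_limit[OF \<Omega>(1,3) D, where B=1]) auto
  then obtain \<rho>1 where \<rho>1: "0 < \<rho>1" "\<And>\<rho> x. 0 < \<rho> \<Longrightarrow> \<rho> < \<rho>1 \<Longrightarrow> x \<in> cball 0 1 \<Longrightarrow>
   norm ((1 / sqrt \<rho> ^ DIM('a)) *\<^sub>R (\<E> y. ind (Ax \<Omega> D \<rho> x) y *\<^sub>R (1::real)) - H1 x) < 1" by blast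
  have "measure mm (Ax \<Omega> D \<rho> x) \<le> sqrt \<rho> ^ DIM('a) * (Mh + 1)" if "0 < \<rho>" "\<rho> < \<rho>1" "x \<in> cball 0 1" for \<rho> x
  proof -
   have "norm (measure mm (Ax \<Omega> D \<rho> x) / sqrt \<rho> ^ DIM('a) - H1 x) < 1" using \<rho>1(2)[OF that] Ab by simp
   then have "measure mm (Ax \<Omega> D \<rho> x) / sqrt \<rho> ^ DIM('a) \<le> Mh + 1" using Mh[OF that(3)] by simp
   then show ?thesis using sq[OF that(1)] by (simp add: field_simps)
  qed
  then show ?thesis using that \<rho>1(1) by blast
 qed
 have small: "\<exists>\<rho>1>0. \<forall>\<rho> x. 0 < \<rho> \<longrightarrow> \<rho> < \<rho>1 \<longrightarrow> x \<in> cball 0 1 \<longrightarrow> measure mm (Ax \<Omega> D \<rho> x) \<le> \<mu>" if \<mu>: "0 < \<mu>" for \<mu>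
 proof -
  have "((\<lambda>\<rho>. sqrt \<rho> ^ DIM('a) * (Mh + 1)) \<longlongrightarrow> sqrt 0 ^ DIM('a) * (Mh + 1)) (at_right 0)"
   by (intro tendsto_intros)
  moreover have "sqrt 0 ^ DIM('a) * (Mh + 1) = 0" by (simp add: zero_power)
  ultimately have "((\<lambda>\<rho>. sqrt \<rho> ^ DIM('a) * (Mh + 1)) \<longlongrightarrow> 0) (at_right 0)" by (simp only:)
  then have "\<forall>\<^sub>F \<rho> in at_right 0. sqrt \<rho> ^ DIM('a) * (Mh + 1) < \<mu>" using \<mu> by (rule order_tendstoD(2))
  then obtain \<rho>1 where \<rho>1: "0 < \<rho>1" "\<And>\<rho>. 0 < \<rho> \<Longrightarrow> \<rho> < \<rho>1 \<Longrightarrow> sqrt \<rho> ^ DIM('a) * (Mh + 1) < \<mu>"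
   unfolding eventually_at_right_field by blast
  show ?thesis
  proof (intro exI[of _ "min \<rho>1 \<rho>a"] conjI allI impI)
   show "0 < min \<rho>1 \<rho>a" using \<rho>1 \<rho>a by simp
   fix \<rho> x assume "0 < \<rho>" "\<rho> < min \<rho>1 \<rho>a" "x \<in> cball (0::'a \<times> real) 1"
   then show "measure mm (Ax \<Omega> D \<rho> x) \<le> \<mu>" using \<rho>a(2)[of \<rho> x] \<rho>1(2)[of \<rho>] by linarith
  qed
 qed
 have P0: "Pm 0 = 0" by (simp add: Pm_def zero_prod_def)
 obtain e0 where e0: "0 < e0" "e0 \<le> 1" "\<And>x. norm x \<le> e0 \<Longrightarrow> norm (Pm x - x) \<le> norm x / 2"
 proof -
  obtain d where d: "0 < d" "\<And>y. norm (y - 0) < d \<Longrightarrow> norm (Pm y - Pm 0 - (y - 0)) \<le> (1/2) * norm (y - 0)"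
   using Pm_deriv unfolding has_derivative_at_alt by (meson half_gt_zero zero_less_one)
  show ?thesis
  proof (rule that[of "min (d/2) 1"])
   show "norm (Pm x - x) \<le> norm x / 2" if "norm x \<le> min (d/2) 1" for x
    using d(2)[of x] d(1) that by (simp add: P0)
  qed (use d in auto)
 qed
 obtain \<rho>m where \<rho>m: "0 < \<rho>m" "\<And>\<rho> x. 0 < \<rho> \<Longrightarrow> \<rho> < \<rho>m \<Longrightarrow> x \<in> cball 0 1 \<Longrightarrow> measure mm (Ax \<Omega> D \<rho> x) \<le> m1"
  using small[OF m1] by blast
 have cont: "continuous_on (cball 0 1) (\<lambda>x. b (Ax \<Omega> D \<rho> x))" if \<rho>: "0 < \<rho>" "\<rho> < \<rho>m" for \<rho>
  unfolding continuous_on_sequentially o_def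
 proof (intro allI ballI impI, elim conjE)
  fix X :: "nat \<Rightarrow> 'a \<times> real" and x
  assume x: "x \<in> cball 0 1" and X: "\<forall>n. X n \<in> cball 0 1" "X \<leadsto> x"
  have cl: "closed (- Omega_rho \<Omega> \<rho>)" using Omega_rho_open[OF \<Omega>(1)] by (simp add: closed_Compl)
  have sd: "(\<lambda>k. measure mm (sym_diff (Ax \<Omega> D \<rho> (X k)) (Ax \<Omega> D \<rho> x))) \<leadsto> 0"
   unfolding Ax_def
   by (rule mm_sym_diff_tendsto[OF cl]) (use D \<rho> in \<open>auto intro!: tendsto_intros tendsto_fst tendsto_snd X(2)\<close>)
  show "(\<lambda>n. b (Ax \<Omega> D \<rho> (X n))) \<leadsto> b (Ax \<Omega> D \<rho> x)"
   unfolding tendsto_iff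
  proof (intro allI impI)
   fix e :: real assume e: "0 < e"
   then have "0 < e/2" by simp
   from b2[unfolded bary_cont_def, rule_format, OF this] obtain d where d: "0 < d" "\<And>A B. A \<in> sets borel \<Longrightarrow> B \<in> sets borel \<Longrightarrow> measure mm A \<le> m1 \<Longrightarrow> measure mm B \<le> m1 \<Longrightarrow>
    measure mm (sym_diff A B) \<le> d \<Longrightarrow> norm (b A - b B) \<le> e/2" by blast
   have "\<forall>\<^sub>F k in sequentially. measure mm (sym_diff (Ax \<Omega> D \<rho> (X k)) (Ax \<Omega> D \<rho> x)) < d"
    using sd d(1) by (simp add: order_tendsto_iff)
   then show "\<forall>\<^sub>F n in sequentially. dist (b (Ax \<Omega> D \<rho> (X n))) (b (Ax \<Omega> D \<rho> x)) < e"
   proof eventually_elim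
    case (elim n)
    have "norm (b (Ax \<Omega> D \<rho> (X n)) - b (Ax \<Omega> D \<rho> x)) \<le> e/2"
     using elim X x \<rho>m(2)[OF \<rho>] by (intro d(2) Ab) auto
    then show ?case using e by (simp add: dist_norm)
   qed
  qed
 qed
 have zero: "\<exists>\<rho>1>0. \<forall>\<rho>. 0 < \<rho> \<longrightarrow> \<rho> < \<rho>1 \<longrightarrow> (\<exists>x\<in>cball 0 e. b (Ax \<Omega> D \<rho> x) = 0)" if e: "0 < e" "e \<le> e0" for e
 proof -
  \<comment> \<open>Of the admissible error e one half is spent on the deviation of
    \<open>Pm\<close> from the identity. The other half is shared equally by the expansion of b,
    which fixes \<eta>, and the uniform limit; cL is the operator bound of
    \<open>Lam\<close>.\<close>
  define \<eta> where "\<eta> = e / (4 * cL * (Mh + 1))"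
  have \<eta>: "0 < \<eta>" using e cL Mh0 by (simp add: \<eta>_def)
  obtain m where m: "0 < m" "\<And>A. A \<in> sets borel \<Longrightarrow> measure mm A \<le> m \<Longrightarrow>
    norm (b A - (\<E> y. ind A y *\<^sub>R stereo y)) \<le> \<eta> * measure mm A" using b1 \<eta> unfolding bary_def mv_def by blast
  obtain \<rho>2 where \<rho>2: "0 < \<rho>2" "\<And>\<rho> x. 0 < \<rho> \<Longrightarrow> \<rho> < \<rho>2 \<Longrightarrow> x \<in> cball 0 1 \<Longrightarrow> measure mm (Ax \<Omega> D \<rho> x) \<le> m"
   using small[OF m(1)] by blast
  have "0 < e / (4 * cL)" using e cL by simp
  then have "\<exists>\<rho>1>0. \<forall>\<rho> x. 0 < \<rho> \<longrightarrow> \<rho> < \<rho>1 \<longrightarrow> x \<in> cball 0 1 \<longrightarrow>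
   norm ((1 / sqrt \<rho> ^ DIM('a)) *\<^sub>R (\<E> y. ind (Ax \<Omega> D \<rho> x) y *\<^sub>R stereo y) - Hlim \<Omega> D stereo (0, -1) x) < e / (4 * cL)"
   by (intro unif_limit[OF \<Omega>(1,3) D continuous_stereo, where B=1] stereo_at_infinity) (auto simp: norm_stereo)
  then obtain \<rho>3 where \<rho>3: "0 < \<rho>3" "\<And>\<rho> x. 0 < \<rho> \<Longrightarrow> \<rho> < \<rho>3 \<Longrightarrow> x \<in> cball 0 1 \<Longrightarrow>
   norm ((1 / sqrt \<rho> ^ DIM('a)) *\<^sub>R (\<E> y. ind (Ax \<Omega> D \<rho> x) y *\<^sub>R stereo y) - Hlim \<Omega> D stereo (0, -1) x) < e / (4 * cL)"
   by blast
  show ?thesis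
  proof (intro exI[of _ "min (min \<rho>2 \<rho>3) (min \<rho>a \<rho>m)"] conjI allI impI)
   show "0 < min (min \<rho>2 \<rho>3) (min \<rho>a \<rho>m)" using \<rho>2 \<rho>3 \<rho>a \<rho>m by simp
   fix \<rho> assume \<rho>: "0 < \<rho>" "\<rho> < min (min \<rho>2 \<rho>3) (min \<rho>a \<rho>m)"
   define G where "G x = ?L ((1 / sqrt \<rho> ^ DIM('a)) *\<^sub>R b (Ax \<Omega> D \<rho> x))" for x
   have Gc: "continuous_on (cball 0 e) G"
   proof -
    have "continuous_on (cball 0 1) G" unfolding G_def[abs_def]
     by (rule continuous_on_compose2[OF linear_continuous_on[OF Lam_linear, of UNIV]])
       (use \<rho> in \<open>auto intro!: continuous_intros cont\<close>)
    then show ?thesis by (rule continuous_on_subset) (use e e0 in auto)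
   qed
   have Gx: "norm (G x - x) \<le> e" if x: "x \<in> cball 0 e" for x
   proof -
    have x1: "x \<in> cball 0 1" using x e e0 by simp
    let ?A = "Ax \<Omega> D \<rho> x" and ?s = "1 / sqrt \<rho> ^ DIM('a)"
    let ?I = "\<integral>y. ind ?A y *\<^sub>R stereo y \<partial>mm"
    have s: "0 < ?s" using sq[OF \<rho>(1)] by simp
    have "norm (?s *\<^sub>R (b ?A - ?I)) = ?s * norm (b ?A - ?I)" using s by simp
    also have "\<dots> \<le> ?s * (\<eta> * measure mm ?A)"
     using \<rho> \<rho>2(2)[of \<rho> x] x1 s by (intro mult_left_mono m(2) Ab) auto
    also have "\<dots> \<le> ?s * (\<eta> * (sqrt \<rho> ^ DIM('a) * (Mh + 1)))"
     using \<rho> \<rho>a(2)[of \<rho> x] x1 s \<eta> by (intro mult_left_mono) auto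
    also have "\<dots> = \<eta> * (Mh + 1)"
    proof -
     have "1 / S * (a * (S * c)) = a * c" if "S \<noteq> 0" for S a c :: real using that by simp
     from this[OF less_imp_neq[OF sq[OF \<rho>(1)], symmetric]] show ?thesis .
    qed
    also have "\<dots> = e / (4 * cL)"
    proof -
     have "e / (c * t) * t = e / c" if "t \<noteq> 0" for c t :: real using that by simp
     then show ?thesis unfolding \<eta>_def using Mh0 by simp
    qed
    finally have 1: "norm (?s *\<^sub>R (b ?A - ?I)) \<le> e / (4 * cL)" .
    have 2: "norm (?s *\<^sub>R ?I - Hlim \<Omega> D stereo (0, -1) x) \<le> e / (4 * cL)"
     using \<rho>3(2)[of \<rho> x] \<rho> x1 by simp
    have "?s *\<^sub>R b ?A - Hlim \<Omega> D stereo (0, -1) x = ?s *\<^sub>R (b ?A - ?I) + (?s *\<^sub>R ?I - Hlim \<Omega> D stereo (0, -1) x)"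
     by (simp add: scaleR_right_diff_distrib)
    then have "norm (?s *\<^sub>R b ?A - Hlim \<Omega> D stereo (0, -1) x) \<le> e / (4 * cL) + e / (4 * cL)"
     by (simp only:) (rule order_trans[OF norm_triangle_ineq add_mono[OF 1 2]])
    also have "\<dots> = e / (2 * cL)" by (simp add: field_simps)
    finally have 3: "norm (?s *\<^sub>R b ?A - Hlim \<Omega> D stereo (0, -1) x) \<le> e / (2 * cL)" .
    have "G x - Pm x = ?L (?s *\<^sub>R b ?A - Hlim \<Omega> D stereo (0, -1) x)"
     unfolding G_def Lam_Hlim[OF D \<kappa>_def[symmetric] \<kappa>2 \<kappa>, symmetric]
     by (rule linear_diff[OF bounded_linear.linear[OF Lam_linear], symmetric])
    then have "norm (G x - Pm x) \<le> norm (?s *\<^sub>R b ?A - Hlim \<Omega> D stereo (0, -1) x) * cL" using cL(2) by simp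
    also have "\<dots> \<le> e / (2 * cL) * cL" using 3 cL(1) by (intro mult_right_mono) auto
    also have "\<dots> = e / 2" using cL(1) by simp
    finally have 4: "norm (G x - Pm x) \<le> e / 2" .
    have 5: "norm (Pm x - x) \<le> e / 2" using e0(3)[of x] x e by simp
    have "G x - x = (G x - Pm x) + (Pm x - x)" by simp
    then show ?thesis using norm_triangle_ineq[of "G x - Pm x" "Pm x - x"] 4 5 by simp
   qed
   \<comment> \<open>A fixed point of x - G x is a zero of G, and |G x - x| \<le> e says that this
     map preserves the ball.\<close>
   obtain x where x: "x \<in> cball 0 e" "x - G x = x"
   proof (rule brouwer_ball[OF e(1), of 0 "\<lambda>x. x - G x"])
    show "continuous_on (cball 0 e) (\<lambda>x. x - G x)" by (intro continuous_intros Gc)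
    show "(\<lambda>x. x - G x) \<in> cball 0 e \<rightarrow> cball 0 e"
     using Gx by (auto simp: dist_norm norm_minus_commute)
   qed (rule that)
   then have "G x = 0" by simp
   moreover have "v = 0" if "?L v = 0" for v
    using that m0_pos \<kappa> N3 by (cases v) (auto simp: Lam_def zero_prod_def)
   ultimately have "(1 / sqrt \<rho> ^ DIM('a)) *\<^sub>R b (Ax \<Omega> D \<rho> x) = 0" unfolding G_def by blast
   then have "b (Ax \<Omega> D \<rho> x) = 0" using \<rho>(1) by simp
   then show "\<exists>x\<in>cball 0 e. b (Ax \<Omega> D \<rho> x) = 0" using x(1) by blast
  qed
 qed
 obtain \<rho>z where \<rho>z: "0 < \<rho>z" "\<And>\<rho>. 0 < \<rho> \<Longrightarrow> \<rho> < \<rho>z \<Longrightarrow> \<exists>x\<in>cball 0 e0. b (Ax \<Omega> D \<rho> x) = 0"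
  using zero[OF e0(1)] by blast
 \<comment> \<open>The zeros may be far from unique. A zero whose norm is within \<rho> of the
   infimum must tend to 0 with \<rho>, because every small ball about 0 contains zeros.\<close>
 define good where "good \<rho> x \<longleftrightarrow> x \<in> cball 0 e0 \<and> b (Ax \<Omega> D \<rho> x) = 0 \<and>
   (\<forall>z\<in>cball 0 e0. b (Ax \<Omega> D \<rho> z) = 0 \<longrightarrow> norm x \<le> norm z + \<rho>)" for \<rho> x
 have ex: "\<exists>x. good \<rho> x" if \<rho>: "0 < \<rho>" "\<rho> < \<rho>z" for \<rho>
 proof -
  let ?S = "norm ` {x \<in> cball 0 e0. b (Ax \<Omega> D \<rho> x) = 0}"
  have ne: "?S \<noteq> {}" using \<rho>z(2)[OF \<rho>] by blast
  have bd: "bdd_below ?S" by (rule bdd_belowI[of _ 0]) auto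
  have "Inf ?S < Inf ?S + \<rho>" using \<rho> by simp
  then obtain s where s: "s \<in> ?S" "s < Inf ?S + \<rho>" using cInf_lessD[OF ne] by blast
  then obtain x where x: "x \<in> cball 0 e0" "b (Ax \<Omega> D \<rho> x) = 0" "s = norm x" by blast
  have "norm x \<le> norm z + \<rho>" if "z \<in> cball 0 e0" "b (Ax \<Omega> D \<rho> z) = 0" for z
  proof -
   have "Inf ?S \<le> norm z" by (rule cInf_lower[OF _ bd]) (use that in auto)
   then show ?thesis using s x by simp
  qed
  then show ?thesis using x unfolding good_def by blast
 qed
 define x where "x \<rho> = (SOME x. good \<rho> x)" for \<rho>
 have x: "good \<rho> (x \<rho>)" if "0 < \<rho>" "\<rho> < \<rho>z" for \<rho>
  unfolding x_def using ex[OF that] by (rule someI_ex)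
 have x1: "x \<rho> \<in> cball 0 1" if "0 < \<rho>" "\<rho> < \<rho>z" for \<rho>
  using x[OF that] e0 by (simp add: good_def)
 show ?thesis
 proof (rule that[of "min \<rho>z \<rho>m" D x])
  show "0 < min \<rho>z \<rho>m" using \<rho>z \<rho>m by simp
  show "0 < D" by (rule D)
  show "measure mm (Ax \<Omega> D \<rho> (x \<rho>)) \<le> m1 \<and> b (Ax \<Omega> D \<rho> (x \<rho>)) = 0" if "0 < \<rho>" "\<rho> < min \<rho>z \<rho>m" for \<rho>
   using x[of \<rho>] x1[of \<rho>] \<rho>m(2)[of \<rho> "x \<rho>"] that by (simp add: good_def)
  show "(x \<longlongrightarrow> 0) (at_right 0)"
   unfolding tendsto_iff
  proof (intro allI impI)
   fix e :: real assume e: "0 < e"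
   define e' where "e' = min (e/2) e0"
   have e': "0 < e'" "e' \<le> e0" "e' \<le> e/2" using e e0 by (auto simp: e'_def)
   obtain \<rho>1 where \<rho>1: "0 < \<rho>1" "\<And>\<rho>. 0 < \<rho> \<Longrightarrow> \<rho> < \<rho>1 \<Longrightarrow> \<exists>x\<in>cball 0 e'. b (Ax \<Omega> D \<rho> x) = 0"
    using zero[OF e'(1,2)] by blast
   show "\<forall>\<^sub>F \<rho> in at_right 0. dist (x \<rho>) 0 < e"
    unfolding eventually_at_right_field
   proof (intro exI[of _ "min (min \<rho>1 \<rho>z) (e/2)"] conjI allI impI)
    show "0 < min (min \<rho>1 \<rho>z) (e/2)" using \<rho>1 \<rho>z e by simp
    fix \<rho> :: real assume \<rho>: "0 < \<rho>" "\<rho> < min (min \<rho>1 \<rho>z) (e/2)"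
    have "\<rho> < \<rho>1" using \<rho> by simp
    then obtain z where z: "z \<in> cball 0 e'" "b (Ax \<Omega> D \<rho> z) = 0" using \<rho>1(2)[OF \<rho>(1)] by blast
    have "z \<in> cball 0 e0" using z e' by simp
    moreover have "good \<rho> (x \<rho>)" using \<rho> by (intro x) auto
    ultimately have "norm (x \<rho>) \<le> norm z + \<rho>" using z(2) unfolding good_def by blast
    then show "dist (x \<rho>) 0 < e" using z \<rho> e' by simp
   qed
  qed
  show "((\<lambda>\<rho>. measure mm (Ax \<Omega> D \<rho> (x \<rho>))) \<longlongrightarrow> 0) (at_right 0)"
   unfolding tendsto_iff
  proof (intro allI impI)
   fix e :: real assume e: "0 < e"
   then have "0 < e/2" by simp
   then obtain \<rho>1 where \<rho>1: "0 < \<rho>1" "\<And>\<rho> x. 0 < \<rho> \<Longrightarrow> \<rho> < \<rho>1 \<Longrightarrow> x \<in> cball 0 1 \<Longrightarrow> measure mm (Ax \<Omega> D \<rho> x) \<le> e/2"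
    using small by blast
   show "\<forall>\<^sub>F \<rho> in at_right 0. dist (measure mm (Ax \<Omega> D \<rho> (x \<rho>))) 0 < e"
    unfolding eventually_at_right_field
   proof (intro exI[of _ "min \<rho>1 \<rho>z"] conjI allI impI)
    show "0 < min \<rho>1 \<rho>z" using \<rho>1 \<rho>z by simp
    fix \<rho> :: real assume \<rho>: "0 < \<rho>" "\<rho> < min \<rho>1 \<rho>z"
    then have "measure mm (Ax \<Omega> D \<rho> (x \<rho>)) \<le> e/2" using x1[of \<rho>] by (intro \<rho>1(2)) auto
    then show "dist (measure mm (Ax \<Omega> D \<rho> (x \<rho>))) 0 < e" using e by simp
   qed
  qed
 qed
qed

end

section \<open>Test functions and weak gradients\<close>

lemma Ck_continuous: "Ck k f \<Longrightarrow> continuous_on UNIV f"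
 by (cases k) auto

lemma Ck_Suc_mono: "Ck (Suc k) f \<Longrightarrow> Ck k f"
proof (induction k arbitrary: f)
 case 0
 then show ?case by simp
next
 case (Suc k)
 have "Ck k (\<lambda>x. frechet_derivative f (at x) i)" if "i \<in> Basis" for i
  using Suc.prems that by (intro Suc.IH) simp
 then show ?case using Suc.prems by simp
qed

lemma Ck_SucI:
 assumes "\<And>x. (f has_derivative D x) (at x)" "\<And>i. i \<in> Basis \<Longrightarrow> Ck k (\<lambda>x. D x i)"
 shows "Ck (Suc k) f"
proof -
 have fd: "frechet_derivative f (at x) = D x" for x
  using frechet_derivative_at[OF assms(1)[of x]] by simp
 have "f differentiable (at x)" for x using assms(1) by (auto simp: differentiable_def)
 moreover have "continuous_on UNIV f"
  using assms(1) by (meson continuous_at_imp_continuous_on has_derivative_continuous)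
 ultimately show ?thesis using assms(2) by (simp add: fd)
qed

lemma Ck_SucD:
 assumes "Ck (Suc k) f"
 shows "(f has_derivative frechet_derivative f (at x)) (at x)"
  and "i \<in> Basis \<Longrightarrow> Ck k (\<lambda>x. frechet_derivative f (at x) i)"
 using assms by (auto simp: frechet_derivative_works[symmetric])

lemma Ck_const: "Ck k (\<lambda>x. c)"
proof (induction k arbitrary: c)
 case (Suc k)
 show ?case by (rule Ck_SucI[where D="\<lambda>x h. 0"]) (auto intro: Suc)
qed simp

lemma Ck_add: "Ck k f \<Longrightarrow> Ck k g \<Longrightarrow> Ck k (\<lambda>x. f x + g x)"
proof (induction k arbitrary: f g)
 case 0
 then show ?case by (simp add: continuous_on_add)
next
 case (Suc k)
 show ?case
  by (rule Ck_SucI[OF has_derivative_add[OF Ck_SucD(1)[OF Suc.prems(1)] Ck_SucD(1)[OF Suc.prems(2)]]])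
    (intro Suc.IH Ck_SucD(2) Suc.prems)
qed

lemma Ck_mult: "Ck k f \<Longrightarrow> Ck k g \<Longrightarrow> Ck k (\<lambda>x. f x * g x)"
proof (induction k arbitrary: f g)
 case 0
 then show ?case by (simp add: continuous_on_mult)
next
 case (Suc k)
 show ?case
  by (rule Ck_SucI[OF has_derivative_mult[OF Ck_SucD(1)[OF Suc.prems(1)] Ck_SucD(1)[OF Suc.prems(2)]]])
    (intro Ck_add Suc.IH Ck_SucD(2) Ck_Suc_mono[OF Suc.prems(1)] Ck_Suc_mono[OF Suc.prems(2)] Suc.prems)
qed

lemma Ck_inner: "Ck k (\<lambda>x. x \<bullet> v)"
proof (cases k)
 case (Suc m)
 have "Ck (Suc m) (\<lambda>x. x \<bullet> v)"
  by (rule Ck_SucI[where D="\<lambda>x h. h \<bullet> v"]) (auto intro!: derivative_eq_intros Ck_const)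
 then show ?thesis using Suc by simp
qed (simp add: continuous_on_inner)

lemma Ck_sum: "(\<And>i. i \<in> I \<Longrightarrow> Ck k (f i)) \<Longrightarrow> Ck k (\<lambda>x. \<Sum>i\<in>I. f i x)"
proof (induction I rule: infinite_finite_induct)
 case (insert i F)
 then show ?case using Ck_add[of k "f i" "\<lambda>x. \<Sum>i\<in>F. f i x"] by simp
qed (auto simp: Ck_const)

lemma Ck_prod: "(\<And>i. i \<in> I \<Longrightarrow> Ck k (f i)) \<Longrightarrow> Ck k (\<lambda>x. \<Prod>i\<in>I. f i x)"
proof (induction I rule: infinite_finite_induct)
 case (insert i F)
 then show ?case using Ck_mult[of k "f i" "\<lambda>x. \<Prod>i\<in>F. f i x"] by simp
qed (auto simp: Ck_const)

text \<open>Differentiating one member of the family calls for others, so the induction on the order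
  k treats all of them at once; \<open>rec\<close> expresses that the derivatives are built from the
  family.\<close>

lemma Ck_compose_real:
 fixes g :: "'a::euclidean_space \<Rightarrow> real"
 assumes \<phi>: "\<And>j t. t \<in> S \<Longrightarrow> (\<phi> j has_real_derivative \<phi>' j t) (at t)"
  and rec: "\<And>k j (g :: 'a \<Rightarrow> real). (\<And>i. Ck k (\<lambda>x. \<phi> i (g x))) \<Longrightarrow> Ck k (\<lambda>x. \<phi>' j (g x))"
  and g: "smooth g" "\<And>x. g x \<in> S"
 shows "Ck k (\<lambda>x. \<phi> j (g x))"
proof (induction k arbitrary: j)
 case 0
 have "isCont (\<lambda>x. \<phi> j (g x)) x" for x
 proof (rule isCont_o2[where g="\<phi> j"])
  show "isCont g x" using g(1) Ck_continuous[of 0 g] by (simp add: smooth_def continuous_on_eq_continuous_at)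
  show "isCont (\<phi> j) (g x)" using \<phi>[OF g(2)] by (rule DERIV_isCont)
 qed
 then show ?case by (simp add: continuous_at_imp_continuous_on)
next
 case (Suc k)
 have gk: "Ck (Suc k) g" using g(1) by (simp add: smooth_def)
 have "((\<lambda>x. \<phi> j (g x)) has_derivative (\<lambda>h. frechet_derivative g (at x) h * \<phi>' j (g x))) (at x)" for x
  by (rule DERIV_compose_FDERIV[OF \<phi>[OF g(2)] Ck_SucD(1)[OF gk]])
 then show ?case
 proof (rule Ck_SucI)
  show "Ck k (\<lambda>x. frechet_derivative g (at x) i * \<phi>' j (g x))" if "i \<in> Basis" for i
   by (rule Ck_mult[OF Ck_SucD(2)[OF gk that] rec[where k=k and j=j and g=g, OF Suc.IH]])
 qed
qed

lemma smooth_const: "smooth (\<lambda>x. c)"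
 by (simp add: smooth_def Ck_const)

lemma smooth_add: "smooth f \<Longrightarrow> smooth g \<Longrightarrow> smooth (\<lambda>x. f x + g x)"
 by (simp add: smooth_def Ck_add)

lemma smooth_mult: "smooth f \<Longrightarrow> smooth g \<Longrightarrow> smooth (\<lambda>x. f x * g x)"
 by (simp add: smooth_def Ck_mult)

lemma smooth_inner: "smooth (\<lambda>x. x \<bullet> v)"
 by (simp add: smooth_def Ck_inner)

lemma smooth_sum: "(\<And>i. i \<in> I \<Longrightarrow> smooth (f i)) \<Longrightarrow> smooth (\<lambda>x. \<Sum>i\<in>I. f i x)"
 by (simp add: smooth_def Ck_sum)

lemma smooth_prod: "(\<And>i. i \<in> I \<Longrightarrow> smooth (f i)) \<Longrightarrow> smooth (\<lambda>x. \<Prod>i\<in>I. f i x)"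
 by (simp add: smooth_def Ck_prod)

lemma smooth_diff_const: "smooth f \<Longrightarrow> smooth (\<lambda>x. f x - c)"
 using smooth_add[OF _ smooth_const[of "-c"], of f] by simp

lemma smooth_powr:
 fixes g :: "'a::euclidean_space \<Rightarrow> real"
 assumes "smooth g" "\<And>x. 0 < g x"
 shows "smooth (\<lambda>x. g x powr a)"
 unfolding smooth_def
proof
 fix k
 have "Ck k (\<lambda>x. g x powr (a - real j))" for j :: nat
 proof (rule Ck_compose_real[where \<phi>="\<lambda>j t. t powr (a - real j)" and S="{0<..}"
    and \<phi>'="\<lambda>j t. (a - real j) * t powr (a - real (Suc j))"])
  show "((\<lambda>t. t powr (a - real j)) has_real_derivative (a - real j) * t powr (a - real (Suc j))) (at t)" if "t \<in> {0<..}" for j t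
  proof -
   have "((\<lambda>t. t powr (a - real j)) has_real_derivative (a - real j) * t powr (a - real j - 1)) (at t)"
    using that by (intro has_real_derivative_powr) simp
   moreover have "a - real j - 1 = a - real (Suc j)" by simp
   ultimately show ?thesis by (simp only:)
  qed
  show "Ck k (\<lambda>x. (a - real j) * g x powr (a - real (Suc j)))" if "\<And>i. Ck k (\<lambda>x. g x powr (a - real i))" for k j and g :: "'a \<Rightarrow> real"
   by (intro Ck_mult Ck_const that)
 qed (use assms in auto)
 from this[of 0] show "Ck k (\<lambda>x. g x powr a)" by simp
qed

lemma smooth_norm_sq: "smooth (\<lambda>y::'a::euclidean_space. (norm (y - x))\<^sup>2)"
proof -
 have "smooth (\<lambda>y::'a. \<Sum>i\<in>Basis. (y \<bullet> i - x \<bullet> i) * (y \<bullet> i - x \<bullet> i))"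
  by (intro smooth_sum smooth_mult smooth_diff_const smooth_inner)
 moreover have "(\<lambda>y::'a. \<Sum>i\<in>Basis. (y \<bullet> i - x \<bullet> i) * (y \<bullet> i - x \<bullet> i)) = (\<lambda>y. (norm (y - x))\<^sup>2)"
 proof
  fix y
  have "(norm (y - x))\<^sup>2 = (\<Sum>i\<in>Basis. ((y - x) \<bullet> i) * ((y - x) \<bullet> i))"
   unfolding power2_norm_eq_inner by (rule euclidean_inner)
  then show "(\<Sum>i\<in>Basis. (y \<bullet> i - x \<bullet> i) * (y \<bullet> i - x \<bullet> i)) = (norm (y - x))\<^sup>2"
   by (simp add: inner_diff_left)
 qed
 ultimately show ?thesis by simp
qed

lemma smooth_hb:
 assumes "smooth g"
 shows "smooth (\<lambda>x. hb j (g x))"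
 unfolding smooth_def
proof
 fix k
 show "Ck k (\<lambda>x. hb j (g x))"
 proof (rule Ck_compose_real[where \<phi>=hb and S=UNIV and \<phi>'="\<lambda>j t. - real j * hb (Suc j) t + hb (j + 2) t"])
  show "Ck k (\<lambda>x. - real j * hb (Suc j) (g x) + hb (j + 2) (g x))" if "\<And>i. Ck k (\<lambda>x. hb i (g x))" for k j and g :: "'a \<Rightarrow> real"
   by (intro Ck_add Ck_mult Ck_const that)
 qed (rule hb_deriv assms UNIV_I)+
qed

lemma test_funI:
 assumes "smooth f" "bounded {x. f x \<noteq> 0}"
 shows "test_fun f"
 using assms by (simp add: test_fun_def compact_closure)

lemma smooth_has_derivative:
 assumes "smooth f"
 shows "(f has_derivative frechet_derivative f (at x)) (at x)"
proof -
 have "Ck (Suc 0) f" using assms unfolding smooth_def by blast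
 then show ?thesis by (rule Ck_SucD(1))
qed

lemma pd_frechet:
 assumes "smooth f"
 shows "pd i f (\<lambda>x. frechet_derivative f (at x) i)"
 unfolding pd_def
proof
 fix x
 have f: "(f has_derivative frechet_derivative f (at x)) (at x)"
  by (rule smooth_has_derivative[OF assms(1)])
 then have f0: "(f has_derivative frechet_derivative f (at x)) (at (x + 0 *\<^sub>R i))" by simp
 have g: "((\<lambda>t. x + t *\<^sub>R i) has_derivative (\<lambda>t. t *\<^sub>R i)) (at 0)" by (auto intro!: derivative_eq_intros)
 have l: "linear (frechet_derivative f (at x))" using f by (rule has_derivative_linear)
 have "((\<lambda>t. f (x + t *\<^sub>R i)) has_derivative (\<lambda>t. frechet_derivative f (at x) (t *\<^sub>R i))) (at 0)"
  by (rule has_derivative_compose[OF g f0])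
 then have "((\<lambda>t. f (x + t *\<^sub>R i)) has_derivative (\<lambda>t. frechet_derivative f (at x) i * t)) (at 0)"
  by (simp add: linear_scale[OF l] mult.commute)
 then show "((\<lambda>t. f (x + t *\<^sub>R i)) has_real_derivative frechet_derivative f (at x) i) (at 0)"
  by (simp add: has_field_derivative_def)
qed

lemma frechet_pd:
 assumes "smooth f" "pd i f f'"
 shows "frechet_derivative f (at x) i = f' x"
 using pd_frechet[OF assms(1), of i] assms(2) unfolding pd_def by (blast intro: DERIV_unique)

lemma test_fun_dec:
 assumes "test_fun f"
 shows "dec b f" and "i \<in> Basis \<Longrightarrow> dec b (\<lambda>x. frechet_derivative f (at x) i)"
proof -
 let ?K = "closure {x. f x \<noteq> 0}"
 have s: "smooth f" and K: "compact ?K" using assms by (auto simp: test_fun_def)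
 show "dec b f"
  by (rule compact_support_dec[OF _ K]) (use s closure_subset[of "{x. f x \<noteq> 0}"] in \<open>auto simp: smooth_def intro: Ck_continuous\<close>)
 assume i: "i \<in> Basis"
 show "dec b (\<lambda>x. frechet_derivative f (at x) i)"
 proof (rule compact_support_dec[OF _ K])
  show "continuous_on UNIV (\<lambda>x. frechet_derivative f (at x) i)"
   using s i Ck_SucD(2)[of 0 f i] Ck_continuous by (auto simp: smooth_def)
  fix x assume x: "x \<notin> ?K"
  have "(f has_derivative (\<lambda>h. 0)) (at x)"
   by (rule has_derivative_transform_within_open[where s="- ?K" and f="\<lambda>x. 0"])
     (use x closure_subset[of "{x. f x \<noteq> 0}"] in \<open>auto simp: open_Compl\<close>)
  then show "frechet_derivative f (at x) i = 0" using frechet_derivative_at by metis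
 qed
qed

section \<open>Borel representatives and uniqueness of weak gradients\<close>

lemma integrable_lebesgue_iff:
 fixes f :: "'a::euclidean_space \<Rightarrow> 'b::{banach, second_countable_topology}"
 assumes "f \<in> BM"
 shows "integrable lebesgue f \<longleftrightarrow> LI f" "integral\<^sup>L lebesgue f = integral\<^sup>L lborel f"
 using assms by (simp_all add: integrable_completion integral_completion)

lemma borel_representative:
 fixes f :: "'a::euclidean_space \<Rightarrow> real"
 assumes "f \<in> borel_measurable lebesgue"
 obtains g where "g \<in> BM" "AE x in lebesgue. f x = g x"
proof -
 obtain g where g: "g \<in> borel_measurable lborel" "AE x in lborel. f x = g x"
  using completion_ex_borel_measurable_real[OF assms] by blast
 then show ?thesis using that[of g] by (auto intro: AE_completion)
qed

text \<open>The positive and the negative part of D are densities of two measures that agree and are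
  finite on boxes, an intersection-stable generator. The measures therefore coincide, and so do
  their densities.\<close>

lemma box_zero_AE_zero:
 fixes D :: "'a::euclidean_space \<Rightarrow> real"
 assumes [measurable]: "D \<in> BM"
  and i: "\<And>a b. LI (\<lambda>x. ind (box a b) x * D x)"
  and z: "\<And>a b. (LBINT x. ind (box a b) x * D x) = 0"
 shows "AE x in lborel. D x = 0"
proof -
 define P where "P x = ennreal (max 0 (D x))" for x
 define M where "M x = ennreal (max 0 (- D x))" for x
 have [measurable]: "P \<in> BM" "M \<in> BM"
  unfolding P_def[abs_def] M_def[abs_def] by measurable
 have box: "emeasure (density lborel P) (box a b) = emeasure (density lborel M) (box a b)"
  and fin: "emeasure (density lborel P) (box a b) \<noteq> \<infinity>" for a b :: 'a
 proof -
  let ?p = "\<lambda>x. ind (box a b) x * max 0 (D x)" and ?m = "\<lambda>x. ind (box a b) x * max 0 (- D x)"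
  have ip: "LI ?p"
   by (rule integrable_dom[OF i[of a b]]) (auto simp: indicator_def)
  have im: "LI ?m"
   by (rule integrable_dom[OF i[of a b]]) (auto simp: indicator_def)
  have "(LBINT x. ?p x) - (LBINT x. ?m x) = (LBINT x. ?p x - ?m x)"
   using ip im by simp
  also have "(\<lambda>x. ?p x - ?m x) = (\<lambda>x. ind (box a b) x * D x)" by (auto simp: fun_eq_iff indicator_def max_def)
  finally have e: "(LBINT x. ?p x) = (LBINT x. ?m x)" using z by simp
  have "emeasure (density lborel P) (box a b) = (\<integral>\<^sup>+x. ennreal (?p x) \<partial>lborel)"
   by (subst emeasure_density) (auto simp: P_def indicator_def intro!: nn_integral_cong)
  also have "\<dots> = ennreal (LBINT x. ?p x)" using ip by (intro nn_integral_eq_integral) auto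
  finally have 1: "emeasure (density lborel P) (box a b) = ennreal (LBINT x. ?p x)" .
  have "emeasure (density lborel M) (box a b) = (\<integral>\<^sup>+x. ennreal (?m x) \<partial>lborel)"
   by (subst emeasure_density) (auto simp: M_def indicator_def intro!: nn_integral_cong)
  also have "\<dots> = ennreal (LBINT x. ?m x)" using im by (intro nn_integral_eq_integral) auto
  finally show "emeasure (density lborel P) (box a b) = emeasure (density lborel M) (box a b)" using 1 e by simp
  show "emeasure (density lborel P) (box a b) \<noteq> \<infinity>" using 1 by simp
 qed
 have "density lborel P = density lborel M"
 proof (rule measure_eqI_generator_eq)
  let ?E = "range (\<lambda>(a, b). box a b::'a set)"
  show "Int_stable ?E" by (auto simp: Int_stable_def box_Int_box)
  show "?E \<subseteq> Pow UNIV" "sets (density lborel P) = sigma_sets UNIV ?E" "sets (density lborel M) = sigma_sets UNIV ?E"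
   by (simp_all add: borel_eq_box)
  let ?A = "\<lambda>n::nat. box (- (real n *\<^sub>R One)) (real n *\<^sub>R One) :: 'a set"
  show "range ?A \<subseteq> ?E" "(\<Union>i. ?A i) = UNIV" unfolding UN_box_eq_UNIV by auto
  show "emeasure (density lborel P) (?A i) \<noteq> \<infinity>" for i by (rule fin)
  show "emeasure (density lborel P) X = emeasure (density lborel M) X" if "X \<in> ?E" for X using that box by auto
 qed
 then have "AE x in lborel. P x = M x" by (intro sigma_finite_measure.density_unique[OF sigma_finite_lborel]) auto
 then show ?thesis
 proof eventually_elim
  case (elim x)
  then have "max 0 (D x) = max 0 (- D x)" by (simp add: P_def M_def)
  then show ?case by (simp add: max_def split: if_splits)
 qed
qed

text \<open>A smooth approximation of the indicator of an open box: each factor exp(-1 / (k s))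
  tends to 1 for s > 0 and is 0 otherwise.\<close>

definition bx :: "'a::euclidean_space \<Rightarrow> 'a \<Rightarrow> nat \<Rightarrow> 'a \<Rightarrow> real"
 where "bx a b k x = (\<Prod>i\<in>Basis. hb 0 (real k * (x \<bullet> i - a \<bullet> i)) * hb 0 (real k * (b \<bullet> i - x \<bullet> i)))"

lemma bx_test_fun: "test_fun (bx a b k)"
proof (rule test_funI)
 have s2: "smooth (\<lambda>x. real k * (b \<bullet> i - x \<bullet> i))" for i :: 'a
 proof -
  have "smooth (\<lambda>x. real k * (b \<bullet> i) + (- real k) * (x \<bullet> i))" by (intro smooth_add smooth_mult smooth_const smooth_inner)
  then show ?thesis by (simp add: algebra_simps)
 qed
 show "smooth (bx a b k)" unfolding bx_def[abs_def]
  by (intro smooth_prod smooth_mult smooth_hb smooth_const smooth_diff_const smooth_inner s2)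
 have "{x. bx a b k x \<noteq> 0} \<subseteq> cbox a b"
 proof
  fix x assume "x \<in> {x. bx a b k x \<noteq> 0}"
  then have "hb 0 (real k * (x \<bullet> i - a \<bullet> i)) \<noteq> 0" "hb 0 (real k * (b \<bullet> i - x \<bullet> i)) \<noteq> 0" if "i \<in> Basis" for i
   using that by (auto simp: bx_def)
  then have "0 < real k * (x \<bullet> i - a \<bullet> i)" "0 < real k * (b \<bullet> i - x \<bullet> i)" if "i \<in> Basis" for i
   using that unfolding hb_def by meson+
  then show "x \<in> cbox a b" by (auto simp: mem_box zero_less_mult_iff less_imp_le)
 qed
 then show "bounded {x. bx a b k x \<noteq> 0}" by (rule bounded_subset[rotated]) simp
qed

lemma bx_bounds: "0 \<le> bx a b k x" "bx a b k x \<le> ind (cbox a b) x"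
proof -
 show "0 \<le> bx a b k x" unfolding bx_def by (intro prod_nonneg mult_nonneg_nonneg ballI hb_nonneg)
 have le: "bx a b k x \<le> 1" unfolding bx_def
  by (intro prod_le_1 conjI mult_nonneg_nonneg hb_nonneg mult_le_one hb0_le)
 show "bx a b k x \<le> ind (cbox a b) x"
 proof (cases "x \<in> cbox a b")
  case False
  then obtain i where i: "i \<in> Basis" "x \<bullet> i < a \<bullet> i \<or> b \<bullet> i < x \<bullet> i" by (auto simp: mem_box not_le)
  then have "hb 0 (real k * (x \<bullet> i - a \<bullet> i)) * hb 0 (real k * (b \<bullet> i - x \<bullet> i)) = 0"
   by (auto simp: hb_def zero_less_mult_iff)
  then have "bx a b k x = 0" unfolding bx_def using i(1) by (intro prod_zero) auto
  then show ?thesis by simp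
 qed (use le in simp)
qed

lemma hb0_limit: "(\<lambda>k. hb 0 (real k * s)) \<leadsto> (if 0 < s then 1 else 0)"
proof (cases "0 < s")
 case True
 have "(\<lambda>k. exp (- (1 / s) * (1 / real k))) \<leadsto> exp (- (1 / s) * 0)"
  by (intro tendsto_intros lim_1_over_n)
 then have "(\<lambda>k. exp (- (1 / s) * (1 / real k))) \<leadsto> 1" by simp
 then have "(\<lambda>k. hb 0 (real k * s)) \<leadsto> 1"
 proof (rule Lim_transform_eventually)
  show "\<forall>\<^sub>F k in sequentially. exp (- (1 / s) * (1 / real k)) = hb 0 (real k * s)"
   unfolding eventually_sequentially using True by (intro exI[of _ 1]) (auto simp: hb_def field_simps)
 qed
 then show ?thesis using True by simp
next
 case False
 then have "hb 0 (real k * s) = 0" for k by (auto simp: hb_def zero_less_mult_iff)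
 then show ?thesis using False by simp
qed

lemma bx_limit: "(\<lambda>k. bx a b k x) \<leadsto> ind (box a b) x"
proof -
 have "(\<lambda>k. bx a b k x) \<leadsto> (\<Prod>i\<in>Basis. (if 0 < x \<bullet> i - a \<bullet> i then 1 else 0) * (if 0 < b \<bullet> i - x \<bullet> i then 1 else 0))"
  unfolding bx_def by (intro tendsto_prod tendsto_mult hb0_limit)
 moreover have "(\<Prod>i\<in>Basis. (if 0 < x \<bullet> i - a \<bullet> i then 1 else 0) * (if 0 < b \<bullet> i - x \<bullet> i then 1 else 0)) = (ind (box a b) x :: real)"
  by (auto simp: indicator_def mem_box intro!: prod.neutral)
 ultimately show ?thesis by simp
qed

text \<open>\<open>wgrad\<close> is only a choice, so every computation with an explicit gradient
  has to pass through uniqueness. A component of the difference is square integrable, hence locally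
  integrable, and testing with \<open>bx\<close> shows that its integral over every box is
  0.\<close>

lemma weak_grad_unique:
 fixes u :: "'a::euclidean_space \<Rightarrow> real"
 assumes G: "weak_grad u G" "integrable lebesgue (\<lambda>x. (norm (G x))\<^sup>2)"
  and H: "weak_grad u H" "integrable lebesgue (\<lambda>x. (norm (H x))\<^sup>2)"
 shows "AE x in lebesgue. G x = H x"
proof -
 have [measurable]: "G \<in> borel_measurable lebesgue" "H \<in> borel_measurable lebesgue"
  using G(1) H(1) by (auto simp: weak_grad_def)
 have "AE x in lebesgue. (G x - H x) \<bullet> i = 0" if i: "i \<in> Basis" for i
 proof -
  have Dm: "(\<lambda>x. (G x - H x) \<bullet> i) \<in> borel_measurable lebesgue" by measurable
  obtain D where D [measurable]: "D \<in> BM" and DA: "AE x in lebesgue. (G x - H x) \<bullet> i = D x"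
   using borel_representative[OF Dm] by blast
  have Dl [measurable]: "D \<in> borel_measurable lebesgue" by (rule measurable_completion) simp
  have D2: "LI (\<lambda>x. (D x)\<^sup>2)"
  proof -
   have "integrable lebesgue (\<lambda>x. 2 * (norm (G x))\<^sup>2 + 2 * (norm (H x))\<^sup>2)" using G(2) H(2) by simp
   then have "integrable lebesgue (\<lambda>x. (D x)\<^sup>2)"
   proof (rule integrable_dom)
    show "AE x in lebesgue. norm ((D x)\<^sup>2) \<le> norm (2 * (norm (G x))\<^sup>2 + 2 * (norm (H x))\<^sup>2)"
     using DA
    proof eventually_elim
     case (elim x)
     have "\<bar>D x\<bar> \<le> norm (G x - H x)" unfolding elim[symmetric] using i by (rule Basis_le_norm)
     also have "\<dots> \<le> norm (G x) + norm (H x)" by (rule norm_triangle_ineq4)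
     finally have "\<bar>D x\<bar>\<^sup>2 \<le> (norm (G x) + norm (H x))\<^sup>2" by (intro power_mono) auto
     also have "\<dots> \<le> 2 * (norm (G x))\<^sup>2 + 2 * (norm (H x))\<^sup>2"
      using sum_squares_bound[of "norm (G x)" "norm (H x)"] by (simp add: power2_sum)
     finally show ?case by simp
    qed
   qed measurable
   then show ?thesis by (subst (asm) integrable_lebesgue_iff) auto
  qed
  have loc: "LI (\<lambda>x. ind (cbox a b) x * \<bar>D x\<bar>)" for a b :: 'a
  proof (rule integrable_dom)
   have "emeasure lborel (cbox a b) < \<infinity>" by (rule emeasure_bounded_finite) simp
   then show "LI (\<lambda>x. ind (cbox a b) x + (D x)\<^sup>2)"
    by (intro Bochner_Integration.integrable_add D2 integrable_real_indicator) auto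
   show "AE x in lborel. norm (ind (cbox a b) x * \<bar>D x\<bar>) \<le> norm (ind (cbox a b) x + (D x)\<^sup>2)"
   proof (intro AE_I2)
    fix x
    have "\<bar>D x\<bar> \<le> 1 + (D x)\<^sup>2" using sum_squares_bound[of 1 "\<bar>D x\<bar>"] by simp
    then show "norm (ind (cbox a b) x * \<bar>D x\<bar>) \<le> norm (ind (cbox a b) x + (D x)\<^sup>2)"
     by (auto simp: indicator_def)
   qed
  qed measurable
  have t0: "(LBINT x. bx a b k x * D x) = 0" for a b k
  proof -
   have t: "test_fun (bx a b k)" by (rule bx_test_fun)
   have [measurable]: "bx a b k \<in> BM" by (rule dec_measurable[OF test_fun_dec(1)[OF t]])
   have e: "(\<integral>x. (G x \<bullet> i) * bx a b k x \<partial>lebesgue) = (\<integral>x. (H x \<bullet> i) * bx a b k x \<partial>lebesgue)"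
    and ig: "integrable lebesgue (\<lambda>x. (G x \<bullet> i) * bx a b k x)" "integrable lebesgue (\<lambda>x. (H x \<bullet> i) * bx a b k x)"
    using G(1) H(1) t i unfolding weak_grad_def by (auto simp: minus_equation_iff)
   have "(LBINT x. bx a b k x * D x) = (\<integral>x. bx a b k x * D x \<partial>lebesgue)"
    by (rule integrable_lebesgue_iff(2)[symmetric]) measurable
   also have "\<dots> = (\<integral>x. (G x \<bullet> i) * bx a b k x - (H x \<bullet> i) * bx a b k x \<partial>lebesgue)"
   proof (rule integral_cong_AE)
    have bl: "bx a b k \<in> borel_measurable lebesgue" by (rule measurable_completion) simp
    note [measurable] = bl
    show "(\<lambda>x. bx a b k x * D x) \<in> borel_measurable lebesgue" by measurable
    show "(\<lambda>x. (G x \<bullet> i) * bx a b k x - (H x \<bullet> i) * bx a b k x) \<in> borel_measurable lebesgue" by measurable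
    show "AE x in lebesgue. bx a b k x * D x = (G x \<bullet> i) * bx a b k x - (H x \<bullet> i) * bx a b k x"
     using DA by eventually_elim (simp add: inner_diff_left algebra_simps)
   qed
   also have "\<dots> = 0" using e ig by simp
   finally show ?thesis .
  qed
  have "AE x in lborel. D x = 0"
  proof (rule box_zero_AE_zero[OF D])
   fix a b :: 'a
   show "LI (\<lambda>x. ind (box a b) x * D x)"
    by (rule integrable_dom[OF loc[of a b]])
      (use box_subset_cbox[of a b] in \<open>auto simp: indicator_def abs_mult\<close>)
   have "(\<lambda>k. (LBINT x. bx a b k x * D x)) \<leadsto> (LBINT x. ind (box a b) x * D x)"
   proof (rule integral_dct[OF _ _ loc[of a b]])
    show "(\<lambda>x. bx a b k x * D x) \<in> borel_measurable lborel" for k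
     using dec_measurable[OF test_fun_dec(1)[OF bx_test_fun[of a b k]]] by measurable
    show "AE x in lborel. (\<lambda>k. bx a b k x * D x) \<leadsto> ind (box a b) x * D x"
     by (intro AE_I2 tendsto_mult bx_limit tendsto_const)
    show "AE x in lborel. norm (bx a b k x * D x) \<le> ind (cbox a b) x * \<bar>D x\<bar>" for k
     using bx_bounds[of a b k] by (intro AE_I2) (simp add: abs_mult mult_right_mono)
   qed measurable
   then show "(LBINT x. ind (box a b) x * D x) = 0" unfolding t0 by (simp add: LIMSEQ_const_iff)
  qed
  then have "AE x in lebesgue. D x = 0" by (rule AE_completion)
  with DA show ?thesis by eventually_elim simp
 qed
 then have "AE x in lebesgue. \<forall>i\<in>Basis. (G x - H x) \<bullet> i = 0" by (subst AE_finite_all) auto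
 then show ?thesis by eventually_elim (simp add: euclidean_eq_iff[of "G _" "H _"] inner_diff_left)
qed

text \<open>Young's inequality with constants 1: if b is at most a^(r - 1), the product is bounded
  by a^r, and otherwise by the conjugate power of b.\<close>

lemma integrable_mult_conj_powr:
 fixes f g :: "'a \<Rightarrow> real"
 assumes r: "1 < r" and f: "integrable M (\<lambda>x. \<bar>f x\<bar> powr r)" and g: "integrable M (\<lambda>x. \<bar>g x\<bar> powr (r / (r - 1)))"
  and [measurable]: "f \<in> borel_measurable M" "g \<in> borel_measurable M"
 shows "integrable M (\<lambda>x. f x * g x)"
proof (rule integrable_dom[OF Bochner_Integration.integrable_add[OF f g]])
 have "a * b \<le> a powr r + b powr (r / (r - 1))" if "0 \<le> a" "0 \<le> b" for a b :: real
 proof (cases "b \<le> a powr (r - 1)")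
  case True
  then have "a * b \<le> a * a powr (r - 1)" using that by (intro mult_left_mono) auto
  also have "\<dots> = a powr r" using that by (cases "a = 0") (auto simp: powr_diff)
  finally show ?thesis by (simp add: add_increasing2)
 next
  case False
  then have "(a powr (r - 1)) powr (1 / (r - 1)) \<le> b powr (1 / (r - 1))" using r that by (intro powr_mono2) auto
  then have "a \<le> b powr (1 / (r - 1))" using r that by (simp add: powr_powr)
  then have "a * b \<le> b powr (1 / (r - 1)) * b" using that by (intro mult_right_mono)
  also have "\<dots> = b powr (1 / (r - 1) + 1)" using that by (cases "b = 0") (auto simp: powr_add)
  also have "1 / (r - 1) + 1 = r / (r - 1)" using r by (simp add: field_simps)
  finally show ?thesis by (simp add: add_increasing)
 qed
 from this[of "\<bar>f _\<bar>" "\<bar>g _\<bar>"] show "AE x in M. norm (f x * g x) \<le> norm (\<bar>f x\<bar> powr r + \<bar>g x\<bar> powr (r / (r - 1)))"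
  by (intro AE_I2) (simp add: abs_mult)
qed measurable

lemma fubini_dominated:
 fixes f :: "'a::euclidean_space \<Rightarrow> 'a \<Rightarrow> real"
 assumes [measurable]: "case_prod f \<in> borel_measurable (borel \<Otimes>\<^sub>M borel)"
  and i: "\<And>x. LI (f x)" and B: "\<And>x. (LBINT y. \<bar>f x y\<bar>) \<le> B x" "LI B"
 shows "(LBINT y. (LBINT x. f x y)) = (LBINT x. (LBINT y. f x y))"
  and "LI (\<lambda>x. \<integral>y. f x y \<partial>lborel)"
  and "LI (\<lambda>y. \<integral>x. f x y \<partial>lborel)"
proof -
 have m: "case_prod f \<in> borel_measurable (lborel \<Otimes>\<^sub>M lborel)" by measurable
 have "integrable (lborel \<Otimes>\<^sub>M lborel) (case_prod f)"
 proof (rule lborel_pair.Fubini_integrable[OF m])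
  show "AE x in lborel. LI (\<lambda>y. case_prod f (x, y))" using i by simp
  have m2: "(\<lambda>x. \<integral>y. norm (case_prod f (x, y)) \<partial>lborel) \<in> borel_measurable lborel" by measurable
  show "LI (\<lambda>x. \<integral>y. norm (case_prod f (x, y)) \<partial>lborel)"
  proof (rule integrable_dom[OF B(2) m2], rule AE_I2)
   show "norm (LBINT y. norm (case_prod f (x, y))) \<le> norm (B x)" for x
   proof -
    have "0 \<le> (LBINT y. \<bar>f x y\<bar>)" by simp
    then show ?thesis using B(1)[of x] by (simp del: integral_nonneg)
   qed
  qed
 qed
 then show "(LBINT y. (LBINT x. f x y)) = (LBINT x. (LBINT y. f x y))"
  and "LI (\<lambda>x. \<integral>y. f x y \<partial>lborel)"
  and "LI (\<lambda>y. \<integral>x. f x y \<partial>lborel)"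
  using lborel_pair.Fubini_integral[of f] lborel_pair.integrable_fst[of f] lborel_pair.integrable_snd[of f] by simp_all
qed

context dim_ge_3
begin

lemma smooth_chi: "smooth (chi k :: 'a \<Rightarrow> real)"
proof -
 have "smooth (\<lambda>x::'a. exp 1 * hb 0 (1 + (- es k) * (norm (x - 0))\<^sup>2))"
  by (intro smooth_mult smooth_hb smooth_add smooth_const smooth_norm_sq)
 then show ?thesis unfolding chi_def[abs_def] by simp
qed

text \<open>Borel representatives of a function of D12 and of its weak gradient, for which joint
  measurability and Fubini's theorem over \<open>lborel\<close> are available.\<close>

definition wg :: "('a \<Rightarrow> real) \<Rightarrow> ('a \<Rightarrow> 'a) \<Rightarrow> bool"
 where "wg v H \<longleftrightarrow> v \<in> BM \<and> H \<in> BM \<and>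
   LI (\<lambda>x. \<bar>v x\<bar> powr (2 * N T / (N T - 2))) \<and> LI (\<lambda>x. (norm (H x))\<^sup>2) \<and>
   (\<forall>(\<psi> :: 'a \<Rightarrow> real) i. test_fun \<psi> \<longrightarrow> i \<in> Basis \<longrightarrow>
    (LBINT x. v x * frechet_derivative \<psi> (at x) i) = - (LBINT x. (H x \<bullet> i) * \<psi> x))"

lemma D12_wgrad:
 assumes "v \<in> D12"
 shows "weak_grad v (wgrad v)" "integrable lebesgue (\<lambda>x. (norm (wgrad v x))\<^sup>2)"
proof -
 have "\<exists>G. weak_grad v G \<and> integrable lebesgue (\<lambda>x. (norm (G x))\<^sup>2)" using assms by (auto simp: D12_def)
 then have "weak_grad v (wgrad v) \<and> integrable lebesgue (\<lambda>x. (norm (wgrad v x))\<^sup>2)"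
  unfolding wgrad_def by (rule someI_ex)
 then show "weak_grad v (wgrad v)" "integrable lebesgue (\<lambda>x. (norm (wgrad v x))\<^sup>2)" by auto
qed

lemma D12_wg:
 assumes "v \<in> D12"
 obtains v0 H where "wg v0 H" "AE x in lebesgue. v x = v0 x" "AE x in lebesgue. wgrad v x = H x"
proof -
 have v: "v \<in> borel_measurable lebesgue" "integrable lebesgue (\<lambda>x. \<bar>v x\<bar> powr (2 * N T / (N T - 2)))"
  using assms by (auto simp: D12_def crit_exp_def)
 note G = D12_wgrad[OF assms]
 have Gm [measurable]: "wgrad v \<in> borel_measurable lebesgue" using G(1) by (simp add: weak_grad_def)
 obtain v0 where v0 [measurable]: "v0 \<in> BM" and vA: "AE x in lebesgue. v x = v0 x"
  using borel_representative[OF v(1)] by blast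
 have "\<exists>g. g \<in> BM \<and> (AE x in lebesgue. wgrad v x \<bullet> i = g x)" for i
  by (rule borel_representative[of "\<lambda>x. wgrad v x \<bullet> i"]) auto
 then obtain g where g [measurable]: "\<And>i. g i \<in> BM" and gA: "\<And>i. AE x in lebesgue. wgrad v x \<bullet> i = g i x"
  by metis
 define H where "H x = (\<Sum>i\<in>Basis. g i x *\<^sub>R i)" for x
 have Hm [measurable]: "H \<in> BM" unfolding H_def[abs_def] by measurable
 have "AE x in lebesgue. \<forall>i\<in>Basis. wgrad v x \<bullet> i = g i x" by (subst AE_finite_all) (auto intro: gA)
 then have HA: "AE x in lebesgue. wgrad v x = H x"
  by eventually_elim (simp add: H_def euclidean_eq_iff[of "wgrad v _"] inner_sum_left inner_Basis if_distrib cong: if_cong)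
 have l: "f \<in> borel_measurable lebesgue" if "f \<in> BM" for f :: "'a \<Rightarrow> real"
  using that by (intro measurable_completion) simp
 have lH: "H \<in> borel_measurable lebesgue" by (intro measurable_completion) simp
 have "wg v0 H"
  unfolding wg_def
 proof (intro conjI allI impI)
  have "integrable lebesgue (\<lambda>x. \<bar>v0 x\<bar> powr (2 * N T / (N T - 2)))"
   by (rule integrable_cong_AE_imp[OF v(2)]) (use vA in \<open>auto intro!: l\<close>)
  then show "LI (\<lambda>x. \<bar>v0 x\<bar> powr (2 * N T / (N T - 2)))" by (simp add: integrable_lebesgue_iff)
  have "integrable lebesgue (\<lambda>x. (norm (H x))\<^sup>2)"
   by (rule integrable_cong_AE_imp[OF G(2)]) (use HA in \<open>auto intro!: l\<close>)
  then show "LI (\<lambda>x. (norm (H x))\<^sup>2)" by (simp add: integrable_lebesgue_iff)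
  fix \<psi> :: "'a \<Rightarrow> real" and i :: 'a assume \<psi>: "test_fun \<psi>" and i: "i \<in> Basis"
  have [measurable]: "\<psi> \<in> BM" "(\<lambda>x. frechet_derivative \<psi> (at x) i) \<in> BM"
   using dec_measurable[OF test_fun_dec(1)[OF \<psi>]] dec_measurable[OF test_fun_dec(2)[OF \<psi> i]] by auto
  have e: "(\<integral>x. v x * frechet_derivative \<psi> (at x) i \<partial>lebesgue) = - (\<integral>x. (wgrad v x \<bullet> i) * \<psi> x \<partial>lebesgue)"
   using G(1) \<psi> i by (simp add: weak_grad_def)
  have "(\<integral>x. v x * frechet_derivative \<psi> (at x) i \<partial>lebesgue) = (\<integral>x. v0 x * frechet_derivative \<psi> (at x) i \<partial>lebesgue)"
   using vA by (intro integral_cong_AE borel_measurable_times[OF v(1)] l) auto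
  also have "\<dots> = (LBINT x. v0 x * frechet_derivative \<psi> (at x) i)" by (rule integrable_lebesgue_iff) measurable
  finally have 1: "(\<integral>x. v x * frechet_derivative \<psi> (at x) i \<partial>lebesgue) = (LBINT x. v0 x * frechet_derivative \<psi> (at x) i)" .
  have "(\<integral>x. (wgrad v x \<bullet> i) * \<psi> x \<partial>lebesgue) = (\<integral>x. (H x \<bullet> i) * \<psi> x \<partial>lebesgue)"
  proof (rule integral_cong_AE)
   have "(\<lambda>x. wgrad v x \<bullet> i) \<in> borel_measurable lebesgue" by measurable
   then show "(\<lambda>x. (wgrad v x \<bullet> i) * \<psi> x) \<in> borel_measurable lebesgue"
    by (rule borel_measurable_times) (rule l, measurable)
   show "(\<lambda>x. (H x \<bullet> i) * \<psi> x) \<in> borel_measurable lebesgue" by (rule l) measurable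
   show "AE x in lebesgue. (wgrad v x \<bullet> i) * \<psi> x = (H x \<bullet> i) * \<psi> x" using HA by eventually_elim simp
  qed
  also have "\<dots> = (LBINT x. (H x \<bullet> i) * \<psi> x)" by (rule integrable_lebesgue_iff) measurable
  finally show "(LBINT x. v0 x * frechet_derivative \<psi> (at x) i) = - (LBINT x. (H x \<bullet> i) * \<psi> x)"
   using e 1 by simp
 qed auto
 then show thesis using that vA HA by blast
qed

text \<open>The conjugate exponent of 2n / (n - 2) is 2n / (n + 2) > 1, and decay |x|^(-n) raised to
  it is integrable.\<close>

lemma wg_v_integrable:
 assumes "wg v H" and g: "dec (- N T/2) g"
 shows "LI (\<lambda>x. v x * g x)"
proof (rule integrable_mult_conj_powr[where r="2 * N T / (N T - 2)"])
 have [measurable]: "g \<in> BM" using g by (rule dec_measurable)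
 show "1 < 2 * N T / (N T - 2)" using N3 by (simp add: field_simps)
 show "v \<in> borel_measurable lborel" "g \<in> borel_measurable lborel" "LI (\<lambda>x. \<bar>v x\<bar> powr (2 * N T / (N T - 2)))"
  using assms by (auto simp: wg_def)
 obtain C where C: "0 < C" "\<And>x. \<bar>g x\<bar> \<le> C * jb x powr (- N T/2)" using decE[OF g] by blast
 let ?q = "2 * N T / (N T - 2) / (2 * N T / (N T - 2) - 1)"
 have "2 * N T / (N T - 2) - 1 = (N T + 2) / (N T - 2)" using N3 by (simp add: field_simps)
 then have q: "?q = 2 * N T / (N T + 2)" using N3 by simp
 have i: "LI (\<lambda>x::'a. C powr ?q * jb x powr (- N T/2 * ?q))"
 proof -
  have "N T / 2 < N T / 2 * (2 * N T / (N T + 2))" using N3 by (simp add: field_simps)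
  then show ?thesis unfolding q using integrable_jb_powr[where 'a='a, of "N T/2 * (2 * N T / (N T + 2))"] by simp
 qed
 show "LI (\<lambda>x. \<bar>g x\<bar> powr ?q)"
 proof (rule integrable_dom[OF i])
  show "AE x in lborel. norm (\<bar>g x\<bar> powr ?q) \<le> norm (C powr ?q * jb x powr (- N T/2 * ?q))"
  proof (rule AE_I2)
   fix x
   have "\<bar>g x\<bar> powr ?q \<le> (C * jb x powr (- N T/2)) powr ?q" using C(2) N3 by (intro powr_mono2) (auto simp: q)
   also have "\<dots> = C powr ?q * jb x powr (- N T/2 * ?q)" using C(1) by (simp only: powr_mult powr_powr)
   finally show "norm (\<bar>g x\<bar> powr ?q) \<le> norm (C powr ?q * jb x powr (- N T/2 * ?q))" by simp
  qed
 qed measurable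
qed

text \<open>Decay |x|^(1 - n) is square integrable because n > 2, and so is H.\<close>

lemma wg_H_integrable:
 assumes "wg v H" and g: "dec (Nh T) g"
 shows "LI (\<lambda>x. (H x \<bullet> i) * g x)" "LI (\<lambda>x. norm (H x) * g x)"
proof -
 have [measurable]: "g \<in> BM" "H \<in> BM"
  using g assms(1) by (auto intro: dec_measurable simp: wg_def)
 have "dec (- (N T - 1)) (\<lambda>x. g x * g x)" by (rule dec_mult'[OF g g]) simp
 then have "LI (\<lambda>x. g x * g x)" by (rule dec_integrable) (use N3 in \<open>simp add: field_simps\<close>)
 then have i: "LI (\<lambda>x. (norm (H x))\<^sup>2 + g x * g x)" using assms(1) by (simp add: wg_def)
 have "norm (H x) * \<bar>g x\<bar> \<le> (norm (H x))\<^sup>2 + g x * g x" for x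
 proof -
  have "0 \<le> norm (H x) * \<bar>g x\<bar>" "\<bar>g x\<bar>\<^sup>2 = g x * g x" by (simp_all add: power2_eq_square)
  then show ?thesis using sum_squares_bound[of "norm (H x)" "\<bar>g x\<bar>"] by linarith
 qed
 then show j: "LI (\<lambda>x. norm (H x) * g x)"
  by (intro integrable_dom[OF i]) (auto simp: abs_mult)
 show "LI (\<lambda>x. (H x \<bullet> i) * g x)"
 proof (rule integrable_dom[OF integrable_mult_left[OF j, of "norm i"]])
  show "AE x in lborel. norm ((H x \<bullet> i) * g x) \<le> norm (norm (H x) * g x * norm i)"
  proof (rule AE_I2)
   fix x
   have "\<bar>H x \<bullet> i\<bar> * \<bar>g x\<bar> \<le> (norm (H x) * norm i) * \<bar>g x\<bar>" by (intro mult_right_mono Cauchy_Schwarz_ineq2) auto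
   then show "norm ((H x \<bullet> i) * g x) \<le> norm (norm (H x) * g x * norm i)" by (simp add: abs_mult mult_ac)
  qed
 qed measurable
qed

lemma smooth_Ge1: "0 < \<epsilon> \<Longrightarrow> smooth (Ge1 \<epsilon> y i)"
proof -
 assume e: "0 < \<epsilon>"
 have "smooth (\<lambda>x. - (N T - 2) * ((\<epsilon>\<^sup>2 + (norm (x - y))\<^sup>2) powr (- N T/2) * (x \<bullet> i - y \<bullet> i)))"
  by (intro smooth_mult smooth_const smooth_powr smooth_add smooth_norm_sq smooth_diff_const smooth_inner) (use e in \<open>simp add: add_pos_nonneg\<close>)
 then show ?thesis unfolding Ge1_def[abs_def] geps_def inner_diff_left .
qed

text \<open>\<open>Ge1\<close> is smooth but not compactly supported, so its products with
  \<open>chi k\<close> serve as test functions. The extra term carries \<open>chi'\<close>, which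
  tends to 0 and is dominated by jb^(-1/2), and v is integrable against the resulting decay
  |x|^(-n).\<close>

lemma wg_Ge1:
 assumes wg: "wg v H" and e: "0 < \<epsilon>" and i: "i \<in> Basis"
 shows "(LBINT x. v x * Ge2 \<epsilon> y i x) = - (LBINT x. (H x \<bullet> i) * Ge1 \<epsilon> y i x)"
proof -
 let ?g = "Ge1 \<epsilon> y i"
 have [measurable]: "v \<in> BM" "H \<in> BM" using wg by (auto simp: wg_def)
 have [measurable]: "Ge1 \<epsilon> y i \<in> BM" "Ge2 \<epsilon> y i \<in> BM"
  using dec_measurable[OF dec_Ge1[OF e]] dec_measurable[OF dec_Ge2[OF e]] by auto
 have [measurable]: "(chi k :: 'a \<Rightarrow> real) \<in> BM" "chi' k i \<in> BM" for k
  using dec_chi[of 0] by (auto intro: dec_measurable)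
 have sm: "smooth (\<lambda>x. chi k x * ?g x)" for k by (intro smooth_mult smooth_chi smooth_Ge1 e)
 have tf: "test_fun (\<lambda>x. chi k x * ?g x)" for k
  by (rule test_funI[OF sm]) (rule bounded_subset[OF bounded_cball[of 0 "real (Suc k)"]], unfold chi_def, use hb_cut in fastforce)
 have fd: "frechet_derivative (\<lambda>x. chi k x * ?g x) (at x) i = chi' k i x * ?g x + chi k x * Ge2 \<epsilon> y i x" for k x
  by (rule frechet_pd[OF sm pd_mult[OF pd_chi pd_Ge1[OF e]]])
 have eq: "(LBINT x. v x * (chi' k i x * ?g x + chi k x * Ge2 \<epsilon> y i x)) = - (LBINT x. (H x \<bullet> i) * (chi k x * ?g x))" for k
  using wg tf[of k] i unfolding wg_def fd[symmetric] by blast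
 have d1: "dec (- N T/2) (\<lambda>x. jb x powr (-1/2) * ?g x)" by (rule dec_mult'[OF dec_jb dec_Ge1[OF e]]) (simp add: field_simps)
 let ?B = "\<lambda>x. 8 * exp 1 * \<bar>v x * (jb x powr (-1/2) * ?g x)\<bar> + exp 1 * \<bar>v x * Ge2 \<epsilon> y i x\<bar>"
 have B: "LI ?B"
  using wg_v_integrable[OF wg d1] wg_v_integrable[OF wg dec_Ge2[OF e]] by (intro Bochner_Integration.integrable_add integrable_mult_right integrable_abs)
 have "(\<lambda>k. \<integral>x. v x * (chi' k i x * ?g x + chi k x * Ge2 \<epsilon> y i x) \<partial>lborel) \<leadsto> (LBINT x. v x * (0 * ?g x + 1 * Ge2 \<epsilon> y i x))"
 proof (rule integral_dct[OF _ _ B])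
  show "AE x in lborel. (\<lambda>k. v x * (chi' k i x * ?g x + chi k x * Ge2 \<epsilon> y i x)) \<leadsto> v x * (0 * ?g x + 1 * Ge2 \<epsilon> y i x)"
   by (intro AE_I2 tendsto_intros chi'_limit chi_limit)
  show "AE x in lborel. norm (v x * (chi' k i x * ?g x + chi k x * Ge2 \<epsilon> y i x)) \<le> ?B x" for k
  proof (rule AE_I2)
   fix x
   have "\<bar>chi' k i x * ?g x + chi k x * Ge2 \<epsilon> y i x\<bar> \<le> \<bar>chi' k i x\<bar> * \<bar>?g x\<bar> + \<bar>chi k x\<bar> * \<bar>Ge2 \<epsilon> y i x\<bar>"
    unfolding abs_mult[symmetric] by (rule abs_triangle_ineq)
   also have "\<dots> \<le> (8 * exp 1 * jb x powr (-1/2)) * \<bar>?g x\<bar> + exp 1 * \<bar>Ge2 \<epsilon> y i x\<bar>"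
    by (intro add_mono mult_right_mono chi'_bound[OF i] chi_bound) auto
   finally have "\<bar>v x\<bar> * \<bar>chi' k i x * ?g x + chi k x * Ge2 \<epsilon> y i x\<bar> \<le> \<bar>v x\<bar> * ((8 * exp 1 * jb x powr (-1/2)) * \<bar>?g x\<bar> + exp 1 * \<bar>Ge2 \<epsilon> y i x\<bar>)"
    by (intro mult_left_mono) auto
   moreover have "norm (v x * (chi' k i x * ?g x + chi k x * Ge2 \<epsilon> y i x)) = \<bar>v x\<bar> * \<bar>chi' k i x * ?g x + chi k x * Ge2 \<epsilon> y i x\<bar>"
    by (simp only: real_norm_def abs_mult)
   moreover have "\<bar>v x\<bar> * ((8 * exp 1 * jb x powr (-1/2)) * \<bar>?g x\<bar> + exp 1 * \<bar>Ge2 \<epsilon> y i x\<bar>) = ?B x"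
    by (simp add: abs_mult algebra_simps)
   ultimately show "norm (v x * (chi' k i x * ?g x + chi k x * Ge2 \<epsilon> y i x)) \<le> ?B x" by (simp only:)
  qed
 qed measurable
 then have l1: "(\<lambda>k. - (LBINT x. (H x \<bullet> i) * (chi k x * ?g x))) \<leadsto> (LBINT x. v x * Ge2 \<epsilon> y i x)"
  by (simp only: eq mult_zero_left add_0 mult_1_left)
 have "(\<lambda>k. \<integral>x. (H x \<bullet> i) * (chi k x * ?g x) \<partial>lborel) \<leadsto> (LBINT x. (H x \<bullet> i) * (1 * ?g x))"
 proof (rule integral_dct[OF _ _ integrable_mult_right[OF integrable_abs[OF wg_H_integrable(1)[OF wg dec_Ge1[OF e]]]]])
  show "AE x in lborel. (\<lambda>k. (H x \<bullet> i) * (chi k x * ?g x)) \<leadsto> (H x \<bullet> i) * (1 * ?g x)"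
   by (intro AE_I2 tendsto_intros chi_limit)
  show "AE x in lborel. norm ((H x \<bullet> i) * (chi k x * ?g x)) \<le> exp 1 * \<bar>(H x \<bullet> i) * Ge1 \<epsilon> y i x\<bar>" for k
  proof (rule AE_I2)
   fix x
   have "\<bar>chi k x\<bar> * \<bar>(H x \<bullet> i) * Ge1 \<epsilon> y i x\<bar> \<le> exp 1 * \<bar>(H x \<bullet> i) * Ge1 \<epsilon> y i x\<bar>" by (intro mult_right_mono chi_bound) auto
   then show "norm ((H x \<bullet> i) * (chi k x * ?g x)) \<le> exp 1 * \<bar>(H x \<bullet> i) * Ge1 \<epsilon> y i x\<bar>" by (simp add: abs_mult mult_ac)
  qed
 qed measurable
 then have "(\<lambda>k. - (LBINT x. (H x \<bullet> i) * (chi k x * ?g x))) \<leadsto> - (LBINT x. (H x \<bullet> i) * ?g x)"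
  unfolding mult_1_left by (rule tendsto_minus)
 with l1 show ?thesis by (rule LIMSEQ_unique)
qed

lemma wg_lap:
 assumes wg: "wg v H" and e: "0 < \<epsilon>"
 shows "(\<Sum>i\<in>Basis. \<integral>x. (H x \<bullet> i) * Ge1 \<epsilon> y i x \<partial>lborel) =
  N T * (N T - 2) * (LBINT x. v x * (\<epsilon>\<^sup>2 * geps \<epsilon> y x powr Np T))"
proof -
 have "(\<Sum>i\<in>Basis. \<integral>x. (H x \<bullet> i) * Ge1 \<epsilon> y i x \<partial>lborel) = (\<Sum>i\<in>Basis. - (LBINT x. v x * Ge2 \<epsilon> y i x))"
  using wg_Ge1[OF wg e] by (intro sum.cong) auto
 also have "\<dots> = - (LBINT x. (\<Sum>i\<in>Basis. v x * Ge2 \<epsilon> y i x))"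
  using wg_v_integrable[OF wg dec_Ge2[OF e]] by (subst Bochner_Integration.integral_sum) (auto simp: sum_negf)
 also have "\<dots> = - (LBINT x. (- (N T * (N T - 2))) * (v x * (\<epsilon>\<^sup>2 * geps \<epsilon> y x powr Np T)))"
  unfolding sum_distrib_left[symmetric] lap_Ge[OF e] by (simp add: mult_ac)
 finally show ?thesis by (subst (asm) integral_mult_right_zero) simp
qed

section \<open>Newtonian potentials and the weak formulation\<close>

text \<open>Up to the factor -(n - 2) the derivative of |x - y|^(2 - n) in direction i; its value on
  the diagonal is 0.\<close>

definition gK :: "'a \<Rightarrow> 'a \<Rightarrow> 'a \<Rightarrow> real"
 where "gK x y i = norm (x - y) powr (- N T) * ((x - y) \<bullet> i)"

text \<open>The denominator is the constant of the fundamental solution, so minus the Laplacian of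
  \<open>newt h\<close> is h in the weak sense.\<close>

definition newt :: "('a \<Rightarrow> real) \<Rightarrow> 'a \<Rightarrow> real"
 where "newt h x = (LBINT y. nk2 x y * h y) / (N T * (N T - 2) * om0 TYPE('a))"

definition gradN :: "('a \<Rightarrow> real) \<Rightarrow> 'a \<Rightarrow> 'a"
 where "gradN h x = (\<Sum>i\<in>Basis. (- (LBINT y. h y * gK x y i) / (N T * om0 TYPE('a))) *\<^sub>R i)"

text \<open>The decay |x|^(-(n + 2)) is that of the p-th power of a bubble. In contrast to
  \<open>dec\<close> only measurability is asked, since the right-hand side jumps across the
  boundary of \<open>Omega_rho \<Omega> \<rho>\<close>.\<close>

definition fast :: "real \<Rightarrow> ('a \<Rightarrow> real) \<Rightarrow> bool"
 where "fast C h \<longleftrightarrow> h \<in> BM \<and> (\<forall>x. \<bar>h x\<bar> \<le> C * jb x powr Np T)"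

lemma gK_measurable [measurable]: "(\<lambda>(x, y). gK x y i) \<in> borel_measurable (borel \<Otimes>\<^sub>M borel)"
 unfolding gK_def by measurable

lemma norm_powr_mult: "norm (z::'a) powr (- N T) * norm z = norm z powr (1 - N T)"
 by (cases "z = 0") (auto simp: powr_diff powr_minus field_simps)

lemma gK_le:
 assumes "i \<in> Basis"
 shows "\<bar>gK x y i\<bar> \<le> nk1 x y"
proof -
 have "\<bar>gK x y i\<bar> \<le> norm (x - y) powr (- N T) * norm (x - y)"
  unfolding gK_def abs_mult using Basis_le_norm[OF assms, of "x - y"] by (intro mult_mono) auto
 then show ?thesis by (simp only: norm_powr_mult)
qed

lemma Ge1_le:
 assumes "i \<in> Basis"
 shows "\<bar>Ge1 \<epsilon> y i x\<bar> \<le> (N T - 2) * nk1 x y"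
proof (cases "x = y")
 case False
 have "geps \<epsilon> y x powr (- N T/2) \<le> ((norm (x - y))\<^sup>2) powr (- N T/2)"
  using False N3 by (intro powr_mono2') (auto simp: geps_def)
 then have 1: "geps \<epsilon> y x powr (- N T/2) \<le> norm (x - y) powr (- N T)" by (simp only: sq_powr_half abs_norm_cancel)
 have "\<bar>Ge1 \<epsilon> y i x\<bar> = (N T - 2) * (geps \<epsilon> y x powr (- N T/2) * \<bar>(x - y) \<bullet> i\<bar>)"
  using N3 by (simp add: Ge1_def abs_mult)
 also have "\<dots> \<le> (N T - 2) * (norm (x - y) powr (- N T) * norm (x - y))"
  using N3 Basis_le_norm[OF assms, of "x - y"] by (intro mult_left_mono mult_mono[OF 1]) auto
 finally show ?thesis by (simp only: norm_powr_mult)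
qed (simp add: Ge1_def)

lemma Ge1_lim: "(\<lambda>k. Ge1 (es k) y i x) \<leadsto> - (N T - 2) * gK x y i"
proof (cases "x = y")
 case False
 have "(\<lambda>k. geps (es k) y x powr (- N T/2)) \<leadsto> (0\<^sup>2 + (norm (x - y))\<^sup>2) powr (- N T/2)"
  unfolding geps_def using False by (intro tendsto_intros es) auto
 then have "(\<lambda>k. geps (es k) y x powr (- N T/2)) \<leadsto> norm (x - y) powr (- N T)"
  by (simp only: zero_power2 add_0 sq_powr_half abs_norm_cancel)
 then show ?thesis unfolding Ge1_def gK_def by (intro tendsto_mult tendsto_const)
qed (simp add: Ge1_def gK_def)

lemma Ge1_measurable [measurable]: "(\<lambda>(x, y). Ge1 \<epsilon> y i x) \<in> borel_measurable (borel \<Otimes>\<^sub>M borel)"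
 unfolding Ge1_def geps_def by measurable

lemma riesz_fast_ex:
 "\<exists>R>0. \<forall>C\<ge>0. \<forall>h. fast C h \<longrightarrow> (\<forall>x. LI (\<lambda>y. nk1 x y * \<bar>h y\<bar>) \<and>
  (LBINT y. nk1 x y * \<bar>h y\<bar>) \<le> C * (R * jb x powr Nh T))"
proof (rule riesz_bound[where 'a='a])
 fix R :: real assume R: "0 < R"
  "\<And>x::'a. LI (\<lambda>y. nk1 x y * jb y powr (- (N T + 1)/2))"
  "\<And>x::'a. (LBINT y. nk1 x y * jb y powr (- (N T + 1)/2)) \<le> R * jb x powr Nh T"
 have le: "nk1 x y * \<bar>h y\<bar> \<le> C * (nk1 x y * jb y powr (- (N T + 1)/2))"
  if "0 \<le> C" "fast C h" for C h and x y :: 'a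
 proof -
  have "\<bar>h y\<bar> \<le> C * jb y powr Np T" using that by (simp add: fast_def)
  also have "\<dots> \<le> C * jb y powr (- (N T + 1)/2)" using that by (intro mult_left_mono powr_mono) auto
  finally have "nk1 x y * \<bar>h y\<bar> \<le> nk1 x y * (C * jb y powr (- (N T + 1)/2))"
   by (intro mult_left_mono) auto
  then show ?thesis by (simp add: mult_ac)
 qed
 have i: "LI (\<lambda>y. nk1 x y * \<bar>h y\<bar>)" if "0 \<le> C" "fast C h" for C h and x :: 'a
 proof (rule integrable_dom[OF integrable_mult_right[OF R(2)[of x], of C]])
  show "(\<lambda>y. nk1 x y * \<bar>h y\<bar>) \<in> borel_measurable lborel" using that(2) by (auto simp: fast_def)
  show "AE y in lborel. norm (nk1 x y * \<bar>h y\<bar>) \<le> norm (C * (nk1 x y * jb y powr (- (N T + 1)/2)))"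
   using le[OF that] that(1) by (intro AE_I2) (simp add: abs_mult)
 qed
 show ?thesis
 proof (intro exI[of _ R] conjI R(1) allI impI i)
  fix C h and x :: 'a assume h: "0 \<le> C" "fast C h"
  have "(LBINT y. nk1 x y * \<bar>h y\<bar>) \<le> (LBINT y. C * (nk1 x y * jb y powr (- (N T + 1)/2)))"
   by (intro integral_mono i[OF h] integrable_mult_right R(2) le[OF h])
  also have "\<dots> = C * (LBINT y. nk1 x y * jb y powr (- (N T + 1)/2))" by simp
  also have "\<dots> \<le> C * (R * jb x powr Nh T)" by (intro mult_left_mono R(3) h)
  finally show "(LBINT y. nk1 x y * \<bar>h y\<bar>) \<le> C * (R * jb x powr Nh T)" .
 qed
qed

text \<open>Named by choice so that one and the same constant can occur in several
  statements.\<close>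

definition rc :: real
 where "rc = (SOME R. R > 0 \<and> (\<forall>C\<ge>0. \<forall>h. fast C h \<longrightarrow> (\<forall>x. LI (\<lambda>y. nk1 x y * \<bar>h y\<bar>) \<and>
  (LBINT y. nk1 x y * \<bar>h y\<bar>) \<le> C * (R * jb x powr Nh T))))"

lemma riesz_fast:
 shows "0 < rc"
  and "0 \<le> C \<Longrightarrow> fast C h \<Longrightarrow> LI (\<lambda>y. nk1 x y * \<bar>h y\<bar>)"
  and "0 \<le> C \<Longrightarrow> fast C h \<Longrightarrow> (LBINT y. nk1 x y * \<bar>h y\<bar>) \<le> C * (rc * jb x powr Nh T)"
 using someI_ex[OF riesz_fast_ex] unfolding rc_def[symmetric] by blast+

lemma integral_kernel_le:
 fixes K :: "'a \<Rightarrow> real"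
 assumes K [measurable]: "K \<in> BM" and h [measurable]: "h \<in> BM"
  and b: "\<And>y. \<bar>K y\<bar> \<le> c * nk1 x y"
  and i: "LI (\<lambda>y. nk1 x y * \<bar>h y\<bar>)"
  and le: "(LBINT y. nk1 x y * \<bar>h y\<bar>) \<le> D" and c: "0 \<le> c"
 shows "LI (\<lambda>y. h y * K y)" "\<bar>\<integral>y. h y * K y \<partial>lborel\<bar> \<le> c * D" "(LBINT y. \<bar>h y * K y\<bar>) \<le> c * D"
proof -
 have p: "\<bar>h y * K y\<bar> \<le> c * (nk1 x y * \<bar>h y\<bar>)" for y
  using mult_left_mono[OF b[of y], of "\<bar>h y\<bar>"] by (simp add: abs_mult mult_ac)
 show j: "LI (\<lambda>y. h y * K y)"
  by (rule integrable_dom[OF integrable_mult_right[OF i, of c]]) (use p c in \<open>auto simp: abs_mult\<close>)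
 have "(LBINT y. \<bar>h y * K y\<bar>) \<le> (LBINT y. c * (nk1 x y * \<bar>h y\<bar>))"
  by (intro integral_mono integrable_abs j integrable_mult_right i p)
 also have "\<dots> \<le> c * D" using mult_left_mono[OF le c] by simp
 finally show k: "(LBINT y. \<bar>h y * K y\<bar>) \<le> c * D" .
 show "\<bar>\<integral>y. h y * K y \<partial>lborel\<bar> \<le> c * D"
  using integral_abs_bound[of lborel "\<lambda>y. h y * K y"] k by linarith
qed

lemma gradN_inner: "i \<in> Basis \<Longrightarrow> gradN h x \<bullet> i = - (LBINT y. h y * gK x y i) / (N T * om0 TYPE('a))"
 unfolding gradN_def by (simp add: inner_sum_left inner_Basis if_distrib cong: if_cong)

lemma gradN_bound:
 assumes h: "0 \<le> C" "fast C h"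
 shows "norm (gradN h x) \<le> C * (rc / om0 TYPE('a) * jb x powr Nh T)"
proof -
 have hm: "h \<in> BM" using h(2) by (simp add: fast_def)
 have b: "\<bar>gradN h x \<bullet> i\<bar> \<le> C * (rc * jb x powr Nh T) / (N T * om0 TYPE('a))" if i: "i \<in> Basis" for i
 proof -
  have "\<bar>\<integral>y. h y * gK x y i \<partial>lborel\<bar> \<le> 1 * (C * (rc * jb x powr Nh T))"
   by (rule integral_kernel_le(2)[OF _ hm _ riesz_fast(2,3)[OF h]]) (use gK_le[OF i] in simp_all)
  then show ?thesis using om0_pos N3 unfolding gradN_inner[OF i] by (simp add: divide_right_mono)
 qed
 have "norm (gradN h x) \<le> (\<Sum>i\<in>Basis. \<bar>gradN h x \<bullet> i\<bar>)" by (rule norm_le_l1)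
 also have "\<dots> \<le> (\<Sum>i\<in>(Basis::'a set). C * (rc * jb x powr Nh T) / (N T * om0 TYPE('a)))" by (intro sum_mono b)
 finally show ?thesis using N3 by simp
qed

lemma gradN_measurable:
 assumes [measurable]: "h \<in> BM"
 shows "gradN h \<in> BM"
proof -
 have "(\<lambda>x. \<integral>y. h y * gK x y i \<partial>lborel) \<in> BM" for i
  unfolding gK_def by measurable
 then show ?thesis unfolding gradN_def[abs_def] by measurable
qed

lemma newt_measurable:
 assumes [measurable]: "h \<in> BM"
 shows "newt h \<in> BM"
proof -
 have "(\<lambda>x. \<integral>y. nk2 x y * h y \<partial>lborel) \<in> BM" by measurable
 then show ?thesis unfolding newt_def[abs_def] by measurable
qed

text \<open>\<open>jb_powr_le\<close> distributes the weight at x between z and x + \<epsilon> z.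
  The factor \<epsilon>^(n + 2) that comes with z outweighs the \<epsilon>^(-n) of the substitution,
  so the bound is uniform in \<epsilon> \<le> 1.\<close>

lemma moll_bound:
 assumes e: "0 < \<epsilon>" "\<epsilon> \<le> 1"
 shows "LI (\<lambda>z. jb (z::'a) powr Np T * jb (x + \<epsilon> *\<^sub>R z) powr Np T)"
  and "(LBINT z. jb (z::'a) powr Np T * jb (x + \<epsilon> *\<^sub>R z) powr Np T)
   \<le> 4 powr ((N T + 2)/2) * 2 * om0 TYPE('a) * jb x powr Np T"
proof -
 define b where "b = (N T + 2)/2"
 have nb: "- (N T + 2)/2 = - b" and b0: "0 \<le> b" by (simp_all add: b_def field_simps)
 let ?P = "\<lambda>z::'a. jb z powr (- b)" and ?Q = "\<lambda>z. jb (x + \<epsilon> *\<^sub>R z) powr (- b)"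
 let ?R = "\<lambda>z. 4 powr b * (jb x powr (- b) * (\<epsilon> powr (2 * b) * ?Q z + ?P z))"
 have iP: "LI ?P" using om0_integrable unfolding nb .
 have iQ: "LI ?Q" using lborel_integral_affine(2)[of \<epsilon> ?P x] e iP by simp
 have iR: "LI ?R" by (intro integrable_mult_right Bochner_Integration.integrable_add iP iQ)
 have le: "?P z * ?Q z \<le> ?R z" for z
 proof -
  let ?j = "jb (x + \<epsilon> *\<^sub>R z)"
  have "norm (x - (x + \<epsilon> *\<^sub>R z)) powr (2 * b) = \<epsilon> powr (2 * b) * norm z powr (2 * b)" using e by (simp add: powr_mult)
  also have "\<dots> \<le> \<epsilon> powr (2 * b) * jb z powr b"
  proof (intro mult_left_mono)
   have "norm z powr (2 * b) \<le> (jb z powr (1/2)) powr (2 * b)" using b0 by (intro powr_mono2 norm_le_jb) auto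
   then show "norm z powr (2 * b) \<le> jb z powr b" by (simp add: powr_powr)
  qed simp
  finally have "4 powr b * (norm (x - (x + \<epsilon> *\<^sub>R z)) powr (2 * b) + ?j powr b) \<le> 4 powr b * (\<epsilon> powr (2 * b) * jb z powr b + ?j powr b)" by simp
  with jb_powr_le[OF b0, of x "x + \<epsilon> *\<^sub>R z"]
  have "jb x powr b \<le> 4 powr b * (\<epsilon> powr (2 * b) * jb z powr b + ?j powr b)" by linarith
  then have "jb x powr b * (jb x powr (- b) * ?P z * ?Q z) \<le> 4 powr b * (\<epsilon> powr (2 * b) * jb z powr b + ?j powr b) * (jb x powr (- b) * ?P z * ?Q z)"
   by (intro mult_right_mono) auto
  moreover have "jb x powr b * (jb x powr (- b) * ?P z * ?Q z) = (jb x powr b * jb x powr (- b)) * (?P z * ?Q z)" by (simp only: mult_ac)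
  moreover have "4 powr b * (\<epsilon> powr (2 * b) * jb z powr b + ?j powr b) * (jb x powr (- b) * ?P z * ?Q z)
    = 4 powr b * (jb x powr (- b) * (\<epsilon> powr (2 * b) * ((jb z powr b * ?P z) * ?Q z) + (?j powr b * ?Q z) * ?P z))" by (simp only: ring_distribs mult_ac)
  moreover have "jb x powr b * jb x powr (- b) = 1" "jb z powr b * ?P z = 1" "?j powr b * ?Q z = 1" by (rule powr_mult_one; simp)+
  ultimately show ?thesis by (simp only: mult_1_left)
 qed
 have i: "LI (\<lambda>z. ?P z * ?Q z)"
  by (rule integrable_dom[OF iR]) (use le in \<open>auto intro!: AE_I2\<close>)
 then show "LI (\<lambda>z. jb (z::'a) powr Np T * jb (x + \<epsilon> *\<^sub>R z) powr Np T)" unfolding nb .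
 have om: "om0 TYPE('a) = (LBINT z. ?P z)" unfolding om0_def nb ..
 have aff: "om0 TYPE('a) = \<epsilon> ^ DIM('a) * (LBINT z. ?Q z)"
  unfolding om using lborel_integral_affine(1)[of \<epsilon> ?P x] e by simp
 have b2: "2 * b = 2 + N T" by (simp add: b_def)
 have "\<epsilon> powr (2 * b) = \<epsilon>\<^sup>2 * \<epsilon> ^ DIM('a)" unfolding b2 using e by (simp add: powr_add powr_realpow)
 then have "\<epsilon> powr (2 * b) * (LBINT z. ?Q z) = \<epsilon>\<^sup>2 * om0 TYPE('a)" unfolding aff by simp
 also have "\<dots> \<le> 1 * om0 TYPE('a)" using e om0_pos by (intro mult_right_mono) (auto simp: power_le_one)
 finally have q: "\<epsilon> powr (2 * b) * (LBINT z. ?Q z) \<le> om0 TYPE('a)" by simp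
 have "(LBINT z. ?P z * ?Q z) \<le> (LBINT z. ?R z)" by (intro integral_mono i iR le)
 also have "\<dots> = 4 powr b * (jb x powr (- b) * (\<epsilon> powr (2 * b) * (LBINT z. ?Q z) + om0 TYPE('a)))"
  using iP iQ by (simp add: om)
 also have "\<dots> \<le> 4 powr b * (jb x powr (- b) * (om0 TYPE('a) + om0 TYPE('a)))"
  by (intro mult_left_mono add_mono q) auto
 finally show "(LBINT z. jb (z::'a) powr Np T * jb (x + \<epsilon> *\<^sub>R z) powr Np T)
   \<le> 4 powr ((N T + 2)/2) * 2 * om0 TYPE('a) * jb x powr Np T" unfolding nb b_def[symmetric] by (simp add: mult_ac)
qed

lemma fast_dec: "dec (Np T) h \<Longrightarrow> \<exists>C\<ge>0. fast C h"
 using decE[of "- (N T + 2)/2" h] dec_measurable[of _ h] unfolding fast_def by (metis less_imp_le)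

lemma Ge1_integral:
 assumes h: "0 \<le> C" "fast C h" and i: "i \<in> Basis"
 shows "LI (\<lambda>y. h y * Ge1 \<epsilon> y i x)"
  and "\<bar>\<integral>y. h y * Ge1 \<epsilon> y i x \<partial>lborel\<bar> \<le> (N T - 2) * (C * (rc * jb x powr Nh T))"
  and "(LBINT y. \<bar>h y * Ge1 \<epsilon> y i x\<bar>) \<le> (N T - 2) * (C * (rc * jb x powr Nh T))"
  and "(\<lambda>k. \<integral>y. h y * Ge1 (es k) y i x \<partial>lborel) \<leadsto> (LBINT y. h y * (- (N T - 2) * gK x y i))"
proof -
 have hm [measurable]: "h \<in> BM" using h(2) by (simp add: fast_def)
 have gm [measurable]: "(\<lambda>y. Ge1 \<epsilon> y i x) \<in> BM" for \<epsilon>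
  unfolding Ge1_def geps_def by measurable
 have [measurable]: "(\<lambda>y. gK x y i) \<in> BM" unfolding gK_def by measurable
 have n2: "0 \<le> N T - 2" using N3 by simp
 note A = integral_kernel_le[OF gm hm Ge1_le[OF i] riesz_fast(2,3)[OF h] n2]
 show "LI (\<lambda>y. h y * Ge1 \<epsilon> y i x)"
  and "\<bar>\<integral>y. h y * Ge1 \<epsilon> y i x \<partial>lborel\<bar> \<le> (N T - 2) * (C * (rc * jb x powr Nh T))"
  and "(LBINT y. \<bar>h y * Ge1 \<epsilon> y i x\<bar>) \<le> (N T - 2) * (C * (rc * jb x powr Nh T))" by (rule A)+
 show "(\<lambda>k. \<integral>y. h y * Ge1 (es k) y i x \<partial>lborel) \<leadsto> (LBINT y. h y * (- (N T - 2) * gK x y i))"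
 proof (rule integral_dct[OF _ _ integrable_mult_right[OF riesz_fast(2)[OF h], of "N T - 2"]])
  show "AE y in lborel. (\<lambda>k. h y * Ge1 (es k) y i x) \<leadsto> h y * (- (N T - 2) * gK x y i)"
   by (intro AE_I2 tendsto_mult Ge1_lim tendsto_const)
  show "AE y in lborel. norm (h y * Ge1 (es k) y i x) \<le> (N T - 2) * (nk1 x y * \<bar>h y\<bar>)" for k
   using mult_left_mono[OF Ge1_le[OF i, of "es k" _ x], of "\<bar>h _\<bar>"] by (intro AE_I2) (simp add: abs_mult mult_ac)
 qed measurable
qed

text \<open>Integrate \<open>wg_lap\<close> against h and exchange the integrals. On one side the
  regularised kernels converge to that of \<open>gradN\<close>; on the other h appears mollified and
  is recovered pointwise by continuity.\<close>

lemma wg_grad_continuous: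
 assumes wg: "wg v H" and h: "dec (Np T) h"
 shows "(LBINT x. gradN h x \<bullet> H x) = (LBINT x. h x * v x)"
proof -
 obtain C where C: "0 \<le> C" "fast C h" using fast_dec[OF h] by blast
 have hC: "\<bar>h x\<bar> \<le> C * jb x powr Np T" for x using C(2) by (simp add: fast_def)
 have [measurable]: "h \<in> BM" "v \<in> BM" "H \<in> BM"
  using h wg by (auto simp: wg_def intro: dec_measurable)
 let ?b = "- (N T + 2)/2"
 define A where "A k i x = (LBINT y. h y * Ge1 (es k) y i x)" for k i x
 define B where "B i x = (LBINT y. h y * (- (N T - 2) * gK x y i))" for i x
 define D where "D x = (N T - 2) * (C * (rc * jb x powr Nh T))" for x :: 'a
 define M where "M k x = (LBINT z. jb z powr ?b * h (x + es k *\<^sub>R z))" for k x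
 have Dd: "dec (Nh T) D" unfolding D_def[abs_def] by (intro dec_cmult dec_jb)
 have HD: "LI (\<lambda>x. norm (H x) * D x)" by (rule wg_H_integrable(2)[OF wg Dd])
 have Am [measurable]: "A k i \<in> BM" for k i
  unfolding A_def[abs_def] Ge1_def geps_def by measurable
 have Bm [measurable]: "B i \<in> BM" for i
  unfolding B_def[abs_def] gK_def by measurable
 have HA: "\<bar>(H x \<bullet> i) * A k i x\<bar> \<le> norm (H x) * D x" if "i \<in> Basis" for k i x
  unfolding abs_mult A_def D_def
  by (intro mult_mono Basis_le_norm[OF that] Ge1_integral(2)[OF C that]) auto
 \<comment> \<open>Fubini is licensed by the product of |H| with the decay |x|^(1 - n) of the
   potential, two square-integrable functions.\<close>
 have fub1: "(LBINT y. h y * (LBINT x. (H x \<bullet> i) * Ge1 (es k) y i x)) = (LBINT x. (H x \<bullet> i) * A k i x)"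
  and int1: "LI (\<lambda>y. h y * (LBINT x. (H x \<bullet> i) * Ge1 (es k) y i x))" if i: "i \<in> Basis" for k i
 proof -
  let ?f = "\<lambda>x y. (H x \<bullet> i) * (h y * Ge1 (es k) y i x)"
  have m: "case_prod ?f \<in> borel_measurable (borel \<Otimes>\<^sub>M borel)" unfolding Ge1_def geps_def by measurable
  have i1: "LI (?f x)" for x by (intro integrable_mult_right Ge1_integral(1)[OF C i])
  have b1: "(LBINT y. \<bar>?f x y\<bar>) \<le> norm (H x) * D x" for x
  proof -
   have "(LBINT y. \<bar>?f x y\<bar>) = \<bar>H x \<bullet> i\<bar> * (LBINT y. \<bar>h y * Ge1 (es k) y i x\<bar>)"
    unfolding abs_mult[of "H x \<bullet> i"] by (rule integral_mult_right_zero)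
   also have "\<dots> \<le> norm (H x) * D x" unfolding D_def
    by (intro mult_mono Basis_le_norm[OF i] Ge1_integral(3)[OF C i]) auto
   finally show ?thesis .
  qed
  have e: "(\<lambda>y. \<integral>x. ?f x y \<partial>lborel) = (\<lambda>y. h y * (LBINT x. (H x \<bullet> i) * Ge1 (es k) y i x))"
   by (simp only: mult.left_commute[of "H _ \<bullet> i" "h _"] integral_mult_right_zero)
  show "(LBINT y. h y * (LBINT x. (H x \<bullet> i) * Ge1 (es k) y i x)) = (LBINT x. (H x \<bullet> i) * A k i x)"
   using fubini_dominated(1)[OF m i1 b1 HD] unfolding e A_def integral_mult_right_zero .
  show "LI (\<lambda>y. h y * (LBINT x. (H x \<bullet> i) * Ge1 (es k) y i x))"
   using fubini_dominated(3)[OF m i1 b1 HD] unfolding e .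
 qed
 have vb: "LI (\<lambda>x. v x * (C * (4 powr ((N T + 2)/2) * 2 * om0 TYPE('a) * jb x powr ?b)))"
  by (rule wg_v_integrable[OF wg]) (intro dec_cmult dec_mono[OF dec_jb], simp)
 have Mi: "LI (\<lambda>z. jb z powr ?b * h (x + es k *\<^sub>R z))"
  and Mb: "(LBINT z. \<bar>jb z powr ?b * h (x + es k *\<^sub>R z)\<bar>) \<le> C * (4 powr ((N T + 2)/2) * 2 * om0 TYPE('a) * jb x powr ?b)" for k x
 proof -
  note mb = moll_bound[OF es(1,2), where x=x]
  have le: "\<bar>jb z powr ?b * h (x + es k *\<^sub>R z)\<bar> \<le> C * (jb z powr ?b * jb (x + es k *\<^sub>R z) powr ?b)" for z
  proof -
   have "\<bar>jb z powr ?b * h (x + es k *\<^sub>R z)\<bar> = jb z powr ?b * \<bar>h (x + es k *\<^sub>R z)\<bar>" by (simp add: abs_mult)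
   also have "\<dots> \<le> jb z powr ?b * (C * jb (x + es k *\<^sub>R z) powr ?b)" by (intro mult_left_mono hC) simp
   finally show ?thesis by (simp only: mult.left_commute)
  qed
  show i: "LI (\<lambda>z. jb z powr ?b * h (x + es k *\<^sub>R z))"
  proof (rule integrable_dom[OF integrable_mult_right[OF mb(1), of C]])
   show "AE z in lborel. norm (jb z powr ?b * h (x + es k *\<^sub>R z)) \<le> norm (C * (jb z powr ?b * jb (x + es k *\<^sub>R z) powr ?b))"
    unfolding real_norm_def by (intro AE_I2 order_trans[OF le abs_ge_self])
  qed measurable
  have "(LBINT z. \<bar>jb z powr ?b * h (x + es k *\<^sub>R z)\<bar>) \<le> (LBINT z. C * (jb z powr ?b * jb (x + es k *\<^sub>R z) powr ?b))"
   by (intro integral_mono integrable_abs i integrable_mult_right mb(1) le)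
  also have "\<dots> \<le> C * (4 powr ((N T + 2)/2) * 2 * om0 TYPE('a) * jb x powr ?b)"
   unfolding integral_mult_right_zero by (intro mult_left_mono mb(2) C(1))
  finally show "(LBINT z. \<bar>jb z powr ?b * h (x + es k *\<^sub>R z)\<bar>) \<le> C * (4 powr ((N T + 2)/2) * 2 * om0 TYPE('a) * jb x powr ?b)" .
 qed
 \<comment> \<open>\<open>geps\<close> is symmetric in its two points, so after the exchange the
   inner integral is the average of h around x at scale \<open>es k\<close>.\<close>
 have fub2: "(LBINT y. h y * (LBINT x. v x * ((es k)\<^sup>2 * geps (es k) y x powr ?b))) = (LBINT x. v x * M k x)" for k
 proof -
  let ?f = "\<lambda>x y. v x * ((es k)\<^sup>2 * geps (es k) x y powr ?b * h y)"
  have sym: "geps (es k) y x = geps (es k) x y" for x y by (simp add: geps_def norm_minus_commute)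
  have m: "case_prod ?f \<in> borel_measurable (borel \<Otimes>\<^sub>M borel)" unfolding geps_def by measurable
  have gi: "LI (\<lambda>y. (es k)\<^sup>2 * geps (es k) x y powr ?b * h y)" for x
  proof -
   have "dec (?b + ?b) (\<lambda>y. geps (es k) x y powr ?b * h y)" by (rule dec_mult[OF dec_geps[OF es(1)] h])
   then have "LI (\<lambda>y. geps (es k) x y powr ?b * h y)" by (rule dec_integrable) (simp add: field_simps)
   then show ?thesis unfolding mult.assoc by (rule integrable_mult_right)
  qed
  have b2: "(LBINT y. \<bar>?f x y\<bar>) \<le> \<bar>v x * (C * (4 powr ((N T + 2)/2) * 2 * om0 TYPE('a) * jb x powr ?b))\<bar>" for x
  proof -
   have "(LBINT y. \<bar>(es k)\<^sup>2 * geps (es k) x y powr ?b * h y\<bar>) = (LBINT y. (es k)\<^sup>2 * geps (es k) x y powr ?b * \<bar>h y\<bar>)"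
    by (simp add: abs_mult)
   also have "\<dots> = (LBINT z. jb z powr ?b * \<bar>h (x + es k *\<^sub>R z)\<bar>)" by (rule mollify[OF es(1)])
   also have "\<dots> = (LBINT z. \<bar>jb z powr ?b * h (x + es k *\<^sub>R z)\<bar>)" by (simp add: abs_mult)
   also note Mb[of x k]
   finally have "\<bar>v x\<bar> * (LBINT y. \<bar>(es k)\<^sup>2 * geps (es k) x y powr ?b * h y\<bar>) \<le> \<bar>v x\<bar> * (C * (4 powr ((N T + 2)/2) * 2 * om0 TYPE('a) * jb x powr ?b))"
    by (intro mult_left_mono) auto
   also have "\<dots> \<le> \<bar>v x * (C * (4 powr ((N T + 2)/2) * 2 * om0 TYPE('a) * jb x powr ?b))\<bar>"
    unfolding abs_mult[of "v x"] by (intro mult_left_mono) auto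
   finally show ?thesis unfolding abs_mult[of "v x" "_ * _ * _"] integral_mult_right_zero .
  qed
  have e: "(\<lambda>y. \<integral>x. ?f x y \<partial>lborel) = (\<lambda>y. h y * (LBINT x. v x * ((es k)\<^sup>2 * geps (es k) y x powr ?b)))"
  proof
   fix y
   have "?f x y = h y * (v x * ((es k)\<^sup>2 * geps (es k) y x powr ?b))" for x unfolding sym[of x y] by simp
   then show "(LBINT x. ?f x y) = h y * (LBINT x. v x * ((es k)\<^sup>2 * geps (es k) y x powr ?b))"
    by (simp only: integral_mult_right_zero)
  qed
  show ?thesis
   using fubini_dominated(1)[OF m integrable_mult_right[OF gi] b2 integrable_abs[OF vb]]
   unfolding e integral_mult_right_zero mollify[OF es(1)] M_def .
 qed
 have key: "(\<Sum>i\<in>Basis. \<integral>x. (H x \<bullet> i) * A k i x \<partial>lborel) = N T * (N T - 2) * (LBINT x. v x * M k x)" for k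
 proof -
  have "(\<Sum>i\<in>Basis. \<integral>x. (H x \<bullet> i) * A k i x \<partial>lborel) = (\<Sum>i\<in>Basis. \<integral>y. h y * (LBINT x. (H x \<bullet> i) * Ge1 (es k) y i x) \<partial>lborel)"
   using fub1 by (intro sum.cong) auto
  also have "\<dots> = (LBINT y. (\<Sum>i\<in>Basis. h y * (LBINT x. (H x \<bullet> i) * Ge1 (es k) y i x)))"
   by (rule Bochner_Integration.integral_sum[symmetric]) (rule int1)
  also have "\<dots> = (LBINT y. N T * (N T - 2) * (h y * (LBINT x. v x * ((es k)\<^sup>2 * geps (es k) y x powr ?b))))"
   unfolding sum_distrib_left[symmetric] wg_lap[OF wg es(1)] by (simp only: mult_ac)
  finally show ?thesis unfolding integral_mult_right_zero fub2 .
 qed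
 have lim1: "(\<lambda>k. \<Sum>i\<in>Basis. \<integral>x. (H x \<bullet> i) * A k i x \<partial>lborel) \<leadsto> (\<Sum>i\<in>Basis. \<integral>x. (H x \<bullet> i) * B i x \<partial>lborel)"
 proof (rule tendsto_sum, rule integral_dct[OF _ _ HD])
  fix i :: 'a assume i: "i \<in> Basis"
  show "AE x in lborel. (\<lambda>k. (H x \<bullet> i) * A k i x) \<leadsto> (H x \<bullet> i) * B i x"
   unfolding A_def B_def by (intro AE_I2 tendsto_mult tendsto_const Ge1_integral(4)[OF C i])
  show "AE x in lborel. norm ((H x \<bullet> i) * A k i x) \<le> norm (H x) * D x" for k using HA[OF i] by simp
 qed measurable
 have Mlim: "(\<lambda>k. M k x) \<leadsto> om0 TYPE('a) * h x" for x
  unfolding M_def by (rule mollify_lim[OF h]) simp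
 have Mm [measurable]: "M k \<in> BM" for k unfolding M_def[abs_def] by measurable
 have "(\<lambda>k. \<integral>x. v x * M k x \<partial>lborel) \<leadsto> (LBINT x. v x * (om0 TYPE('a) * h x))"
 proof (rule integral_dct[OF _ _ integrable_abs[OF vb]])
  show "AE x in lborel. (\<lambda>k. v x * M k x) \<leadsto> v x * (om0 TYPE('a) * h x)"
   by (intro AE_I2 tendsto_mult tendsto_const Mlim)
  show "AE x in lborel. norm (v x * M k x) \<le> \<bar>v x * (C * (4 powr ((N T + 2)/2) * 2 * om0 TYPE('a) * jb x powr ?b))\<bar>" for k
  proof (rule AE_I2)
   fix x
   have "\<bar>M k x\<bar> \<le> C * (4 powr ((N T + 2)/2) * 2 * om0 TYPE('a) * jb x powr ?b)"
    unfolding M_def using integral_abs_bound Mb by (rule order_trans)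
   then show "norm (v x * M k x) \<le> \<bar>v x * (C * (4 powr ((N T + 2)/2) * 2 * om0 TYPE('a) * jb x powr ?b))\<bar>"
    unfolding real_norm_def abs_mult[of "v x"] by (intro mult_left_mono) auto
  qed
 qed measurable
 then have lim2: "(\<lambda>k. N T * (N T - 2) * (LBINT x. v x * M k x)) \<leadsto> N T * (N T - 2) * (LBINT x. v x * (om0 TYPE('a) * h x))"
  by (intro tendsto_mult tendsto_const)
 have eq: "(\<Sum>i\<in>Basis. \<integral>x. (H x \<bullet> i) * B i x \<partial>lborel) = N T * (N T - 2) * (LBINT x. v x * (om0 TYPE('a) * h x))"
  using lim1 lim2 unfolding key by (rule LIMSEQ_unique)
 have HBi: "LI (\<lambda>x. (H x \<bullet> i) * B i x)" if i: "i \<in> Basis" for i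
 proof (rule integrable_dom[OF HD])
  show "AE x in lborel. norm ((H x \<bullet> i) * B i x) \<le> norm (norm (H x) * D x)"
  proof (rule AE_I2)
   fix x
   have "(\<lambda>k. (H x \<bullet> i) * A k i x) \<leadsto> (H x \<bullet> i) * B i x"
    unfolding A_def B_def by (intro tendsto_mult tendsto_const Ge1_integral(4)[OF C i])
   then have "\<bar>(H x \<bullet> i) * B i x\<bar> \<le> norm (H x) * D x"
    by (rule LIMSEQ_le_const2[OF tendsto_rabs]) (use HA[OF i] in auto)
   then show "norm ((H x \<bullet> i) * B i x) \<le> norm (norm (H x) * D x)" by simp
  qed
 qed measurable
 let ?c = "N T * (N T - 2) * om0 TYPE('a)"
 have c: "?c \<noteq> 0" using N3 om0_pos by simp
 have "?c * (gradN h x \<bullet> H x) = (\<Sum>i\<in>Basis. (H x \<bullet> i) * B i x)" for x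
 proof -
  have "?c * (gradN h x \<bullet> i) = B i x" if "i \<in> Basis" for i
   unfolding gradN_inner[OF that] B_def mult.left_commute[of "h _"] integral_mult_right_zero
   using N3 om0_pos by (simp add: field_simps)
  then have "(\<Sum>i\<in>Basis. (H x \<bullet> i) * B i x) = (\<Sum>i\<in>Basis. (H x \<bullet> i) * (?c * (gradN h x \<bullet> i)))" by (intro sum.cong) auto
  also have "\<dots> = ?c * (\<Sum>i\<in>Basis. (gradN h x \<bullet> i) * (H x \<bullet> i))" by (simp add: sum_distrib_left mult_ac)
  finally show ?thesis by (simp only: sum_Basis_inner)
 qed
 then have "?c * (LBINT x. gradN h x \<bullet> H x) = (LBINT x. (\<Sum>i\<in>Basis. (H x \<bullet> i) * B i x))"
  by (simp only: integral_mult_right_zero[symmetric])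
 also have "\<dots> = (\<Sum>i\<in>Basis. \<integral>x. (H x \<bullet> i) * B i x \<partial>lborel)"
  by (rule Bochner_Integration.integral_sum) (rule HBi)
 also have "\<dots> = ?c * (LBINT x. h x * v x)"
 proof -
  have "v x * (om0 TYPE('a) * h x) = om0 TYPE('a) * (h x * v x)" for x by simp
  then show ?thesis unfolding eq by (simp only: integral_mult_right_zero mult.assoc)
 qed
 finally show ?thesis using c by simp
qed

text \<open>Pointwise limits of continuous densities under one common bound: wide enough to contain
  sign changes across the boundary of a set, narrow enough that both sides of the weak formulation
  pass to the limit.\<close>

definition fast_lim :: "('a \<Rightarrow> real) \<Rightarrow> bool"
 where "fast_lim h \<longleftrightarrow> (\<exists>C\<ge>0. \<exists>q. (\<forall>k. continuous_on UNIV (q k) \<and> fast C (q k)) \<and> (\<forall>x. (\<lambda>k. q k x) \<leadsto> h x))"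

lemma fast_lim_fast:
 assumes "fast_lim h"
 obtains C where "0 \<le> C" "fast C h"
proof -
 obtain C q where C: "0 \<le> C" and q: "\<And>k. continuous_on UNIV (q k)" "\<And>k. fast C (q k)" and l: "\<And>x. (\<lambda>k. q k x) \<leadsto> h x"
  using assms by (auto simp: fast_lim_def)
 have m: "h \<in> BM"
  by (rule borel_measurable_LIMSEQ_real[OF l]) (use q(2) in \<open>simp add: fast_def\<close>)
 have "\<bar>h x\<bar> \<le> C * jb x powr Np T" for x
  by (rule LIMSEQ_le_const2[OF tendsto_rabs[OF l]]) (use q(2) in \<open>auto simp: fast_def\<close>)
 then show thesis using that C m by (simp add: fast_def)
qed

lemma wg_grad:
 assumes wg: "wg v H" and h: "fast_lim h"
 shows "(LBINT x. gradN h x \<bullet> H x) = (LBINT x. h x * v x)"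
proof -
 obtain C q where C: "0 \<le> C" and q: "\<And>k. continuous_on UNIV (q k)" "\<And>k. fast C (q k)" and l: "\<And>x. (\<lambda>k. q k x) \<leadsto> h x"
  using h by (auto simp: fast_lim_def)
 obtain C' where h': "fast C' h" using fast_lim_fast[OF h] by blast
 have [measurable]: "h \<in> BM" "q k \<in> BM" "v \<in> BM" "H \<in> BM" for k
  using h' q wg by (auto simp: fast_def wg_def)
 have qC: "\<bar>q k x\<bar> \<le> C * jb x powr Np T" for k x using q(2) by (simp add: fast_def)
 have eq: "(LBINT x. gradN (q k) x \<bullet> H x) = (LBINT x. q k x * v x)" for k
  by (rule wg_grad_continuous[OF wg]) (rule decI[OF q(1) qC])
 have i: "LI (\<lambda>x. \<bar>v x * (C * jb x powr Np T)\<bar>)"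
  by (intro integrable_abs wg_v_integrable[OF wg] dec_cmult dec_mono[OF dec_jb]) simp
 have "(\<lambda>k. \<integral>x. q k x * v x \<partial>lborel) \<leadsto> (LBINT x. h x * v x)"
 proof (rule integral_dct[OF _ _ i])
  show "AE x in lborel. (\<lambda>k. q k x * v x) \<leadsto> h x * v x" by (intro AE_I2 tendsto_mult l tendsto_const)
  show "AE x in lborel. norm (q k x * v x) \<le> \<bar>v x * (C * jb x powr Np T)\<bar>" for k
  proof (rule AE_I2)
   fix x
   have "\<bar>v x\<bar> * \<bar>q k x\<bar> \<le> \<bar>v x\<bar> * (C * jb x powr Np T)" by (intro mult_left_mono qC) simp
   then show "norm (q k x * v x) \<le> \<bar>v x * (C * jb x powr Np T)\<bar>" using C by (simp add: abs_mult mult.commute)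
  qed
 qed measurable
 moreover have "(\<lambda>k. \<integral>x. gradN (q k) x \<bullet> H x \<partial>lborel) \<leadsto> (LBINT x. gradN h x \<bullet> H x)"
 proof (rule integral_dct)
  have d: "dec (Nh T) (\<lambda>x::'a. C * (rc / om0 TYPE('a) * jb x powr Nh T))" by (intro dec_cmult dec_jb)
  show "LI (\<lambda>x. norm (H x) * (C * (rc / om0 TYPE('a) * jb x powr Nh T)))" by (rule wg_H_integrable(2)[OF wg d])
  have [measurable]: "gradN (q k) \<in> BM" "gradN h \<in> BM" for k
   by (rule gradN_measurable; measurable)+
  show "(\<lambda>x. gradN h x \<bullet> H x) \<in> borel_measurable lborel" "(\<lambda>x. gradN (q k) x \<bullet> H x) \<in> borel_measurable lborel" for k
   by measurable
  show "AE x in lborel. (\<lambda>k. gradN (q k) x \<bullet> H x) \<leadsto> gradN h x \<bullet> H x"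
  proof (intro AE_I2 tendsto_inner tendsto_const)
   fix x
   have "(\<lambda>k. \<integral>y. q k y * gK x y i \<partial>lborel) \<leadsto> (LBINT y. h y * gK x y i)" if i: "i \<in> Basis" for i
   proof -
    have [measurable]: "(\<lambda>y. gK x y i) \<in> BM" unfolding gK_def by measurable
    have f: "fast C (\<lambda>y. C * jb y powr Np T)" using C by (simp add: fast_def)
    show ?thesis
    proof (rule integral_dct[OF _ _ riesz_fast(2)[OF C f, of x]])
     show "AE y in lborel. (\<lambda>k. q k y * gK x y i) \<leadsto> h y * gK x y i" by (intro AE_I2 tendsto_mult l tendsto_const)
     show "AE y in lborel. norm (q k y * gK x y i) \<le> nk1 x y * \<bar>C * jb y powr Np T\<bar>" for k
     proof (rule AE_I2)
      fix y
      have "\<bar>gK x y i\<bar> * \<bar>q k y\<bar> \<le> nk1 x y * \<bar>C * jb y powr Np T\<bar>"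
       by (intro mult_mono gK_le[OF i] order_trans[OF qC abs_ge_self]) auto
      then show "norm (q k y * gK x y i) \<le> nk1 x y * \<bar>C * jb y powr Np T\<bar>"
       by (simp only: real_norm_def abs_mult[of "q k y"] mult.commute[of "\<bar>q k y\<bar>"])
     qed
    qed measurable
   qed
   then show "(\<lambda>k. gradN (q k) x) \<leadsto> gradN h x"
    unfolding gradN_def using N3 om0_pos by (intro tendsto_intros) auto
  qed
  show "AE x in lborel. norm (gradN (q k) x \<bullet> H x) \<le> norm (H x) * (C * (rc / om0 TYPE('a) * jb x powr Nh T))" for k
  proof (rule AE_I2)
   fix x
   have "\<bar>gradN (q k) x \<bullet> H x\<bar> \<le> norm (gradN (q k) x) * norm (H x)" by (rule Cauchy_Schwarz_ineq2)
   also have "\<dots> \<le> (C * (rc / om0 TYPE('a) * jb x powr Nh T)) * norm (H x)" by (intro mult_right_mono gradN_bound[OF C q(2)]) simp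
   finally show "norm (gradN (q k) x \<bullet> H x) \<le> norm (H x) * (C * (rc / om0 TYPE('a) * jb x powr Nh T))" by (simp add: mult.commute)
  qed
 qed
 ultimately show ?thesis unfolding eq by (rule LIMSEQ_unique[rotated])
qed

text \<open>\<open>Kop_1\<close> evaluates the potential of jb^(-(n + 2)/2) exactly as a multiple of
  jb^(-(n - 2)/2). The potential of every \<open>fast\<close> density therefore decays like a
  bubble.\<close>

lemma newton_fast_integrable:
 assumes h: "fast C h"
 shows "LI (\<lambda>y. nk2 x y * h y)"
  and "(LBINT y. \<bar>nk2 x y * h y\<bar>) \<le> C * (om0 TYPE('a) * jb x powr Nm T)"
proof -
 have [measurable]: "h \<in> BM" using h by (simp add: fast_def)
 let ?j = "\<lambda>y. nk2 x y * jb y powr Np T"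
 have le: "\<bar>nk2 x y * h y\<bar> \<le> C * ?j y" for y
  using h mult_left_mono[of "\<bar>h y\<bar>" "C * jb y powr Np T" "nk2 x y"]
  by (simp add: fast_def abs_mult mult.left_commute)
 show i: "LI (\<lambda>y. nk2 x y * h y)"
  by (rule integrable_dom[OF integrable_mult_right[OF newton_integrable[of x], of C]])
    (use order_trans[OF le abs_ge_self] in simp_all)
 have "(LBINT y. \<bar>nk2 x y * h y\<bar>) \<le> (LBINT y. C * ?j y)"
  by (intro integral_mono integrable_abs i integrable_mult_right newton_integrable le)
 also have "\<dots> = C * (LBINT y. ?j y)" by (rule integral_mult_right_zero)
 also have "(LBINT y. ?j y) = om0 TYPE('a) * jb x powr Nm T"
 proof -
  have "jb x powr ((N T - 2)/2) / om0 TYPE('a) * (LBINT y. ?j y) = 1"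
   using Kop_1[of x] unfolding Kop_def by (simp only: mult_1_right)
  moreover have "jb x powr ((N T - 2)/2) * (LBINT y. ?j y) = (jb x powr ((N T - 2)/2) / om0 TYPE('a) * (LBINT y. ?j y)) * om0 TYPE('a)"
   using om0_pos by simp
  ultimately have h: "jb x powr ((N T - 2)/2) * (LBINT y. ?j y) = om0 TYPE('a)" by (simp only: mult_1_left)
  have "(a * b) * I = (a * I) * b" for a b I :: real by simp
  from this[of "jb x powr ((N T - 2)/2)" "jb x powr Nm T" "\<integral>y. ?j y \<partial>lborel"]
  have "(jb x powr ((N T - 2)/2) * jb x powr Nm T) * (LBINT y. ?j y) = om0 TYPE('a) * jb x powr Nm T"
   unfolding h .
  moreover have "jb x powr ((N T - 2)/2) * jb x powr Nm T = 1" by (rule powr_mult_one) (auto simp: field_simps)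
  ultimately show ?thesis by (simp only: mult_1_left)
 qed
 finally show "(LBINT y. \<bar>nk2 x y * h y\<bar>) \<le> C * (om0 TYPE('a) * jb x powr Nm T)" .
qed

lemma newt_bound:
 assumes h: "fast C h"
 shows "\<bar>newt h x\<bar> \<le> C * jb x powr Nm T / (N T * (N T - 2))"
proof -
 have "\<bar>\<integral>y. nk2 x y * h y \<partial>lborel\<bar> \<le> C * (om0 TYPE('a) * jb x powr Nm T)"
  using integral_abs_bound newton_fast_integrable(2)[OF h] by (rule order_trans)
 then have "\<bar>\<integral>y. nk2 x y * h y \<partial>lborel\<bar> / (N T * (N T - 2) * om0 TYPE('a)) \<le> C * (om0 TYPE('a) * jb x powr Nm T) / (N T * (N T - 2) * om0 TYPE('a))"
  using N3 om0_pos by (intro divide_right_mono) auto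
 then show ?thesis using N3 om0_pos by (simp add: newt_def)
qed

text \<open>Integration by parts against the singular kernel: it is carried out for
  \<open>Ge\<close>, and both sides pass to the limit under integrable majorants.\<close>

lemma newton_test:
 assumes \<psi>: "test_fun \<psi>" and i: "i \<in> Basis"
 shows "(LBINT x. nk2 x y * frechet_derivative \<psi> (at x) i) = (N T - 2) * (LBINT x. gK x y i * \<psi> x)"
proof -
 have s: "smooth \<psi>" using \<psi> by (simp add: test_fun_def)
 let ?d = "\<lambda>x. frechet_derivative \<psi> (at x) i"
 note d0 = test_fun_dec(1)[OF \<psi>] and d1 = test_fun_dec(2)[OF \<psi> i]
 have [measurable]: "\<psi> \<in> BM" "?d \<in> BM"
  using dec_measurable[OF d0] dec_measurable[OF d1] by auto
 obtain C where C: "0 \<le> C" "fast C \<psi>" using fast_dec[OF d0] by blast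
 have iR: "LI (\<lambda>x. nk1 x y * \<bar>\<psi> x\<bar>)"
  by (subst norm_minus_commute) (rule riesz_fast(2)[OF C])
 have iN: "LI (\<lambda>x. nk2 y x * ?d x)" by (rule newton_dec_integrable[OF d1])
 have [measurable]: "(\<lambda>x. gK x y i) \<in> BM" unfolding gK_def by measurable
 have [measurable]: "Ge (es k) y \<in> BM" "Ge1 (es k) y i \<in> BM" for k
  using dec_measurable[OF dec_Ge[OF es(1)]] dec_measurable[OF dec_Ge1[OF es(1)]] by auto
 have j1: "LI (\<lambda>x. Ge1 (es k) y i x * \<psi> x)" and j2: "LI (\<lambda>x. Ge (es k) y x * ?d x)" for k
  by (rule dec_integrable[OF dec_mult[OF dec_Ge1[OF es(1)] test_fun_dec(1)[OF \<psi>, of "- 1"]]], simp add: field_simps)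
    (rule dec_integrable[OF dec_mult[OF dec_Ge[OF es(1)] test_fun_dec(2)[OF \<psi> i, of "- 2"]]], simp add: field_simps)
 have eq: "(LBINT x. Ge (es k) y x * ?d x) = - (LBINT x. Ge1 (es k) y i x * \<psi> x)" for k
 proof -
  have "(LBINT x. Ge1 (es k) y i x * \<psi> x + Ge (es k) y x * ?d x) = 0"
  proof (rule integral_pd_zero_dec[OF i pd_mult[OF pd_Ge[OF es(1)] pd_frechet[OF s]]])
   show "dec (- (N T - 2)/2 + - 1) (\<lambda>x. Ge (es k) y x * \<psi> x)" by (intro dec_mult dec_Ge es d0)
   show "dec (- (N T - 2)/2 + - 2) (\<lambda>x. Ge1 (es k) y i x * \<psi> x + Ge (es k) y x * ?d x)"
    by (intro dec_add dec_mult'[OF dec_Ge1[OF es(1)] test_fun_dec(1)[OF \<psi>, of "- 3/2"]] dec_mult dec_Ge es d1) (simp add: field_simps)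
  qed (simp_all add: field_simps)
  then show ?thesis using j1[of k] j2[of k] by simp
 qed
 have "(\<lambda>k. \<integral>x. Ge (es k) y x * ?d x \<partial>lborel) \<leadsto> (LBINT x. nk2 y x * ?d x)"
 proof (rule integral_dct[OF _ _ integrable_abs[OF iN]])
  show "AE x in lborel. (\<lambda>k. Ge (es k) y x * ?d x) \<leadsto> nk2 y x * ?d x"
   using AE_neq[of y] by eventually_elim (intro tendsto_mult Ge_lim tendsto_const)
  show "AE x in lborel. norm (Ge (es k) y x * ?d x) \<le> \<bar>nk2 y x * ?d x\<bar>" for k
   using AE_neq[of y]
  proof eventually_elim
   case (elim x)
   have "0 \<le> Ge (es k) y x" by (simp add: Ge_def)
   then show ?case using Ge_le[OF elim es(1), of k] by (simp add: abs_mult mult_right_mono)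
  qed
 qed measurable
 moreover have "(\<lambda>k. \<integral>x. Ge1 (es k) y i x * \<psi> x \<partial>lborel) \<leadsto> (LBINT x. (- (N T - 2) * gK x y i) * \<psi> x)"
 proof (rule integral_dct[OF _ _ integrable_mult_right[OF iR, of "N T - 2"]])
  show "AE x in lborel. (\<lambda>k. Ge1 (es k) y i x * \<psi> x) \<leadsto> (- (N T - 2) * gK x y i) * \<psi> x"
   by (intro AE_I2 tendsto_mult Ge1_lim tendsto_const)
  show "AE x in lborel. norm (Ge1 (es k) y i x * \<psi> x) \<le> (N T - 2) * (nk1 x y * \<bar>\<psi> x\<bar>)" for k
   using mult_right_mono[OF Ge1_le[OF i, of "es k" y], of "\<bar>\<psi> _\<bar>"] by (intro AE_I2) (simp add: abs_mult mult.assoc)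
 qed measurable
 then have "(\<lambda>k. - (LBINT x. Ge1 (es k) y i x * \<psi> x)) \<leadsto> - (LBINT x. (- (N T - 2) * gK x y i) * \<psi> x)"
  by (rule tendsto_minus)
 ultimately have "(LBINT x. nk2 y x * ?d x) = - (LBINT x. (- (N T - 2) * gK x y i) * \<psi> x)"
  unfolding eq by (rule LIMSEQ_unique)
 then show ?thesis by (simp only: mult.assoc integral_mult_right_zero mult_minus_left Bochner_Integration.integral_minus minus_minus norm_minus_commute[of y])
qed

text \<open>Fubini moves the derivative of the test function onto the kernel, where
  \<open>newton_test\<close> applies. Integrability of the required powers follows from the
  pointwise decay of the potential and of \<open>gradN\<close>.\<close>

lemma newt_weak_grad:
 assumes h: "0 \<le> C" "fast C h"
 shows "weak_grad (newt h) (gradN h)"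
  and "LI (\<lambda>x. (norm (gradN h x))\<^sup>2)"
  and "newt h \<in> D12"
proof -
 have hm [measurable]: "h \<in> BM" using h(2) by (simp add: fast_def)
 have gm [measurable]: "gradN h \<in> BM" and nm [measurable]: "newt h \<in> BM"
  by (rule gradN_measurable newt_measurable, measurable)+
 have g2: "LI (\<lambda>x. (norm (gradN h x))\<^sup>2)"
 proof -
  have "dec (real 2 * (Nh T)) (\<lambda>x::'a. (C * (rc / om0 TYPE('a) * jb x powr Nh T))\<^sup>2)" by (intro dec_power dec_cmult dec_jb)
  then have i: "LI (\<lambda>x::'a. (C * (rc / om0 TYPE('a) * jb x powr Nh T))\<^sup>2)"
   by (rule dec_integrable) (use N3 in \<open>simp add: field_simps\<close>)
  show ?thesis
   by (rule integrable_dom[OF i]) (use gradN_bound[OF h] in \<open>auto intro!: power_mono\<close>)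
 qed
 then show "LI (\<lambda>x. (norm (gradN h x))\<^sup>2)" .
 have n2: "LI (\<lambda>x. \<bar>newt h x\<bar> powr (2 * N T / (N T - 2)))"
 proof -
  define c where "c = C / (N T * (N T - 2))"
  let ?q = "2 * N T / (N T - 2)"
  have i: "LI (\<lambda>x::'a. c powr ?q * jb x powr (- N T))"
   using integrable_jb_powr[where 'a='a, of "N T"] N3 by simp
  show ?thesis
  proof (rule integrable_dom[OF i])
   show "AE x in lborel. norm (\<bar>newt h x\<bar> powr ?q) \<le> norm (c powr ?q * jb x powr (- N T))"
   proof (rule AE_I2)
    fix x
    have "\<bar>newt h x\<bar> \<le> c * jb x powr Nm T" using newt_bound[OF h(2), of x] by (simp add: c_def)
    then have "\<bar>newt h x\<bar> powr ?q \<le> (c * jb x powr Nm T) powr ?q" using N3 by (intro powr_mono2) auto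
    also have "\<dots> = c powr ?q * jb x powr (- (N T - 2)/2 * ?q)" by (simp only: powr_mult powr_powr)
    also have "- (N T - 2)/2 * ?q = - N T" using N3 by (simp add: field_simps)
    finally show "norm (\<bar>newt h x\<bar> powr ?q) \<le> norm (c powr ?q * jb x powr (- N T))" by simp
   qed
  qed measurable
 qed
 show wgr: "weak_grad (newt h) (gradN h)"
  unfolding weak_grad_def
 proof (intro conjI allI impI ballI)
  show "gradN h \<in> borel_measurable lebesgue" by (intro measurable_completion) simp
  fix \<psi> :: "'a \<Rightarrow> real" and i :: 'a assume \<psi>: "test_fun \<psi>" and i: "i \<in> Basis"
  let ?d = "\<lambda>x. frechet_derivative \<psi> (at x) i"
  note d0 = test_fun_dec(1)[OF \<psi>] and d1 = test_fun_dec(2)[OF \<psi> i]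
  have [measurable]: "\<psi> \<in> BM" "?d \<in> BM"
   using dec_measurable[OF d0] dec_measurable[OF d1] by auto
  let ?c = "1 / (N T * (N T - 2) * om0 TYPE('a))"
  let ?f = "\<lambda>x y. (nk2 x y * h y) * ?d x"
  have mf: "case_prod ?f \<in> borel_measurable (borel \<Otimes>\<^sub>M borel)" by measurable
  have bf: "(LBINT y. \<bar>?f x y\<bar>) \<le> (C * (om0 TYPE('a) * jb x powr Nm T)) * \<bar>?d x\<bar>" for x
   unfolding abs_mult[of _ "?d x"] integral_mult_left_zero by (intro mult_right_mono newton_fast_integrable(2)[OF h(2)]) simp
  have "dec (- (N T - 2)/2 + - 2) (\<lambda>x. (C * (om0 TYPE('a) * jb x powr Nm T)) * ?d x)"
   by (intro dec_mult dec_cmult dec_jb d1)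
  then have "LI (\<lambda>x. (C * (om0 TYPE('a) * jb x powr Nm T)) * ?d x)"
   by (rule dec_integrable) (simp add: field_simps)
  from integrable_abs[OF this] have Bf: "LI (\<lambda>x. (C * (om0 TYPE('a) * jb x powr Nm T)) * \<bar>?d x\<bar>)"
   using h(1) om0_pos by (simp add: abs_mult)
  note F = fubini_dominated[OF mf integrable_mult_left[OF newton_fast_integrable(1)[OF h(2)]] bf Bf]
  let ?g = "\<lambda>x y. (h y * gK x y i) * \<psi> x"
  have mg: "case_prod ?g \<in> borel_measurable (borel \<Otimes>\<^sub>M borel)" unfolding gK_def by measurable
  have G: "(LBINT y. (LBINT x. ?g x y)) = (LBINT x. (LBINT y. ?g x y))"
   "LI (\<lambda>x. \<integral>y. ?g x y \<partial>lborel)"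
  proof -
   have "(\<lambda>y. gK x y i) \<in> BM" for x unfolding gK_def by measurable
   note A = integral_kernel_le[OF this hm _ riesz_fast(2,3)[OF h], where c=1]
   have i1: "LI (?g x)" for x by (intro integrable_mult_left A(1)) (use gK_le[OF i] in simp_all)
   have b1: "(LBINT y. \<bar>?g x y\<bar>) \<le> (C * (rc * jb x powr Nh T)) * \<bar>\<psi> x\<bar>" for x
   proof -
    have "(LBINT y. \<bar>h y * gK x y i\<bar>) \<le> 1 * (C * (rc * jb x powr Nh T))" by (rule A(3)) (use gK_le[OF i] in simp_all)
    then show ?thesis unfolding abs_mult[of _ "\<psi> x"] integral_mult_left_zero by (intro mult_right_mono) auto
   qed
   have "dec (- (N T - 1)/2 + - 2) (\<lambda>x. (C * (rc * jb x powr Nh T)) * \<psi> x)"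
    by (intro dec_mult dec_cmult dec_jb d0)
   then have "LI (\<lambda>x. (C * (rc * jb x powr Nh T)) * \<psi> x)"
    by (rule dec_integrable) (simp add: field_simps)
   from integrable_abs[OF this] have B1: "LI (\<lambda>x. (C * (rc * jb x powr Nh T)) * \<bar>\<psi> x\<bar>)"
    using h(1) riesz_fast(1) by (simp add: abs_mult)
   show "(LBINT y. (LBINT x. ?g x y)) = (LBINT x. (LBINT y. ?g x y))"
    "LI (\<lambda>x. \<integral>y. ?g x y \<partial>lborel)" by (rule fubini_dominated[OF mg i1 b1 B1])+
  qed
  have n: "newt h x * ?d x = ?c * (LBINT y. ?f x y)" for x by (simp add: newt_def)
  have g: "(gradN h x \<bullet> i) * \<psi> x = - (1 / (N T * om0 TYPE('a))) * (LBINT y. ?g x y)" for x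
   unfolding gradN_inner[OF i] by simp
  show "integrable lebesgue (\<lambda>x. newt h x * ?d x)"
   by (subst integrable_lebesgue_iff, measurable) (unfold n, intro integrable_mult_right F(2))
  show "integrable lebesgue (\<lambda>x. (gradN h x \<bullet> i) * \<psi> x)"
   by (subst integrable_lebesgue_iff, measurable) (unfold g, intro integrable_mult_right G(2))
  have "(LBINT x. newt h x * ?d x) = ?c * (LBINT y. (LBINT x. ?f x y))"
   unfolding n integral_mult_right_zero F(1) ..
  also have "(\<lambda>y. \<integral>x. ?f x y \<partial>lborel) = (\<lambda>y. (N T - 2) * (LBINT x. ?g x y))"
  proof
   fix y
   have "(LBINT x. ?f x y) = (LBINT x. h y * (nk2 x y * ?d x))" by (simp only: mult_ac)
   also have "\<dots> = h y * ((N T - 2) * (LBINT x. gK x y i * \<psi> x))" by (simp only: integral_mult_right_zero newton_test[OF \<psi> i])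
   also have "\<dots> = (N T - 2) * (h y * (LBINT x. gK x y i * \<psi> x))" by simp
   also have "\<dots> = (N T - 2) * (LBINT x. ?g x y)" by (simp only: integral_mult_right_zero[symmetric] mult.assoc)
   finally show "(LBINT x. ?f x y) = (N T - 2) * (LBINT x. ?g x y)" .
  qed
  also have "?c * (LBINT y. (N T - 2) * (LBINT x. ?g x y)) = (1 / (N T * om0 TYPE('a))) * (LBINT x. (LBINT y. ?g x y))"
   unfolding integral_mult_right_zero G(1) using N3 by simp
  also have "\<dots> = - (LBINT x. (gradN h x \<bullet> i) * \<psi> x)"
   unfolding g integral_mult_right_zero by simp
  finally have eq: "(LBINT x. newt h x * ?d x) = - (LBINT x. (gradN h x \<bullet> i) * \<psi> x)" .
  have "(\<integral>x. newt h x * ?d x \<partial>lebesgue) = (LBINT x. newt h x * ?d x)"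
   "(\<integral>x. (gradN h x \<bullet> i) * \<psi> x \<partial>lebesgue) = (LBINT x. (gradN h x \<bullet> i) * \<psi> x)"
   by (rule integrable_lebesgue_iff; measurable)+
  with eq show "(\<integral>x. newt h x * ?d x \<partial>lebesgue) = - (\<integral>x. (gradN h x \<bullet> i) * \<psi> x \<partial>lebesgue)" by simp
 qed
 have "integrable lebesgue (\<lambda>x. (norm (gradN h x))\<^sup>2)" "integrable lebesgue (\<lambda>x. \<bar>newt h x\<bar> powr crit_exp TYPE('a))"
  using g2 n2 by (subst integrable_lebesgue_iff; simp add: crit_exp_def)+
 moreover have "newt h \<in> borel_measurable lebesgue" by (intro measurable_completion) simp
 ultimately show "newt h \<in> D12" unfolding D12_def using wgr by blast
qed

text \<open>The equation for the potential, tested with arbitrary functions of D12. Uniqueness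
  replaces the chosen gradient by \<open>gradN\<close>, and Borel representatives replace the test
  function.\<close>

proposition newt_weak:
 assumes h: "fast_lim h" and v: "v \<in> D12"
 shows "(\<integral>x. wgrad (newt h) x \<bullet> wgrad v x \<partial>lebesgue) = (\<integral>x. h x * v x \<partial>lebesgue)"
proof -
 obtain C where C: "0 \<le> C" "fast C h" by (rule fast_lim_fast[OF h])
 have [measurable]: "h \<in> BM" using C(2) by (simp add: fast_def)
 note W = newt_weak_grad[OF C]
 have i: "integrable lebesgue (\<lambda>x. (norm (gradN h x))\<^sup>2)"
  using W(2) gradN_measurable[of h] by (subst integrable_lebesgue_iff) auto
 note W3 = D12_wgrad[OF W(3)] and V = D12_wgrad[OF v]
 have gA: "AE x in lebesgue. wgrad (newt h) x = gradN h x" by (rule weak_grad_unique[OF W3 W(1) i])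
 have [measurable]: "wgrad (newt h) \<in> borel_measurable lebesgue" "wgrad v \<in> borel_measurable lebesgue"
  using W3(1) V(1) by (auto simp: weak_grad_def)
 have [measurable]: "v \<in> borel_measurable lebesgue" "h \<in> borel_measurable lebesgue"
  using v by (auto simp: D12_def intro!: measurable_completion)
 obtain v0 H where wg: "wg v0 H" and vA: "AE x in lebesgue. v x = v0 x" and HA: "AE x in lebesgue. wgrad v x = H x"
  by (rule D12_wg[OF v])
 have [measurable]: "v0 \<in> BM" "H \<in> BM" "gradN h \<in> BM"
  using wg gradN_measurable[of h] by (auto simp: wg_def)
 have cong: "integral\<^sup>L lebesgue f = integral\<^sup>L lborel g"
  if "AE x in lebesgue. f x = g x" "f \<in> borel_measurable lebesgue" and [measurable]: "g \<in> BM" for f g :: "'a \<Rightarrow> real"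
 proof -
  have g: "g \<in> borel_measurable lebesgue" by (intro measurable_completion) simp
  have "integral\<^sup>L lebesgue f = integral\<^sup>L lebesgue g" by (rule integral_cong_AE[OF that(2) g that(1)])
  then show ?thesis by (simp add: integrable_lebesgue_iff(2))
 qed
 have "(\<integral>x. wgrad (newt h) x \<bullet> wgrad v x \<partial>lebesgue) = (LBINT x. gradN h x \<bullet> H x)"
  by (rule cong) (use gA HA in \<open>eventually_elim, simp\<close>, (measurable; fail)+)
 also have "\<dots> = (LBINT x. h x * v0 x)" by (rule wg_grad[OF wg h])
 also have "\<dots> = (\<integral>x. h x * v x \<partial>lebesgue)"
  by (rule cong[symmetric]) (use vA in \<open>eventually_elim, simp\<close>, (measurable; fail)+)
 finally show ?thesis .
qed

text \<open>The indicator of a closed set is the limit of the continuous functions max 0 (1 - k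
  dist). The summand c makes room for a difference of two right-hand sides, as occurs in the
  equation for \<phi>.\<close>

lemma fast_lim_cut:
 assumes E: "closed E" "E \<noteq> {}" and a: "dec (Np T) a" and c: "dec (Np T) c"
 shows "fast_lim (\<lambda>x. (1 - 2 * ind E x) * a x + c x)"
proof -
 define s where "s k x = max 0 (1 - real k * infdist x E)" for k :: nat and x
 have s01: "0 \<le> s k x" "s k x \<le> 1" for k x by (auto simp: s_def infdist_nonneg)
 obtain Ca where Ca: "0 \<le> Ca" "fast Ca a" using fast_dec[OF a] by blast
 obtain Cc where Cc: "0 \<le> Cc" "fast Cc c" using fast_dec[OF c] by blast
 have cont: "continuous_on UNIV (\<lambda>x. (1 - 2 * s k x) * a x + c x)" for k
  unfolding s_def by (intro continuous_intros dec_continuous[OF a] dec_continuous[OF c])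
 have "fast (Ca + Cc) (\<lambda>x. (1 - 2 * s k x) * a x + c x)" for k
  unfolding fast_def
 proof (intro conjI allI)
  show "(\<lambda>x. (1 - 2 * s k x) * a x + c x) \<in> BM" using cont by (rule borel_measurable_continuous_onI)
  fix x
  have "\<bar>1 - 2 * s k x\<bar> \<le> 1" using s01[of k x] by simp
  then have "\<bar>(1 - 2 * s k x) * a x\<bar> \<le> 1 * \<bar>a x\<bar>" unfolding abs_mult by (rule mult_right_mono) simp
  then have "\<bar>(1 - 2 * s k x) * a x + c x\<bar> \<le> \<bar>a x\<bar> + \<bar>c x\<bar>" by linarith
  also have "\<dots> \<le> Ca * jb x powr Np T + Cc * jb x powr Np T"
   using Ca(2) Cc(2) unfolding fast_def by (intro add_mono) blast+
  finally show "\<bar>(1 - 2 * s k x) * a x + c x\<bar> \<le> (Ca + Cc) * jb x powr Np T" by (simp only: ring_distribs)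
 qed
 moreover have "(\<lambda>k. (1 - 2 * s k x) * a x + c x) \<leadsto> (1 - 2 * ind E x) * a x + c x" for x
 proof -
  have "(\<lambda>k. s k x) \<leadsto> ind E x"
  proof (cases "x \<in> E")
   case True
   then show ?thesis by (simp add: s_def)
  next
   case False
   then have "infdist x E \<noteq> 0" using E in_closed_iff_infdist_zero by blast
   then have d: "0 < infdist x E" using infdist_nonneg[of x E] by linarith
   obtain m :: nat where m: "1 / infdist x E \<le> real m" using real_arch_simple by blast
   have "s k x = 0" if "m \<le> k" for k
   proof -
    have "1 / infdist x E \<le> real k" using m that by (meson of_nat_le_iff order_trans)
    then have "1 \<le> real k * infdist x E" using d by (simp add: field_simps)
    then show ?thesis by (simp add: s_def)
   qed
   then have "\<forall>\<^sub>F k in sequentially. s k x = ind E x" using False by (auto simp: eventually_sequentially)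
   then show ?thesis by (rule tendsto_eventually)
  qed
  then show ?thesis by (intro tendsto_intros)
 qed
 ultimately show ?thesis unfolding fast_lim_def using cont Ca(1) Cc(1)
  by (intro exI[of _ "Ca + Cc"] conjI exI[of _ "\<lambda>k x. (1 - 2 * s k x) * a x + c x"] allI) auto
qed

section \<open>Bubbles and the solution built from a profile\<close>

lemma alpha_pos: "0 < alpha_n TYPE('a)"
 using N3 by (simp add: alpha_n_def)

text \<open>The constant \<alpha>_n is the one for which the bubble solves the critical equation
  without a factor.\<close>

lemma alpha_pp: "alpha_n TYPE('a) powr pp = N T * (N T - 2) * alpha_n TYPE('a)"
proof -
 let ?X = "N T * (N T - 2)"
 have X: "0 < ?X" using N3 by simp
 have e: "(N T - 2)/4 * pp = 1 + (N T - 2)/4" using N3 by (simp add: pp_def field_simps)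
 have "alpha_n TYPE('a) powr pp = ?X powr ((N T - 2)/4 * pp)" by (simp only: alpha_n_def powr_powr)
 also have "\<dots> = ?X * alpha_n TYPE('a)" unfolding e alpha_n_def powr_add using X by simp
 finally show ?thesis .
qed

definition sc :: "real \<Rightarrow> 'a \<Rightarrow> 'a \<Rightarrow> 'a"
 where "sc \<delta> \<xi> x = (1 / \<delta>) *\<^sub>R (x - \<xi>)"

lemma sc_inverse: "0 < \<delta> \<Longrightarrow> \<xi> + \<delta> *\<^sub>R sc \<delta> \<xi> x = x" "0 < \<delta> \<Longrightarrow> sc \<delta> \<xi> (\<xi> + \<delta> *\<^sub>R z) = z"
 by (simp_all add: sc_def)

lemma bubble_eq:
 assumes d: "0 < \<delta>"
 shows "bubble \<delta> \<xi> x = alpha_n TYPE('a) * (\<delta> powr Nm T * jb (sc \<delta> \<xi> x) powr Nm T)"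
proof -
 have "\<delta>\<^sup>2 + (norm (x - \<xi>))\<^sup>2 = \<delta>\<^sup>2 * jb (sc \<delta> \<xi> x)"
 proof -
  have "norm (x - \<xi>) = \<delta> * norm (sc \<delta> \<xi> x)" using d by (simp add: sc_def)
  then show ?thesis by (simp add: jb_def power_mult_distrib algebra_simps)
 qed
 then have "(\<delta>\<^sup>2 + (norm (x - \<xi>))\<^sup>2) powr Nm T = \<delta> powr (- (N T - 2)) * jb (sc \<delta> \<xi> x) powr Nm T"
  using d by (simp only: powr_mult sq_powr_half abs_of_pos)
 moreover have "\<delta> powr ((N T - 2)/2) * \<delta> powr (- (N T - 2)) = \<delta> powr Nm T"
  by (simp only: powr_add[symmetric]) (simp add: field_simps)
 ultimately show ?thesis unfolding bubble_def by (simp only: mult.assoc) (simp only: mult.assoc[symmetric])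
qed

lemma bubble_pos: "0 < \<delta> \<Longrightarrow> 0 < bubble \<delta> \<xi> (x::'a)"
 unfolding bubble_eq using alpha_pos by simp

lemma bubble_powr:
 assumes d: "0 < \<delta>"
 shows "bubble \<delta> \<xi> x powr pp = alpha_n TYPE('a) powr pp * (\<delta> powr Np T * jb (sc \<delta> \<xi> x) powr Np T)"
proof -
 have "- (N T - 2)/2 * pp = - (N T + 2)/2" using N3 by (simp add: pp_def field_simps)
 then show ?thesis unfolding bubble_eq[OF d] by (simp only: powr_mult powr_powr)
qed

lemma dec_bubble: "0 < \<delta> \<Longrightarrow> dec (Nm T) (bubble \<delta> (\<xi>::'a))"
 unfolding bubble_def[abs_def] by (intro dec_cmult dec_eps)

lemma dec_powr_pp:
 assumes f: "dec (Nm T) f" and p: "\<And>x. 0 < f x"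
 shows "dec (Np T) (\<lambda>x. f x powr pp)"
proof -
 obtain C where C: "0 < C" "\<And>x. \<bar>f x\<bar> \<le> C * jb x powr Nm T" using decE[OF f] by blast
 have e: "- (N T - 2)/2 * pp = - (N T + 2)/2" using N3 by (simp add: pp_def field_simps)
 show ?thesis
 proof (rule decI)
  show "continuous_on UNIV (\<lambda>x. f x powr pp)"
   using p by (intro continuous_intros dec_continuous[OF f]) (metis less_irrefl)
  show "\<bar>f x powr pp\<bar> \<le> C powr pp * jb x powr Np T" for x
  proof -
   have "f x powr pp \<le> (C * jb x powr Nm T) powr pp"
    using C(2)[of x] p[of x] pp1 by (intro powr_mono2) auto
   then show ?thesis by (simp only: powr_mult powr_powr e) simp
  qed
 qed
qed

text \<open>Conformal covariance: in the rescaled variable the potential of U^p f is U times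
  \<open>Kop f\<close>. The fixed point equation for the profile is thus the differential equation
  in integral form.\<close>

lemma newt_scale:
 assumes d: "0 < \<delta>"
 shows "newt (\<lambda>x. bubble \<delta> \<xi> x powr pp * f (sc \<delta> \<xi> x)) x = bubble \<delta> \<xi> x * Kop f (sc \<delta> \<xi> x)"
proof -
 let ?y = "sc \<delta> \<xi> x" and ?a = "alpha_n TYPE('a)"
 define I where "I = (LBINT z. nk2 ?y z * (jb z powr Np T * f z))"
 have pt: "norm (x - (\<xi> + \<delta> *\<^sub>R z)) powr (2 - N T) * (bubble \<delta> \<xi> (\<xi> + \<delta> *\<^sub>R z) powr pp * f (sc \<delta> \<xi> (\<xi> + \<delta> *\<^sub>R z)))
   = (\<delta> powr (2 - N T) * (?a powr pp * \<delta> powr Np T)) * (nk2 ?y z * (jb z powr Np T * f z))" for z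
 proof -
  have "x - (\<xi> + \<delta> *\<^sub>R z) = \<delta> *\<^sub>R (?y - z)" using d by (simp add: sc_def algebra_simps)
  then have "norm (x - (\<xi> + \<delta> *\<^sub>R z)) = \<delta> * norm (?y - z)" using d by simp
  then show ?thesis unfolding bubble_powr[OF d] sc_inverse(2)[OF d] by (simp only: powr_mult mult_ac)
 qed
 have "(LBINT w. nk2 x w * (bubble \<delta> \<xi> w powr pp * f (sc \<delta> \<xi> w)))
  = \<delta> powr N T * ((\<delta> powr (2 - N T) * (?a powr pp * \<delta> powr Np T)) * I)"
  using d by (subst lborel_integral_affine(1)[of \<delta> _ \<xi>]) (simp_all only: pt integral_mult_right_zero I_def, simp_all add: powr_realpow)
 also have "\<dots> = ?a powr pp * ((\<delta> powr N T * \<delta> powr (2 - N T) * \<delta> powr Np T) * I)" by (simp only: mult_ac)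
 also have "\<delta> powr N T * \<delta> powr (2 - N T) * \<delta> powr Np T = \<delta> powr Nm T"
  by (simp only: powr_add[symmetric]) (simp add: field_simps)
 finally have l: "newt (\<lambda>x. bubble \<delta> \<xi> x powr pp * f (sc \<delta> \<xi> x)) x = ?a * (\<delta> powr Nm T * (I / om0 TYPE('a)))"
  unfolding newt_def alpha_pp using N3 by simp
 have "jb ?y powr Nm T * Kop f ?y = (jb ?y powr Nm T * jb ?y powr ((N T - 2)/2)) * (I / om0 TYPE('a))"
  unfolding Kop_def I_def by simp
 also have "jb ?y powr Nm T * jb ?y powr ((N T - 2)/2) = 1" by (rule powr_mult_one) (auto simp: field_simps)
 finally have "I / om0 TYPE('a) = jb ?y powr Nm T * Kop f ?y" by simp
 moreover have "bubble \<delta> \<xi> x * Kop f ?y = ?a * (\<delta> powr Nm T * (jb ?y powr Nm T * Kop f ?y))"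
  unfolding bubble_eq[OF d] by (simp only: mult.assoc)
 ultimately show ?thesis by (simp only: l)
qed

lemma newt_diff:
 assumes "fast C f" "fast D g"
 shows "newt (\<lambda>x. f x - g x) x = newt f x - newt g x"
 unfolding newt_def using newton_fast_integrable(1)[OF assms(1)] newton_fast_integrable(1)[OF assms(2)]
 by (simp add: right_diff_distrib diff_divide_distrib)

text \<open>The integral of U^(p + 1) does not depend on \<delta> and \<xi>, which makes the final
  norm bound uniform along the family.\<close>

lemma bubble_integral:
 assumes d: "0 < \<delta>"
 shows "LI (\<lambda>x. bubble \<delta> \<xi> (x::'a) powr pp * bubble \<delta> \<xi> x)"
  and "(LBINT x. bubble \<delta> \<xi> (x::'a) powr pp * bubble \<delta> \<xi> x) = alpha_n TYPE('a) powr pp * alpha_n TYPE('a) * (LBINT z. jb (z::'a) powr (- N T))"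
proof -
 let ?c = "alpha_n TYPE('a) powr pp * alpha_n TYPE('a)"
 have eq: "bubble \<delta> \<xi> x powr pp * bubble \<delta> \<xi> x = ?c * (\<delta> powr (- N T) * jb (sc \<delta> \<xi> x) powr (- N T))" for x :: 'a
 proof -
  have e: "- (N T + 2)/2 + - (N T - 2)/2 = - N T" by (simp add: field_simps)
  have "t powr Np T * t powr Nm T = t powr (- N T)" for t :: real by (simp only: powr_add[symmetric] e)
  note pw = this
  have "(a * (s * u)) * (b * (s' * u')) = a * b * ((s * s') * (u * u'))" for a b s s' u u' :: real by simp
  from this[of "alpha_n TYPE('a) powr pp" "\<delta> powr Np T" "jb (sc \<delta> \<xi> x) powr Np T" "alpha_n TYPE('a)"
   "\<delta> powr Nm T" "jb (sc \<delta> \<xi> x) powr Nm T"]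
  show ?thesis by (simp only: pw bubble_powr[OF d] bubble_eq[OF d, symmetric])
 qed
 have "LI (\<lambda>z::'a. jb z powr (- N T))" using integrable_jb_powr[where 'a='a, of "N T"] N3 by simp
 then have i: "LI (\<lambda>x. jb (sc \<delta> \<xi> x) powr (- N T))"
  using lborel_integral_affine(2)[of "\<delta>" "\<lambda>x. jb (sc \<delta> \<xi> x) powr (- N T)" \<xi>] d by (simp add: sc_inverse)
 then show "LI (\<lambda>x. bubble \<delta> \<xi> (x::'a) powr pp * bubble \<delta> \<xi> x)" unfolding eq by simp
 have "(LBINT x. jb (sc \<delta> \<xi> x) powr (- N T)) = \<delta> powr N T * (LBINT z. jb (z::'a) powr (- N T))"
  using lborel_integral_affine(1)[of "\<delta>" "\<lambda>x. jb (sc \<delta> \<xi> x) powr (- N T)" \<xi>] d by (simp add: sc_inverse powr_realpow)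
 moreover have "\<delta> powr (- N T) * \<delta> powr N T = 1" by (rule powr_mult_one) (use d in auto)
 ultimately have "\<delta> powr (- N T) * (LBINT x. jb (sc \<delta> \<xi> x) powr (- N T)) = (LBINT z. jb (z::'a) powr (- N T))"
  by (simp only: mult.assoc[symmetric] mult_1_left)
 then show "(LBINT x. bubble \<delta> \<xi> (x::'a) powr pp * bubble \<delta> \<xi> x) = ?c * (LBINT z. jb (z::'a) powr (- N T))"
  unfolding eq by (simp only: integral_mult_right_zero)
qed

text \<open>Both u and \<phi> are Newtonian potentials, of Q u^p and of Q u^p - U^p, hence in D12
  with known weak equations. Positivity is immediate from |\<psi>| \<le> 1/2.\<close>

proposition solution_from_profile:
 fixes \<psi> :: "'a \<Rightarrow>\<^sub>C real" and \<Omega> :: "'a set"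
 assumes \<Omega>: "open \<Omega>" and r: "0 < \<rho>" and d: "0 < \<delta>" and \<psi>: "\<And>y. \<bar>bc \<psi> y\<bar> \<le> 1/2"
  and eq: "\<And>y. 1 + bc \<psi> y = Kop (\<lambda>y. (1 - 2 * ind (AAs (- Omega_rho \<Omega> \<rho>) \<delta> \<eta>) y) * (1 + bc \<psi> y) powr pp) y"
 defines "\<xi> \<equiv> \<delta> *\<^sub>R \<eta>"
 defines "\<phi> \<equiv> \<lambda>x. bubble \<delta> \<xi> x * bc \<psi> (sc \<delta> \<xi> x)"
 shows "\<phi> \<in> D12" and "weak_solution (Qsign (Omega_rho \<Omega> \<rho>)) pp (\<lambda>x. bubble \<delta> \<xi> x + \<phi> x)"
  and "0 < bubble \<delta> \<xi> x + \<phi> x"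
  and "D12_norm \<phi> \<le> sqrt ((1 + (3/2) powr pp) * (alpha_n TYPE('a) powr pp * alpha_n TYPE('a) * (LBINT z. jb (z::'a) powr (- N T))) * norm \<psi>)"
proof -
 let ?U = "bubble \<delta> \<xi>" and ?s = "\<lambda>x. bc \<psi> (sc \<delta> \<xi> x)" and ?E = "- Omega_rho \<Omega> \<rho>"
 let ?u = "\<lambda>x. ?U x + \<phi> x" and ?Q = "\<lambda>x. 1 - 2 * ind ?E x :: real"
 have U: "0 < ?U x" for x by (rule bubble_pos[OF d])
 have u: "?u x = ?U x * (1 + ?s x)" for x by (simp add: \<phi>_def algebra_simps)
 have s: "1/2 \<le> 1 + ?s x" "1 + ?s x \<le> 3/2" "\<bar>?s x\<bar> \<le> norm \<psi>" for x
  using \<psi>[of "sc \<delta> \<xi> x"] bcontfun_abs[of \<psi> "sc \<delta> \<xi> x"] by (auto simp: abs_le_iff)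
 show up: "0 < ?u x" for x unfolding u using U[of x] s(1)[of x] by (intro mult_pos_pos) auto
 have E: "closed ?E" "?E \<noteq> {}"
 proof -
  show "closed ?E" using Omega_rho_open[OF \<Omega>] by (simp add: closed_Compl)
  have "0 \<in> ?E" using r by (simp add: Omega_rho_def)
  then show "?E \<noteq> {}" by blast
 qed
 have sd: "dec 0 (\<lambda>x. 1 + ?s x)"
 proof (rule decI[where C="3/2"])
  show "continuous_on UNIV (\<lambda>x. 1 + ?s x)" unfolding sc_def
   by (intro continuous_intros continuous_on_compose2[OF continuous_on_apply_bcontfun]) auto
  show "\<bar>1 + ?s x\<bar> \<le> 3/2 * jb x powr 0" for x using s(1,2)[of x] by simp
 qed
 have ud: "dec (Nm T) ?u" unfolding u by (rule dec_mult'[OF dec_bubble[OF d] sd]) simp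
 have ad: "dec (Np T) (\<lambda>x. ?u x powr pp)" and Ud: "dec (Np T) (\<lambda>x. ?U x powr pp)"
  by (rule dec_powr_pp[OF ud up] dec_powr_pp[OF dec_bubble[OF d] U])+
 have z: "dec (Np T) (\<lambda>x::'a. 0)" using dec_cmult[OF dec_jb, of "- (N T + 2)/2" 0] by simp
 let ?h = "\<lambda>x. ?Q x * ?u x powr pp" and ?k = "\<lambda>x. ?Q x * ?u x powr pp - ?U x powr pp"
 have hl: "fast_lim ?h" using fast_lim_cut[OF E ad z] by simp
 have kl: "fast_lim ?k" using fast_lim_cut[OF E ad dec_uminus[OF Ud]] by simp
 obtain Ch where Ch: "0 \<le> Ch" "fast Ch ?h" by (rule fast_lim_fast[OF hl])
 obtain Ck where Ck: "0 \<le> Ck" "fast Ck ?k" by (rule fast_lim_fast[OF kl])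
 obtain CU where CU: "0 \<le> CU" "fast CU (\<lambda>x. ?U x powr pp)" using fast_dec[OF Ud] by blast
 have nh: "newt ?h = ?u"
 proof
  fix x
  have "?h x = ?U x powr pp * ((1 - 2 * ind (AAs ?E \<delta> \<eta>) (sc \<delta> \<xi> x)) * (1 + ?s x) powr pp)" for x
  proof -
   have "\<delta> *\<^sub>R (sc \<delta> \<xi> x + \<eta>) = x" using sc_inverse(1)[OF d, of \<xi> x] by (simp add: \<xi>_def scaleR_right_distrib add.commute)
   then have "ind (AAs ?E \<delta> \<eta>) (sc \<delta> \<xi> x) = (ind ?E x :: real)" by (simp add: AAs_def indicator_def)
   then show ?thesis unfolding u by (simp only: powr_mult mult.left_commute)
  qed
  then have "newt ?h x = ?U x * Kop (\<lambda>y. (1 - 2 * ind (AAs ?E \<delta> \<eta>) y) * (1 + bc \<psi> y) powr pp) (sc \<delta> \<xi> x)"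
   using newt_scale[OF d, of \<xi> "\<lambda>y. (1 - 2 * ind (AAs ?E \<delta> \<eta>) y) * (1 + bc \<psi> y) powr pp" x] by (simp only:)
  then show "newt ?h x = ?u x" unfolding u eq[symmetric] .
 qed
 have nU: "newt (\<lambda>x. ?U x powr pp) x = ?U x" for x
  using newt_scale[OF d, of \<xi> "\<lambda>_. 1" x] by (simp add: Kop_1)
 have nk: "newt ?k = \<phi>"
  using newt_diff[OF Ch(2) CU(2)] unfolding nh nU by (simp add: fun_eq_iff)
 show D: "\<phi> \<in> D12" using newt_weak_grad(3)[OF Ck] unfolding nk .
 show "weak_solution (Qsign (Omega_rho \<Omega> \<rho>)) pp ?u"
  unfolding weak_solution_def
 proof (intro conjI ballI)
  show "?u \<in> D12" using newt_weak_grad(3)[OF Ch] unfolding nh .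
  fix v :: "'a \<Rightarrow> real" assume v: "v \<in> D12"
  have "?h x = Qsign (Omega_rho \<Omega> \<rho>) x * \<bar>?u x\<bar> powr (pp - 1) * ?u x" for x
  proof -
   have "\<bar>?u x\<bar> powr (pp - 1) * ?u x = ?u x powr pp" using up[of x] by (simp add: powr_diff)
   moreover have "?Q x = Qsign (Omega_rho \<Omega> \<rho>) x" by (simp add: Qsign_def indicator_def)
   ultimately show ?thesis by (simp only: mult.assoc)
  qed
  then show "(\<integral>x. wgrad ?u x \<bullet> wgrad v x \<partial>lebesgue) = (\<integral>x. Qsign (Omega_rho \<Omega> \<rho>) x * \<bar>?u x\<bar> powr (pp - 1) * ?u x * v x \<partial>lebesgue)"
   using newt_weak[OF hl v] unfolding nh by (simp only:)
 qed
 have km [measurable]: "?k \<in> BM" using Ck(2) by (simp add: fast_def)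
 have fm [measurable]: "\<phi> \<in> BM" using newt_measurable[OF km] unfolding nk .
 let ?K = "(1 + (3/2) powr pp) * norm \<psi>"
 have le: "\<bar>?k x * \<phi> x\<bar> \<le> ?K * (?U x powr pp * ?U x)" for x
 proof -
  have "?u x powr pp = ?U x powr pp * (1 + ?s x) powr pp" unfolding u by (rule powr_mult)
  also have "\<dots> \<le> ?U x powr pp * (3/2) powr pp"
   using s(1,2)[of x] pp1 by (intro mult_left_mono powr_mono2) auto
  finally have "?u x powr pp \<le> ?U x powr pp * (3/2) powr pp" .
  moreover have "\<bar>?Q x * ?u x powr pp\<bar> = ?u x powr pp" by (simp add: indicator_def)
  ultimately have "\<bar>?k x\<bar> \<le> ?U x powr pp * (3/2) powr pp + ?U x powr pp"
   using abs_triangle_ineq4[of "?Q x * ?u x powr pp" "?U x powr pp"] by simp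
  moreover have "\<bar>\<phi> x\<bar> \<le> ?U x * norm \<psi>"
   unfolding \<phi>_def abs_mult using U[of x] s(3)[of x] by (simp add: mult_left_mono)
  ultimately have "\<bar>?k x\<bar> * \<bar>\<phi> x\<bar> \<le> (?U x powr pp * (3/2) powr pp + ?U x powr pp) * (?U x * norm \<psi>)"
   by (intro mult_mono) auto
  also have "\<dots> = ?K * (?U x powr pp * ?U x)" by (simp add: algebra_simps)
  finally show ?thesis by (simp only: abs_mult)
 qed
 note BI = bubble_integral[OF d, of \<xi>]
 have ik: "LI (\<lambda>x. ?k x * \<phi> x)"
  by (rule integrable_dom[OF integrable_mult_right[OF BI(1), of ?K]]) (use order_trans[OF le abs_ge_self] in simp_all)
 \<comment> \<open>The norm is found by duality, testing the equation for \<phi> with \<phi>. As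
   |\<phi>| \<le> U \<open>norm \<psi>\<close> while the right-hand side is of order U^p, its square
   is linear in \<open>norm \<psi>\<close>.\<close>
 have "(\<integral>x. (norm (wgrad \<phi> x))\<^sup>2 \<partial>lebesgue) = (\<integral>x. wgrad \<phi> x \<bullet> wgrad \<phi> x \<partial>lebesgue)"
  by (simp only: power2_norm_eq_inner)
 also have "\<dots> = (\<integral>x. ?k x * \<phi> x \<partial>lebesgue)" using newt_weak[OF kl D] unfolding nk .
 also have "\<dots> = (LBINT x. ?k x * \<phi> x)" by (rule integrable_lebesgue_iff) measurable
 also have "\<dots> \<le> (LBINT x. ?K * (?U x powr pp * ?U x))"
  by (intro integral_mono ik integrable_mult_right BI(1) order_trans[OF abs_ge_self le])
 also have "\<dots> = (1 + (3/2) powr pp) * (alpha_n TYPE('a) powr pp * alpha_n TYPE('a) * (LBINT z. jb (z::'a) powr (- N T))) * norm \<psi>"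
  unfolding integral_mult_right_zero BI(2) by simp
 finally show "D12_norm \<phi> \<le> sqrt ((1 + (3/2) powr pp) * (alpha_n TYPE('a) powr pp * alpha_n TYPE('a) * (LBINT z. jb (z::'a) powr (- N T))) * norm \<psi>)"
  unfolding D12_norm_def by (rule real_sqrt_le_mono)
qed

end

theorem theorem1p4:
  fixes \<Omega> :: "'a::euclidean_space set"
  assumes "DIM('a) \<ge> 3"
    and "smooth_bounded_domain \<Omega>"
    and "0 \<in> \<Omega>"
  defines "p \<equiv> (real DIM('a) + 2) / (real DIM('a) - 2)"
  shows "\<exists>\<rho>0 > 0. \<exists>d > 0. \<exists>(\<delta>::real \<Rightarrow> real) (\<xi>::real \<Rightarrow> 'a) (\<phi>::real \<Rightarrow> 'a \<Rightarrow> real).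
     (\<forall>\<rho>. 0 < \<rho> \<and> \<rho> < \<rho>0 \<longrightarrow>
        \<delta> \<rho> > 0 \<and> \<phi> \<rho> \<in> D12 \<and>
        weak_solution (Qsign (Omega_rho \<Omega> \<rho>)) p (\<lambda>x. bubble (\<delta> \<rho>) (\<xi> \<rho>) x + \<phi> \<rho> x) \<and>
        (AE x in lebesgue. bubble (\<delta> \<rho>) (\<xi> \<rho>) x + \<phi> \<rho> x > 0)) \<and>
     ((\<lambda>\<rho>. D12_norm (\<phi> \<rho>)) \<longlongrightarrow> 0) (at_right 0) \<and>
     ((\<lambda>\<rho>. \<delta> \<rho> * \<rho> powr (-1/2)) \<longlongrightarrow> d) (at_right 0) \<and>
     (\<xi> \<longlongrightarrow> 0) (at_right 0)"
proof -
 interpret dim_ge_3 "TYPE('a)" by unfold_locales (rule assms(1))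
 have \<Omega>: "open \<Omega>" "bounded \<Omega>" using assms(2) by (auto simp: smooth_bounded_domain_def)
 have p: "p = pp" by (simp add: p_def pp_def)
 obtain m1 :: real and \<Psi> :: "'a set \<Rightarrow> 'a \<Rightarrow>\<^sub>C real" and b :: "'a set \<Rightarrow> 'a \<times> real" where m1: "0 < m1"
  and P1: "\<And>A x. A \<in> sets borel \<Longrightarrow> measure mm A \<le> m1 \<Longrightarrow> \<bar>bc (\<Psi> A) x\<bar> \<le> 1/2"
  and P2: "\<And>A x. A \<in> sets borel \<Longrightarrow> measure mm A \<le> m1 \<Longrightarrow> b A = 0 \<Longrightarrow>
    1 + bc (\<Psi> A) x = Kop (\<lambda>y. (1 - 2 * ind A y) * (1 + bc (\<Psi> A) y) powr pp) x"
  and b1: "bary b" and b2: "bary_cont m1 b"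
  and P3: "\<And>\<eta>. 0 < \<eta> \<Longrightarrow> \<exists>m>0. \<forall>A\<in>sets borel. measure mm A \<le> m \<longrightarrow> norm (\<Psi> A) \<le> \<eta>"
  by (rule auxiliary_problem) (rule that; assumption)
 obtain \<rho>0 D :: real and x :: "real \<Rightarrow> 'a \<times> real" where \<rho>0: "0 < \<rho>0" and D: "0 < D" and x: "(x \<longlongrightarrow> 0) (at_right 0)"
  and A: "\<And>\<rho>. 0 < \<rho> \<Longrightarrow> \<rho> < \<rho>0 \<Longrightarrow> measure mm (Ax \<Omega> D \<rho> (x \<rho>)) \<le> m1 \<and> b (Ax \<Omega> D \<rho> (x \<rho>)) = 0"
  and Alim: "((\<lambda>\<rho>. measure mm (Ax \<Omega> D \<rho> (x \<rho>))) \<longlongrightarrow> 0) (at_right 0)"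
  by (rule reduced_problem[OF \<Omega> assms(3) m1 b1 b2]) (rule that; assumption)
 \<comment> \<open>Since the second parameter tends to 0, the quotient of \<delta> and sqrt \<rho>
   tends to D.\<close>
 define \<delta> where "\<delta> \<rho> = D * exp (snd (x \<rho>)) * sqrt \<rho>" for \<rho>
 define \<xi> where "\<xi> \<rho> = \<delta> \<rho> *\<^sub>R fst (x \<rho>)" for \<rho>
 define \<psi> where "\<psi> \<rho> = \<Psi> (Ax \<Omega> D \<rho> (x \<rho>))" for \<rho>
 define \<phi> where "\<phi> \<rho> z = bubble (\<delta> \<rho>) (\<xi> \<rho>) z * bc (\<psi> \<rho>) (sc (\<delta> \<rho>) (\<xi> \<rho>) z)" for \<rho> z
 \<comment> \<open>Independent of \<rho> by the scale invariance of the bubble integral, so the norm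
   of \<phi> vanishes with that of the profile.\<close>
 define K where "K = (1 + (3/2) powr pp) * (alpha_n TYPE('a) powr pp * alpha_n TYPE('a) * (LBINT z. jb (z::'a) powr (- real DIM('a))))"
 have dp: "0 < \<delta> \<rho>" if "0 < \<rho>" for \<rho> using D that by (simp add: \<delta>_def)
 have Ab: "Ax \<Omega> D \<rho> (x \<rho>) \<in> sets borel" for \<rho> by (rule Ax_borel[OF \<Omega>(1)])
 have sol: "\<phi> \<rho> \<in> D12 \<and> weak_solution (Qsign (Omega_rho \<Omega> \<rho>)) pp (\<lambda>z. bubble (\<delta> \<rho>) (\<xi> \<rho>) z + \<phi> \<rho> z) \<and>
   (\<forall>z. 0 < bubble (\<delta> \<rho>) (\<xi> \<rho>) z + \<phi> \<rho> z) \<and> D12_norm (\<phi> \<rho>) \<le> sqrt (K * norm (\<psi> \<rho>))" if "0 < \<rho>" "\<rho> < \<rho>0" for \<rho>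
 proof -
  have m: "measure mm (Ax \<Omega> D \<rho> (x \<rho>)) \<le> m1" and b0: "b (Ax \<Omega> D \<rho> (x \<rho>)) = 0" using A[OF that] by auto
  have AA: "Ax \<Omega> D \<rho> (x \<rho>) = AAs (- Omega_rho \<Omega> \<rho>) (\<delta> \<rho>) (fst (x \<rho>))" by (simp add: Ax_def \<delta>_def)
  have e: "1 + bc (\<psi> \<rho>) y = Kop (\<lambda>y. (1 - 2 * ind (AAs (- Omega_rho \<Omega> \<rho>) (\<delta> \<rho>) (fst (x \<rho>))) y) * (1 + bc (\<psi> \<rho>) y) powr pp) y" for y
   unfolding AA[symmetric] \<psi>_def by (rule P2[OF Ab m b0])
  have s: "\<bar>bc (\<psi> \<rho>) y\<bar> \<le> 1/2" for y unfolding \<psi>_def by (rule P1[OF Ab m])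
  show ?thesis
   using solution_from_profile[OF \<Omega>(1) that(1) dp[OF that(1)] s e] unfolding \<xi>_def[symmetric] \<phi>_def[symmetric] K_def[symmetric] by blast
 qed
 have psi0: "((\<lambda>\<rho>. norm (\<psi> \<rho>)) \<longlongrightarrow> 0) (at_right 0)"
 proof (rule tendstoI)
  fix e :: real assume e: "0 < e"
  obtain m where m: "0 < m" "\<And>A. A \<in> sets borel \<Longrightarrow> measure mm A \<le> m \<Longrightarrow> norm (\<Psi> A) \<le> e/2" using P3[of "e/2"] e by auto
  have "\<forall>\<^sub>F \<rho> in at_right 0. measure mm (Ax \<Omega> D \<rho> (x \<rho>)) < m" using order_tendstoD(2)[OF Alim m(1)] .
  then show "\<forall>\<^sub>F \<rho> in at_right 0. dist (norm (\<psi> \<rho>)) 0 < e"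
  proof eventually_elim
   case (elim \<rho>)
   then have "norm (\<psi> \<rho>) \<le> e/2" unfolding \<psi>_def by (intro m(2) Ab) simp
   then show ?case using e by simp
  qed
 qed
 have pos: "\<forall>\<^sub>F \<rho>::real in at_right 0. 0 < \<rho>" by (rule eventually_at_right_less)
 have small: "\<forall>\<^sub>F \<rho> in at_right 0. 0 < \<rho> \<and> \<rho> < \<rho>0" unfolding eventually_at_right_field using \<rho>0 by blast
 have "((\<lambda>\<rho>. sqrt (K * norm (\<psi> \<rho>))) \<longlongrightarrow> sqrt (K * 0)) (at_right 0)" by (intro tendsto_intros psi0)
 then have up: "((\<lambda>\<rho>. sqrt (K * norm (\<psi> \<rho>))) \<longlongrightarrow> 0) (at_right 0)" by simp
 have n0: "((\<lambda>\<rho>. D12_norm (\<phi> \<rho>)) \<longlongrightarrow> 0) (at_right 0)"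
 proof (rule tendsto_sandwich[OF _ _ tendsto_const up])
  show "\<forall>\<^sub>F \<rho> in at_right 0. D12_norm (\<phi> \<rho>) \<le> sqrt (K * norm (\<psi> \<rho>))"
   using small by eventually_elim (use sol in blast)
 qed (simp add: D12_norm_def)
 have ex: "((\<lambda>\<rho>. D * exp (snd (x \<rho>))) \<longlongrightarrow> D * exp (snd (0::'a \<times> real))) (at_right 0)"
  by (intro tendsto_intros tendsto_snd[OF x])
 then have dl: "((\<lambda>\<rho>. D * exp (snd (x \<rho>))) \<longlongrightarrow> D) (at_right 0)" by simp
 then have d0: "((\<lambda>\<rho>. \<delta> \<rho> * \<rho> powr (-1/2)) \<longlongrightarrow> D) (at_right 0)"
 proof (rule Lim_transform_eventually)
  show "\<forall>\<^sub>F \<rho> in at_right 0. D * exp (snd (x \<rho>)) = \<delta> \<rho> * \<rho> powr (-1/2)"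
   using pos
  proof eventually_elim
   case (elim \<rho>)
   have "sqrt \<rho> * \<rho> powr (-1/2) = 1" using elim powr_mult_one[of \<rho> "1/2" "-1/2"] by (simp add: powr_half_sqrt)
   then show ?case unfolding \<delta>_def by (simp only: mult.assoc mult_1_right)
  qed
 qed
 have "((\<lambda>\<rho>. (D * exp (snd (x \<rho>)) * sqrt \<rho>) *\<^sub>R fst (x \<rho>)) \<longlongrightarrow> (D * sqrt 0) *\<^sub>R fst (0::'a \<times> real)) (at_right 0)"
  by (intro tendsto_intros dl tendsto_fst[OF x] tendsto_ident_at)
 then have x0: "(\<xi> \<longlongrightarrow> 0) (at_right 0)" by (simp add: \<xi>_def[abs_def] \<delta>_def)
 have main: "\<forall>\<rho>. 0 < \<rho> \<and> \<rho> < \<rho>0 \<longrightarrow>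
    \<delta> \<rho> > 0 \<and> \<phi> \<rho> \<in> D12 \<and>
    weak_solution (Qsign (Omega_rho \<Omega> \<rho>)) p (\<lambda>x. bubble (\<delta> \<rho>) (\<xi> \<rho>) x + \<phi> \<rho> x) \<and>
    (AE x in lebesgue. bubble (\<delta> \<rho>) (\<xi> \<rho>) x + \<phi> \<rho> x > 0)"
 proof (intro allI impI)
  fix \<rho> assume r: "0 < \<rho> \<and> \<rho> < \<rho>0"
  then have s: "\<phi> \<rho> \<in> D12" "weak_solution (Qsign (Omega_rho \<Omega> \<rho>)) p (\<lambda>z. bubble (\<delta> \<rho>) (\<xi> \<rho>) z + \<phi> \<rho> z)"
   "\<And>z. 0 < bubble (\<delta> \<rho>) (\<xi> \<rho>) z + \<phi> \<rho> z"
   using sol[of \<rho>] unfolding p by blast+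
  show "\<delta> \<rho> > 0 \<and> \<phi> \<rho> \<in> D12 \<and>
    weak_solution (Qsign (Omega_rho \<Omega> \<rho>)) p (\<lambda>x. bubble (\<delta> \<rho>) (\<xi> \<rho>) x + \<phi> \<rho> x) \<and>
    (AE x in lebesgue. bubble (\<delta> \<rho>) (\<xi> \<rho>) x + \<phi> \<rho> x > 0)"
   by (intro conjI s AE_I2 dp) (use r in blast)
 qed
 show ?thesis by (rule exI[of _ \<rho>0], rule conjI, rule \<rho>0, rule exI[of _ D], rule conjI, rule D,
  rule exI[of _ \<delta>], rule exI[of _ \<xi>], rule exI[of _ \<phi>], intro conjI main n0 d0 x0)
qed

end
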